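(* Let $n,r$ be positive integers with $r\ge n$, let $V$ be a set with $|V|=n$, and let $\Gamma$ be a (geometric) triangulation of the $(n-1)$-dimensional simplex $2^V$. Let $\mathrm{esd}_r(\Gamma)$ denote the $r$-fold edgewise subdivision of $\Gamma$ (with respect to any linear ordering of the vertices of $\Gamma$), regarded as a triangulation of $2^V$. Then the local $h$-polynomial $\ell_V(\mathrm{esd}_r(\Gamma),x)$ is real-rooted and is interlaced by $E_{n,r}(x)$.
   Context: Triangulation means geometric triangulation; for a triangulation $\Delta$ of $2^V$ and $F\subseteq V$, the restriction $\Delta_F$ is the subcomplex of faces whose carrier (smallest face of $2^V$ whose realization contains the face's realization) is contained in $F$. The $h$-polynomial of a $(d-1)$-dimensional complex $K$ is $h(K,x)=\sum_{i=0}^d f_{i-1}(K)x^i(1-x)^{d-i}$ with $f_{-1}=1$; the local $h$-polynomial is $\ell_V(\Delta,x)=\sum_{F\subseteq V}(-1)^{|V|-|F|}h(\Delta_F,x)$. Edgewise subdivision: given a simplicial complex $\Gamma$ with vertices linearly ordered $v_1,\dots,v_m$, let $V_r(\Gamma)$ be the set of maps $f:\{v_1,\dots,v_m\}\to\mathbb N$ with $\mathrm{supp}(f)=\{v: f(v)\neq 0\}\in\Gamma$ and $\sum_i f(v_i)=r$; let $\iota(f)(v_j)=f(v_1)+\cdots+f(v_j)$. Then $\mathrm{esd}_r(\Gamma)$ is the simplicial complex on $V_r(\Gamma)$ whose faces are the sets $E\subseteq V_r(\Gamma)$ with $\bigcup_{f\in E}\mathrm{supp}(f)\in\Gamma$ and,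 for all $f,g\in E$, $\iota(f)-\iota(g)\in\{0,1\}^{m}$ or $\iota(g)-\iota(f)\in\{0,1\}^{m}$; it can be realized as a triangulation of $\Gamma$. $E_{n,r}(x)$ is the $h$-polynomial of $\mathrm{esd}_r$ of the $(n-1)$-dimensional simplex; equivalently $E_{n,r}(x)=\mathcal S^r_0\big((1+x+\cdots+x^{r-1})^n\big)$, where $\mathcal S^r_0(\sum_k a_kx^k)=\sum_k a_{rk}x^k$; equivalently it is the ascent enumerator $\sum_w x^{\mathrm{asc}(w)}$ over words $w:\{0,\dots,n-1\}\to\{0,\dots,r-1\}$ with $w(0)=0$, where $\mathrm{asc}(w)=\#\{i\in[n-1]:w(i-1)<w(i)\}$. Real-rooted: all roots real or zero polynomial. For real-rooted $f$ (roots $\alpha_1\ge\alpha_2\ge\cdots$) and $g$ (roots $\beta_1\ge\beta_2\ge\cdots$), "$f$ interlaces $g$" means $\cdots\le\alpha_2\le\beta_2\le\alpha_1\le\beta_1$; the zero polynomial interlaces and is interlaced by every real-rooted polynomial, and nonzero constants interlace every polynomial of degree at most one. *)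

theory Defs
  imports "HOL-Analysis.Analysis" "HOL-Computational_Algebra.Computational_Algebra"
begin

section \<open>Simplicial complexes given by their faces\<close>

text \<open>
  A complex is the set of its faces, each face being its finite set of vertices; the empty
  set is a face. Since the empty face has cardinality 0, the number of faces of dimension
  \<open>i - 1\<close> is \<open>face_num K i\<close>, and a complex of dimension \<open>d - 1\<close> has \<open>cdim1 K = d\<close>.
\<close>

definition face_num :: "'v set set \<Rightarrow> nat \<Rightarrow> nat" where
  "face_num K i = card {S \<in> K. card S = i}"

definition cdim1 :: "'v set set \<Rightarrow> nat" where
  "cdim1 K = Max (card ` K)"

definition h_poly :: "'v set set \<Rightarrow> real poly" where
  "h_poly K = (\<Sum>i\<le>cdim1 K.
     smult (real (face_num K i)) (monom 1 i * [:1, -1:] ^ (cdim1 K - i)))"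

section \<open>Geometric triangulations of a simplex and local h-polynomials\<close>

text \<open>
  The simplex \<open>2\<^sup>V\<close> is realized as the convex hull of an affinely independent set \<open>V\<close> of
  points, and a triangulation of it has points of the same space as its vertices, so that
  the realization of a face is its convex hull.
\<close>

definition geom_triangulation :: "'a::euclidean_space set \<Rightarrow> 'a set set \<Rightarrow> bool" where
  "geom_triangulation V \<Gamma> \<longleftrightarrow>
     (\<forall>S\<in>\<Gamma>. \<not> affine_dependent S) \<and>
     simplicial_complex ((\<lambda>S. convex hull S) ` \<Gamma>) \<and>
     (\<Union>S\<in>\<Gamma>. convex hull S) = convex hull V"

definition carrier_face :: "'a::euclidean_space set \<Rightarrow> 'a set \<Rightarrow> 'a set" where
  "carrier_face V G = (LEAST F. F \<subseteq> V \<and> convex hull G \<subseteq> convex hull F)"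

lemma carrier_face_eq_Inter:
  fixes V :: "'a::euclidean_space set"
  assumes V: "\<not> affine_dependent V" and G: "G \<subseteq> convex hull V"
  shows "carrier_face V G = \<Inter>{F. F \<subseteq> V \<and> convex hull G \<subseteq> convex hull F}"
proof -
  define \<F> where "\<F> = {F. F \<subseteq> V \<and> convex hull G \<subseteq> convex hull F}"
  have ne: "V \<in> \<F>"
    using G by (simp add: \<F>_def hull_minimal)
  have "\<not> affine_dependent (\<Union>\<F>)"
    using V by (rule affine_independent_subset) (auto simp: \<F>_def)
  hence "convex hull (\<Inter>\<F>) = (\<Inter>F\<in>\<F>. convex hull F)"
    by (rule convex_hull_Inter)
  hence "\<Inter>\<F> \<in> \<F>"
    using ne by (auto simp: \<F>_def)
  hence "carrier_face V G = \<Inter>\<F>"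
    unfolding carrier_face_def by (intro Least_equality) (auto simp: \<F>_def)
  thus ?thesis
    by (simp add: \<F>_def)
qed

definition restrict_tri :: "'a::euclidean_space set \<Rightarrow> 'a set set \<Rightarrow> 'a set \<Rightarrow> 'a set set" where
  "restrict_tri V \<Delta> F = {G \<in> \<Delta>. carrier_face V G \<subseteq> F}"

definition local_h :: "'a::euclidean_space set \<Rightarrow> 'a set set \<Rightarrow> real poly" where
  "local_h V \<Delta> = (\<Sum>F\<in>Pow V. smult ((-1) ^ (card V - card F)) (h_poly (restrict_tri V \<Delta> F)))"

section \<open>Edgewise subdivisions\<close>

text \<open>
  The linear ordering \<open>v\<^sub>1, \<dots>, v\<^sub>m\<close> of the vertices is the distinct list \<open>vs\<close>, with
  \<open>v\<^sub>j = vs ! (j - 1)\<close>. A map from the vertices to the naturals is encoded as a total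
  function that vanishes outside \<open>set vs\<close>; for the functions in \<open>esd_verts\<close> this holds
  because their support is a face.
\<close>

definition supp :: "('v \<Rightarrow> nat) \<Rightarrow> 'v set" where
  "supp f = {v. f v \<noteq> 0}"

definition esd_verts :: "nat \<Rightarrow> 'v list \<Rightarrow> 'v set set \<Rightarrow> ('v \<Rightarrow> nat) set" where
  "esd_verts r vs \<Gamma> = {f. supp f \<in> \<Gamma> \<and> (\<Sum>v\<in>set vs. f v) = r}"

definition esd_iota :: "'v list \<Rightarrow> ('v \<Rightarrow> nat) \<Rightarrow> nat \<Rightarrow> int" where
  "esd_iota vs f j = (\<Sum>i\<le>j. int (f (vs ! i)))"

definition esd :: "nat \<Rightarrow> 'v list \<Rightarrow> 'v set set \<Rightarrow> ('v \<Rightarrow> nat) set set" where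
  "esd r vs \<Gamma> = {E. E \<subseteq> esd_verts r vs \<Gamma> \<and> (\<Union>f\<in>E. supp f) \<in> \<Gamma> \<and>
     (\<forall>f\<in>E. \<forall>g\<in>E.
        (\<forall>j<length vs. esd_iota vs f j - esd_iota vs g j \<in> {0, 1}) \<or>
        (\<forall>j<length vs. esd_iota vs g j - esd_iota vs f j \<in> {0, 1}))}"

text \<open>
  If the vertices of \<open>\<Gamma>\<close> are points, then the vertex \<open>f\<close> of the edgewise subdivision is
  realized as the point with barycentric coordinates \<open>f v / r\<close> in the face \<open>supp f\<close> of
  \<open>\<Gamma>\<close>. This is the standard realization of the edgewise subdivision as a
  triangulation of \<open>\<Gamma>\<close>.
\<close>

definition esd_point :: "nat \<Rightarrow> ('a::real_vector \<Rightarrow> nat) \<Rightarrow> 'a" where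
  "esd_point r f = (\<Sum>v\<in>supp f. (real (f v) / real r) *\<^sub>R v)"

definition esd_geom :: "nat \<Rightarrow> 'a::real_vector list \<Rightarrow> 'a set set \<Rightarrow> 'a set set" where
  "esd_geom r vs \<Gamma> = (\<lambda>E. esd_point r ` E) ` esd r vs \<Gamma>"

definition esd_simplex_h :: "nat \<Rightarrow> nat \<Rightarrow> real poly" where
  "esd_simplex_h n r = h_poly (esd r [0..<n] (Pow {0..<n}))"

section \<open>Real-rootedness and interlacing\<close>

definition real_rooted :: "real poly \<Rightarrow> bool" where
  "real_rooted p \<longleftrightarrow> p = 0 \<or> (\<forall>z::complex. poly (map_poly of_real p) z = 0 \<longrightarrow> z \<in> \<real>)"

text \<open>The roots, repeated with multiplicity, in decreasing order.\<close>

definition roots_desc :: "real poly \<Rightarrow> real list" where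
  "roots_desc p = rev (sorted_list_of_multiset (proots p))"

text \<open>
  The chain \<open>\<dots> \<le> \<alpha>\<^sub>2 \<le> \<beta>\<^sub>2 \<le> \<alpha>\<^sub>1 \<le> \<beta>\<^sub>1\<close> uses up all roots of both polynomials, so
  \<open>g\<close> has as many roots as \<open>f\<close> or one more. In particular a nonzero constant interlaces
  exactly the real-rooted polynomials of degree at most one.
\<close>

definition interlaces :: "real poly \<Rightarrow> real poly \<Rightarrow> bool" where
  "interlaces f g \<longleftrightarrow> real_rooted f \<and> real_rooted g \<and>
     (f = 0 \<or> g = 0 \<or>
      (let \<alpha> = roots_desc f; \<beta> = roots_desc g in
         (length \<beta> = length \<alpha> \<or> length \<beta> = Suc (length \<alpha>)) \<and>
         (\<forall>i<length \<alpha>. \<alpha> ! i \<le> \<beta> ! i) \<and>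
         (\<forall>i. Suc i < length \<beta> \<longrightarrow> \<beta> ! Suc i \<le> \<alpha> ! i)))"

end

theory Submission
  imports Defs "HOL-Library.Function_Algebras"
begin

text \<open>
  Let \<open>U = 1 + x + \<dots> + x\<^sup>r\<^sup>-\<^sup>1\<close>, let \<open>D = U - 1\<close>, and let \<open>S\<close> keep the coefficients of the powers
  of \<open>x\<^sup>r\<close>. Comparing Hilbert functions, a multiset of \<open>m\<close> vertices spanning a face of
  \<open>esd\<^sub>r(K)\<close> is the same as a monomial of degree \<open>r m\<close> supported on a face of \<open>K\<close>, so
  \<open>h(esd\<^sub>r(K)) = S(U\<^sup>d h(K))\<close>. With Moebius inversion over the faces of the simplex the local
  h-polynomial becomes the sum over \<open>G \<subseteq> V\<close> of \<open>S(\<ell>\<^sub>G U\<^sup>a D\<^sup>b)\<close>, where \<open>a = |G|\<close>, \<open>b = n - a\<close>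
  and \<open>\<ell>\<^sub>G\<close> is the local h-polynomial of \<open>\<Gamma>\<close> restricted to \<open>G\<close>.

  The coefficients of \<open>\<ell>\<^sub>G\<close> are nonnegative (Stanley). The linear coordinates of the fan over \<open>\<Gamma>\<close>
  form a regular sequence on the face ring, that is, the Koszul complex is acyclic below the top degree:
  some iterated edge subdivision can be cut by linear functionals into half-open pieces on which a
  homotopy is explicit, and acyclicity descends along edge subdivisions by pushing forward piecewise
  polynomials. The subcomplex of pairs \<open>(T, a)\<close> with \<open>T\<close> inside the carrier of the monomial \<open>a\<close>
  inherits acyclicity, and the Euler characteristics of its graded pieces are the coefficients
  of \<open>\<ell>\<^sub>V\<close>.

  For \<open>z\<close> in the upper half plane, the values \<open>c\<^sub>0, \<dots>, c\<^sub>r\<^sub>-\<^sub>1\<close> at \<open>z\<close> of the \<open>r\<close>-sections of a product of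
  powers of \<open>x\<close>, \<open>U\<close>, \<open>D\<close> have decreasing arguments that span at most \<open>arg z\<close>. Consequently the
  argument of \<open>S(x\<^sup>i U\<^sup>a D\<^sup>b)\<close> exceeds the one of \<open>E = S(U\<^sup>n)\<close> by a number in \<open>[0, arg z]\<close> as soon as
  \<open>i \<le> a\<close> and \<open>a + b = n \<le> r\<close>. This property survives nonnegative combinations, and at
  the real axis the arguments count roots, which gives the interlacing.
\<close>

section \<open>Koszul complexes on sets of exponents\<close>

text \<open>Nonnegativity of the local h-polynomial is needed for every restriction of the
  triangulation, and an arbitrary triangulation offers no shelling to induct on. A fine enough
  subdivision can instead be cut by hyperplanes, and its acyclicity is carried back. A face on a
  cutting hyperplane has to go to exactly one side; a point \<open>q\<close> outside all spans of
  too few vertices makes this choice consistently, so that each final piece is empty or an interval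
  of faces of one simplicial cone. Acyclicity below the top exterior degree suffices, because it
  turns the Euler characteristic of a graded piece into the dimension of its top cohomology.

  The hypothesis r >= n bounds a shift: the argument of \<open>S(x^i U^a D^b)\<close> is squeezed
  between those of \<open>S(x^i U^n)\<close> and \<open>S(x^(i+b) U^n)\<close>, the latter exceeds
  that of E by at most arg z when i + b <= r, and i <= a gives i + b <= n. Relative to E all
  summands of the expansion then lie in one pointed cone, so they cannot cancel.\<close>

text \<open>
  A pair \<open>(T, a)\<close> stands for the monomial with exponent \<open>a\<close> times the exterior generator \<open>e\<^sub>T\<close>, and
  \<open>lam k x\<close> is the coefficient of the variable \<open>x\<close> in the \<open>k\<close>-th linear form. The boundary \<open>kbd\<close> is
  multiplication by the sum of the \<open>\<theta>\<^sub>k e\<^sub>k\<close>, truncated to the set \<open>U\<close>; it squares to zero if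
  \<open>U\<close> is convex for the divisibility order (\<open>kconvex\<close>).
\<close>

definition ksign :: "nat \<Rightarrow> nat set \<Rightarrow> real" where
  "ksign k T = (-1) ^ card {j\<in>T. j < k}"

definition lin_shift :: "(nat \<Rightarrow> 'x \<Rightarrow> real) \<Rightarrow> nat \<Rightarrow> (('x \<Rightarrow> nat) \<Rightarrow> real) \<Rightarrow> ('x \<Rightarrow> nat) \<Rightarrow> real" where
  "lin_shift lam k c a = (\<Sum>w\<in>supp a. lam k w * c (a(w := a w - 1)))"

definition kbd :: "(nat \<Rightarrow> 'x \<Rightarrow> real) \<Rightarrow> (nat set \<times> ('x \<Rightarrow> nat)) set \<Rightarrow>
    (nat set \<Rightarrow> ('x \<Rightarrow> nat) \<Rightarrow> real) \<Rightarrow> nat set \<Rightarrow> ('x \<Rightarrow> nat) \<Rightarrow> real" where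
  "kbd lam U z T a =
     (if (T, a) \<in> U then \<Sum>k\<in>T. ksign k T * lin_shift lam k (z (T - {k})) a else 0)"

definition chain :: "(nat set \<times> ('x \<Rightarrow> nat)) set \<Rightarrow> nat \<Rightarrow> (nat set \<Rightarrow> ('x \<Rightarrow> nat) \<Rightarrow> real) \<Rightarrow> bool" where
  "chain U k z \<longleftrightarrow> (\<forall>T a. z T a \<noteq> 0 \<longrightarrow> (T, a) \<in> U \<and> card T = k)"

definition kacyclic :: "(nat \<Rightarrow> 'x \<Rightarrow> real) \<Rightarrow> nat \<Rightarrow> (nat set \<times> ('x \<Rightarrow> nat)) set \<Rightarrow> bool" where
  "kacyclic lam n U \<longleftrightarrow> (\<forall>k<n. \<forall>z. chain U k z \<and> (\<forall>T a. kbd lam U z T a = 0) \<longrightarrow>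
     (\<exists>b. (\<forall>T a. b T a \<noteq> 0 \<longrightarrow> (T, a) \<in> U \<and> Suc (card T) = k) \<and> (\<forall>T a. kbd lam U b T a = z T a)))"

definition kfin :: "(nat set \<times> ('x \<Rightarrow> nat)) set \<Rightarrow> bool" where
  "kfin U \<longleftrightarrow> (\<forall>(T, a)\<in>U. finite T \<and> finite (supp a))"

definition kconvex :: "(nat \<Rightarrow> 'x \<Rightarrow> real) \<Rightarrow> (nat set \<times> ('x \<Rightarrow> nat)) set \<Rightarrow> bool" where
  "kconvex lam U \<longleftrightarrow> (\<forall>T a j k u w. (T, a) \<in> U \<longrightarrow> k \<in> T \<longrightarrow> j \<in> T - {k} \<longrightarrow> w \<in> supp a \<longrightarrow>
     u \<in> supp (a(w := a w - 1)) \<longrightarrow> lam j u \<noteq> 0 \<longrightarrow>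
     (T - {k} - {j}, a(w := a w - 1, u := (a(w := a w - 1)) u - 1)) \<in> U \<longrightarrow>
     (T - {k}, a(w := a w - 1)) \<in> U)"

definition kclosed :: "(nat \<Rightarrow> 'x \<Rightarrow> real) \<Rightarrow> (nat set \<times> ('x \<Rightarrow> nat)) set \<Rightarrow> (nat set \<times> ('x \<Rightarrow> nat)) set \<Rightarrow> bool" where
  "kclosed lam U2 U1 \<longleftrightarrow> (\<forall>T a k w. (T, a) \<in> U1 \<longrightarrow> k \<in> T \<longrightarrow> w \<in> supp a \<longrightarrow> lam k w \<noteq> 0 \<longrightarrow>
     (T - {k}, a(w := a w - 1)) \<notin> U2)"

section \<open>The boundary operator and its square\<close>

lemma supp_dec_subset: "supp (a(w := a w - 1)) \<subseteq> supp a"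
  by (auto simp: supp_def)

lemma lin_shift_commute:
  assumes "finite (supp a)"
  shows "lin_shift lam k (lin_shift lam j c) a = lin_shift lam j (lin_shift lam k c) a"
proof -
  let ?P = "Sigma (supp a) (\<lambda>w. supp (a(w := a w - 1)))"
  have fin: "finite (supp (a(w := a w - 1)))" for w
    using assms supp_dec_subset finite_subset by metis
  have E: "lin_shift lam k (lin_shift lam j c) a =
      (\<Sum>(w,u)\<in>?P. lam k w * lam j u * c ((a(w := a w - 1))(u := (a(w := a w - 1)) u - 1)))" for k j
    unfolding lin_shift_def using assms fin
    by (subst sum.Sigma[symmetric]) (auto simp: sum_distrib_left mult.assoc)
  show ?thesis
    unfolding E
    by (rule sum.reindex_bij_witness[of _ "\<lambda>(w,u). (u,w)" "\<lambda>(w,u). (u,w)"])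
       (auto simp: supp_def fun_upd_twist split: if_splits)
qed

text \<open>Removing the larger of two elements keeps the rank of the smaller one; removing the
  smaller one first lowers the rank of the larger one by one.\<close>

lemma ksign_swap:
  assumes "finite T" "k \<in> T" "j \<in> T" "j \<noteq> k"
  shows "ksign k T * ksign j (T - {k}) = - (ksign j T * ksign k (T - {j}))"
proof -
  have main: "ksign k T * ksign j (T - {k}) = - (ksign j T * ksign k (T - {j}))"
    if "k \<in> T" "j \<in> T" "j < k" for j k
  proof -
    have 1: "{i \<in> T - {k}. i < j} = {i \<in> T. i < j}" using that by auto
    have 2: "{i \<in> T. i < k} = insert j {i \<in> T - {j}. i < k}" using that by auto
    have "card {i \<in> T. i < k} = Suc (card {i \<in> T - {j}. i < k})"
      unfolding 2 by (rule card_insert_disjoint) (use assms in auto)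
    thus ?thesis unfolding ksign_def 1 by simp
  qed
  show ?thesis
    using main[of k j] main[of j k] assms by (cases "j < k") auto
qed

lemma lin_shift_sum: "lin_shift lam k (\<lambda>a. \<Sum>i\<in>I. c i * f i a) a = (\<Sum>i\<in>I. c i * lin_shift lam k (f i) a)"
proof -
  have "lin_shift lam k (\<lambda>a. \<Sum>i\<in>I. c i * f i a) a =
     (\<Sum>w\<in>supp a. \<Sum>i\<in>I. c i * (lam k w * f i (a(w := a w - 1))))"
    by (simp add: lin_shift_def sum_distrib_left mult_ac)
  also have "\<dots> = (\<Sum>i\<in>I. \<Sum>w\<in>supp a. c i * (lam k w * f i (a(w := a w - 1))))"
    by (rule sum.swap)
  finally show ?thesis by (simp add: lin_shift_def sum_distrib_left)
qed

lemma lin_shift_cong: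
  assumes "\<And>w. w \<in> supp a \<Longrightarrow> lam k w \<noteq> 0 \<Longrightarrow> c (a(w := a w - 1)) = c' (a(w := a w - 1))"
  shows "lin_shift lam k c a = lin_shift lam k c' a"
  unfolding lin_shift_def by (rule sum.cong) (use assms in auto)

lemma lin_shift_zero: "(\<And>w. w \<in> supp a \<Longrightarrow> lam k w \<noteq> 0 \<Longrightarrow> c (a(w := a w - 1)) = 0) \<Longrightarrow> lin_shift lam k c a = 0"
  unfolding lin_shift_def by (rule sum.neutral) auto

lemma lin_shift_diff: "lin_shift lam k (\<lambda>a. f a - g a) a = lin_shift lam k f a - lin_shift lam k g a"
  by (simp add: lin_shift_def right_diff_distrib sum_subtractf)

lemma kbd_diff: "kbd lam U (\<lambda>T a. y T a - z T a) T a = kbd lam U y T a - kbd lam U z T a"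
  by (simp add: kbd_def lin_shift_diff right_diff_distrib sum_subtractf)

lemma kbd_outside: "(T, a) \<notin> U \<Longrightarrow> kbd lam U z T a = 0"
  by (simp add: kbd_def)

lemma sum_antisym:
  fixes F :: "nat \<Rightarrow> nat \<Rightarrow> real"
  assumes "finite T" and anti: "\<And>j k. j \<in> T \<Longrightarrow> k \<in> T \<Longrightarrow> j \<noteq> k \<Longrightarrow> F k j = - F j k"
  shows "(\<Sum>k\<in>T. \<Sum>j\<in>T-{k}. F k j) = 0"
proof -
  let ?S = "\<Sum>p\<in>Sigma T (\<lambda>k. T-{k}). F (fst p) (snd p)"
  have 1: "(\<Sum>k\<in>T. \<Sum>j\<in>T-{k}. F k j) = ?S"
    using assms(1) by (subst sum.Sigma) (auto simp: case_prod_beta)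
  have "?S = (\<Sum>p\<in>Sigma T (\<lambda>k. T-{k}). - F (fst p) (snd p))"
    by (rule sum.reindex_bij_witness[of _ "\<lambda>(w,u). (u,w)" "\<lambda>(w,u). (u,w)"])
       (auto simp: anti[symmetric], metis anti)
  also have "\<dots> = - ?S" by (simp add: sum_negf)
  finally show ?thesis using 1 by simp
qed

text \<open>Convexity makes the truncation of the inner boundary invisible, so the double sum is the
  untruncated one. It is antisymmetric in the two removed generators because multiplications by
  linear forms commute while the signs anticommute.\<close>

lemma kbd_kbd:
  assumes fin: "kfin U" and conv: "kconvex lam U"
    and sup: "\<And>T a. z T a \<noteq> 0 \<Longrightarrow> (T, a) \<in> U"
  shows "kbd lam U (kbd lam U z) T a = 0"
proof (cases "(T, a) \<in> U")
  case True
  hence finT: "finite T" and fina: "finite (supp a)" using fin by (auto simp: kfin_def)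
  let ?a = "\<lambda>w. a(w := a w - 1)"
  have inner: "kbd lam U z (T - {k}) (?a w) =
      (\<Sum>j\<in>T-{k}. ksign j (T - {k}) * lin_shift lam j (z (T - {k} - {j})) (?a w))"
    if "k \<in> T" "w \<in> supp a" for k w
  proof (cases "(T - {k}, ?a w) \<in> U")
    case False
    \<comment> \<open>A nonzero term would put both ends of a two-step divisor chain into
      \<open>U\<close>, and convexity would force the intermediate pair into \<open>U\<close> as
      well.\<close>
    have "lin_shift lam j (z (T - {k} - {j})) (?a w) = 0" if "j \<in> T - {k}" for j
    proof (rule lin_shift_zero, rule ccontr)
      fix u assume u: "u \<in> supp (?a w)" "lam j u \<noteq> 0" "z (T - {k} - {j}) ((?a w)(u := (?a w) u - 1)) \<noteq> 0"
      from sup[OF u(3)] conv True \<open>k \<in> T\<close> that \<open>w \<in> supp a\<close> u(1,2) False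
      show False unfolding kconvex_def by blast
    qed
    thus ?thesis using False by (simp add: kbd_def)
  qed (simp add: kbd_def)
  have "kbd lam U (kbd lam U z) T a =
     (\<Sum>k\<in>T. ksign k T * lin_shift lam k (\<lambda>b. \<Sum>j\<in>T-{k}. ksign j (T - {k}) * lin_shift lam j (z (T - {k} - {j})) b) a)"
    using True unfolding kbd_def[of lam U "kbd lam U z"]
    by (auto intro!: sum.cong arg_cong2[of _ _ _ _ "(*)"] lin_shift_cong inner)
  also have "\<dots> = (\<Sum>k\<in>T. \<Sum>j\<in>T-{k}. (ksign k T * ksign j (T - {k})) *
      lin_shift lam k (lin_shift lam j (z (T - {k} - {j}))) a)"
    by (simp add: lin_shift_sum sum_distrib_left mult.assoc)
  also have "\<dots> = 0"
  proof (rule sum_antisym[OF finT])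
    fix j k assume jk: "j \<in> T" "k \<in> T" "j \<noteq> k"
    have "T - {j} - {k} = T - {k} - {j}" by auto
    thus "ksign k T * ksign j (T - {k}) * lin_shift lam k (lin_shift lam j (z (T - {k} - {j}))) a =
      - (ksign j T * ksign k (T - {j}) * lin_shift lam j (lin_shift lam k (z (T - {j} - {k}))) a)"
      using ksign_swap[OF finT jk(2) jk(1) jk(3)] lin_shift_commute[OF fina, of lam k j]
      by simp
  qed
  finally show ?thesis .
qed (simp add: kbd_outside)

section \<open>Subcomplexes, quotients and their exact sequence\<close>

definition krestrict where "krestrict U z T a = (if (T, a) \<in> U then z T a else (0::real))"

text \<open>\<open>kclosed\<close> says that the boundary never leads from \<open>U2\<close> into
  \<open>U1\<close>. So \<open>U2\<close> carries a subcomplex, \<open>U1\<close> the quotient, and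
  \<open>krestrict U1\<close> is the projection onto the quotient.\<close>

lemma kbd_restrict_quotient:
  assumes "kclosed lam U2 U1" and "\<And>T a. z T a \<noteq> 0 \<Longrightarrow> (T, a) \<in> U1 \<union> U2" and "(T, a) \<in> U1"
  shows "kbd lam (U1 \<union> U2) z T a = kbd lam U1 (krestrict U1 z) T a"
proof -
  have "z (T - {k}) (a(w := a w - 1)) = krestrict U1 z (T - {k}) (a(w := a w - 1))"
    if "k \<in> T" "w \<in> supp a" "lam k w \<noteq> 0" for k w
    using assms that unfolding kclosed_def krestrict_def by (metis Un_iff)
  thus ?thesis using assms(3)
    unfolding kbd_def by (auto intro!: sum.cong arg_cong2[of _ _ _ _ "(*)"] lin_shift_cong)
qed

lemma kbd_sub:
  assumes "kclosed lam U2 U1" "U1 \<inter> U2 = {}" and "\<And>T a. z T a \<noteq> 0 \<Longrightarrow> (T, a) \<in> U2"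
  shows "kbd lam (U1 \<union> U2) z T a = kbd lam U2 z T a"
proof (cases "(T, a) \<in> U1")
  case True
  have "z (T - {k}) (a(w := a w - 1)) = 0" if "k \<in> T" "w \<in> supp a" "lam k w \<noteq> 0" for k w
    using assms that True unfolding kclosed_def by (metis Un_iff)
  hence "kbd lam (U1 \<union> U2) z T a = 0"
    unfolding kbd_def by (auto intro!: sum.neutral lin_shift_zero)
  thus ?thesis using True assms(2) by (auto simp: kbd_def)
qed (auto simp: kbd_def)

lemma kacyclicD:
  assumes "kacyclic lam n U" "k < n" "chain U k z" "\<And>T a. kbd lam U z T a = 0"
  obtains b where "\<And>T a. b T a \<noteq> 0 \<Longrightarrow> (T, a) \<in> U \<and> Suc (card T) = k" "\<And>T a. kbd lam U b T a = z T a"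
  using assms unfolding kacyclic_def by blast

lemma kbd_level:
  assumes "kfin U" "\<And>T a. z T a \<noteq> 0 \<Longrightarrow> Suc (card T) = k" "kbd lam U z T a \<noteq> 0"
  shows "(T, a) \<in> U \<and> card T = k"
proof -
  have U: "(T, a) \<in> U" using assms(3) by (auto simp: kbd_def split: if_splits)
  hence "finite T" using assms(1) by (auto simp: kfin_def)
  from U assms(3) obtain j where j: "j \<in> T" "lin_shift lam j (z (T - {j})) a \<noteq> 0"
    unfolding kbd_def by (metis (mono_tags, lifting) mult_zero_right sum.neutral)
  from j(2) obtain w where "z (T - {j}) (a(w := a w - 1)) \<noteq> 0"
    using lin_shift_zero by metis
  from assms(2)[OF this] j(1) \<open>finite T\<close> U show ?thesis
    by (metis card_Suc_Diff1)
qed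

text \<open>The usual chase: bound the cycle in the quotient, lift the primitive, and bound the
  remaining cycle in the subcomplex.\<close>

lemma kacyclic_glue:
  assumes fin: "kfin (U1 \<union> U2)" and conv: "kconvex lam (U1 \<union> U2)" and cl: "kclosed lam U2 U1"
    and disj: "U1 \<inter> U2 = {}" and "kacyclic lam n U1" "kacyclic lam n U2"
  shows "kacyclic lam n (U1 \<union> U2)"
  unfolding kacyclic_def
proof (intro allI impI, elim conjE)
  fix k z assume k: "k < n" and z: "chain (U1 \<union> U2) k z" "\<forall>T a. kbd lam (U1 \<union> U2) z T a = 0"
  let ?U = "U1 \<union> U2"
  define z1 where "z1 = krestrict U1 z"
  have zs: "z T a \<noteq> 0 \<Longrightarrow> (T, a) \<in> U1 \<union> U2" for T a using z(1) by (auto simp: chain_def)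
  have "chain U1 k z1" using z(1) by (auto simp: chain_def z1_def krestrict_def)
  moreover have "kbd lam U1 z1 T a = 0" for T a
    using kbd_restrict_quotient[OF cl zs, where z=z and T=T and a=a] z(2) unfolding z1_def
    by (cases "(T, a) \<in> U1") (auto simp: kbd_outside)
  ultimately obtain b where b: "\<And>T a. b T a \<noteq> 0 \<Longrightarrow> (T, a) \<in> U1 \<and> Suc (card T) = k"
      "\<And>T a. kbd lam U1 b T a = z1 T a"
    using kacyclicD[OF assms(5) k] by blast
  have bs: "b T a \<noteq> 0 \<Longrightarrow> (T, a) \<in> U1 \<union> U2" for T a using b(1) by blast
  have rb: "krestrict U1 b = b" using b(1) by (auto simp: krestrict_def fun_eq_iff)
  define y where "y = (\<lambda>T a. z T a - kbd lam ?U b T a)"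
  \<comment> \<open>After the boundary of the lifted primitive is subtracted, nothing is left in the
    quotient.\<close>
  have y0: "y T a = 0" if "(T, a) \<in> U1" for T a
    using kbd_restrict_quotient[OF cl bs, where z=b and T=T and a=a] b(2)[of T a] that
    by (simp add: y_def rb z1_def krestrict_def)
  have lev: "kbd lam ?U b T a \<noteq> 0 \<Longrightarrow> (T, a) \<in> ?U \<and> card T = k" for T a
    using kbd_level[OF fin, of b k lam T a] b(1) by blast
  have yc: "chain U2 k y"
    unfolding chain_def
  proof (intro allI impI)
    fix T a assume "y T a \<noteq> 0"
    hence "z T a \<noteq> 0 \<or> kbd lam ?U b T a \<noteq> 0" by (auto simp: y_def)
    hence "(T, a) \<in> ?U \<and> card T = k" using z(1) lev by (auto simp: chain_def)
    thus "(T, a) \<in> U2 \<and> card T = k" using y0 \<open>y T a \<noteq> 0\<close> by auto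
  qed
  hence ys: "y T a \<noteq> 0 \<Longrightarrow> (T, a) \<in> U2" for T a by (auto simp: chain_def)
  have "kbd lam U2 y T a = 0" for T a
  proof -
    have "kbd lam U2 y T a = kbd lam ?U y T a" using kbd_sub[OF cl disj ys, where z=y] by simp
    also have "\<dots> = 0" unfolding y_def using z(2) kbd_kbd[OF fin conv bs] by (simp add: kbd_diff)
    finally show ?thesis .
  qed
  then obtain c where c: "\<And>T a. c T a \<noteq> 0 \<Longrightarrow> (T, a) \<in> U2 \<and> Suc (card T) = k"
      "\<And>T a. kbd lam U2 c T a = y T a"
    using kacyclicD[OF assms(6) k yc] by blast
  have "kbd lam ?U c T a = y T a" for T a
    using kbd_sub[OF cl disj, of c] c by metis
  hence "kbd lam ?U (\<lambda>T a. c T a - (- b T a)) T a = z T a" for T a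
    using kbd_diff[of lam ?U "\<lambda>T a. 0" b T a]
    by (subst kbd_diff) (simp add: y_def kbd_def lin_shift_def)
  moreover have "c T a - (- b T a) \<noteq> 0 \<Longrightarrow> (T, a) \<in> ?U \<and> Suc (card T) = k" for T a
    using b(1)[of T a] c(1)[of T a] by (cases "b T a = 0") auto
  ultimately show "\<exists>b. (\<forall>T a. b T a \<noteq> 0 \<longrightarrow> (T, a) \<in> ?U \<and> Suc (card T) = k) \<and> (\<forall>T a. kbd lam ?U b T a = z T a)"
    by (intro exI[of _ "\<lambda>T a. c T a - (- b T a)"]) blast
qed

text \<open>The primitive found in the whole complex projects to a cycle of the quotient in one
  exterior degree less. A primitive of that projection corrects it to one supported on the
  subcomplex.\<close>

lemma kacyclic_sub:
  assumes fin: "kfin (U1 \<union> U2)" and conv: "kconvex lam (U1 \<union> U2)" and cl: "kclosed lam U2 U1"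
    and disj: "U1 \<inter> U2 = {}" and "kacyclic lam n U1" "kacyclic lam n (U1 \<union> U2)"
  shows "kacyclic lam n U2"
  unfolding kacyclic_def
proof (intro allI impI, elim conjE)
  fix k z assume k: "k < n" and z: "chain U2 k z" "\<forall>T a. kbd lam U2 z T a = 0"
  let ?U = "U1 \<union> U2"
  have zs: "z T a \<noteq> 0 \<Longrightarrow> (T, a) \<in> U2" for T a using z(1) by (auto simp: chain_def)
  have zc: "chain ?U k z" using z(1) by (auto simp: chain_def)
  have "kbd lam ?U z T a = 0" for T a using kbd_sub[OF cl disj zs, where z=z] z(2) by simp
  then obtain b where b: "\<And>T a. b T a \<noteq> 0 \<Longrightarrow> (T, a) \<in> ?U \<and> Suc (card T) = k"
      "\<And>T a. kbd lam ?U b T a = z T a"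
    using kacyclicD[OF assms(6) k zc] by blast
  have bs: "b T a \<noteq> 0 \<Longrightarrow> (T, a) \<in> U1 \<union> U2" for T a using b(1) by blast
  define b1 where "b1 = krestrict U1 b"
  have b1: "kbd lam U1 b1 T a = 0" for T a
  proof (cases "(T, a) \<in> U1")
    case True
    hence "kbd lam U1 b1 T a = z T a"
      using kbd_restrict_quotient[OF cl bs, where z=b and T=T and a=a] True b(2) by (simp add: b1_def)
    thus ?thesis using zs[of T a] True disj by (metis disjoint_iff)
  qed (simp add: kbd_outside)
  \<comment> \<open>In exterior degree 0 there are no primitives, hence \<open>b1\<close> vanishes
    and no correction is required.\<close>
  have "\<exists>c. (\<forall>T a. c T a \<noteq> 0 \<longrightarrow> (T, a) \<in> U1 \<and> Suc (Suc (card T)) = k) \<and>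
      (\<forall>T a. kbd lam U1 c T a = b1 T a)"
  proof (cases k)
    case 0
    hence "b1 T a = 0" for T a using b(1)[of T a] by (auto simp: b1_def krestrict_def)
    thus ?thesis by (intro exI[of _ "\<lambda>T a. 0"]) (auto simp: kbd_def lin_shift_def)
  next
    case (Suc k')
    have "chain U1 k' b1" using b(1) Suc by (auto simp: chain_def b1_def krestrict_def split: if_splits)
    moreover have "k' < n" using Suc k by simp
    ultimately obtain c where "\<And>T a. c T a \<noteq> 0 \<Longrightarrow> (T, a) \<in> U1 \<and> Suc (card T) = k'"
      "\<And>T a. kbd lam U1 c T a = b1 T a"
      using kacyclicD[OF assms(5), of k' b1] b1 by blast
    thus ?thesis using Suc by auto
  qed
  then obtain c where c: "\<And>T a. c T a \<noteq> 0 \<Longrightarrow> (T, a) \<in> U1 \<and> Suc (Suc (card T)) = k"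
      "\<And>T a. kbd lam U1 c T a = b1 T a" by blast
  have cs: "c T a \<noteq> 0 \<Longrightarrow> (T, a) \<in> ?U" for T a using c(1) by blast
  have rc: "krestrict U1 c = c" using c(1) by (auto simp: krestrict_def fun_eq_iff)
  define y where "y = (\<lambda>T a. b T a - kbd lam ?U c T a)"
  have y0: "y T a = 0" if "(T, a) \<in> U1" for T a
    using kbd_restrict_quotient[OF cl cs, where z=c and T=T and a=a] c(2)[of T a] that
    by (simp add: y_def rc b1_def krestrict_def)
  have lev: "kbd lam ?U c T a \<noteq> 0 \<Longrightarrow> (T, a) \<in> ?U \<and> Suc (card T) = k" for T a
  proof -
    assume nz: "kbd lam ?U c T a \<noteq> 0"
    then obtain T' a' where "c T' a' \<noteq> 0"
      by (metis (no_types, lifting) kbd_def lin_shift_zero mult_zero_right sum.neutral)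
    hence "k \<ge> 1" using c(1) by force
    thus ?thesis using kbd_level[OF fin, of c "k - 1" lam T a] c(1) nz by force
  qed
  have ys: "y T a \<noteq> 0 \<Longrightarrow> (T, a) \<in> U2 \<and> Suc (card T) = k" for T a
  proof -
    assume "y T a \<noteq> 0"
    hence "b T a \<noteq> 0 \<or> kbd lam ?U c T a \<noteq> 0" by (auto simp: y_def)
    hence "(T, a) \<in> ?U \<and> Suc (card T) = k" using b(1) lev by blast
    thus ?thesis using y0 \<open>y T a \<noteq> 0\<close> by auto
  qed
  have "kbd lam U2 y T a = z T a" for T a
  proof -
    have "kbd lam U2 y T a = kbd lam ?U y T a" using kbd_sub[OF cl disj, of y] ys by simp
    also have "\<dots> = z T a" unfolding y_def using b(2) kbd_kbd[OF fin conv cs] by (simp add: kbd_diff)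
    finally show ?thesis .
  qed
  thus "\<exists>b. (\<forall>T a. b T a \<noteq> 0 \<longrightarrow> (T, a) \<in> U2 \<and> Suc (card T) = k) \<and> (\<forall>T a. kbd lam U2 b T a = z T a)"
    using ys by blast
qed

text \<open>
  The contracting homotopy on \<open>{a. R \<subseteq> supp a \<subseteq> \<rho>}\<close>: partial derivatives in the coordinates dual to the
  linear forms, with exponents counted relative to the least monomial, the product over \<open>R\<close>.
\<close>

definition dshift :: "'x set \<Rightarrow> 'x set \<Rightarrow> (nat \<Rightarrow> 'x \<Rightarrow> real) \<Rightarrow> nat \<Rightarrow> (('x \<Rightarrow> nat) \<Rightarrow> real) \<Rightarrow> ('x \<Rightarrow> nat) \<Rightarrow> real" where
  "dshift R \<rho> B v c a =
     (\<Sum>u\<in>\<rho>. B v u * (real (a u) - of_bool (u \<in> R) + 1) * c (a(u := a u + 1)))"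

lemma ksign_sq [simp]: "ksign k T * ksign k T = 1"
  by (simp add: ksign_def flip: power_add)

lemma lin_shift_guard:
  assumes "supp a \<subseteq> \<rho>" "finite \<rho>"
  shows "lin_shift lam k c a = (\<Sum>w\<in>\<rho>. lam k w * (if a w > 0 then c (a(w := a w - 1)) else 0))"
  unfolding lin_shift_def
  by (rule sum.mono_neutral_cong_left) (use assms in \<open>auto simp: supp_def\<close>)

text \<open>The Heisenberg relation between a derivative and multiplication by a linear form. The
  two double sums share the off-diagonal terms \<open>g\<close>; on the diagonal the weights differ
  by one.\<close>

lemma dshift_lin_shift:
  assumes "finite \<rho>" "R \<subseteq> supp a" "supp a \<subseteq> \<rho>"
  shows "dshift R \<rho> B j (lin_shift lam k c) a - lin_shift lam k (dshift R \<rho> B j c) a =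
    (\<Sum>u\<in>\<rho>. B j u * lam k u) * c a"
proof -
  define g where "g w u = B j u * lam k w *
     (if a w > 0 \<and> u \<noteq> w then (real (a u) - of_bool (u \<in> R) + 1) * c (a(w := a w - 1, u := a u + 1)) else 0)" for w u
  have 1: "dshift R \<rho> B j (lin_shift lam k c) a =
      (\<Sum>u\<in>\<rho>. \<Sum>w\<in>\<rho>. g w u + (if w = u then B j u * lam k u * ((real (a u) - of_bool (u \<in> R) + 1) * c a) else 0))"
    unfolding dshift_def
  proof (rule sum.cong[OF refl])
    fix u assume u: "u \<in> \<rho>"
    have s: "supp (a(u := a u + 1)) \<subseteq> \<rho>" using assms u by (auto simp: supp_def)
    show "B j u * (real (a u) - of_bool (u \<in> R) + 1) * lin_shift lam k c (a(u := a u + 1)) =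
      (\<Sum>w\<in>\<rho>. g w u + (if w = u then B j u * lam k u * ((real (a u) - of_bool (u \<in> R) + 1) * c a) else 0))"
      unfolding lin_shift_guard[OF s assms(1)] sum_distrib_left
      by (rule sum.cong) (auto simp: g_def fun_upd_twist)
  qed
  have 2: "lin_shift lam k (dshift R \<rho> B j c) a =
      (\<Sum>w\<in>\<rho>. \<Sum>u\<in>\<rho>. g w u + (if w = u then B j u * lam k u * ((real (a u) - of_bool (u \<in> R)) * c a) else 0))"
    unfolding lin_shift_guard[OF assms(3,1)]
  proof (rule sum.cong[OF refl])
    fix w assume w: "w \<in> \<rho>"
    show "lam k w * (if a w > 0 then dshift R \<rho> B j c (a(w := a w - 1)) else 0) =
      (\<Sum>u\<in>\<rho>. g w u + (if w = u then B j u * lam k u * ((real (a u) - of_bool (u \<in> R)) * c a) else 0))"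
    proof (cases "a w > 0")
      case True
      thus ?thesis unfolding dshift_def
        by (auto simp: g_def sum_distrib_left of_nat_diff intro!: sum.cong)
    next
      case False
      \<comment> \<open>Here the predecessor is missing, and the diagonal weight
        \<open>a w - of_bool (w \<in> R)\<close> that it would carry is 0.\<close>
      hence "w \<notin> R" using assms(2) by (auto simp: supp_def)
      thus ?thesis using False by (auto simp: g_def intro!: sum.neutral)
    qed
  qed
  have "dshift R \<rho> B j (lin_shift lam k c) a - lin_shift lam k (dshift R \<rho> B j c) a =
     (\<Sum>u\<in>\<rho>. B j u * lam k u * ((real (a u) - of_bool (u \<in> R) + 1) * c a) - B j u * lam k u * ((real (a u) - of_bool (u \<in> R)) * c a))"
    unfolding 1 2 sum.distrib sum_subtractf
    by (subst sum.swap) (use assms(1) in \<open>simp add: sum.delta sum.delta'\<close>)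
  also have "\<dots> = (\<Sum>u\<in>\<rho>. B j u * lam k u) * c a"
    unfolding sum_distrib_right by (rule sum.cong) (auto simp: algebra_simps)
  finally show ?thesis .
qed

text \<open>The degree above the least monomial, which is the eigenvalue of the Euler operator in
  the next lemma.\<close>

definition rdeg :: "'x set \<Rightarrow> ('x \<Rightarrow> nat) \<Rightarrow> real" where
  "rdeg R a = (\<Sum>w\<in>supp a. real (a w) - of_bool (w \<in> R))"

text \<open>Euler's identity in the coordinates dual to the linear forms: since \<open>lam\<close>
  and \<open>B\<close> are inverse matrices, the sum over \<open>N\<close> becomes the sum of the x
  d/dx over the variables.\<close>

lemma lin_shift_dshift_sum:
  assumes "finite \<rho>" "finite N" "R \<subseteq> supp a" "supp a \<subseteq> \<rho>"
    and B: "\<And>w u. w \<in> \<rho> \<Longrightarrow> u \<in> \<rho> \<Longrightarrow> (\<Sum>k\<in>N. lam k w * B k u) = of_bool (w = u)"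
  shows "(\<Sum>k\<in>N. lin_shift lam k (dshift R \<rho> B k c) a) = rdeg R a * c a"
proof -
  let ?b = "\<lambda>w u. a(w := a w - 1, u := (a(w := a w - 1)) u + 1)"
  let ?f = "\<lambda>w u. real ((a(w := a w - 1)) u) - of_bool (u \<in> R) + 1"
  have "(\<Sum>k\<in>N. lin_shift lam k (dshift R \<rho> B k c) a) =
     (\<Sum>k\<in>N. \<Sum>w\<in>supp a. \<Sum>u\<in>\<rho>. lam k w * B k u * (?f w u * c (?b w u)))"
    unfolding lin_shift_def dshift_def by (simp add: sum_distrib_left mult.assoc)
  also have "\<dots> = (\<Sum>w\<in>supp a. \<Sum>u\<in>\<rho>. \<Sum>k\<in>N. lam k w * B k u * (?f w u * c (?b w u)))"
    by (subst sum.swap, rule sum.cong[OF refl], rule sum.swap)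
  also have "\<dots> = (\<Sum>w\<in>supp a. \<Sum>u\<in>\<rho>. of_bool (w = u) * (?f w u * c (?b w u)))"
    unfolding sum_distrib_right[symmetric]
    by (intro sum.cong refl arg_cong2[of _ _ _ _ "(*)"] B) (use assms in auto)
  also have "\<dots> = (\<Sum>w\<in>supp a. (real (a w) - of_bool (w \<in> R)) * c a)"
  proof (rule sum.cong[OF refl])
    fix w assume w: "w \<in> supp a"
    hence "w \<in> \<rho>" using assms by auto
    have "(\<Sum>u\<in>\<rho>. of_bool (w = u) * (?f w u * c (?b w u))) =
        (\<Sum>u\<in>\<rho>. if u = w then ?f w w * c (?b w w) else 0)"
      by (rule sum.cong) auto
    also have "\<dots> = ?f w w * c (?b w w)" using \<open>w \<in> \<rho>\<close> assms(1) by simp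
    also have "\<dots> = (real (a w) - of_bool (w \<in> R)) * c a"
      using w by (simp add: supp_def of_nat_diff)
    finally show "(\<Sum>u\<in>\<rho>. of_bool (w = u) * (?f w u * c (?b w u))) = (real (a w) - of_bool (w \<in> R)) * c a" .
  qed
  finally show ?thesis by (simp add: rdeg_def sum_distrib_right)
qed

lemma dshift_sum: "dshift R \<rho> B v (\<lambda>a. \<Sum>i\<in>I. c i * f i a) a = (\<Sum>i\<in>I. c i * dshift R \<rho> B v (f i) a)"
proof -
  let ?g = "\<lambda>u. B v u * (real (a u) - of_bool (u \<in> R) + 1)"
  have "dshift R \<rho> B v (\<lambda>a. \<Sum>i\<in>I. c i * f i a) a =
     (\<Sum>u\<in>\<rho>. \<Sum>i\<in>I. c i * (?g u * f i (a(u := a u + 1))))"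
    by (simp add: dshift_def sum_distrib_left mult_ac)
  also have "\<dots> = (\<Sum>i\<in>I. \<Sum>u\<in>\<rho>. c i * (?g u * f i (a(u := a u + 1))))"
    by (rule sum.swap)
  finally show ?thesis by (simp add: dshift_def sum_distrib_left)
qed

text \<open>Boundary and homotopy anticommute to multiplication by \<open>q\<close>: Euler's
  identity contributes the relative degree, and each of the \<open>card N - card T\<close> absent
  generators contributes 1. Below the top exterior degree this number is positive, so dividing by it
  gives a primitive.\<close>

theorem koszul_interval_acyclic:
  assumes fin: "finite \<rho>" "finite N" and R: "R \<subseteq> \<rho>"
    and B1: "\<And>j k. j \<in> N \<Longrightarrow> k \<in> N \<Longrightarrow> (\<Sum>u\<in>\<rho>. B j u * lam k u) = of_bool (j = k)"
    and B2: "\<And>w u. w \<in> \<rho> \<Longrightarrow> u \<in> \<rho> \<Longrightarrow> (\<Sum>k\<in>N. lam k w * B k u) = of_bool (w = u)"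
  shows "kacyclic lam (card N) {(T, a). T \<subseteq> N \<and> R \<subseteq> supp a \<and> supp a \<subseteq> \<rho>}"
  unfolding kacyclic_def
proof (intro allI impI, elim conjE)
  let ?U = "{(T, a). T \<subseteq> N \<and> R \<subseteq> supp a \<and> supp a \<subseteq> \<rho>}"
  fix k z assume k: "k < card N" and z: "chain ?U k z" and cyc: "\<forall>T a. kbd lam ?U z T a = 0"
  define q where "q T a = rdeg R a + real (card N) - real (card T)" for T :: "nat set" and a :: "'a \<Rightarrow> nat"
  define y where "y T a = z T a / q T a" for T a
  define b where "b T a = (\<Sum>u\<in>N-T. ksign u (insert u T) * dshift R \<rho> B u (y (insert u T)) a)" for T a
  have ys: "(T, a) \<in> ?U \<and> card T = k" if "y T a \<noteq> 0" for T a
  proof -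
    from that have "z T a \<noteq> 0" by (auto simp: y_def)
    thus ?thesis using z unfolding chain_def by blast
  qed
  have rdec: "rdeg R (a(w := a w - 1)) = rdeg R a - 1" if "finite (supp a)" "w \<in> supp a" "R \<subseteq> supp (a(w := a w - 1))" for a w
  proof -
    have eq: "rdeg R (a(w := a w - 1)) = (\<Sum>v\<in>supp a. real ((a(w := a w - 1)) v) - of_bool (v \<in> R))"
      unfolding rdeg_def using that
      by (intro sum.mono_neutral_left supp_dec_subset) (auto simp: supp_def subset_iff split: if_splits)
    have "(\<Sum>v\<in>supp a - {w}. real ((a(w := a w - 1)) v) - of_bool (v \<in> R)) =
        (\<Sum>v\<in>supp a - {w}. real (a v) - of_bool (v \<in> R))"
      by (rule sum.cong) auto
    moreover have "real (a w - 1) = real (a w) - 1" using that(2) by (simp add: supp_def of_nat_diff)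
    ultimately show ?thesis
      by (subst eq) (simp add: rdeg_def sum.remove[OF that(1,2)])
  qed
  \<comment> \<open>The weight \<open>q\<close> agrees at both ends of every boundary term, since
    the relative degree and the size of \<open>T\<close> drop together; dividing by \<open>q\<close>
    therefore preserves cycles.\<close>
  have ycyc: "kbd lam ?U y T a = 0" for T a
  proof (cases "(T, a) \<in> ?U")
    case True
    hence fT: "finite T" and fa: "finite (supp a)" using fin finite_subset by auto
    have "y (T - {v}) (a(w := a w - 1)) = (1 / q T a) * z (T - {v}) (a(w := a w - 1))"
      if "v \<in> T" "w \<in> supp a" for v w
    proof (cases "z (T - {v}) (a(w := a w - 1)) = 0")
      case False
      hence "R \<subseteq> supp (a(w := a w - 1))" using z by (auto simp: chain_def)
      moreover have "real (card (T - {v})) = real (card T) - 1"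
        using card_Suc_Diff1[OF fT that(1)] by linarith
      ultimately have "q (T - {v}) (a(w := a w - 1)) = q T a"
        unfolding q_def using rdec[OF fa that(2)] by linarith
      thus ?thesis unfolding y_def by simp
    qed (simp add: y_def)
    hence "lin_shift lam v (y (T - {v})) a = (1 / q T a) * lin_shift lam v (z (T - {v})) a" if "v \<in> T" for v
      unfolding lin_shift_def sum_distrib_left using that by (intro sum.cong) auto
    hence "kbd lam ?U y T a = (1 / q T a) * kbd lam ?U z T a"
      using True by (simp add: kbd_def sum_divide_distrib)
    thus ?thesis using cyc by simp
  qed (simp add: kbd_outside)
  have bs: "(T, a) \<in> ?U \<and> Suc (card T) = k" if nz: "b T a \<noteq> 0" for T a
  proof -
    from nz obtain u where u: "u \<in> N - T" "dshift R \<rho> B u (y (insert u T)) a \<noteq> 0"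
      unfolding b_def by (metis (no_types, lifting) mult_zero_right sum.neutral)
    from u(2) obtain v where v: "v \<in> \<rho>" "real (a v) - of_bool (v \<in> R) + 1 \<noteq> 0" "y (insert u T) (a(v := a v + 1)) \<noteq> 0"
      unfolding dshift_def by (metis (no_types, lifting) mult_zero_right mult_zero_left sum.neutral)
    from ys[OF v(3)] have *: "insert u T \<subseteq> N" "R \<subseteq> supp (a(v := a v + 1))" "supp (a(v := a v + 1)) \<subseteq> \<rho>" "card (insert u T) = k"
      by auto
    \<comment> \<open>A derivative that would delete an element of \<open>R\<close> from the support
      carries the weight 0, so \<open>b\<close> stays inside the interval.\<close>
    have "R \<subseteq> supp a" using *(2) v(2) by (auto simp: supp_def subset_iff split: if_splits)
    moreover have "supp a \<subseteq> \<rho>" using *(3) by (auto simp: supp_def subset_iff split: if_splits)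
    moreover have "finite T" using *(1) fin(2) finite_subset by auto
    ultimately show ?thesis using * u(1) by auto
  qed
  have hom: "kbd lam ?U b T a = z T a" if "T \<subseteq> N" "R \<subseteq> supp a" "supp a \<subseteq> \<rho>" "card T = k" for T a
  proof -
    have TU: "(T, a) \<in> ?U" using that by simp
    have fT: "finite T" using that fin finite_subset by auto
    let ?m = "\<lambda>v u. ksign v T * ksign u (insert u (T - {v})) * lin_shift lam v (dshift R \<rho> B u (y (insert u (T - {v})))) a"
    have "kbd lam ?U b T a = (\<Sum>v\<in>T. ksign v T * lin_shift lam v (b (T - {v})) a)"
      using TU by (simp add: kbd_def)
    also have "\<dots> = (\<Sum>v\<in>T. \<Sum>u\<in>N-(T-{v}). ?m v u)"
      unfolding b_def lin_shift_sum by (simp add: sum_distrib_left mult.assoc)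
    also have "\<dots> = (\<Sum>v\<in>T. lin_shift lam v (dshift R \<rho> B v (y T)) a + (\<Sum>u\<in>N-T. ?m v u))"
    proof (rule sum.cong[OF refl])
      fix v assume v: "v \<in> T"
      have "N - (T - {v}) = insert v (N - T)" using v that by auto
      thus "(\<Sum>u\<in>N-(T-{v}). ?m v u) = lin_shift lam v (dshift R \<rho> B v (y T)) a + (\<Sum>u\<in>N-T. ?m v u)"
        using v fin by (simp add: insert_absorb)
    qed
    finally have L: "kbd lam ?U b T a = (\<Sum>v\<in>T. lin_shift lam v (dshift R \<rho> B v (y T)) a) + (\<Sum>v\<in>T. \<Sum>u\<in>N-T. ?m v u)"
      by (simp add: sum.distrib)
    let ?m' = "\<lambda>u v. ksign u (insert u T) * ksign v (insert u T) * dshift R \<rho> B u (lin_shift lam v (y (insert u T - {v}))) a"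
    have "0 = (\<Sum>u\<in>N-T. ksign u (insert u T) * dshift R \<rho> B u (kbd lam ?U y (insert u T)) a)"
      using ycyc by (simp add: dshift_def)
    also have "\<dots> = (\<Sum>u\<in>N-T. ksign u (insert u T) * dshift R \<rho> B u
         (\<lambda>a. \<Sum>v\<in>insert u T. ksign v (insert u T) * lin_shift lam v (y (insert u T - {v})) a) a)"
    proof (rule sum.cong[OF refl], rule arg_cong2[of _ _ _ _ "(*)"], rule refl)
      fix u assume u: "u \<in> N - T"
      have "(insert u T, a(w := a w + 1)) \<in> ?U" if "w \<in> \<rho>" for w
        using that TU u by (auto simp: supp_def)
      thus "dshift R \<rho> B u (kbd lam ?U y (insert u T)) a = dshift R \<rho> B u
         (\<lambda>a. \<Sum>v\<in>insert u T. ksign v (insert u T) * lin_shift lam v (y (insert u T - {v})) a) a"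
        unfolding dshift_def by (intro sum.cong refl) (auto simp: kbd_def)
    qed
    also have "\<dots> = (\<Sum>u\<in>N-T. \<Sum>v\<in>insert u T. ?m' u v)"
      unfolding dshift_sum by (simp add: sum_distrib_left mult.assoc)
    also have "\<dots> = (\<Sum>u\<in>N-T. dshift R \<rho> B u (lin_shift lam u (y T)) a + (\<Sum>v\<in>T. ?m' u v))"
      by (rule sum.cong[OF refl]) (use fT in auto)
    finally have R0: "0 = (\<Sum>u\<in>N-T. dshift R \<rho> B u (lin_shift lam u (y T)) a) + (\<Sum>u\<in>N-T. \<Sum>v\<in>T. ?m' u v)"
      by (simp add: sum.distrib)
    have comm: "dshift R \<rho> B u (lin_shift lam v c) a = lin_shift lam v (dshift R \<rho> B u c) a + of_bool (u = v) * c a"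
      if "u \<in> N" "v \<in> N" for u v c
      using dshift_lin_shift[OF fin(1) \<open>R \<subseteq> supp a\<close> \<open>supp a \<subseteq> \<rho>\<close>, of B u lam v c] B1[OF that] by simp
    \<comment> \<open>For distinct \<open>u\<close> and \<open>v\<close> the derivative commutes
      with the linear form, and the two orders of inserting \<open>u\<close> and removing
      \<open>v\<close> have opposite signs.\<close>
    have canc: "?m' u v = - ?m v u" if "u \<in> N - T" "v \<in> T" for u v
    proof -
      have ne: "u \<noteq> v" "insert u T - {v} = insert u (T - {v})" "insert u T - {u} = T" using that by auto
      have s: "ksign u (insert u T) * ksign v T = - (ksign v (insert u T) * ksign u (insert u (T - {v})))"
        using ksign_swap[of "insert u T" u v] fT that ne by auto
      have sg: "ksign i S = 1 \<or> ksign i S = -1" for i S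
        unfolding ksign_def by (metis neg_one_even_power neg_one_odd_power)
      have "ksign u (insert u T) * ksign v (insert u T) = - (ksign v T * ksign u (insert u (T - {v})))"
        using s sg[of u "insert u T"] sg[of v T] sg[of v "insert u T"] sg[of u "insert u (T - {v})"] by auto
      moreover have "dshift R \<rho> B u (lin_shift lam v (y (insert u T - {v}))) a = lin_shift lam v (dshift R \<rho> B u (y (insert u (T - {v})))) a"
        using comm[of u v] that ne \<open>T \<subseteq> N\<close> by auto
      ultimately show ?thesis by simp
    qed
    have "(\<Sum>u\<in>N-T. \<Sum>v\<in>T. ?m' u v) = - (\<Sum>v\<in>T. \<Sum>u\<in>N-T. ?m v u)"
      by (subst sum.swap) (simp add: canc sum_negf)
    moreover have "(\<Sum>u\<in>N-T. dshift R \<rho> B u (lin_shift lam u (y T)) a) =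
        (\<Sum>u\<in>N-T. lin_shift lam u (dshift R \<rho> B u (y T)) a) + real (card (N - T)) * y T a"
      using comm by (simp add: sum.distrib)
    ultimately have "kbd lam ?U b T a = (\<Sum>v\<in>T. lin_shift lam v (dshift R \<rho> B v (y T)) a)
        + (\<Sum>u\<in>N-T. lin_shift lam u (dshift R \<rho> B u (y T)) a) + real (card (N - T)) * y T a"
      using L R0 by linarith
    also have "\<dots> = (\<Sum>v\<in>N. lin_shift lam v (dshift R \<rho> B v (y T)) a) + real (card (N - T)) * y T a"
      using sum.subset_diff[OF \<open>T \<subseteq> N\<close> fin(2), of "\<lambda>v. lin_shift lam v (dshift R \<rho> B v (y T)) a"] by simp
    also have "(\<Sum>v\<in>N. lin_shift lam v (dshift R \<rho> B v (y T)) a) = rdeg R a * y T a"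
      using lin_shift_dshift_sum[OF fin \<open>R \<subseteq> supp a\<close> \<open>supp a \<subseteq> \<rho>\<close> B2] by simp
    finally have "kbd lam ?U b T a = q T a * y T a"
      using fin \<open>T \<subseteq> N\<close> card_mono[OF fin(2) \<open>T \<subseteq> N\<close>] by (simp add: q_def card_Diff_subset fT algebra_simps of_nat_diff)
    moreover have "rdeg R a \<ge> 0" unfolding rdeg_def by (rule sum_nonneg) (auto simp: supp_def)
    hence "q T a \<noteq> 0" using k \<open>card T = k\<close> by (simp add: q_def)
    ultimately show ?thesis by (simp add: y_def)
  qed
  have "kbd lam ?U b T a = z T a" for T a
  proof (cases "(T, a) \<in> ?U \<and> card T = k")
    case False
    have "kfin ?U" unfolding kfin_def using finite_subset[OF _ fin(1)] finite_subset[OF _ fin(2)] by auto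
    have lev: "\<And>T a. b T a \<noteq> 0 \<Longrightarrow> Suc (card T) = k" using bs by simp
    have "kbd lam ?U b T a = 0"
    proof (rule ccontr)
      assume "kbd lam ?U b T a \<noteq> 0"
      from kbd_level[OF \<open>kfin ?U\<close> _ this, of k] lev False show False by blast
    qed
    moreover have "z T a = 0"
    proof (rule ccontr)
      assume "z T a \<noteq> 0"
      hence "(T, a) \<in> ?U \<and> card T = k" using z unfolding chain_def by blast
      with False show False by contradiction
    qed
    ultimately show ?thesis by simp
  qed (use hom in auto)
  thus "\<exists>b. (\<forall>T a. b T a \<noteq> 0 \<longrightarrow> (T, a) \<in> ?U \<and> Suc (card T) = k) \<and> (\<forall>T a. kbd lam ?U b T a = z T a)"
    using bs by blast
qed

section \<open>Simplicial fans and edge subdivisions\<close>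

definition rsupp :: "('b \<Rightarrow> real) \<Rightarrow> 'b set" where "rsupp t = {w. t w \<noteq> 0}"

definition vval :: "('b::real_vector \<Rightarrow> real) \<Rightarrow> 'b" where
  "vval t = (\<Sum>w\<in>rsupp t. t w *\<^sub>R w)"

definition cpos :: "'b set set \<Rightarrow> ('b \<Rightarrow> real) set" where
  "cpos G = {t. (\<forall>w. t w \<ge> 0) \<and> rsupp t \<in> G}"

definition fcone :: "'b::real_vector set \<Rightarrow> 'b set" where
  "fcone V = vval ` cpos (Pow V)"

text \<open>The bijection says that every point of the cone over \<open>V\<close> has exactly one
  nonnegative coordinate function supported on a face. This packs covering, independence of the
  generators and intersection in common faces into one condition.\<close>

definition fan :: "'b::real_vector set \<Rightarrow> 'b set set \<Rightarrow> bool" where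
  "fan V G \<longleftrightarrow> finite V \<and> independent V \<and> finite G \<and> (\<forall>\<tau>\<in>G. finite \<tau>) \<and>
     (\<forall>\<tau>\<in>G. \<forall>\<sigma>\<subseteq>\<tau>. \<sigma> \<in> G) \<and> bij_betw vval (cpos G) (fcone V)"

text \<open>A dual basis functional, extended linearly to the whole space in an arbitrary way; only
  its values on the span of \<open>\<rho>\<close> are determined.\<close>

definition dualf :: "'b::real_vector set \<Rightarrow> 'b \<Rightarrow> 'b \<Rightarrow> real" where
  "dualf \<rho> w = (SOME f. linear f \<and> (\<forall>u\<in>\<rho>. f u = (if u = w then 1 else 0)))"

section \<open>Cones and dual bases\<close>

lemma vval_eq: "finite S \<Longrightarrow> rsupp t \<subseteq> S \<Longrightarrow> vval t = (\<Sum>w\<in>S. t w *\<^sub>R w)"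
  unfolding vval_def by (rule sum.mono_neutral_left) (auto simp: rsupp_def)

lemma fcone_eq: "finite S \<Longrightarrow> fcone S = {\<Sum>w\<in>S. t w *\<^sub>R w | t. \<forall>w\<in>S. t w \<ge> (0::real)}"
proof (intro equalityI subsetI)
  fix y assume fin: "finite S" and "y \<in> fcone S"
  then obtain t where t: "y = vval t" "\<forall>w. t w \<ge> 0" "rsupp t \<subseteq> S" by (auto simp: fcone_def cpos_def)
  thus "y \<in> {\<Sum>w\<in>S. t w *\<^sub>R w | t. \<forall>w\<in>S. t w \<ge> (0::real)}"
    using vval_eq[OF fin t(3)] by auto
next
  fix y assume fin: "finite S" and "y \<in> {\<Sum>w\<in>S. t w *\<^sub>R w | t. \<forall>w\<in>S. t w \<ge> (0::real)}"
  then obtain t where t: "y = (\<Sum>w\<in>S. t w *\<^sub>R w)" "\<forall>w\<in>S. t w \<ge> 0" by auto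
  define t' where "t' w = (if w \<in> S then t w else 0)" for w
  have "rsupp t' \<subseteq> S" "\<forall>w. t' w \<ge> 0" using t by (auto simp: rsupp_def t'_def)
  moreover have "vval t' = y" using vval_eq[OF fin \<open>rsupp t' \<subseteq> S\<close>] t by (simp add: t'_def)
  ultimately show "y \<in> fcone S" by (auto simp: fcone_def cpos_def)
qed

lemma linear_dualf:
  assumes "independent \<rho>"
  shows "linear (dualf \<rho> w)" and "u \<in> \<rho> \<Longrightarrow> dualf \<rho> w u = (if u = w then 1 else 0)"
proof -
  from linear_independent_extend[OF assms, of "\<lambda>u. if u = w then 1 else (0::real)"]
  have "\<exists>f. linear f \<and> (\<forall>u\<in>\<rho>. f u = (if u = w then 1 else (0::real)))" by blast
  from someI_ex[OF this] show "linear (dualf \<rho> w)" "u \<in> \<rho> \<Longrightarrow> dualf \<rho> w u = (if u = w then 1 else 0)"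
    unfolding dualf_def by blast+
qed

lemma linear_vsum:
  assumes "linear (l :: 'b::real_vector \<Rightarrow> real)"
  shows "l (\<Sum>w\<in>S. t w *\<^sub>R w) = (\<Sum>w\<in>S. t w * l w)"
  using assms by (simp add: linear_sum linear_cmul)

lemma dualf_expand:
  assumes "finite \<rho>" "independent \<rho>" "y \<in> span \<rho>"
  shows "y = (\<Sum>w\<in>\<rho>. dualf \<rho> w y *\<^sub>R w)"
proof -
  obtain t where t: "y = (\<Sum>w\<in>\<rho>. t w *\<^sub>R w)" using assms by (auto simp: span_finite)
  have "dualf \<rho> w y = t w" if "w \<in> \<rho>" for w
  proof -
    have "dualf \<rho> w y = (\<Sum>u\<in>\<rho>. t u * dualf \<rho> w u)"
      unfolding t by (rule linear_vsum[OF linear_dualf(1)[OF assms(2)]])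
    also have "\<dots> = (\<Sum>u\<in>\<rho>. if u = w then t u else 0)"
      by (rule sum.cong) (auto simp: linear_dualf(2)[OF assms(2)])
    finally show ?thesis using that assms(1) by simp
  qed
  thus ?thesis using t by simp
qed

lemma dualf_sum:
  assumes "finite \<rho>" "independent \<rho>" "w \<in> \<rho>"
  shows "dualf \<rho> w (\<Sum>u\<in>\<rho>. t u *\<^sub>R u) = t w"
proof -
  have "dualf \<rho> w (\<Sum>u\<in>\<rho>. t u *\<^sub>R u) = (\<Sum>u\<in>\<rho>. t u * dualf \<rho> w u)"
    by (rule linear_vsum[OF linear_dualf(1)[OF assms(2)]])
  also have "\<dots> = (\<Sum>u\<in>\<rho>. if u = w then t u else 0)"
    by (rule sum.cong) (auto simp: linear_dualf(2)[OF assms(2)])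
  finally show ?thesis using assms by simp
qed

lemma fcone_dualf:
  assumes "finite \<rho>" "independent \<rho>"
  shows "y \<in> fcone \<rho> \<longleftrightarrow> y \<in> span \<rho> \<and> (\<forall>w\<in>\<rho>. dualf \<rho> w y \<ge> 0)"
proof
  assume "y \<in> fcone \<rho>"
  then obtain t where "y = (\<Sum>w\<in>\<rho>. t w *\<^sub>R w)" "\<forall>w\<in>\<rho>. t w \<ge> 0" using assms by (auto simp: fcone_eq)
  thus "y \<in> span \<rho> \<and> (\<forall>w\<in>\<rho>. dualf \<rho> w y \<ge> 0)"
    using assms by (auto simp: dualf_sum intro!: span_sum span_scale intro: span_base)
next
  assume "y \<in> span \<rho> \<and> (\<forall>w\<in>\<rho>. dualf \<rho> w y \<ge> 0)"
  thus "y \<in> fcone \<rho>" using dualf_expand[OF assms, of y] assms(1) by (auto simp: fcone_eq)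
qed

lemma fcone_subset_span: "finite S \<Longrightarrow> fcone S \<subseteq> span S"
  by (auto simp: fcone_eq intro!: span_sum span_scale intro: span_base)

lemma fcone_base: "w \<in> S \<Longrightarrow> w \<in> fcone S"
proof -
  assume w: "w \<in> S"
  have "vval (\<lambda>u. if u = w then 1 else 0) = w" by (simp add: vval_def rsupp_def)
  moreover have "(\<lambda>u. if u = w then 1 else (0::real)) \<in> cpos (Pow S)" using w by (auto simp: cpos_def rsupp_def)
  ultimately show ?thesis unfolding fcone_def by force
qed

lemma fcone_add: "finite S \<Longrightarrow> x \<in> fcone S \<Longrightarrow> y \<in> fcone S \<Longrightarrow> x + y \<in> fcone S"
proof -
  assume "finite S" "x \<in> fcone S" "y \<in> fcone S"
  then obtain s t where "x = (\<Sum>w\<in>S. s w *\<^sub>R w)" "\<forall>w\<in>S. s w \<ge> 0" "y = (\<Sum>w\<in>S. t w *\<^sub>R w)" "\<forall>w\<in>S. t w \<ge> 0"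
    by (auto simp: fcone_eq)
  hence "x + y = (\<Sum>w\<in>S. (s w + t w) *\<^sub>R w)" "\<forall>w\<in>S. s w + t w \<ge> 0"
    by (auto simp: scaleR_add_left sum.distrib)
  thus ?thesis unfolding fcone_eq[OF \<open>finite S\<close>] by (intro CollectI exI[of _ "\<lambda>w. s w + t w"]) simp
qed

lemma fcone_scale: "finite S \<Longrightarrow> x \<in> fcone S \<Longrightarrow> c \<ge> 0 \<Longrightarrow> c *\<^sub>R x \<in> fcone S"
proof -
  assume "finite S" "x \<in> fcone S" "c \<ge> 0"
  then obtain s where "x = (\<Sum>w\<in>S. s w *\<^sub>R w)" "\<forall>w\<in>S. s w \<ge> 0" by (auto simp: fcone_eq)
  hence "c *\<^sub>R x = (\<Sum>w\<in>S. (c * s w) *\<^sub>R w)" "\<forall>w\<in>S. c * s w \<ge> 0"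
    using \<open>c \<ge> 0\<close> by (auto simp: scaleR_sum_right)
  thus ?thesis unfolding fcone_eq[OF \<open>finite S\<close>] by (intro CollectI exI[of _ "\<lambda>w. c * s w"]) simp
qed

lemma fcone_zero: "finite S \<Longrightarrow> 0 \<in> fcone S"
  by (auto simp: fcone_eq intro!: exI[of _ "\<lambda>_. 0"])

lemma fcone_sum: "finite S \<Longrightarrow> (\<And>i. i \<in> I \<Longrightarrow> f i \<in> fcone S) \<Longrightarrow> (\<Sum>i\<in>I. f i) \<in> fcone S"
  by (induction I rule: infinite_finite_induct) (auto simp: fcone_zero fcone_add)

lemma fcone_trans: "finite S \<Longrightarrow> finite T \<Longrightarrow> T \<subseteq> fcone S \<Longrightarrow> fcone T \<subseteq> fcone S"
  by (auto simp: fcone_eq[of T] intro!: fcone_sum fcone_scale)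

section \<open>Elementary properties of fans\<close>

lemma fanD:
  assumes "fan V G"
  shows "finite V" "independent V" "finite G" "\<tau> \<in> G \<Longrightarrow> finite \<tau>" "\<tau> \<in> G \<Longrightarrow> \<sigma> \<subseteq> \<tau> \<Longrightarrow> \<sigma> \<in> G"
  using assms by (auto simp: fan_def)

lemma fan_inj:
  assumes "fan V G" "s \<in> cpos G" "t \<in> cpos G" "vval s = vval t"
  shows "s = t"
  using assms by (auto simp: fan_def bij_betw_def inj_on_def)

lemma fan_cover:
  assumes "fan V G" "y \<in> fcone V"
  obtains t where "t \<in> cpos G" "vval t = y"
proof -
  have "y \<in> vval ` cpos G" using assms by (simp add: fan_def bij_betw_def)
  thus ?thesis using that by blast
qed

lemma fan_val: "fan V G \<Longrightarrow> t \<in> cpos G \<Longrightarrow> vval t \<in> fcone V"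
  by (auto simp: fan_def bij_betw_def)

lemma fan_face_subset:
  assumes "fan V G" "\<tau> \<in> G" shows "\<tau> \<subseteq> fcone V"
proof
  fix w assume w: "w \<in> \<tau>"
  let ?t = "\<lambda>u. if u = w then 1 else (0::real)"
  have "vval ?t = w" by (simp add: vval_def rsupp_def)
  moreover have "rsupp ?t = {w}" by (auto simp: rsupp_def)
  hence "?t \<in> cpos G" using fanD(5)[OF assms, of "{w}"] w by (auto simp: cpos_def)
  ultimately show "w \<in> fcone V" using fan_val[OF assms(1)] by metis
qed

lemma fan_span: "fan V G \<Longrightarrow> \<tau> \<in> G \<Longrightarrow> \<tau> \<subseteq> span V"
  using fan_face_subset fcone_subset_span fanD(1) by blast

lemma fan_fcone_inj:
  assumes f: "fan V G" and r: "\<rho> \<in> G" "\<kappa> \<in> G" and s: "\<forall>w. s w \<ge> 0" "rsupp s \<subseteq> \<rho>"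
    and t: "\<forall>w. t w \<ge> 0" "rsupp t \<subseteq> \<kappa>" and "vval s = vval t"
  shows "s = t"
  using fan_inj[OF f _ _ \<open>vval s = vval t\<close>] fanD(5)[OF f r(1) s(2)] fanD(5)[OF f r(2) t(2)] s t
  by (auto simp: cpos_def)

text \<open>Adding a large constant to the coefficients of a linear relation gives a second
  nonnegative representation of one point, so uniqueness of coordinates kills the relation.\<close>

lemma fan_independent:
  assumes f: "fan V G" and t: "\<tau> \<in> G" shows "independent \<tau>"
proof -
  have fin: "finite \<tau>" using fanD[OF f] t by blast
  have "u w = 0" if u: "(\<Sum>w\<in>\<tau>. u w *\<^sub>R w) = 0" and w: "w \<in> \<tau>" for u w
  proof -
    define M where "M = 1 + (\<Sum>w\<in>\<tau>. \<bar>u w\<bar>)"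
    have M: "M > 0" "\<And>w. w \<in> \<tau> \<Longrightarrow> \<bar>u w\<bar> \<le> M"
      unfolding M_def using member_le_sum[of _ \<tau> "\<lambda>w. \<bar>u w\<bar>"] fin
      by (auto simp: add_pos_nonneg sum_nonneg add_increasing)
    define s where "s w = (if w \<in> \<tau> then M else 0)" for w
    define t' where "t' w = (if w \<in> \<tau> then M + u w else 0)" for w
    have sup: "rsupp s \<subseteq> \<tau>" "rsupp t' \<subseteq> \<tau>" by (auto simp: rsupp_def s_def t'_def)
    have nn: "\<forall>w. s w \<ge> 0" "\<forall>w. t' w \<ge> 0" using M by (auto simp: s_def t'_def) (smt (verit))+
    have "vval t' = vval s" using u by (simp add: vval_eq[OF fin] sup s_def t'_def scaleR_add_left sum.distrib)
    hence "s = t'" using fan_fcone_inj[OF f t t nn(1) sup(1) nn(2) sup(2)] by simp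
    from fun_cong[OF this, of w] w show "u w = 0" by (simp add: s_def t'_def)
  qed
  thus ?thesis using fin by (auto simp: dependent_finite)
qed

lemma fan_card_le:
  assumes f: "fan V G" and t: "\<tau> \<in> G" shows "card \<tau> \<le> card V"
  using independent_span_bound[OF fanD(1)[OF f] fan_independent[OF f t]] fan_span[OF f t] by blast

lemma fan_full_span:
  assumes f: "fan V G" and t: "\<tau> \<in> G" "card \<tau> = card V" shows "span \<tau> = span V"
proof -
  have s: "\<tau> \<subseteq> span V" by (rule fan_span[OF f t(1)])
  have "V \<subseteq> span \<tau>"
  proof (rule ccontr)
    assume "\<not> V \<subseteq> span \<tau>"
    then obtain x where x: "x \<in> V" "x \<notin> span \<tau>" by blast
    have "independent (insert x \<tau>)" using x fan_independent[OF f t(1)] by (simp add: independent_insertI)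
    moreover have "insert x \<tau> \<subseteq> span V" using s x by (auto intro: span_base)
    ultimately have "card (insert x \<tau>) \<le> card V" using independent_span_bound[OF fanD(1)[OF f]] by blast
    moreover have "x \<notin> \<tau>" "finite \<tau>" using x fanD(4)[OF f t(1)] by (auto intro: span_base)
    ultimately show False using t(2) by simp
  qed
  thus ?thesis using s by (simp add: span_eq)
qed

section \<open>Stellar subdivision of an edge\<close>

definition stellar :: "'b \<Rightarrow> 'b \<Rightarrow> 'b \<Rightarrow> 'b set set \<Rightarrow> 'b set set" where
  "stellar a b w G = {\<tau>\<in>G. \<not> {a, b} \<subseteq> \<tau>} \<union> {insert w \<tau> | \<tau>. \<tau> \<union> {a, b} \<in> G \<and> \<not> {a, b} \<subseteq> \<tau>}"

lemma rsupp_eq_iff: "x \<in> rsupp t \<longleftrightarrow> t x \<noteq> 0" by (simp add: rsupp_def)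

locale stellar_step =
  fixes V :: "'b::real_vector set" and G and a b :: 'b and \<alpha> \<beta> :: real
  assumes f: "fan V G" and ab: "a \<noteq> b" "{a, b} \<in> G" and pos: "\<alpha> > 0" "\<beta> > 0"
begin

definition "w = \<alpha> *\<^sub>R a + \<beta> *\<^sub>R b"

text \<open>Otherwise the point \<open>w\<close> would have two coordinate functions, supported on
  \<open>{w}\<close> and on \<open>{a, b}\<close>.\<close>

lemma w_fresh: "\<tau> \<in> G \<Longrightarrow> w \<notin> \<tau>"
proof
  assume t: "\<tau> \<in> G" "w \<in> \<tau>"
  let ?s = "\<lambda>u. if u = w then 1 else (0::real)" and ?t = "\<lambda>u. if u = a then \<alpha> else if u = b then \<beta> else 0"
  have rs: "rsupp ?s = {w}" "rsupp ?t = {a, b}" using pos by (auto simp: rsupp_def)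
  have "{w} \<in> G" using fanD(5)[OF f t(1)] t(2) by auto
  hence "?s \<in> cpos G" "?t \<in> cpos G" unfolding cpos_def using rs ab pos by auto
  moreover have "vval ?s = vval ?t" using ab unfolding vval_def rs by (simp add: w_def)
  ultimately have "?s = ?t" using fan_inj[OF f] by blast
  hence "{w} = {a, b}" using rs by metis
  thus False using ab by auto
qed

lemma w_neq: "w \<noteq> a" "w \<noteq> b" using w_fresh[OF ab(2)] by auto

text \<open>Coordinates with respect to \<open>G\<close> from those with respect to the subdivision:
  the coefficient of \<open>w\<close> is distributed over \<open>a\<close> and
  \<open>b\<close>.\<close>

definition Psi :: "('b \<Rightarrow> real) \<Rightarrow> 'b \<Rightarrow> real" where
  "Psi t = t(a := t a + \<alpha> * t w, b := t b + \<beta> * t w, w := 0)"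

lemma rsupp_G'_notboth:
  assumes "t \<in> cpos (stellar a b w G)" shows "t a = 0 \<or> t b = 0"
proof (rule ccontr)
  assume "\<not> (t a = 0 \<or> t b = 0)"
  hence "{a, b} \<subseteq> rsupp t" by (auto simp: rsupp_def)
  moreover have "rsupp t \<in> stellar a b w G" using assms by (auto simp: cpos_def)
  ultimately show False using w_neq by (auto simp: stellar_def)
qed

lemma rsupp_G'_cases:
  assumes "t \<in> cpos (stellar a b w G)"
  shows "t w = 0 \<and> rsupp t \<in> G \<or> t w > 0 \<and> (rsupp t - {w}) \<union> {a, b} \<in> G"
proof -
  have nn: "t w \<ge> 0" and r: "rsupp t \<in> stellar a b w G" using assms by (auto simp: cpos_def)
  from r consider "rsupp t \<in> G" | \<tau> where "rsupp t = insert w \<tau>" "\<tau> \<union> {a, b} \<in> G"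
    by (auto simp: stellar_def)
  thus ?thesis
  proof cases
    case 1
    thus ?thesis using w_fresh[OF 1] by (simp add: rsupp_def)
  next
    case 2
    have "w \<notin> \<tau>" using w_fresh[OF 2(2)] by auto
    hence "rsupp t - {w} = \<tau>" using 2 by auto
    moreover have "t w \<noteq> 0" using 2(1) by (metis insertI1 rsupp_eq_iff)
    ultimately show ?thesis using 2 nn by auto
  qed
qed

lemma Psi_cpos: assumes t: "t \<in> cpos (stellar a b w G)" shows "Psi t \<in> cpos G" "vval (Psi t) = vval t"
proof -
  have nn: "t x \<ge> 0" for x using t by (auto simp: cpos_def)
  have nnP: "Psi t x \<ge> 0" for x using nn pos by (auto simp: Psi_def)
  consider "t w = 0" "rsupp t \<in> G" | "t w > 0" "(rsupp t - {w}) \<union> {a, b} \<in> G"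
    using rsupp_G'_cases[OF t] by blast
  hence "rsupp (Psi t) \<in> G \<and> finite (rsupp t \<union> {a,b,w})"
  proof cases
    case 1
    hence "Psi t = t" by (auto simp: Psi_def)
    thus ?thesis using 1 fanD(4)[OF f] by auto
  next
    case 2
    have "rsupp (Psi t) \<subseteq> (rsupp t - {w}) \<union> {a, b}" by (auto simp: rsupp_def Psi_def)
    moreover have "finite (rsupp t - {w} \<union> {a, b})" using fanD(4)[OF f 2(2)] .
    ultimately show ?thesis using fanD(5)[OF f 2(2)] by auto
  qed
  note A = this
  show "Psi t \<in> cpos G" using A nnP by (auto simp: cpos_def)
  let ?S = "rsupp t \<union> {a,b,w}"
  define D where "D x = (if x = a then \<alpha> * t w else 0) + (if x = b then \<beta> * t w else 0) - (if x = w then t w else 0)" for x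
  have "Psi t x = t x + D x" for x using ab w_neq by (auto simp: Psi_def D_def)
  hence "(\<Sum>x\<in>?S. Psi t x *\<^sub>R x) = (\<Sum>x\<in>?S. t x *\<^sub>R x) + (\<Sum>x\<in>?S. D x *\<^sub>R x)"
    by (simp add: scaleR_add_left sum.distrib)
  also have "(\<Sum>x\<in>?S. D x *\<^sub>R x) = (\<Sum>x\<in>?S. (if x = a then (\<alpha> * t w) *\<^sub>R a else 0) + (if x = b then (\<beta> * t w) *\<^sub>R b else 0) - (if x = w then t w *\<^sub>R w else 0))"
    by (rule sum.cong) (use ab w_neq in \<open>auto simp: D_def\<close>)
  also have "\<dots> = 0" using A by (simp add: sum.distrib sum_subtractf w_def scaleR_add_right mult.commute)
  finally show "vval (Psi t) = vval t"
    using A by (subst (1 2) vval_eq[of ?S]) (auto simp: rsupp_def Psi_def)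
qed

lemma Psi_bij: "bij_betw Psi (cpos (stellar a b w G)) (cpos G)"
proof (rule bij_betwI')
  fix s t assume s: "s \<in> cpos (stellar a b w G)" and t: "t \<in> cpos (stellar a b w G)"
  \<comment> \<open>At least one of the coefficients at \<open>a\<close> and \<open>b\<close>
    vanishes on a face of the subdivision, so the minimum of the two rescaled coordinates recovers
    the coefficient of \<open>w\<close>.\<close>
  have mw: "u w = min (Psi u a / \<alpha>) (Psi u b / \<beta>)" if u: "u \<in> cpos (stellar a b w G)" for u
  proof -
    have "u a \<ge> 0" "u b \<ge> 0" using u by (auto simp: cpos_def)
    moreover have "Psi u a / \<alpha> = u a / \<alpha> + u w" "Psi u b / \<beta> = u b / \<beta> + u w"
      using pos ab w_neq by (auto simp: Psi_def field_simps)
    ultimately show ?thesis using rsupp_G'_notboth[OF u] pos by auto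
  qed
  have "s = t" if e: "Psi s = Psi t"
  proof
    fix x
    have w: "s w = t w" using mw[OF s] mw[OF t] e by simp
    have "Psi s x = Psi t x" using e by simp
    thus "s x = t x" using w ab w_neq by (auto simp: Psi_def split: if_splits)
  qed
  thus "Psi s = Psi t \<longleftrightarrow> s = t" by blast
next
  fix t assume "t \<in> cpos (stellar a b w G)" thus "Psi t \<in> cpos G" by (rule Psi_cpos)
next
  fix t assume t: "t \<in> cpos G"
  \<comment> \<open>The largest multiple of \<open>w\<close> that can be split off with nonnegative
    remainder; it exhausts the coefficient of \<open>a\<close> or of \<open>b\<close>.\<close>
  define m where "m = min (t a / \<alpha>) (t b / \<beta>)"
  define s where "s = t(a := t a - \<alpha> * m, b := t b - \<beta> * m, w := m)"
  have tw: "t w = 0" using t w_fresh by (auto simp: cpos_def rsupp_def)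
  have nn: "t x \<ge> 0" for x using t by (auto simp: cpos_def)
  have m0: "m \<ge> 0" using nn pos by (auto simp: m_def)
  have ma: "\<alpha> * m \<le> t a" "\<beta> * m \<le> t b" using pos by (auto simp: m_def min_def field_simps)
  have nns: "s x \<ge> 0" for x using nn m0 ma by (auto simp: s_def)
  have z: "s a = 0 \<or> s b = 0" using pos ab w_neq by (auto simp: s_def m_def min_def field_simps)
  have "t = Psi s" using ab w_neq tw by (auto simp: Psi_def s_def fun_eq_iff)
  moreover have "rsupp s \<in> stellar a b w G"
  proof (cases "m = 0")
    case True
    hence "s = t" using tw by (auto simp: s_def)
    thus ?thesis using z t by (auto simp: stellar_def cpos_def rsupp_def)
  next
    case False
    hence "t a \<noteq> 0" "t b \<noteq> 0" using ma nn[of a] nn[of b] m0 pos by (auto simp: m_def)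
    hence "rsupp s - {w} \<union> {a, b} \<subseteq> rsupp t" by (auto simp: rsupp_def s_def)
    hence "rsupp s - {w} \<union> {a, b} \<in> G" using t fanD(5)[OF f] by (auto simp: cpos_def)
    moreover have "rsupp s = insert w (rsupp s - {w})" using False by (auto simp: rsupp_def s_def)
    moreover have "\<not> {a, b} \<subseteq> rsupp s - {w}" using z by (auto simp: rsupp_def)
    ultimately show ?thesis unfolding stellar_def by blast
  qed
  ultimately show "\<exists>s\<in>cpos (stellar a b w G). t = Psi s" using nns by (auto simp: cpos_def)
qed

text \<open>Coordinates of the subdivision are coordinates of \<open>G\<close> composed with the
  bijection \<open>Psi\<close>, so covering and uniqueness are inherited without any
  geometry.\<close>

lemma fan_stellar: "fan V (stellar a b w G)"
proof -
  have st: "stellar a b w G \<subseteq> G \<union> insert w ` G"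
    using fanD(5)[OF f] by (auto simp: stellar_def)
  hence fin: "finite (stellar a b w G)" using fanD(3)[OF f] finite_subset by blast
  have sub: "\<sigma> \<in> stellar a b w G" if \<tau>: "\<tau> \<in> stellar a b w G" and "\<sigma> \<subseteq> \<tau>" for \<sigma> \<tau>
    using \<tau> unfolding stellar_def
  proof (elim UnE)
    assume "\<tau> \<in> {\<tau> \<in> G. \<not> {a, b} \<subseteq> \<tau>}"
    thus "\<sigma> \<in> {\<tau> \<in> G. \<not> {a, b} \<subseteq> \<tau>} \<union> {insert w \<tau> |\<tau>. \<tau> \<union> {a, b} \<in> G \<and> \<not> {a, b} \<subseteq> \<tau>}"
      using that(2) fanD(5)[OF f, of \<tau> \<sigma>] by auto
  next
    assume "\<tau> \<in> {insert w \<tau> |\<tau>. \<tau> \<union> {a, b} \<in> G \<and> \<not> {a, b} \<subseteq> \<tau>}"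
    then obtain \<kappa> where k: "\<tau> = insert w \<kappa>" "\<kappa> \<union> {a, b} \<in> G" "\<not> {a, b} \<subseteq> \<kappa>" by blast
    have *: "\<sigma> - {w} \<subseteq> \<kappa>" using k that by auto
    show "\<sigma> \<in> {\<tau> \<in> G. \<not> {a, b} \<subseteq> \<tau>} \<union> {insert w \<tau> |\<tau>. \<tau> \<union> {a, b} \<in> G \<and> \<not> {a, b} \<subseteq> \<tau>}"
    proof (cases "w \<in> \<sigma>")
      case True
      hence "\<sigma> = insert w (\<sigma> - {w})" by auto
      moreover have "(\<sigma> - {w}) \<union> {a, b} \<in> G" by (rule fanD(5)[OF f k(2)]) (use * in auto)
      moreover have "\<not> {a, b} \<subseteq> \<sigma> - {w}" using * k(3) by auto
      ultimately show ?thesis by (intro UnI2 CollectI exI[of _ "\<sigma> - {w}"] conjI)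
    next
      case False
      hence "\<sigma> \<subseteq> \<kappa>" using * by auto
      hence "\<sigma> \<in> G" "\<not> {a, b} \<subseteq> \<sigma>" using fanD(5)[OF f k(2), of \<sigma>] k(3) by auto
      thus ?thesis by (intro UnI1 CollectI conjI)
    qed
  qed
  have "bij_betw (vval \<circ> Psi) (cpos (stellar a b w G)) (fcone V)"
    by (rule bij_betw_trans[OF Psi_bij]) (use f in \<open>auto simp: fan_def\<close>)
  hence "bij_betw vval (cpos (stellar a b w G)) (fcone V)"
    using Psi_cpos(2) by (subst bij_betw_cong[of _ _ "vval \<circ> Psi"]) auto
  moreover have "finite \<tau>" if "\<tau> \<in> stellar a b w G" for \<tau>
    using that st fanD(4)[OF f] by fastforce
  ultimately show ?thesis using fin sub fanD(1,2)[OF f] unfolding fan_def by blast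
qed

lemma stellar_refines:
  assumes "\<tau> \<in> stellar a b w G" shows "\<exists>\<kappa>\<in>G. \<tau> \<subseteq> fcone \<kappa>"
proof -
  consider "\<tau> \<in> G" | \<sigma> where "\<tau> = insert w \<sigma>" "\<sigma> \<union> {a, b} \<in> G" using assms by (auto simp: stellar_def)
  thus ?thesis
  proof cases
    case 1 thus ?thesis using fcone_base by blast
  next
    case 2
    have fin: "finite (\<sigma> \<union> {a, b})" using fanD(4)[OF f 2(2)] .
    have "w \<in> fcone (\<sigma> \<union> {a, b})" unfolding w_def
      using pos by (intro fcone_add[OF fin] fcone_scale[OF fin] fcone_base) auto
    hence "\<tau> \<subseteq> fcone (\<sigma> \<union> {a, b})" using 2(1) by (auto intro: fcone_base)
    thus ?thesis using 2(2) by blast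
  qed
qed

lemma stellar_vertices: "\<Union>G \<subseteq> \<Union>(stellar a b w G)"
proof
  fix x assume "x \<in> \<Union>G"
  hence "{x} \<in> G" using fanD(5)[OF f] by blast
  hence "{x} \<in> stellar a b w G" using ab by (auto simp: stellar_def)
  thus "x \<in> \<Union>(stellar a b w G)" by blast
qed

end

section \<open>Iterated edge subdivisions and one-sided functionals\<close>

definition estep :: "'b::real_vector set set \<Rightarrow> 'b set set \<Rightarrow> bool" where
  "estep G G' \<longleftrightarrow> (\<exists>a b \<alpha> \<beta>. a \<noteq> b \<and> {a, b} \<in> G \<and> \<alpha> > 0 \<and> \<beta> > 0 \<and> G' = stellar a b (\<alpha> *\<^sub>R a + \<beta> *\<^sub>R b) G)"

lemma estepE:
  assumes "fan V G" "estep G G'"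
  obtains a b \<alpha> \<beta> where "stellar_step V G a b \<alpha> \<beta>" "G' = stellar a b (stellar_step.w a b \<alpha> \<beta>) G"
  using assms unfolding estep_def by (metis stellar_step.intro stellar_step.w_def)

lemma estep_fan: "fan V G \<Longrightarrow> estep G G' \<Longrightarrow> fan V G'"
  by (erule (1) estepE) (simp add: stellar_step.fan_stellar)

lemma esteps_fan: "estep\<^sup>*\<^sup>* G G' \<Longrightarrow> fan V G \<Longrightarrow> fan V G'"
  by (induction rule: rtranclp_induct) (auto intro: estep_fan)

lemma esteps_vertices: "estep\<^sup>*\<^sup>* G G' \<Longrightarrow> fan V G \<Longrightarrow> \<Union>G \<subseteq> \<Union>G'"
proof (induction rule: rtranclp_induct)
  case (step y z)
  from estepE[OF esteps_fan[OF step(1,4)] step(2)] obtain a b \<alpha> \<beta> where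
    "stellar_step V y a b \<alpha> \<beta>" "z = stellar a b (stellar_step.w a b \<alpha> \<beta>) y" .
  hence "\<Union>y \<subseteq> \<Union>z" by (simp add: stellar_step.stellar_vertices)
  thus ?case using step by blast
qed simp

lemma esteps_refines: "estep\<^sup>*\<^sup>* G G' \<Longrightarrow> fan V G \<Longrightarrow> \<tau> \<in> G' \<Longrightarrow> \<exists>\<kappa>\<in>G. \<tau> \<subseteq> fcone \<kappa>"
proof (induction arbitrary: \<tau> rule: rtranclp_induct)
  case base thus ?case using fcone_base by blast
next
  case (step y z)
  have fy: "fan V y" using esteps_fan step by blast
  from estepE[OF fy step(2)] obtain a b \<alpha> \<beta> where
    "stellar_step V y a b \<alpha> \<beta>" "z = stellar a b (stellar_step.w a b \<alpha> \<beta>) y" .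
  then obtain \<kappa> where k: "\<kappa> \<in> y" "\<tau> \<subseteq> fcone \<kappa>" using stellar_step.stellar_refines step.prems(2) by metis
  obtain \<kappa>' where k': "\<kappa>' \<in> G" "\<kappa> \<subseteq> fcone \<kappa>'" using step.IH[OF step.prems(1) k(1)] by blast
  have "fcone \<kappa> \<subseteq> fcone \<kappa>'" using fcone_trans k' k fanD(4) fy step.prems(1) by metis
  thus ?case using k k' by blast
qed

definition onesided :: "('b \<Rightarrow> real) \<Rightarrow> 'b set set \<Rightarrow> bool" where
  "onesided l G \<longleftrightarrow> (\<forall>\<tau>\<in>G. (\<forall>w\<in>\<tau>. l w \<ge> 0) \<or> (\<forall>w\<in>\<tau>. l w \<le> 0))"

lemma onesided_stellar:
  assumes "stellar_step V G a b \<alpha> \<beta>" "linear l" "onesided l G"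
  shows "onesided l (stellar a b (stellar_step.w a b \<alpha> \<beta>) G)"
  unfolding onesided_def
proof
  interpret stellar_step V G a b \<alpha> \<beta> by fact
  have lw: "l w = \<alpha> * l a + \<beta> * l b" using assms(2) by (simp add: w_def linear_add linear_cmul)
  fix \<tau> assume "\<tau> \<in> stellar a b w G"
  then consider "\<tau> \<in> G" | \<sigma> where "\<tau> = insert w \<sigma>" "\<sigma> \<union> {a, b} \<in> G" by (auto simp: stellar_def)
  thus "(\<forall>w\<in>\<tau>. l w \<ge> 0) \<or> (\<forall>w\<in>\<tau>. l w \<le> 0)"
  proof cases
    case 1 thus ?thesis using assms(3) by (auto simp: onesided_def)
  next
    case 2
    have "(\<forall>w\<in>\<sigma> \<union> {a,b}. l w \<ge> 0) \<or> (\<forall>w\<in>\<sigma> \<union> {a, b}. l w \<le> 0)"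
      using assms(3) 2(2) unfolding onesided_def by (rule bspec)
    thus ?thesis
    proof
      assume h: "\<forall>w\<in>\<sigma> \<union> {a,b}. l w \<ge> 0"
      hence "l a \<ge> 0" "l b \<ge> 0" by blast+
      hence "l w \<ge> 0" using pos unfolding lw by simp
      thus ?thesis using h unfolding 2(1) by blast
    next
      assume h: "\<forall>w\<in>\<sigma> \<union> {a,b}. l w \<le> 0"
      hence "l a \<le> 0" "l b \<le> 0" by blast+
      hence "\<alpha> * l a \<le> 0" "\<beta> * l b \<le> 0" using pos by (simp_all add: mult_le_0_iff)
      hence "l w \<le> 0" unfolding lw by simp
      thus ?thesis using h unfolding 2(1) by blast
    qed
  qed
qed

definition crossing :: "('b \<Rightarrow> real) \<Rightarrow> 'b set set \<Rightarrow> 'b set set" where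
  "crossing l G = {e\<in>G. \<exists>a b. e = {a, b} \<and> l a > 0 \<and> l b < 0}"

text \<open>Induction on the number of edges crossed by the hyperplane. Subdividing such an edge at
  its crossing point removes it and creates no new crossing, because \<open>l\<close> vanishes at
  the new vertex.\<close>

lemma exists_onesided_1:
  assumes "fan V G" "linear l" "\<forall>m\<in>L. linear m \<and> onesided m G"
  shows "\<exists>G'. estep\<^sup>*\<^sup>* G G' \<and> onesided l G' \<and> (\<forall>m\<in>L. onesided m G')"
  using assms(1,3)
proof (induction "card (crossing l G)" arbitrary: G rule: less_induct)
  case less
  show ?case
  proof (cases "crossing l G = {}")
    case True
    have "onesided l G" unfolding onesided_def
    proof (rule ballI, rule ccontr)
      fix \<tau> assume "\<tau> \<in> G" "\<not> ((\<forall>w\<in>\<tau>. l w \<ge> 0) \<or> (\<forall>w\<in>\<tau>. l w \<le> 0))"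
      then obtain a b where ab: "a \<in> \<tau>" "b \<in> \<tau>" "l a > 0" "l b < 0" by force
      hence "{a, b} \<in> G" using fanD(5)[OF less.prems(1) \<open>\<tau> \<in> G\<close>] by simp
      hence "{a, b} \<in> crossing l G" unfolding crossing_def using ab by blast
      thus False using True by simp
    qed
    thus ?thesis using less.prems by blast
  next
    case False
    then obtain a b where lab: "{a, b} \<in> G" "l a > 0" "l b < 0" by (auto simp: crossing_def)
    \<comment> \<open>These positive weights place \<open>w\<close> on the hyperplane
      \<open>l = 0\<close>.\<close>
    interpret stellar_step V G a b "- l b" "l a" by unfold_locales (use lab less.prems in auto)
    let ?G = "stellar a b w G"
    have lw: "l w = 0" using assms(2) by (simp add: w_def linear_add linear_diff linear_cmul)
    have sub: "crossing l ?G \<subseteq> crossing l G - {{a, b}}"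
    proof
      fix e assume e: "e \<in> crossing l ?G"
      then obtain x y where xy: "e = {x, y}" "l x > 0" "l y < 0" "e \<in> ?G" by (auto simp: crossing_def)
      hence "w \<notin> e" using lw by auto
      hence "e \<in> G" "\<not> {a, b} \<subseteq> e" using xy(4) by (auto simp: stellar_def)
      thus "e \<in> crossing l G - {{a, b}}" using xy(1-3) by (auto simp: crossing_def)
    qed
    have mem: "{a, b} \<in> crossing l G"
    proof -
      have "\<exists>x y. {a, b} = {x, y} \<and> l x > 0 \<and> l y < 0" using lab(2,3) by blast
      thus ?thesis using lab(1) by (simp add: crossing_def)
    qed
    have fin: "finite (crossing l G)" using fanD(3)[OF less.prems(1)] by (simp add: crossing_def)
    have "card (crossing l ?G) \<le> card (crossing l G - {{a, b}})"
      by (rule card_mono[OF finite_Diff[OF fin] sub])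
    also have "\<dots> < card (crossing l G)" by (rule card_Diff1_less[OF fin mem])
    finally have "card (crossing l ?G) < card (crossing l G)" .
    moreover have "\<forall>m\<in>L. linear m \<and> onesided m ?G"
      using less.prems(2) onesided_stellar[OF stellar_step_axioms] by simp
    ultimately obtain G' where G': "estep\<^sup>*\<^sup>* ?G G'" "onesided l G'" "\<forall>m\<in>L. onesided m G'"
      using less.hyps[OF _ fan_stellar] by blast
    moreover have "estep G ?G" unfolding estep_def w_def
      by (intro exI[of _ a] exI[of _ b] exI[of _ "- l b"] exI[of _ "l a"] conjI refl ab pos)
    ultimately show ?thesis by (meson converse_rtranclp_into_rtranclp)
  qed
qed

lemma exists_onesided:
  assumes "fan V G" "finite L" "\<forall>m\<in>L. linear m"
  shows "\<exists>G'. estep\<^sup>*\<^sup>* G G' \<and> (\<forall>m\<in>L. onesided m G')"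
  using assms(2,3)
proof (induction L rule: finite_induct)
  case empty thus ?case by auto
next
  case (insert l L)
  then obtain G1 where G1: "estep\<^sup>*\<^sup>* G G1" "\<forall>m\<in>L. onesided m G1" by auto
  have "fan V G1" using esteps_fan G1 assms by blast
  from exists_onesided_1[OF this, of l L] obtain G2 where "estep\<^sup>*\<^sup>* G1 G2" "onesided l G2" "\<forall>m\<in>L. onesided m G2"
    using insert.prems G1 by auto
  thus ?case using G1 by (auto intro!: exI[of _ G2])
qed

section \<open>Half-open pieces of a fan\<close>

text \<open>\<open>X\<close> may be a half-open piece, which contains a face without all of its
  subsets; the boundary is then truncated to \<open>X\<close>.\<close>

definition kos :: "nat set \<Rightarrow> 'x set set \<Rightarrow> (nat set \<times> ('x \<Rightarrow> nat)) set" where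
  "kos N X = {(T, a). T \<subseteq> N \<and> supp a \<in> X}"

text \<open>
  The point \<open>q\<close> decides which of the two half-open halves of a complex contains the faces on the
  hyperplane \<open>l = 0\<close>.
\<close>

definition face_pos :: "'b \<Rightarrow> ('b \<Rightarrow> real) \<Rightarrow> 'b set \<Rightarrow> bool" where
  "face_pos q l \<tau> \<longleftrightarrow> (\<forall>w\<in>\<tau>. l w \<ge> 0) \<and> (l q > 0 \<or> (\<exists>w\<in>\<tau>. l w > 0))"

definition half_open :: "'b set set \<Rightarrow> 'b \<Rightarrow> ('b \<Rightarrow> real) set \<Rightarrow> 'b set set" where
  "half_open G q L = {\<tau>\<in>G. \<forall>l\<in>L. face_pos q l \<tau>}"

text \<open>Since \<open>q\<close> is on the positive side, faces on the hyperplane go to the first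
  half, and every face of the second half has a strictly negative vertex. A divisor of a monomial of
  the first half has none, so the second half carries a subcomplex and the two can be glued.\<close>

lemma half_open_glue:
  assumes N: "finite N" and G: "\<forall>\<tau>\<in>G. finite \<tau>" "\<forall>\<tau>\<in>G. \<forall>\<sigma>\<subseteq>\<tau>. \<sigma> \<in> G" and q: "l q > 0"
    and side: "onesided l (half_open G q L)"
    and 1: "kacyclic lam (card N) (kos N (half_open G q (insert l L)))"
    and 2: "kacyclic lam (card N) (kos N (half_open G q (insert (\<lambda>x. - l x) L)))"
  shows "kacyclic lam (card N) (kos N (half_open G q L))"
proof -
  let ?X = "half_open G q L" and ?X1 = "half_open G q (insert l L)" and ?X2 = "half_open G q (insert (\<lambda>x. - l x) L)"
  have "\<tau> \<in> ?X1 \<or> \<tau> \<in> ?X2" if t: "\<tau> \<in> ?X" for \<tau>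
  proof -
    from t side have "(\<forall>w\<in>\<tau>. l w \<ge> 0) \<or> (\<forall>w\<in>\<tau>. l w \<le> 0)" unfolding onesided_def by (rule bspec[rotated])
    hence "(\<forall>w\<in>\<tau>. l w \<ge> 0) \<or> (\<forall>w\<in>\<tau>. - l w \<ge> 0) \<and> (\<exists>w\<in>\<tau>. - l w > 0)" by force
    hence "face_pos q l \<tau> \<or> face_pos q (\<lambda>x. - l x) \<tau>" using q unfolding face_pos_def by blast
    thus ?thesis using t by (auto simp: half_open_def)
  qed
  moreover have "?X1 \<subseteq> ?X" "?X2 \<subseteq> ?X" by (auto simp: half_open_def)
  ultimately have X: "?X = ?X1 \<union> ?X2" by blast
  have "\<not> (face_pos q l \<tau> \<and> face_pos q (\<lambda>x. - l x) \<tau>)" for \<tau>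
    using q unfolding face_pos_def by force
  hence disj: "?X1 \<inter> ?X2 = {}" by (auto simp: half_open_def)
  have eq: "kos N ?X = kos N ?X1 \<union> kos N ?X2" unfolding X by (auto simp: kos_def)
  have dec: "a(w := a w - 1) = b \<Longrightarrow> supp b \<subseteq> supp a" for a b :: "'a \<Rightarrow> nat" and w
    using supp_dec_subset by metis
  show ?thesis unfolding eq
  proof (rule kacyclic_glue[OF _ _ _ _ 1 2])
    show "kfin (kos N ?X1 \<union> kos N ?X2)" unfolding eq[symmetric]
      using N G finite_subset by (auto simp: kfin_def kos_def half_open_def)
    show "kconvex lam (kos N ?X1 \<union> kos N ?X2)" unfolding eq[symmetric] kconvex_def
    proof (intro allI impI)
      fix T a j k u w
      assume a: "(T, a) \<in> kos N ?X" and "w \<in> supp a" and c: "(T - {k} - {j}, a(w := a w - 1, u := (a(w := a w - 1)) u - 1)) \<in> kos N ?X"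
      let ?b = "a(w := a w - 1)" and ?c = "a(w := a w - 1, u := (a(w := a w - 1)) u - 1)"
      have s: "supp ?b \<subseteq> supp a" "supp ?c \<subseteq> supp ?b" by (rule supp_dec_subset)+
      \<comment> \<open>Between two faces of the piece, nonnegativity is inherited from the larger
        one and a strictly positive vertex from the smaller one.\<close>
      have "supp ?b \<in> ?X"
      proof -
        have 1: "supp a \<in> ?X" "supp ?c \<in> ?X" using a c by (auto simp: kos_def)
        have "supp ?b \<in> G" using 1 s G unfolding half_open_def by blast
        moreover have "face_pos q l (supp ?b)" if "l \<in> L" for l
        proof -
          have "face_pos q l (supp a)" "face_pos q l (supp ?c)" using 1 that unfolding half_open_def by blast+
          thus ?thesis using s unfolding face_pos_def by blast
        qed
        ultimately show ?thesis by (simp add: half_open_def)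
      qed
      thus "(T - {k}, ?b) \<in> kos N ?X" using a by (auto simp: kos_def)
    qed
    show "kclosed lam (kos N ?X2) (kos N ?X1)" unfolding kclosed_def
    proof (intro allI impI notI)
      fix T a k w assume a: "(T, a) \<in> kos N ?X1" and b: "(T - {k}, a(w := a w - 1)) \<in> kos N ?X2"
      have 1: "supp a \<in> ?X1" "supp (a(w := a w - 1)) \<in> ?X2" using a b by (auto simp: kos_def)
      hence p: "face_pos q l (supp a)" "face_pos q (\<lambda>x. - l x) (supp (a(w := a w - 1)))"
        unfolding half_open_def by auto
      then obtain x where x: "x \<in> supp (a(w := a w - 1))" "l x < 0" using q by (auto simp: face_pos_def)
      have "x \<in> supp a" by (rule subsetD[OF supp_dec_subset x(1)])
      thus False using p(1) x(2) unfolding face_pos_def by force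
    qed
    show "kos N ?X1 \<inter> kos N ?X2 = {}" using disj by (auto simp: kos_def)
  qed
qed

lemma half_open_glue':
  assumes N: "finite N" and G: "\<forall>\<tau>\<in>G. finite \<tau>" "\<forall>\<tau>\<in>G. \<forall>\<sigma>\<subseteq>\<tau>. \<sigma> \<in> G" and q: "l q \<noteq> 0"
    and side: "onesided l (half_open G q L)"
    and 1: "kacyclic lam (card N) (kos N (half_open G q (insert l L)))"
    and 2: "kacyclic lam (card N) (kos N (half_open G q (insert (\<lambda>x. - l x) L)))"
  shows "kacyclic lam (card N) (kos N (half_open G q L))"
proof (cases "l q > 0")
  case True thus ?thesis using half_open_glue[OF N G _ side 1 2] by blast
next
  case False
  have "onesided (\<lambda>x. - l x) (half_open G q L)" using side by (auto simp: onesided_def)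
  thus ?thesis using half_open_glue[OF N G, of "\<lambda>x. - l x" q L lam] False q 1 2 by simp
qed

lemma linear_agree:
  fixes f g :: "'b::real_vector \<Rightarrow> real"
  assumes "linear f" "linear g" "finite \<rho>" "\<And>x. x \<in> \<rho> \<Longrightarrow> f x = g x" "y \<in> span \<rho>"
  shows "f y = g y"
proof -
  obtain t where t: "y = (\<Sum>x\<in>\<rho>. t x *\<^sub>R x)" using assms(3,5) by (auto simp: span_finite)
  show ?thesis unfolding t linear_vsum[OF assms(1)] linear_vsum[OF assms(2)]
    by (rule sum.cong) (auto simp: assms(4))
qed

lemma face_pos_cong:
  "(\<And>x. x \<in> \<tau> \<Longrightarrow> l x = m x) \<Longrightarrow> l q = m q \<Longrightarrow> face_pos q l \<tau> = face_pos q m \<tau>"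
  by (auto simp: face_pos_def)

lemma face_pos_scale: "c > 0 \<Longrightarrow> face_pos q (\<lambda>x. c * l x) \<tau> \<longleftrightarrow> face_pos q l \<tau>"
  by (simp add: face_pos_def zero_le_mult_iff zero_less_mult_iff)

lemma face_pos_add: "face_pos q l \<tau> \<Longrightarrow> face_pos q m \<tau> \<Longrightarrow> face_pos q (\<lambda>x. l x + m x) \<tau>"
  unfolding face_pos_def by (smt (verit, best))

lemma kacyclic_empty: "kacyclic lam n {}"
  unfolding kacyclic_def chain_def by (auto intro!: exI[of _ "\<lambda>T a. 0"] simp: kbd_def)

text \<open>A vertex has its indicator as coordinate function, and coordinates are unique.\<close>

lemma vertex_in_cone:
  assumes f: "fan V G" and "\<tau> \<in> G" "\<rho> \<in> G" "u \<in> \<tau>" "u \<in> fcone \<rho>" shows "u \<in> \<rho>"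
proof -
  obtain t where t: "vval t = u" "\<forall>x. t x \<ge> 0" "rsupp t \<subseteq> \<rho>"
    using assms(5) by (auto simp: fcone_def cpos_def)
  let ?d = "\<lambda>x. if x = u then 1 else (0::real)"
  have d: "vval ?d = u" "rsupp ?d \<subseteq> \<tau>" "rsupp ?d = {u}" using assms(4) by (auto simp: vval_def rsupp_def)
  have "?d = t" by (rule fan_fcone_inj[OF f assms(2,3) _ d(2) t(2,3)]) (use d(1) t(1) in auto)
  thus ?thesis using d(3) t(3) by auto
qed

section \<open>Dual coordinates on the two halves of a subdivided facet\<close>

context stellar_step
begin

lemma swap: "stellar_step V G b a \<beta> \<alpha>" "stellar_step.w b a \<beta> \<alpha> = w"
  "stellar b a x G = stellar a b x G"
proof -
  show 1: "stellar_step V G b a \<beta> \<alpha>" by unfold_locales (use f ab pos in \<open>auto simp: insert_commute\<close>)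
  show "stellar_step.w b a \<beta> \<alpha> = w" by (simp add: stellar_step.w_def[OF 1] w_def)
  show "stellar b a x G = stellar a b x G" by (simp add: stellar_def insert_commute)
qed

lemma facet_child:
  assumes "\<rho> \<in> G" "{a, b} \<subseteq> \<rho>"
  shows "insert w (\<rho> - {b}) \<in> stellar a b w G" "card (insert w (\<rho> - {b})) = card \<rho>"
proof -
  have "\<rho> - {b} \<union> {a, b} = \<rho>" using assms by auto
  hence "\<rho> - {b} \<union> {a, b} \<in> G" using assms(1) by simp
  thus "insert w (\<rho> - {b}) \<in> stellar a b w G"
    unfolding stellar_def by (intro UnI2 CollectI exI[of _ "\<rho> - {b}"] conjI refl) auto
  show "card (insert w (\<rho> - {b})) = card \<rho>"
    using w_fresh[OF assms(1)] fanD(4)[OF f assms(1)] assms(2) card_Suc_Diff1[of \<rho> b] by simp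
qed

context
  fixes \<rho> \<rho>1 assumes r: "\<rho> \<in> G" "{a, b} \<subseteq> \<rho>" "card \<rho> = card V"
  defines "\<rho>1 \<equiv> insert w (\<rho> - {b})"
begin

lemma r1: "\<rho>1 \<in> stellar a b w G" "card \<rho>1 = card V" "finite \<rho>1" "independent \<rho>1" "span \<rho>1 = span V"
  "finite \<rho>" "independent \<rho>" "span \<rho> = span V"
proof -
  show 1: "\<rho>1 \<in> stellar a b w G" "card \<rho>1 = card V" using facet_child[OF r(1,2)] r(3) by (auto simp: \<rho>1_def)
  show "finite \<rho>1" "independent \<rho>1" "span \<rho>1 = span V"
    using fanD(4)[OF fan_stellar 1(1)] fan_independent[OF fan_stellar 1(1)] fan_full_span[OF fan_stellar 1] by auto
  show "finite \<rho>" "independent \<rho>" "span \<rho> = span V"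
    using fanD(4)[OF f r(1)] fan_independent[OF f r(1)] fan_full_span[OF f r(1,3)] by auto
qed

text \<open>Both sides are linear, so they are compared on the basis \<open>\<rho>1\<close>, with
  \<open>w\<close> expanded in \<open>a\<close> and \<open>b\<close>.\<close>

lemma dual_eqs:
  assumes y: "y \<in> span V"
  shows "dualf \<rho> b y = \<beta> * dualf \<rho>1 w y"
    and "dualf \<rho> a y = dualf \<rho>1 a y + \<alpha> * dualf \<rho>1 w y"
    and "c \<in> \<rho> \<Longrightarrow> c \<noteq> a \<Longrightarrow> c \<noteq> b \<Longrightarrow> dualf \<rho> c y = dualf \<rho>1 c y"
proof -
  note L = linear_dualf[OF r1(7)] and L1 = linear_dualf[OF r1(4)]
  have y1: "y \<in> span \<rho>1" using y r1(5) by simp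
  have wr: "w \<notin> \<rho>" using w_fresh r(1) by blast
  have dw: "dualf \<rho> x w = \<alpha> * dualf \<rho> x a + \<beta> * dualf \<rho> x b" for x
    using L(1) by (simp add: w_def linear_add linear_cmul)
  have ab': "a \<in> \<rho>" "b \<in> \<rho>" "a \<in> \<rho>1" "w \<in> \<rho>1" using r ab by (auto simp: \<rho>1_def)
  have lin: "linear (\<lambda>y. \<beta> * dualf \<rho>1 w y)" "linear (\<lambda>y. dualf \<rho>1 a y + \<alpha> * dualf \<rho>1 w y)"
    using L1(1) by (auto intro!: linear_compose_add linear_compose_scale_right[where 'b=real, simplified])
  show "dualf \<rho> b y = \<beta> * dualf \<rho>1 w y"
    by (rule linear_agree[OF L(1) lin(1) r1(3) _ y1])
       (use wr ab' ab w_neq in \<open>auto simp: \<rho>1_def L(2) dw L1(2)[unfolded \<rho>1_def]\<close>)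
  show "dualf \<rho> a y = dualf \<rho>1 a y + \<alpha> * dualf \<rho>1 w y"
    by (rule linear_agree[OF L(1) lin(2) r1(3) _ y1])
       (use wr ab' ab w_neq in \<open>auto simp: \<rho>1_def L(2) dw L1(2)[unfolded \<rho>1_def]\<close>)
  show "dualf \<rho> c y = dualf \<rho>1 c y" if "c \<in> \<rho>" "c \<noteq> a" "c \<noteq> b"
    by (rule linear_agree[OF L(1) L1(1) r1(3) _ y1])
       (use wr ab' ab w_neq that in \<open>auto simp: \<rho>1_def L(2) dw L1(2)[unfolded \<rho>1_def]\<close>)
qed

text \<open>The half with vertices \<open>\<rho>1\<close> is cut out of the cone over
  \<open>\<rho>\<close> by the single wall functional dual to \<open>a\<close>; the lemma is the
  half-open version of this.\<close>

lemma face_pos_child: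
  assumes t: "\<tau> \<subseteq> span V" "q \<in> span V"
  shows "(\<forall>l\<in>dualf \<rho> ` \<rho>. face_pos q l \<tau>) \<and> face_pos q (dualf \<rho>1 a) \<tau> \<longleftrightarrow>
         (\<forall>l\<in>dualf \<rho>1 ` \<rho>1. face_pos q l \<tau>)"
proof -
  have cb: "face_pos q (dualf \<rho> b) \<tau> \<longleftrightarrow> face_pos q (dualf \<rho>1 w) \<tau>"
    by (subst face_pos_scale[OF pos(2), symmetric], rule face_pos_cong) (use dual_eqs(1) t in auto)
  have cc: "face_pos q (dualf \<rho> c) \<tau> \<longleftrightarrow> face_pos q (dualf \<rho>1 c) \<tau>" if "c \<in> \<rho>" "c \<noteq> a" "c \<noteq> b" for c
    by (rule face_pos_cong) (use dual_eqs(3)[OF _ that] t in auto)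
  \<comment> \<open>The old \<open>a\<close>-coordinate is a positive combination of new
    coordinates, so its condition follows from theirs.\<close>
  have ca: "face_pos q (dualf \<rho> a) \<tau>" if "face_pos q (dualf \<rho>1 a) \<tau>" "face_pos q (dualf \<rho>1 w) \<tau>"
  proof -
    have "face_pos q (\<lambda>y. \<alpha> * dualf \<rho>1 w y) \<tau>" using that(2) by (simp add: face_pos_scale pos)
    from face_pos_add[OF that(1) this] show ?thesis
      by (rule iffD1[OF face_pos_cong, rotated -1]) (use dual_eqs(2) t in auto)
  qed
  have mem: "a \<in> \<rho>" "b \<in> \<rho>" "a \<in> \<rho>1" "w \<in> \<rho>1" using r ab by (auto simp: \<rho>1_def)
  show ?thesis
  proof (intro iffI conjI ballI)
    fix l assume h: "(\<forall>l\<in>dualf \<rho> ` \<rho>. face_pos q l \<tau>) \<and> face_pos q (dualf \<rho>1 a) \<tau>" and "l \<in> dualf \<rho>1 ` \<rho>1"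
    then obtain c where c: "c \<in> \<rho>1" "l = dualf \<rho>1 c" by blast
    consider "c = a" | "c = w" | "c \<in> \<rho>" "c \<noteq> a" "c \<noteq> b" using c(1) by (auto simp: \<rho>1_def)
    thus "face_pos q l \<tau>" using h c(2) cb cc mem by cases auto
  next
    fix l assume h: "\<forall>l\<in>dualf \<rho>1 ` \<rho>1. face_pos q l \<tau>" and "l \<in> dualf \<rho> ` \<rho>"
    then obtain c where c: "c \<in> \<rho>" "l = dualf \<rho> c" by blast
    consider "c = a" | "c = b" | "c \<in> \<rho>1" "c \<noteq> a" "c \<noteq> b" using c(1) by (auto simp: \<rho>1_def)
    thus "face_pos q l \<tau>" using h c cb cc ca mem by cases auto
  next
    assume h: "\<forall>l\<in>dualf \<rho>1 ` \<rho>1. face_pos q l \<tau>"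
    thus "face_pos q (dualf \<rho>1 a) \<tau>" using mem by blast
  qed
qed

text \<open>The two halves share a wall, so their wall functionals are negative multiples of each
  other. Eliminating the old coordinates of \<open>a\<close> and \<open>b\<close> gives the
  factor.\<close>

lemma opposite_child:
  assumes y: "y \<in> span V"
  shows "dualf (insert w (\<rho> - {a})) b y = - (\<beta> / \<alpha>) * dualf \<rho>1 a y"
proof -
  define \<rho>2 where "\<rho>2 = insert w (\<rho> - {a})"
  interpret s: stellar_step V G b a \<beta> \<alpha> by (rule swap(1))
  have r': "\<rho> \<in> G" "{b, a} \<subseteq> \<rho>" "card \<rho> = card V" using r by auto
  have "dualf \<rho> a y = \<alpha> * dualf \<rho>2 w y" "dualf \<rho> b y = dualf \<rho>2 b y + \<beta> * dualf \<rho>2 w y"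
    using s.dual_eqs(1,2)[OF r' y] by (auto simp: \<rho>2_def swap(2))
  with dual_eqs(1,2)[OF y] have 1: "dualf \<rho>2 b y = \<beta> * (dualf \<rho>1 w y - dualf \<rho>2 w y)"
    and 2: "\<alpha> * (dualf \<rho>1 w y - dualf \<rho>2 w y) = - dualf \<rho>1 a y"
    by (simp_all add: right_diff_distrib)
  have "\<alpha> * dualf \<rho>2 b y = \<beta> * (\<alpha> * (dualf \<rho>1 w y - dualf \<rho>2 w y))" by (simp add: 1)
  also have "\<dots> = - (\<beta> * dualf \<rho>1 a y)" unfolding 2 by simp
  finally have "\<alpha> * dualf \<rho>2 b y = - (\<beta> * dualf \<rho>1 a y)" .
  thus ?thesis using pos by (simp add: \<rho>2_def field_simps)
qed

end

end

section \<open>Acyclicity of the half-open pieces\<close>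

definition coord :: "(nat \<Rightarrow> 'b::real_vector) \<Rightarrow> nat set \<Rightarrow> nat \<Rightarrow> 'b \<Rightarrow> real" where
  "coord v N k = dualf (v ` N) (v k)"

text \<open>The conditions dual to a facet of the fan leave exactly the faces between
  \<open>R\<close> and \<open>\<rho>\<close>. Every further functional is one-sided on
  \<open>\<rho>\<close> and therefore either empties the piece or follows from the other
  conditions.\<close>

lemma half_open_leaf:
  fixes v :: "nat \<Rightarrow> 'b::real_vector"
  assumes N: "finite N" "inj_on v N" and f: "fan (v ` N) G"
    and L: "\<And>l. l \<in> L \<Longrightarrow> linear l \<and> onesided l G \<and> l q \<noteq> 0"
    and q: "q \<in> span (v ` N)" "\<And>Y. Y \<subseteq> \<Union>G \<Longrightarrow> finite Y \<Longrightarrow> card Y < card N \<Longrightarrow> q \<notin> span Y"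
    and r: "\<rho> \<in> G" "card \<rho> = card N"
  shows "kacyclic (coord v N) (card N) (kos N (half_open G q (L \<union> dualf \<rho> ` \<rho>)))"
proof -
  let ?V = "v ` N" and ?X = "half_open G q (L \<union> dualf \<rho> ` \<rho>)"
  have cV: "card ?V = card N" using N by (simp add: card_image)
  have fr: "finite \<rho>" and ir: "independent \<rho>" and sr: "span \<rho> = span ?V"
    using fanD(4)[OF f r(1)] fan_independent[OF f r(1)] fan_full_span[OF f r(1)] r cV by auto
  note lr = linear_dualf[OF ir]
  \<comment> \<open>If the \<open>u\<close>-coordinate of \<open>q\<close> is negative, a face of
    the piece needs a vertex with positive \<open>u\<close>-coordinate, and among the vertices of
    \<open>\<rho>\<close> only \<open>u\<close> has one.\<close>
  define R where "R = {u\<in>\<rho>. dualf \<rho> u q < 0}"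
  have qs: "q \<in> span \<rho>" using q(1) sr by simp
  have qe: "q = (\<Sum>u\<in>\<rho>. dualf \<rho> u q *\<^sub>R u)" by (rule dualf_expand[OF fr ir qs])
  have dq: "dualf \<rho> u q \<noteq> 0" if u: "u \<in> \<rho>" for u
  proof
    assume "dualf \<rho> u q = 0"
    hence "q = (\<Sum>x\<in>\<rho>-{u}. dualf \<rho> x q *\<^sub>R x)"
      using qe sum.remove[OF fr u, of "\<lambda>x. dualf \<rho> x q *\<^sub>R x"] by simp
    also have "\<dots> \<in> span (\<rho> - {u})" by (auto intro!: span_sum span_scale intro: span_base)
    finally have "q \<in> span (\<rho> - {u})" .
    moreover have "\<rho> - {u} \<subseteq> \<Union>G" "card (\<rho> - {u}) < card N" "finite (\<rho> - {u})"
      using r(1) r(2)[symmetric] card_Diff1_less[OF fr u] fr by auto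
    ultimately show False using q(2) by blast
  qed
  have lq: "l q = (\<Sum>u\<in>\<rho>. dualf \<rho> u q * l u)" if "l \<in> L" for l
    using linear_vsum[of l "\<lambda>u. dualf \<rho> u q" \<rho>] L[OF that] qe by simp
  have sub: "\<tau> \<subseteq> \<rho>" "R \<subseteq> \<tau>" if t: "\<tau> \<in> ?X" for \<tau>
  proof -
    have tG: "\<tau> \<in> G" and fp: "\<And>u. u \<in> \<rho> \<Longrightarrow> face_pos q (dualf \<rho> u) \<tau>"
      using t by (auto simp: half_open_def)
    show 1: "\<tau> \<subseteq> \<rho>"
    proof
      fix x assume x: "x \<in> \<tau>"
      have "x \<in> span \<rho>" using fan_span[OF f tG] x sr by auto
      moreover have "dualf \<rho> u x \<ge> 0" if "u \<in> \<rho>" for u using fp[OF that] x by (auto simp: face_pos_def)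
      ultimately have "x \<in> fcone \<rho>" using fcone_dualf[OF fr ir] by blast
      thus "x \<in> \<rho>" using vertex_in_cone[OF f tG r(1) x] by blast
    qed
    show "R \<subseteq> \<tau>"
    proof
      fix u assume u: "u \<in> R"
      hence ur: "u \<in> \<rho>" "\<not> dualf \<rho> u q > 0" by (auto simp: R_def)
      then obtain x where x: "x \<in> \<tau>" "dualf \<rho> u x > 0" using fp[OF ur(1)] by (auto simp: face_pos_def)
      hence "x = u" using lr(2)[of x u] 1 by (auto split: if_splits)
      thus "u \<in> \<tau>" using x by simp
    qed
  qed
  have "?X = {} \<or> ?X = {\<tau>. R \<subseteq> \<tau> \<and> \<tau> \<subseteq> \<rho>}"
  \<comment> \<open>If \<open>l\<close> is nonpositive on \<open>\<rho>\<close>, a face of the piece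
    lies in the zero set of \<open>l\<close>, and \<open>l q > 0\<close>. Expanding
    \<open>l q\<close> in the vertices then exhibits an element of \<open>R\<close> with
    \<open>l\<close> nonzero, although \<open>R\<close> is contained in the face.\<close>
  proof (cases "\<exists>l\<in>L. \<forall>u\<in>\<rho>. l u \<le> 0")
    case True
    then obtain l where l: "l \<in> L" "\<forall>u\<in>\<rho>. l u \<le> 0" by blast
    have False if t: "\<tau> \<in> ?X" for \<tau>
    proof -
      have fp: "face_pos q l \<tau>" using t l(1) by (auto simp: half_open_def)
      have z: "l x = 0" if "x \<in> \<tau>" for x using fp l(2) sub(1)[OF t] that by (force simp: face_pos_def)
      hence "l q > 0" using fp by (auto simp: face_pos_def)
      have "\<exists>u\<in>\<rho>. dualf \<rho> u q * l u > 0"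
      proof (rule ccontr)
        assume "\<not> ?thesis"
        hence "(\<Sum>u\<in>\<rho>. dualf \<rho> u q * l u) \<le> 0" by (intro sum_nonpos) (auto simp: not_less)
        thus False using lq[OF l(1)] \<open>l q > 0\<close> by simp
      qed
      then obtain u where u: "u \<in> \<rho>" "dualf \<rho> u q * l u > 0" by blast
      hence "dualf \<rho> u q < 0" "l u \<noteq> 0" using l(2) by (auto simp: zero_less_mult_iff)
      hence "u \<in> \<tau>" using sub(2)[OF t] u(1) by (auto simp: R_def)
      thus False using z \<open>l u \<noteq> 0\<close> by blast
    qed
    thus ?thesis by blast
  next
    case False
    have "\<tau> \<in> ?X" if t: "R \<subseteq> \<tau>" "\<tau> \<subseteq> \<rho>" for \<tau>
    proof -
      have tG: "\<tau> \<in> G" using fanD(5)[OF f r(1) t(2)] .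
      have "face_pos q (dualf \<rho> u) \<tau>" if u: "u \<in> \<rho>" for u
      proof -
        have nn: "\<forall>x\<in>\<tau>. dualf \<rho> u x \<ge> 0" using t(2) lr(2) by auto
        show ?thesis
        proof (cases "u \<in> R")
          case True
          hence "u \<in> \<tau>" "dualf \<rho> u u > 0" using t(1) lr(2)[OF u, of u] by auto
          thus ?thesis using nn unfolding face_pos_def by blast
        next
          case False
          hence "dualf \<rho> u q > 0" using dq[OF u] u by (simp add: R_def)
          thus ?thesis using nn unfolding face_pos_def by blast
        qed
      qed
      moreover have "face_pos q l \<tau>" if l: "l \<in> L" for l
      proof -
        have "(\<forall>u\<in>\<rho>. l u \<ge> 0) \<or> (\<forall>u\<in>\<rho>. l u \<le> 0)"
          using L[OF l] r(1) unfolding onesided_def by (metis (no_types, lifting))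
        hence nn: "\<forall>u\<in>\<rho>. l u \<ge> 0" using False l by blast
        show ?thesis
        proof (cases "l q > 0")
          case True thus ?thesis using nn t(2) unfolding face_pos_def by blast
        next
          case neg: False
          hence "l q < 0" using L[OF l] by simp
          \<comment> \<open>A nonnegative \<open>l\<close> with \<open>l q < 0\<close> is strictly
            positive at some element of \<open>R\<close>; that vertex witnesses the strict
            condition.\<close>
          have "\<exists>u\<in>\<rho>. dualf \<rho> u q * l u < 0"
          proof (rule ccontr)
            assume "\<not> ?thesis"
            hence "(\<Sum>u\<in>\<rho>. dualf \<rho> u q * l u) \<ge> 0" by (intro sum_nonneg) (auto simp: not_less)
            thus False using lq[OF l] \<open>l q < 0\<close> by simp
          qed
          then obtain u where u: "u \<in> \<rho>" "dualf \<rho> u q * l u < 0" by blast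
          hence "dualf \<rho> u q < 0" "l u > 0" using nn by (auto simp: mult_less_0_iff)
          hence "u \<in> \<tau>" using t(1) u(1) by (auto simp: R_def)
          thus ?thesis using nn t(2) \<open>l u > 0\<close> unfolding face_pos_def by blast
        qed
      qed
      ultimately show ?thesis using tG by (auto simp: half_open_def)
    qed
    hence "?X = {\<tau>. R \<subseteq> \<tau> \<and> \<tau> \<subseteq> \<rho>}" using sub by blast
    thus ?thesis by blast
  qed
  thus ?thesis
  proof
    assume "?X = {}"
    hence "kos N ?X = {}" by (simp add: kos_def)
    thus ?thesis by (simp add: kacyclic_empty)
  next
    assume X: "?X = {\<tau>. R \<subseteq> \<tau> \<and> \<tau> \<subseteq> \<rho>}"
    have K: "kos N ?X = {(T, a). T \<subseteq> N \<and> R \<subseteq> supp a \<and> supp a \<subseteq> \<rho>}" unfolding X kos_def by auto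
    have iV: "independent ?V" "finite ?V" using fanD[OF f] by auto
    show ?thesis unfolding K
    \<comment> \<open>Expanding the basis \<open>v\<close> in the basis \<open>\<rho>\<close> gives
      the inverse of the matrix of linear coordinates.\<close>
    proof (rule koszul_interval_acyclic[where B = "\<lambda>k u. dualf \<rho> u (v k)"])
      fix j k assume jk: "j \<in> N" "k \<in> N"
      have "v j \<in> span \<rho>" using sr jk by (auto intro: span_base)
      hence "coord v N k (v j) = (\<Sum>u\<in>\<rho>. dualf \<rho> u (v j) * coord v N k u)"
        using dualf_expand[OF fr ir, of "v j"] linear_vsum[OF linear_dualf(1)[OF iV(1)], of "v k" "\<lambda>u. dualf \<rho> u (v j)" \<rho>]
        by (simp add: coord_def)
      moreover have "coord v N k (v j) = of_bool (j = k)"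
        using linear_dualf(2)[OF iV(1), of "v j" "v k"] jk N(2) by (auto simp: coord_def inj_on_def)
      ultimately show "(\<Sum>u\<in>\<rho>. dualf \<rho> u (v j) * coord v N k u) = of_bool (j = k)" by simp
    next
      fix x u assume xu: "x \<in> \<rho>" "u \<in> \<rho>"
      have "x \<in> span ?V" using sr xu by (auto intro: span_base)
      hence "x = (\<Sum>k\<in>N. coord v N k x *\<^sub>R v k)"
        using dualf_expand[OF iV(2,1), of x] sum.reindex[OF N(2), of "\<lambda>y. dualf ?V y x *\<^sub>R y"] by (simp add: coord_def)
      hence "dualf \<rho> u x = dualf \<rho> u (\<Sum>k\<in>N. coord v N k x *\<^sub>R v k)" by simp
      also have "\<dots> = (\<Sum>k\<in>N. coord v N k x * dualf \<rho> u (v k))"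
        using lr(1) by (simp add: linear_sum linear_cmul)
      finally show "(\<Sum>k\<in>N. coord v N k x * dualf \<rho> u (v k)) = of_bool (x = u)"
        using lr(2)[OF xu(1), of u] by (simp add: of_bool_def)
    qed (use fr N in \<open>auto simp: R_def\<close>)
  qed
qed

lemma half_open_child:
  assumes s: "stellar_step V G a b \<alpha> \<beta>" and r: "\<rho> \<in> G" "{a, b} \<subseteq> \<rho>" "card \<rho> = card V"
    and G': "\<Union>G' \<subseteq> span V" and q: "q \<in> span V"
  defines "\<rho>1 \<equiv> insert (stellar_step.w a b \<alpha> \<beta>) (\<rho> - {b})"
  shows "half_open G' q (insert (dualf \<rho>1 a) (L \<union> dualf \<rho> ` \<rho>)) = half_open G' q (L \<union> dualf \<rho>1 ` \<rho>1)"
proof -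
  interpret stellar_step V G a b \<alpha> \<beta> by fact
  have "(\<forall>l\<in>insert (dualf \<rho>1 a) (L \<union> dualf \<rho> ` \<rho>). face_pos q l \<tau>) \<longleftrightarrow>
        (\<forall>l\<in>L \<union> dualf \<rho>1 ` \<rho>1. face_pos q l \<tau>)" if t: "\<tau> \<in> G'" for \<tau>
  proof -
    have "\<tau> \<subseteq> span V" using t G' by blast
    from face_pos_child[OF r this q] show ?thesis unfolding \<rho>1_def by blast
  qed
  thus ?thesis unfolding half_open_def by blast
qed

text \<open>The vertex sum of \<open>\<tau>\<close> lies in the cone over \<open>\<rho>1\<close> by
  the sign hypothesis and in the cone over \<open>\<kappa>\<close> by refinement. By uniqueness of
  coordinates its support lies in \<open>\<rho>1\<close>, and so do the supports of all summands, as
  nothing cancels.\<close>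

lemma facet_side:
  assumes s: "stellar_step V G a b \<alpha> \<beta>" and r: "\<rho> \<in> G" "{a, b} \<subseteq> \<rho>" "card \<rho> = card V"
  defines "\<rho>1 \<equiv> insert (stellar_step.w a b \<alpha> \<beta>) (\<rho> - {b})"
  assumes t: "finite \<tau>" "\<kappa> \<in> stellar a b (stellar_step.w a b \<alpha> \<beta>) G" "\<tau> \<subseteq> fcone \<kappa>" "\<tau> \<subseteq> fcone \<rho>"
    and y: "dualf \<rho>1 a (\<Sum>\<tau>) \<ge> 0" and u: "u \<in> \<tau>"
  shows "dualf \<rho>1 a u \<ge> 0"
proof -
  interpret stellar_step V G a b \<alpha> \<beta> by fact
  note f1 = fan_stellar
  note R = r1[OF r, folded \<rho>1_def]
  have mem: "a \<in> \<rho>1" "b \<in> \<rho>" using r(2) ab by (auto simp: \<rho>1_def)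
  have fk: "finite \<kappa>" using fanD(4)[OF f1 t(2)] .
  have ys: "\<Sum>\<tau> \<in> fcone \<rho>" using fcone_sum[OF R(6), of \<tau> "\<lambda>x. x"] t(4) by auto
  hence ysV: "\<Sum>\<tau> \<in> span V" using fcone_subset_span[OF R(6)] R(8) by blast
  have yd: "dualf \<rho> c (\<Sum>\<tau>) \<ge> 0" if "c \<in> \<rho>" for c using ys that by (simp add: fcone_dualf[OF R(6,7)])
  have "dualf \<rho>1 c (\<Sum>\<tau>) \<ge> 0" if c: "c \<in> \<rho>1" for c
  proof -
    consider "c = a" | "c = w" | "c \<in> \<rho>" "c \<noteq> a" "c \<noteq> b" using c by (auto simp: \<rho>1_def)
    thus ?thesis
    proof cases
      case 1 thus ?thesis using y by simp
    next
      case 2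
      thus ?thesis using dual_eqs(1)[OF r ysV, folded \<rho>1_def] yd[OF mem(2)] pos by (simp add: zero_le_mult_iff)
    next
      case 3
      thus ?thesis using dual_eqs(3)[OF r ysV 3, folded \<rho>1_def] yd[OF 3(1)] by simp
    qed
  qed
  hence "\<Sum>\<tau> \<in> fcone \<rho>1" using ysV R(5) by (simp add: fcone_dualf[OF R(3,4)])
  then obtain t1 where t1: "vval t1 = \<Sum>\<tau>" "\<forall>x. t1 x \<ge> 0" "rsupp t1 \<subseteq> \<rho>1" by (auto simp: fcone_def cpos_def)
  have "\<forall>x\<in>\<tau>. \<exists>t. vval t = x \<and> (\<forall>z. t z \<ge> 0) \<and> rsupp t \<subseteq> \<kappa>" using t(3) by (force simp: fcone_def cpos_def)
  then obtain g where g: "\<And>x. x \<in> \<tau> \<Longrightarrow> vval (g x) = x \<and> (\<forall>z. g x z \<ge> 0) \<and> rsupp (g x) \<subseteq> \<kappa>" by metis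
  define h where "h z = (\<Sum>x\<in>\<tau>. g x z)" for z
  have h0: "h z \<ge> 0" for z unfolding h_def using g by (intro sum_nonneg) auto
  have hk: "rsupp h \<subseteq> \<kappa>"
  proof
    fix z assume "z \<in> rsupp h"
    then obtain x where "x \<in> \<tau>" "g x z \<noteq> 0" unfolding rsupp_def h_def using sum.neutral by force
    thus "z \<in> \<kappa>" using g by (auto simp: rsupp_def)
  qed
  have "vval h = (\<Sum>z\<in>\<kappa>. \<Sum>x\<in>\<tau>. g x z *\<^sub>R z)" by (simp add: vval_eq[OF fk hk] h_def scaleR_sum_left)
  also have "\<dots> = (\<Sum>x\<in>\<tau>. \<Sum>z\<in>\<kappa>. g x z *\<^sub>R z)" by (rule sum.swap)
  also have "\<dots> = \<Sum>\<tau>" using g vval_eq[OF fk] by (intro sum.cong) force+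
  finally have "h = t1" using fan_fcone_inj[OF f1 t(2) R(1) _ hk t1(2,3)] h0 t1(1) by simp
  hence "rsupp (g u) \<subseteq> \<rho>1"
  proof -
    have "h z \<noteq> 0" if "g u z \<noteq> 0" for z
    proof -
      have "g u z > 0" using g[OF u] that by (simp add: order_less_le)
      also have "g u z \<le> h z" unfolding h_def using g by (intro member_le_sum u t(1)) auto
      finally show ?thesis by simp
    qed
    thus ?thesis using \<open>h = t1\<close> t1(3) by (auto simp: rsupp_def)
  qed
  hence "u \<in> fcone \<rho>1" using g[OF u] unfolding fcone_def cpos_def by (intro image_eqI[of _ _ "g u"]) auto
  thus ?thesis using mem by (simp add: fcone_dualf[OF R(3,4)])
qed

text \<open>Induction backwards along the subdivisions. Each step leaves a facet alone or splits it
  into two facets, whose pieces are glued along the common wall; the final facets are the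
  leaves.\<close>

lemma facet_acyclic:
  fixes v :: "nat \<Rightarrow> 'b::real_vector"
  assumes N: "finite N" "inj_on v N" and "estep\<^sup>*\<^sup>* G G'" and f: "fan (v ` N) G"
    and L: "\<And>l. l \<in> L \<Longrightarrow> linear l \<and> onesided l G' \<and> l q \<noteq> 0"
    and q: "q \<in> span (v ` N)" "\<And>Y. Y \<subseteq> \<Union>G' \<Longrightarrow> finite Y \<Longrightarrow> card Y < card N \<Longrightarrow> q \<notin> span Y"
    and r: "\<rho> \<in> G" "card \<rho> = card N"
  shows "kacyclic (coord v N) (card N) (kos N (half_open G' q (L \<union> dualf \<rho> ` \<rho>)))"
  using assms(3) f r
proof (induction arbitrary: \<rho> rule: converse_rtranclp_induct)
  case base
  thus ?case using half_open_leaf[OF N _ L q] by blast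
next
  case (step G G1)
  let ?V = "v ` N"
  have cV: "card ?V = card N" using N by (simp add: card_image)
  obtain a b \<alpha> \<beta> where s: "stellar_step ?V G a b \<alpha> \<beta>" and G1: "G1 = stellar a b (stellar_step.w a b \<alpha> \<beta>) G"
    using estepE[OF step.prems(1) step.hyps(1)] .
  interpret s: stellar_step ?V G a b \<alpha> \<beta> by fact
  have f1: "fan ?V G1" unfolding G1 by (rule s.fan_stellar)
  have f': "fan ?V G'" using esteps_fan[OF step.hyps(2) f1] .
  show ?case
  proof (cases "{a, b} \<subseteq> \<rho>")
    case False
    hence "\<rho> \<in> G1" using step.prems(2) unfolding G1 stellar_def by blast
    thus ?thesis using step.IH[OF f1 _ step.prems(3)] by blast
  next
    case True
    have cr: "card \<rho> = card ?V" using step.prems(3) cV by simp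
    have True': "{b, a} \<subseteq> \<rho>" using True by auto
    define \<rho>1 where "\<rho>1 = insert s.w (\<rho> - {b})"
    define \<rho>2 where "\<rho>2 = insert s.w (\<rho> - {a})"
    have s': "stellar_step ?V G b a \<beta> \<alpha>" "stellar_step.w b a \<beta> \<alpha> = s.w" by (rule s.swap)+
    have G1': "G1 = stellar b a (stellar_step.w b a \<beta> \<alpha>) G" unfolding G1 s'(2) s.swap(3) ..
    have R: "\<rho>1 \<in> G1" "card \<rho>1 = card N" "\<rho>2 \<in> G1" "card \<rho>2 = card N"
      using s.facet_child[OF step.prems(2) True] stellar_step.facet_child[OF s'(1) step.prems(2) True'] step.prems(3)
      unfolding \<rho>1_def \<rho>2_def G1 s'(2) s.swap(3) by auto
    let ?l = "dualf \<rho>1 a"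
    have sp: "\<Union>G' \<subseteq> span ?V" using fan_span[OF f'] by blast
    note R1 = s.r1[OF step.prems(2) True cr, folded \<rho>1_def]
    have opp: "dualf \<rho>2 b y = - (\<beta> / \<alpha>) * ?l y" if "y \<in> span ?V" for y
      using s.opposite_child[OF step.prems(2) True cr that] unfolding \<rho>1_def \<rho>2_def .
    have ho1: "half_open G' q (insert ?l (L \<union> dualf \<rho> ` \<rho>)) = half_open G' q (L \<union> dualf \<rho>1 ` \<rho>1)"
      using half_open_child[OF s step.prems(2) True cr sp q(1)] unfolding \<rho>1_def .
    have ho2': "half_open G' q (insert (dualf \<rho>2 b) (L \<union> dualf \<rho> ` \<rho>)) = half_open G' q (L \<union> dualf \<rho>2 ` \<rho>2)"
      using half_open_child[OF s'(1) step.prems(2) True' cr sp q(1)] unfolding \<rho>2_def s'(2) .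
    have "face_pos q (dualf \<rho>2 b) \<tau> \<longleftrightarrow> face_pos q (\<lambda>x. - ?l x) \<tau>" if t: "\<tau> \<in> G'" for \<tau>
    proof -
      have "face_pos q (dualf \<rho>2 b) \<tau> \<longleftrightarrow> face_pos q (\<lambda>y. (\<beta> / \<alpha>) * (- ?l y)) \<tau>"
        by (rule face_pos_cong) (use opp sp t q(1) in auto)
      also have "\<dots> \<longleftrightarrow> face_pos q (\<lambda>x. - ?l x) \<tau>"
        by (rule face_pos_scale) (use s.pos in simp)
      finally show ?thesis .
    qed
    hence ho2: "half_open G' q (insert (\<lambda>x. - ?l x) (L \<union> dualf \<rho> ` \<rho>)) = half_open G' q (L \<union> dualf \<rho>2 ` \<rho>2)"
      by (subst ho2'[symmetric]) (auto simp: half_open_def)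
    have fin': "\<forall>\<tau>\<in>G'. finite \<tau>" "\<forall>\<tau>\<in>G'. \<forall>\<sigma>\<subseteq>\<tau>. \<sigma> \<in> G'" using fanD(4,5)[OF f'] by auto
    \<comment> \<open>If \<open>q\<close> were on the wall, it would be spanned by the fewer than
      \<open>card N\<close> vertices of \<open>\<rho>1\<close> other than \<open>a\<close>.\<close>
    have lq: "?l q \<noteq> 0"
    proof
      assume z: "?l q = 0"
      have am: "a \<in> \<rho>1" using True s.ab by (auto simp: \<rho>1_def)
      have "q \<in> span \<rho>1" using q(1) R1(5) by simp
      hence "q = (\<Sum>x\<in>\<rho>1. dualf \<rho>1 x q *\<^sub>R x)" by (rule dualf_expand[OF R1(3,4)])
      also have "\<dots> = (\<Sum>x\<in>\<rho>1-{a}. dualf \<rho>1 x q *\<^sub>R x)"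
        using z sum.remove[OF R1(3) am, of "\<lambda>x. dualf \<rho>1 x q *\<^sub>R x"] by simp
      also have "\<dots> \<in> span (\<rho>1 - {a})" by (auto intro!: span_sum span_scale intro: span_base)
      finally have "q \<in> span (\<rho>1 - {a})" .
      moreover have "\<rho>1 - {a} \<subseteq> \<Union>G'" using esteps_vertices[OF step.hyps(2) f1] R(1) by blast
      moreover have "card (\<rho>1 - {a}) < card N" using R(2)[symmetric] card_Diff1_less[OF R1(3) am] by simp
      ultimately show False using q(2) R1(3) by blast
    qed
    have side: "onesided ?l (half_open G' q (L \<union> dualf \<rho> ` \<rho>))" unfolding onesided_def
    proof
      fix \<tau> assume t: "\<tau> \<in> half_open G' q (L \<union> dualf \<rho> ` \<rho>)"
      hence tG: "\<tau> \<in> G'" by (simp add: half_open_def)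
      have ft: "finite \<tau>" using fanD(4)[OF f' tG] .
      have ts: "\<tau> \<subseteq> span ?V" using fan_span[OF f' tG] .
      have tc: "\<tau> \<subseteq> fcone \<rho>"
      proof
        fix x assume x: "x \<in> \<tau>"
        have "dualf \<rho> u x \<ge> 0" if "u \<in> \<rho>" for u using t that x by (auto simp: half_open_def face_pos_def)
        moreover have "x \<in> span \<rho>" using ts x R1(8) by auto
        ultimately show "x \<in> fcone \<rho>" by (simp add: fcone_dualf[OF R1(6,7)])
      qed
      obtain \<kappa> where k: "\<kappa> \<in> G1" "\<tau> \<subseteq> fcone \<kappa>" using esteps_refines[OF step.hyps(2) f1 tG] by blast
      have ys: "\<Sum>\<tau> \<in> span ?V" using ts by (intro span_sum) auto
      show "(\<forall>x\<in>\<tau>. ?l x \<ge> 0) \<or> (\<forall>x\<in>\<tau>. ?l x \<le> 0)"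
      proof (cases "?l (\<Sum>\<tau>) \<ge> 0")
        case True1: True
        have "\<forall>x\<in>\<tau>. ?l x \<ge> 0"
          using facet_side[OF s step.prems(2) True cr ft k(1)[unfolded G1] k(2) tc] True1 unfolding \<rho>1_def by blast
        thus ?thesis ..
      next
        case False
        hence "dualf \<rho>2 b (\<Sum>\<tau>) \<ge> 0" using opp[OF ys] s.pos by (simp add: mult_le_0_iff divide_le_0_iff)
        hence "\<forall>x\<in>\<tau>. dualf \<rho>2 b x \<ge> 0"
          using facet_side[OF s'(1) step.prems(2) True' cr ft k(1)[unfolded G1'] k(2) tc] unfolding \<rho>2_def s'(2) by blast
        hence "\<forall>x\<in>\<tau>. ?l x \<le> 0" using opp ts s.pos by (force simp: mult_le_0_iff zero_le_mult_iff zero_le_divide_iff divide_le_0_iff)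
        thus ?thesis ..
      qed
    qed
    show ?thesis
      by (rule half_open_glue'[OF N(1) fin' lq side]) (use ho1 ho2 step.IH[OF f1] R in auto)
  qed
qed

text \<open>Take a point on a moment curve. A functional that vanishes on \<open>span Y\<close> but
  not at some \<open>v k0\<close> restricts to a nonzero polynomial in the parameter, so each
  \<open>Y\<close> excludes finitely many parameters.\<close>

lemma generic_point:
  fixes v :: "nat \<Rightarrow> 'b::real_vector"
  assumes N: "finite N" "inj_on v N" and ind: "independent (v ` N)"
    and Y: "finite \<Y>" "\<And>Y. Y \<in> \<Y> \<Longrightarrow> finite Y \<and> card Y < card N"
  shows "\<exists>q. q \<in> fcone (v ` N) \<and> (\<forall>Y\<in>\<Y>. q \<notin> span Y)"
proof -
  define Q where "Q s = (\<Sum>k\<in>N. s ^ k *\<^sub>R v k)" for s :: real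
  have "finite {s. Q s \<in> span Y}" if Y': "Y \<in> \<Y>" for Y
  proof -
    have "\<not> v ` N \<subseteq> span Y"
      using independent_span_bound[of Y "v ` N"] ind Y(2)[OF Y'] N by (auto simp: card_image)
    then obtain k0 where k0: "k0 \<in> N" "v k0 \<notin> span Y" by auto
    obtain B where B: "B \<subseteq> Y" "independent B" "Y \<subseteq> span B" using maximal_independent_subset by blast
    hence "span B = span Y" by (metis span_eq span_superset subset_trans)
    hence "independent (insert (v k0) B)" using B k0 by (simp add: independent_insertI)
    from linear_independent_extend[OF this, of "\<lambda>x. if x = v k0 then 1 else (0::real)"]
    obtain l :: "'b \<Rightarrow> real" where l: "linear l" "\<And>x. x \<in> insert (v k0) B \<Longrightarrow> l x = (if x = v k0 then 1 else 0)"
      by blast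
    have "v k0 \<notin> B" using k0 B by (auto intro: span_base)
    have lY: "l y = 0" if "y \<in> span Y" for y
    proof (rule linear_eq_0_on_span[OF l(1), of B])
      show "\<And>x. x \<in> B \<Longrightarrow> l x = 0" using l(2) \<open>v k0 \<notin> B\<close> by auto
    qed (use that \<open>span B = span Y\<close> in auto)
    define p where "p = (\<Sum>k\<in>N. monom (l (v k)) k)"
    have "coeff p k0 = (\<Sum>k\<in>N. if k = k0 then l (v k0) else 0)" unfolding p_def coeff_sum
      by (rule sum.cong) auto
    hence "coeff p k0 = 1" using k0 N l(2) by simp
    hence "p \<noteq> 0" by auto
    have "poly p s = l (Q s)" for s
      using l(1) by (simp add: p_def Q_def poly_sum poly_monom linear_sum linear_cmul mult.commute)
    hence "{s. Q s \<in> span Y} \<subseteq> {s. poly p s = 0}" using lY by auto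
    thus ?thesis using poly_roots_finite[OF \<open>p \<noteq> 0\<close>] finite_subset by blast
  qed
  hence "finite (\<Union>Y\<in>\<Y>. {s. Q s \<in> span Y})" using Y(1) by blast
  moreover have "infinite {0::real<..}" by (rule infinite_Ioi)
  ultimately have "infinite ({0<..} - (\<Union>Y\<in>\<Y>. {s. Q s \<in> span Y}))" by (rule Diff_infinite_finite)
  then obtain s where "s \<in> {0<..} - (\<Union>Y\<in>\<Y>. {s. Q s \<in> span Y})" by (metis equals0I finite.emptyI)
  hence s: "s > 0" "\<forall>Y\<in>\<Y>. Q s \<notin> span Y" by auto
  have "Q s \<in> fcone (v ` N)" unfolding Q_def
    using s(1) N by (intro fcone_sum fcone_scale fcone_base) auto
  thus ?thesis using s(2) by blast
qed

text \<open>After making all dual functionals of \<open>G\<close> one-sided, cut the refinement by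
  the functionals of the facets. When all their signs are fixed, a nonempty piece belongs to one
  facet of \<open>G\<close>, to which \<open>facet_acyclic\<close> applies.\<close>

lemma exists_acyclic_refinement:
  fixes v :: "nat \<Rightarrow> 'b::real_vector"
  assumes N: "finite N" "inj_on v N" and f: "fan (v ` N) G"
  shows "\<exists>G'. estep\<^sup>*\<^sup>* G G' \<and> kacyclic (coord v N) (card N) (kos N G')"
proof -
  let ?V = "v ` N" and ?n = "card N"
  have cV: "card ?V = ?n" using N by (simp add: card_image)
  define L0 where "L0 = (\<Union>\<sigma>\<in>G. dualf \<sigma> ` \<sigma>)"
  have finL: "finite L0" unfolding L0_def using fanD(3,4)[OF f] by blast
  have lin: "linear l" if "l \<in> L0" for l using that fan_independent[OF f] by (auto simp: L0_def linear_dualf(1))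
  obtain G' where G': "estep\<^sup>*\<^sup>* G G'" "\<forall>l\<in>L0. onesided l G'"
    using exists_onesided[OF f finL] lin by blast
  have f': "fan ?V G'" using esteps_fan[OF G'(1) f] .
  have finite_vertices: "finite (\<Union>G')" using fanD(3,4)[OF f'] by blast
  have vert: "\<Union>G \<subseteq> \<Union>G'" using esteps_vertices[OF G'(1) f] .
  define \<Y> where "\<Y> = {Y. Y \<subseteq> \<Union>G' \<and> card Y < ?n}"
  have "finite \<Y>" unfolding \<Y>_def using finite_vertices by simp
  moreover have "finite Y \<and> card Y < ?n" if "Y \<in> \<Y>" for Y using that finite_vertices finite_subset by (auto simp: \<Y>_def)
  ultimately obtain q where q: "q \<in> fcone ?V" "\<forall>Y\<in>\<Y>. q \<notin> span Y"
    using generic_point[OF N fanD(2)[OF f], of \<Y>] by blast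
  have qs: "q \<in> span ?V" using q(1) fcone_subset_span N by blast
  have qY: "q \<notin> span Y" if "Y \<subseteq> \<Union>G'" "finite Y" "card Y < ?n" for Y using q(2) that by (auto simp: \<Y>_def)
  define L1 where "L1 = (\<Union>\<sigma>\<in>{\<sigma>\<in>G. card \<sigma> = ?n}. dualf \<sigma> ` \<sigma>)"
  have L1: "L1 \<subseteq> L0" by (auto simp: L1_def L0_def)
  have lq: "l q \<noteq> 0" if l: "l \<in> L1" for l
  proof
    assume z: "l q = 0"
    from l obtain \<sigma> u where u: "\<sigma> \<in> G" "card \<sigma> = ?n" "u \<in> \<sigma>" "l = dualf \<sigma> u" by (auto simp: L1_def)
    have fs: "finite \<sigma>" "independent \<sigma>" "q \<in> span \<sigma>"
      using fanD(4)[OF f u(1)] fan_independent[OF f u(1)] fan_full_span[OF f u(1)] u(2) cV qs by auto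
    have "q = (\<Sum>x\<in>\<sigma>. dualf \<sigma> x q *\<^sub>R x)" by (rule dualf_expand[OF fs])
    also have "\<dots> = (\<Sum>x\<in>\<sigma>-{u}. dualf \<sigma> x q *\<^sub>R x)"
      using z u(4) sum.remove[OF fs(1) u(3), of "\<lambda>x. dualf \<sigma> x q *\<^sub>R x"] by simp
    also have "\<dots> \<in> span (\<sigma> - {u})" by (auto intro!: span_sum span_scale intro: span_base)
    finally have "q \<in> span (\<sigma> - {u})" .
    moreover have "\<sigma> - {u} \<subseteq> \<Union>G'" using vert u(1) by blast
    moreover have "card (\<sigma> - {u}) < ?n" using u(2)[symmetric] card_Diff1_less[OF fs(1) u(3)] by simp
    ultimately show False using qY fs(1) by blast
  qed
  have ok: "linear l \<and> onesided l G' \<and> l q \<noteq> 0" if l: "l \<in> L1 \<or> (\<exists>m\<in>L1. l = (\<lambda>x. - m x))" for l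
  proof -
    have *: "linear m \<and> onesided m G' \<and> m q \<noteq> 0" if "m \<in> L1" for m using that lin G'(2) lq L1 by blast
    from l show ?thesis
    proof
      assume "\<exists>m\<in>L1. l = (\<lambda>x. - m x)"
      then obtain m where m: "m \<in> L1" "l = (\<lambda>x. - m x)" by blast
      thus ?thesis using *[OF m(1)] by (auto simp: onesided_def intro: linear_compose_neg)
    qed (use * in blast)
  qed
  \<comment> \<open>\<open>E\<close> now decides the sign of every facet functional. Starting from
    the vertex sum of a face of the piece, a small generic move towards \<open>q\<close> ends inside
    a facet \<open>\<sigma>\<close>, and comparing signs there shows that \<open>E\<close> contains
    all functionals of \<open>\<sigma>\<close>.\<close>
  have top: "kacyclic (coord v N) ?n (kos N (half_open G' q E))"
    if E: "\<forall>l\<in>E. l \<in> L1 \<or> (\<exists>m\<in>L1. l = (\<lambda>x. - m x))" "\<forall>l\<in>L1. l \<in> E \<or> (\<lambda>x. - l x) \<in> E" for E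
  proof (cases "half_open G' q E = {}")
    case True
    hence "kos N (half_open G' q E) = {}" by (simp add: kos_def)
    thus ?thesis by (simp add: kacyclic_empty)
  next
    case False
    then obtain \<tau> where t: "\<tau> \<in> G'" "\<And>l. l \<in> E \<Longrightarrow> face_pos q l \<tau>" by (auto simp: half_open_def)
    define p0 where "p0 = \<Sum>\<tau>"
    have ft: "finite \<tau>" using fanD(4)[OF f' t(1)] .
    have p0: "p0 \<in> fcone ?V" unfolding p0_def using fan_face_subset[OF f' t(1)] N by (intro fcone_sum) auto
    have finE: "finite E"
    proof -
      have "E \<subseteq> L1 \<union> (\<lambda>m x. - m x) ` L1" using E(1) by auto
      moreover have "finite L1" using finL L1 finite_subset by blast
      ultimately show ?thesis using finite_subset by blast
    qed
    \<comment> \<open>A condition holds at \<open>p0\<close> strictly, or weakly with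
      \<open>l q > 0\<close>; in both cases it becomes strict after a small positive move in
      direction \<open>q\<close>.\<close>
    have "\<exists>d>0. \<forall>\<delta>. 0 < \<delta> \<and> \<delta> < d \<longrightarrow> l p0 + \<delta> * l q > 0" if l: "l \<in> E" for l
    proof -
      have "linear l" using ok E(1) l by blast
      hence lp: "l p0 = (\<Sum>x\<in>\<tau>. l x)" by (simp add: p0_def linear_sum)
      have nn: "\<And>x. x \<in> \<tau> \<Longrightarrow> l x \<ge> 0" using t(2)[OF l] by (auto simp: face_pos_def)
      hence lp0: "l p0 \<ge> 0" unfolding lp by (rule sum_nonneg)
      show ?thesis
      proof (cases "l q > 0")
        case True thus ?thesis using lp0 by (intro exI[of _ 1]) (auto intro: add_nonneg_pos)
      next
        case False
        then obtain x where x: "x \<in> \<tau>" "l x > 0" using t(2)[OF l] by (auto simp: face_pos_def)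
        have pos: "l p0 > 0" unfolding lp by (rule sum_pos2[OF ft x(1), of l]) (use x nn in auto)
        show ?thesis
        proof (intro exI[of _ "l p0 / (1 + \<bar>l q\<bar>)"] conjI allI impI)
          show "l p0 / (1 + \<bar>l q\<bar>) > 0" using pos by simp
          fix \<delta> assume d: "0 < \<delta> \<and> \<delta> < l p0 / (1 + \<bar>l q\<bar>)"
          hence "\<delta> * (1 + \<bar>l q\<bar>) < l p0" by (simp add: pos_less_divide_eq)
          moreover have "- (\<delta> * l q) \<le> \<delta> * (1 + \<bar>l q\<bar>)" using d
            by (metis abs_ge_minus_self add_increasing less_imp_le mult_left_mono mult_minus_right zero_le_one)
          ultimately show "l p0 + \<delta> * l q > 0" by linarith
        qed
      qed
    qed
    then obtain d where d: "\<And>l. l \<in> E \<Longrightarrow> d l > 0 \<and> (\<forall>\<delta>. 0 < \<delta> \<and> \<delta> < d l \<longrightarrow> l p0 + \<delta> * l q > 0)"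
      by metis
    define d0 where "d0 = Min (insert 1 (d ` E))"
    have d0: "d0 > 0" "\<And>l. l \<in> E \<Longrightarrow> d0 \<le> d l" unfolding d0_def using finE d by auto
    \<comment> \<open>Moves that end in the span of a lower-dimensional face. Each such span
      excludes at most one value, since \<open>q\<close> is not in it.\<close>
    define Bad where "Bad = (\<Union>\<sigma>\<in>{\<sigma>\<in>G. card \<sigma> < ?n}. {\<delta>. p0 + \<delta> *\<^sub>R q \<in> span \<sigma>})"
    have "finite {\<delta>. p0 + \<delta> *\<^sub>R q \<in> span \<sigma>}" if s: "\<sigma> \<in> G" "card \<sigma> < ?n" for \<sigma>
    proof -
      have qn: "q \<notin> span \<sigma>" using qY[of \<sigma>] s vert fanD(4)[OF f s(1)] by blast
      have "\<delta> = \<epsilon>" if "p0 + \<delta> *\<^sub>R q \<in> span \<sigma>" "p0 + \<epsilon> *\<^sub>R q \<in> span \<sigma>" for \<delta> \<epsilon>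
      proof (rule ccontr)
        assume ne: "\<delta> \<noteq> \<epsilon>"
        have "(p0 + \<delta> *\<^sub>R q) - (p0 + \<epsilon> *\<^sub>R q) \<in> span \<sigma>" using that by (rule span_diff)
        hence "(\<delta> - \<epsilon>) *\<^sub>R q \<in> span \<sigma>" by (simp add: scaleR_diff_left)
        hence "(1 / (\<delta> - \<epsilon>)) *\<^sub>R ((\<delta> - \<epsilon>) *\<^sub>R q) \<in> span \<sigma>" by (rule span_scale)
        thus False using qn ne by simp
      qed
      hence "\<exists>x. {\<delta>. p0 + \<delta> *\<^sub>R q \<in> span \<sigma>} \<subseteq> {x}" by blast
      thus ?thesis using finite_subset by blast
    qed
    hence "finite Bad" unfolding Bad_def using fanD(3)[OF f] by auto
    moreover have "infinite {0<..<d0}" using d0(1) by (rule infinite_Ioo)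
    ultimately have "infinite ({0<..<d0} - Bad)" by (rule Diff_infinite_finite)
    then obtain \<delta> where "\<delta> \<in> {0<..<d0} - Bad" by (metis equals0I finite.emptyI)
    hence \<delta>: "0 < \<delta>" "\<delta> < d0" "\<delta> \<notin> Bad" by auto
    define y where "y = p0 + \<delta> *\<^sub>R q"
    have "y \<in> fcone ?V" unfolding y_def using p0 q(1) \<delta>(1) N by (intro fcone_add fcone_scale) auto
    then obtain t' where t': "t' \<in> cpos G" "vval t' = y" using fan_cover[OF f] by blast
    define \<sigma> where "\<sigma> = rsupp t'"
    have s: "\<sigma> \<in> G" using t'(1) by (simp add: cpos_def \<sigma>_def)
    have fs: "finite \<sigma>" "independent \<sigma>" using fanD(4)[OF f s] fan_independent[OF f s] by auto
    have ye: "y = (\<Sum>u\<in>\<sigma>. t' u *\<^sub>R u)" using t'(2) by (simp add: vval_def \<sigma>_def)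
    hence "y \<in> span \<sigma>" by (auto intro!: span_sum span_scale intro: span_base)
    hence "\<not> card \<sigma> < ?n" using \<delta>(3) s unfolding Bad_def y_def by blast
    hence cs: "card \<sigma> = ?n" using fan_card_le[OF f s] cV by simp
    have "dualf \<sigma> ` \<sigma> \<subseteq> E"
    proof
      fix l assume "l \<in> dualf \<sigma> ` \<sigma>"
      then obtain u where u: "u \<in> \<sigma>" "l = dualf \<sigma> u" by blast
      have "l y = t' u" unfolding u(2) ye by (rule dualf_sum[OF fs u(1)])
      moreover have "t' u > 0" using t'(1) u(1) by (auto simp: cpos_def \<sigma>_def rsupp_def order_less_le)
      ultimately have ly: "l y > 0" by simp
      have lL: "l \<in> L1" using u s cs by (auto simp: L1_def)
      have "(\<lambda>x. - l x) \<notin> E"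
      proof
        assume m: "(\<lambda>x. - l x) \<in> E"
        from d[OF m] d0(2)[OF m] \<delta> have "- l p0 + \<delta> * (- l q) > 0" by auto
        moreover have "l y = l p0 + \<delta> * l q" using ok lL by (simp add: y_def linear_add linear_cmul)
        ultimately show False using ly by simp
      qed
      thus "l \<in> E" using E(2) lL by blast
    qed
    hence "E \<union> dualf \<sigma> ` \<sigma> = E" by blast
    thus ?thesis using facet_acyclic[OF N G'(1) f _ qs qY s cs, of E] ok E(1) by metis
  qed
  \<comment> \<open>Induction on the set \<open>M\<close> of functionals whose sign may still be
    open; each step splits the piece by one of them.\<close>
  have "\<forall>E. (\<forall>l\<in>E. l \<in> L1 \<or> (\<exists>m\<in>L1. l = (\<lambda>x. - m x))) \<longrightarrow> (\<forall>l\<in>L1 - M. l \<in> E \<or> (\<lambda>x. - l x) \<in> E) \<longrightarrow>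
      kacyclic (coord v N) ?n (kos N (half_open G' q E))" if "finite M" "M \<subseteq> L1" for M
    using that
  proof (induction M rule: finite_induct)
    case empty thus ?case using top by simp
  next
    case (insert l M)
    have l: "l \<in> L1" using insert.prems by simp
    show ?case
    proof (intro allI impI)
      fix E assume E: "\<forall>l\<in>E. l \<in> L1 \<or> (\<exists>m\<in>L1. l = (\<lambda>x. - m x))"
        "\<forall>m\<in>L1 - insert l M. m \<in> E \<or> (\<lambda>x. - m x) \<in> E"
      have IH: "kacyclic (coord v N) ?n (kos N (half_open G' q E'))"
        if "\<forall>l\<in>E'. l \<in> L1 \<or> (\<exists>m\<in>L1. l = (\<lambda>x. - m x))" "\<forall>l\<in>L1 - M. l \<in> E' \<or> (\<lambda>x. - l x) \<in> E'" for E'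
        using insert.IH insert.prems that by blast
      show "kacyclic (coord v N) ?n (kos N (half_open G' q E))"
      proof (rule half_open_glue'[OF N(1), of G' l])
        show "\<forall>\<tau>\<in>G'. finite \<tau>" "\<forall>\<tau>\<in>G'. \<forall>\<sigma>\<subseteq>\<tau>. \<sigma> \<in> G'" using fanD(4,5)[OF f'] by auto
        show "l q \<noteq> 0" by (rule lq[OF l])
        show "onesided l (half_open G' q E)" using ok l by (auto simp: onesided_def half_open_def)
        show "kacyclic (coord v N) ?n (kos N (half_open G' q (insert l E)))"
          by (rule IH) (use E l in auto)
        show "kacyclic (coord v N) ?n (kos N (half_open G' q (insert (\<lambda>x. - l x) E)))"
          by (rule IH) (use E l in auto)
      qed
    qed
  qed
  from this[of L1] have "kacyclic (coord v N) ?n (kos N (half_open G' q {}))"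
    using finL L1 finite_subset by auto
  moreover have "half_open G' q {} = G'" by (simp add: half_open_def)
  ultimately show ?thesis using G'(1) by auto
qed

section \<open>Piecewise polynomials and descent along edge subdivisions\<close>

definition edeg :: "('x \<Rightarrow> nat) \<Rightarrow> nat" where "edeg a = (\<Sum>w\<in>supp a. a w)"

definition expo :: "'x set set \<Rightarrow> nat \<Rightarrow> ('x \<Rightarrow> nat) set" where
  "expo X d = {a. supp a \<in> X \<and> edeg a = d}"

definition mono_val :: "('x \<Rightarrow> nat) \<Rightarrow> ('x \<Rightarrow> real) \<Rightarrow> real" where
  "mono_val a t = (\<Prod>w\<in>supp a. t w ^ a w)"

lemma edeg_ge: "finite (supp a) \<Longrightarrow> a w \<le> edeg a"
  by (cases "w \<in> supp a") (auto simp: edeg_def supp_def intro: member_le_sum)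

lemma finite_expo:
  assumes "finite X" "\<forall>\<tau>\<in>X. finite \<tau>" shows "finite (expo X d)"
proof (rule finite_subset)
  show "expo X d \<subseteq> {a. \<forall>x. (x \<in> \<Union>X \<longrightarrow> a x \<in> {..d}) \<and> (x \<notin> \<Union>X \<longrightarrow> a x = 0)}"
  proof
    fix a assume a: "a \<in> expo X d"
    hence "finite (supp a)" using assms(2) by (auto simp: expo_def)
    from edeg_ge[OF this] a have "a x \<le> d" for x by (simp add: expo_def)
    moreover have "a x = 0" if "x \<notin> \<Union>X" for x
      using a that unfolding expo_def supp_def by (auto dest: UnionI)
    ultimately show "a \<in> {a. \<forall>x. (x \<in> \<Union>X \<longrightarrow> a x \<in> {..d}) \<and> (x \<notin> \<Union>X \<longrightarrow> a x = 0)}" by simp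
  qed
  show "finite {a. \<forall>x. (x \<in> \<Union>X \<longrightarrow> a x \<in> {..d}) \<and> (x \<notin> \<Union>X \<longrightarrow> a x = 0)}"
    by (rule finite_set_of_finite_funs) (use assms in auto)
qed

lemma edeg_eq: "finite S \<Longrightarrow> supp a \<subseteq> S \<Longrightarrow> edeg a = (\<Sum>w\<in>S. a w)"
  unfolding edeg_def by (rule sum.mono_neutral_left) (auto simp: supp_def)

lemma mono_val_eq: "finite S \<Longrightarrow> supp a \<subseteq> S \<Longrightarrow> mono_val a t = (\<Prod>w\<in>S. t w ^ a w)"
  unfolding mono_val_def by (rule prod.mono_neutral_left) (auto simp: supp_def)

lemma edeg_inc: "finite (supp a) \<Longrightarrow> edeg (a(w := a w + 1)) = edeg a + 1"
proof -
  assume f: "finite (supp a)"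
  let ?S = "insert w (supp a)"
  have "edeg (a(w := a w + 1)) = (\<Sum>x\<in>?S. (a(w := a w + 1)) x)" by (rule edeg_eq) (use f in \<open>auto simp: supp_def\<close>)
  also have "\<dots> = (\<Sum>x\<in>?S. a x + (if x = w then 1 else 0))" by (rule sum.cong) auto
  also have "\<dots> = edeg a + 1" using f edeg_eq[of ?S a] by (simp add: sum.distrib subset_insertI)
  finally show ?thesis .
qed

lemma mono_val_inc: "finite (supp a) \<Longrightarrow> mono_val (a(w := a w + 1)) t = t w * mono_val a t"
proof -
  assume f: "finite (supp a)"
  let ?S = "insert w (supp a)"
  have "mono_val (a(w := a w + 1)) t = (\<Prod>x\<in>?S. t x ^ (a(w := a w + 1)) x)" by (rule mono_val_eq) (use f in \<open>auto simp: supp_def\<close>)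
  also have "\<dots> = (\<Prod>x\<in>?S. t x ^ a x * (if x = w then t w else 1))" by (rule prod.cong) auto
  also have "\<dots> = t w * mono_val a t" using f mono_val_eq[of ?S a] by (simp add: prod.distrib subset_insertI)
  finally show ?thesis .
qed

lemma dec_inc: "w \<in> supp a \<Longrightarrow> (a(w := a w - 1))(w := (a(w := a w - 1)) w + 1) = a"
  by (auto simp: supp_def)

lemma mono_val_dec: "finite (supp a) \<Longrightarrow> w \<in> supp a \<Longrightarrow> mono_val a t = t w * mono_val (a(w := a w - 1)) t"
  using mono_val_inc[of "a(w := a w - 1)" w t, OF finite_subset[OF supp_dec_subset]] dec_inc[of w a] by simp

lemma edeg_dec: "finite (supp a) \<Longrightarrow> w \<in> supp a \<Longrightarrow> edeg a = Suc (edeg (a(w := a w - 1)))"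
  using edeg_inc[of "a(w := a w - 1)" w, OF finite_subset[OF supp_dec_subset]] dec_inc[of w a] by simp

lemma mono_val_nz: "mono_val a t \<noteq> 0 \<Longrightarrow> finite (supp a) \<Longrightarrow> supp a \<subseteq> rsupp t"
proof (rule ccontr)
  assume h: "mono_val a t \<noteq> 0" "finite (supp a)" "\<not> supp a \<subseteq> rsupp t"
  then obtain x where x: "x \<in> supp a" "t x = 0" by (auto simp: rsupp_def)
  hence "t x ^ a x = 0" by (simp add: supp_def)
  with x(1) have "\<exists>x\<in>supp a. t x ^ a x = 0" by (rule bexI[rotated])
  hence "mono_val a t = 0" unfolding mono_val_def by (rule prod_zero[OF h(2)])
  thus False using h(1) by contradiction
qed

section \<open>Exponent functions as piecewise polynomials\<close>

definition ev :: "('x \<Rightarrow> nat) set \<Rightarrow> (('x \<Rightarrow> nat) \<Rightarrow> real) \<Rightarrow> ('x \<Rightarrow> real) \<Rightarrow> real" where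
  "ev A c t = (\<Sum>a\<in>A. c a * mono_val a t)"

text \<open>Induction on the variables: as a polynomial in the coordinate \<open>x\<close> the
  function vanishes identically, so each of its coefficients is a vanishing polynomial in the other
  variables.\<close>

lemma ev_eq_0_imp:
  assumes "finite \<tau>" "finite A" "\<And>a. a \<in> A \<Longrightarrow> supp a \<subseteq> \<tau>" "\<And>t. rsupp t \<subseteq> \<tau> \<Longrightarrow> ev A c t = 0" "a \<in> A"
  shows "c a = 0"
  using assms
proof (induction \<tau> arbitrary: A c a rule: finite_induct)
  case empty
  have *: "b = (\<lambda>_. 0)" if "b \<in> A" for b using empty.prems(2)[OF that] by (auto simp: supp_def)
  have "a = (\<lambda>_. 0)" "A = {\<lambda>_. 0}" using * empty.prems(4) by auto
  thus ?case using empty.prems(3)[of "\<lambda>_. 0"] by (simp add: ev_def mono_val_def supp_def rsupp_def)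
next
  case (insert x \<tau>)
  define j where "j = a x"
  define Aj where "Aj i = {b\<in>A. b x = i}" for i
  have inj: "inj_on (\<lambda>b. b(x := 0)) (Aj i)" for i
    by (rule inj_onI) (auto simp: Aj_def fun_eq_iff split: if_splits, metis)
  define B where "B = (\<lambda>b. b(x := 0)) ` Aj j"
  define cB where "cB b = c (b(x := j))" for b
  have "cB (a(x := 0)) = 0"
  proof (rule insert.IH[of B cB "a(x := 0)"])
    show "finite B" using insert.prems(1) by (simp add: B_def Aj_def)
    show "supp b \<subseteq> \<tau>" if "b \<in> B" for b
    proof -
      from that obtain b' where b': "b' \<in> A" "b = b'(x := 0)" by (auto simp: B_def Aj_def)
      show ?thesis using insert.prems(2)[OF b'(1)] b'(2) by (auto simp: supp_def split: if_splits)
    qed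
    show "a(x := 0) \<in> B" using insert.prems(4) by (auto simp: B_def Aj_def j_def)
    fix t :: "'a \<Rightarrow> real" assume t: "rsupp t \<subseteq> \<tau>"
    define e where "e i = (\<Sum>b\<in>Aj i. c b * mono_val (b(x := 0)) t)" for i
    define p where "p = (\<Sum>b\<in>A. monom (c b * mono_val (b(x := 0)) t) (b x))"
    have fS: "finite (insert x \<tau>)" using insert.hyps by simp
    have "poly p s = ev A c (t(x := s))" for s
      unfolding p_def ev_def poly_sum
    proof (rule sum.cong[OF refl])
      fix b assume b: "b \<in> A"
      have sb: "supp b \<subseteq> insert x \<tau>" "supp (b(x := 0)) \<subseteq> insert x \<tau>" using insert.prems(2)[OF b] by (auto simp: supp_def)
      have P1: "(\<Prod>w\<in>\<tau>. (t(x := s)) w ^ b w) = (\<Prod>w\<in>\<tau>. t w ^ b w)"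
        and P2: "(\<Prod>w\<in>\<tau>. t w ^ (b(x := 0)) w) = (\<Prod>w\<in>\<tau>. t w ^ b w)"
        by (rule prod.cong; use insert.hyps in auto)+
      have "mono_val b (t(x := s)) = s ^ b x * (\<Prod>w\<in>\<tau>. t w ^ b w)"
        unfolding mono_val_eq[OF fS sb(1)] using insert.hyps P1 by simp
      moreover have "mono_val (b(x := 0)) t = (\<Prod>w\<in>\<tau>. t w ^ b w)"
        unfolding mono_val_eq[OF fS sb(2)] using insert.hyps P2 by simp
      ultimately show "poly (monom (c b * mono_val (b(x := 0)) t) (b x)) s = c b * mono_val b (t(x := s))"
        by (simp add: poly_monom)
    qed
    also have "\<dots> s = 0" for s by (rule insert.prems(3)) (use t in \<open>auto simp: rsupp_def split: if_splits\<close>)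
    finally have "p = 0" using poly_all_0_iff_0 by blast
    hence "0 = coeff p j" by simp
    also have "\<dots> = (\<Sum>b\<in>A. if b x = j then c b * mono_val (b(x := 0)) t else 0)"
      by (simp add: p_def coeff_sum)
    also have "\<dots> = e j" using insert.prems(1) by (simp add: e_def Aj_def sum.inter_filter)
    also have "\<dots> = ev B cB t"
      unfolding ev_def B_def e_def sum.reindex[OF inj]
      by (rule sum.cong) (auto simp: cB_def Aj_def fun_upd_idem)
    finally show "ev B cB t = 0" by simp
  qed
  thus ?case by (simp add: cB_def j_def)
qed

text \<open>Elements of the face ring are determined by their values on the union of coordinate
  subspaces of the faces. On the subspace of \<open>supp a\<close> only monomials supported there
  survive.\<close>

lemma ev_expo_eq_0_imp:
  assumes X: "finite X" "\<forall>\<tau>\<in>X. finite \<tau>" "\<forall>\<tau>\<in>X. \<forall>\<sigma>\<subseteq>\<tau>. \<sigma> \<in> X"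
    and z: "\<And>t. rsupp t \<in> X \<Longrightarrow> ev (expo X d) c t = 0" and a: "a \<in> expo X d"
  shows "c a = 0"
proof -
  let ?A = "{b\<in>expo X d. supp b \<subseteq> supp a}"
  have fa: "finite (supp a)" "supp a \<in> X" using a X by (auto simp: expo_def)
  have fin: "finite (expo X d)" using finite_expo X by blast
  show ?thesis
  proof (rule ev_eq_0_imp[OF fa(1), of ?A])
    show "finite ?A" using fin by simp
    fix t :: "'a \<Rightarrow> real" assume t: "rsupp t \<subseteq> supp a"
    have "ev ?A c t = ev (expo X d) c t" unfolding ev_def
    proof (rule sum.mono_neutral_left[OF fin], blast, rule ballI)
      fix b assume b: "b \<in> expo X d - ?A"
      hence "finite (supp b)" using X by (auto simp: expo_def)
      thus "c b * mono_val b t = 0" using b t mono_val_nz[of b t] by auto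
    qed
    also have "\<dots> = 0" using z t fa X by blast
    finally show "ev ?A c t = 0" .
  qed (use a in auto)
qed

text \<open>Translates \<open>lin_shift\<close> into multiplication by a linear form, so that
  identities between chains become identities between functions.\<close>

lemma ev_lin_shift:
  assumes X: "finite X" "\<forall>\<tau>\<in>X. finite \<tau>" "\<forall>\<tau>\<in>X. \<forall>\<sigma>\<subseteq>\<tau>. \<sigma> \<in> X" and t: "rsupp t \<in> X"
  shows "ev (expo X (Suc d)) (lin_shift lam k c) t = (\<Sum>x\<in>rsupp t. lam k x * t x) * ev (expo X d) c t"
proof -
  let ?D = "{a\<in>expo X d. supp a \<subseteq> rsupp t}" and ?D1 = "{a\<in>expo X (Suc d). supp a \<subseteq> rsupp t}"
  have ft: "finite (rsupp t)" using X t by blast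
  have ev: "ev (expo X d) c t = (\<Sum>a\<in>{a\<in>expo X d. supp a \<subseteq> rsupp t}. c a * mono_val a t)" for d c
    unfolding ev_def
  proof (rule sum.mono_neutral_right[OF finite_expo[OF X(1,2)]], blast, rule ballI)
    fix b assume b: "b \<in> expo X d - {a\<in>expo X d. supp a \<subseteq> rsupp t}"
    hence "finite (supp b)" using X by (auto simp: expo_def)
    thus "c b * mono_val b t = 0" using b mono_val_nz[of b t] by auto
  qed
  have fD: "finite ?D" "finite ?D1" using finite_expo[OF X(1,2)] by auto
  have fa: "finite (supp a)" if "supp a \<subseteq> rsupp t" for a :: "'a \<Rightarrow> nat" using that ft finite_subset by blast
  have "ev (expo X (Suc d)) (lin_shift lam k c) t =
      (\<Sum>a\<in>?D1. \<Sum>w\<in>supp a. lam k w * c (a(w := a w - 1)) * mono_val a t)"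
    unfolding ev lin_shift_def by (simp add: sum_distrib_right)
  also have "\<dots> = (\<Sum>(a,w)\<in>Sigma ?D1 supp. lam k w * c (a(w := a w - 1)) * mono_val a t)"
    by (rule sum.Sigma) (use fD fa in auto)
  also have "\<dots> = (\<Sum>(a,w)\<in>?D \<times> rsupp t. lam k w * t w * (c a * mono_val a t))"
  proof (rule sum.reindex_bij_witness[of _ "\<lambda>(a,w). (a(w := a w + 1), w)" "\<lambda>(a,w). (a(w := a w - 1), w)"], goal_cases)
    case (1 p) thus ?case by (auto simp: supp_def)
  next
    case (2 p)
    then obtain a w where p: "p = (a, w)" "a \<in> ?D1" "w \<in> supp a" by auto
    have s: "supp (a(w := a w - 1)) \<subseteq> rsupp t" using p supp_dec_subset[of a w] by auto
    hence "supp (a(w := a w - 1)) \<in> X" using X t by blast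
    moreover have "edeg (a(w := a w - 1)) = d" using edeg_dec[OF fa p(3)] p(2) by (auto simp: expo_def)
    ultimately show ?case using p s by (auto simp: expo_def)
  next
    case (3 p) thus ?case by auto
  next
    case (4 p)
    then obtain a w where p: "p = (a, w)" "a \<in> ?D" "w \<in> rsupp t" by auto
    have s: "supp (a(w := a w + 1)) \<subseteq> rsupp t" using p by (auto simp: supp_def)
    hence "supp (a(w := a w + 1)) \<in> X" using X t by blast
    moreover have "edeg (a(w := a w + 1)) = Suc d" using edeg_inc[OF fa] p(2) by (auto simp: expo_def)
    ultimately show ?case using p s by (auto simp: expo_def supp_def)
  next
    case (5 p)
    then obtain a w where p: "p = (a, w)" "a \<in> ?D1" "w \<in> supp a" by auto
    thus ?case using mono_val_dec[OF fa p(3), of t] by auto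
  qed
  also have "\<dots> = (\<Sum>w\<in>rsupp t. \<Sum>a\<in>?D. lam k w * t w * (c a * mono_val a t))"
    by (subst sum.swap) (rule sum.cartesian_product[symmetric])
  also have "\<dots> = (\<Sum>x\<in>rsupp t. lam k x * t x) * ev (expo X d) c t"
    unfolding ev by (simp add: sum_product)
  finally show ?thesis .
qed

section \<open>Homogeneous polynomial functions\<close>

definition hpoly :: "'x set \<Rightarrow> nat \<Rightarrow> (('x \<Rightarrow> real) \<Rightarrow> real) \<Rightarrow> bool" where
  "hpoly X d f \<longleftrightarrow> (\<exists>c. \<forall>t. f t = ev (expo (Pow X) d) c t)"

context
  fixes X :: "'x set" assumes X: "finite X"
begin

lemma finite_exponents: "finite (expo (Pow X) d)" by (rule finite_expo) (use X finite_subset in auto)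

lemma hpoly_zero: "hpoly X d (\<lambda>t. 0)" unfolding hpoly_def by (rule exI[of _ "\<lambda>_. 0"]) (simp add: ev_def)

lemma hpoly_add: "hpoly X d f \<Longrightarrow> hpoly X d g \<Longrightarrow> hpoly X d (\<lambda>t. f t + g t)"
  unfolding hpoly_def
proof (elim exE)
  fix c c' assume "\<forall>t. f t = ev (expo (Pow X) d) c t" "\<forall>t. g t = ev (expo (Pow X) d) c' t"
  thus "\<exists>c. \<forall>t. f t + g t = ev (expo (Pow X) d) c t"
    by (intro exI[of _ "\<lambda>a. c a + c' a"]) (simp add: ev_def sum.distrib distrib_right)
qed

lemma hpoly_scale: "hpoly X d f \<Longrightarrow> hpoly X d (\<lambda>t. r * f t)"
  unfolding hpoly_def
proof (elim exE)
  fix c assume "\<forall>t. f t = ev (expo (Pow X) d) c t"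
  thus "\<exists>c. \<forall>t. r * f t = ev (expo (Pow X) d) c t"
    by (intro exI[of _ "\<lambda>a. r * c a"]) (simp add: ev_def sum_distrib_left mult.assoc)
qed

lemma hpoly_sum: "(\<And>i. i \<in> I \<Longrightarrow> hpoly X d (f i)) \<Longrightarrow> hpoly X d (\<lambda>t. \<Sum>i\<in>I. f i t)"
  by (induction I rule: infinite_finite_induct) (auto intro: hpoly_zero hpoly_add)

lemma hpoly_mono: "a \<in> expo (Pow X) d \<Longrightarrow> hpoly X d (mono_val a)"
proof -
  assume a: "a \<in> expo (Pow X) d"
  have "mono_val a t = ev (expo (Pow X) d) (\<lambda>b. if b = a then 1 else 0) t" for t
  proof -
    have "ev (expo (Pow X) d) (\<lambda>b. if b = a then 1 else 0) t = (\<Sum>b\<in>expo (Pow X) d. if b = a then mono_val a t else 0)"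
      unfolding ev_def by (rule sum.cong) auto
    thus ?thesis using a finite_exponents by simp
  qed
  thus ?thesis unfolding hpoly_def by (intro exI allI)
qed

lemma hpoly_one: "hpoly X 0 (\<lambda>t. 1)"
proof -
  have 1: "mono_val (\<lambda>_. 0) = (\<lambda>t. 1)" by (simp add: mono_val_def supp_def fun_eq_iff)
  have "(\<lambda>_. 0) \<in> expo (Pow X) 0" by (simp add: expo_def edeg_def supp_def)
  from hpoly_mono[OF this] show ?thesis unfolding 1 .
qed

lemma hpoly_coord_mult: assumes "hpoly X d f" "x \<in> X" shows "hpoly X (Suc d) (\<lambda>t. t x * f t)"
proof -
  from assms(1) obtain c where c: "\<And>t. f t = ev (expo (Pow X) d) c t" unfolding hpoly_def by blast
  have "hpoly X (Suc d) (\<lambda>t. \<Sum>a\<in>expo (Pow X) d. c a * mono_val (a(x := a x + 1)) t)"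
  proof (rule hpoly_sum, rule hpoly_scale, rule hpoly_mono)
    fix a assume a: "a \<in> expo (Pow X) d"
    hence "finite (supp a)" using X finite_subset by (auto simp: expo_def)
    from edeg_inc[OF this, of x] a assms(2) show "a(x := a x + 1) \<in> expo (Pow X) (Suc d)"
      by (auto simp: expo_def supp_def)
  qed
  moreover have "(\<Sum>a\<in>expo (Pow X) d. c a * mono_val (a(x := a x + 1)) t) = t x * f t" for t
  proof -
    have "finite (supp a)" if "a \<in> expo (Pow X) d" for a using that X finite_subset by (auto simp: expo_def)
    hence "(\<Sum>a\<in>expo (Pow X) d. c a * mono_val (a(x := a x + 1)) t) = (\<Sum>a\<in>expo (Pow X) d. t x * (c a * mono_val a t))"
      by (intro sum.cong refl) (subst mono_val_inc, auto)
    thus ?thesis by (simp add: c ev_def sum_distrib_left)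
  qed
  ultimately show ?thesis by simp
qed

lemma hpoly_linear_mult:
  assumes "hpoly X d f" shows "hpoly X (Suc d) (\<lambda>t. (\<Sum>x\<in>X. l x * t x) * f t)"
proof -
  have "hpoly X (Suc d) (\<lambda>t. \<Sum>x\<in>X. l x * (t x * f t))"
    by (intro hpoly_sum hpoly_scale hpoly_coord_mult assms)
  thus ?thesis by (simp add: sum_distrib_right mult.assoc)
qed

end

lemma mono_val_induct [consumes 2, case_names one mult]:
  assumes "finite Y" "b \<in> expo (Pow Y) d"
    and "P 0 (\<lambda>t. 1)" "\<And>d f x. P d f \<Longrightarrow> x \<in> Y \<Longrightarrow> P (Suc d) (\<lambda>t. t x * f t)"
  shows "P d (mono_val b)"
  using assms(2)
proof (induction d arbitrary: b)
  case 0
  hence f: "finite (supp b)" using assms(1) finite_subset by (auto simp: expo_def)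
  hence "b = (\<lambda>_. 0)" using 0 edeg_ge[OF f] by (auto simp: expo_def)
  hence "mono_val b = (\<lambda>t. 1)" by (simp add: mono_val_def supp_def fun_eq_iff)
  thus ?case using assms(3) by simp
next
  case (Suc d)
  hence f: "finite (supp b)" using assms(1) finite_subset by (auto simp: expo_def)
  have "supp b \<noteq> {}" using Suc.prems by (auto simp: expo_def edeg_def)
  then obtain x where x: "x \<in> supp b" by blast
  have mem: "b(x := b x - 1) \<in> expo (Pow Y) d"
    using Suc.prems edeg_dec[OF f x] supp_dec_subset[of b x] by (auto simp: expo_def)
  have "x \<in> Y" using x Suc.prems by (auto simp: expo_def)
  from assms(4)[OF Suc.IH[OF mem] this] have "P (Suc d) (\<lambda>t. t x * mono_val (b(x := b x - 1)) t)" .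
  moreover have "(\<lambda>t. t x * mono_val (b(x := b x - 1)) t) = mono_val b" using mono_val_dec[OF f x] by auto
  ultimately show ?case by simp
qed

lemma hpoly_subst:
  assumes X: "finite X" "finite Y" and f: "hpoly Y d f" and L: "\<And>x t. x \<in> Y \<Longrightarrow> L t x = (\<Sum>y\<in>X. M x y * t y)"
  shows "hpoly X d (\<lambda>t. f (L t))"
proof -
  from f obtain c where c: "\<And>t. f t = ev (expo (Pow Y) d) c t" unfolding hpoly_def by blast
  have "hpoly X d (\<lambda>t. mono_val b (L t))" if "b \<in> expo (Pow Y) d" for b
    using X(2) that
  proof (induction rule: mono_val_induct)
    case one show ?case by (rule hpoly_one[OF X(1)])
  next
    case (mult d f x)
    from hpoly_linear_mult[OF X(1) mult(1), of "M x"] show ?case using L[OF mult(2)] by simp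
  qed
  hence "hpoly X d (\<lambda>t. \<Sum>b\<in>expo (Pow Y) d. c b * mono_val b (L t))"
    by (intro hpoly_sum hpoly_scale X)
  thus ?thesis by (simp add: c ev_def)
qed

text \<open>Used to extend identities to the points where the denominator of the divided difference
  vanishes.\<close>

lemma hpoly_continuous:
  assumes "finite X" "hpoly X d f" shows "continuous_on UNIV (\<lambda>s. f (t(x := s)))"
proof -
  from assms obtain c where c: "\<And>t. f t = ev (expo (Pow X) d) c t" unfolding hpoly_def by blast
  have "continuous_on UNIV (\<lambda>s. (t(x := s)) w ^ n)" for w n
    by (cases "w = x") (auto intro!: continuous_intros)
  hence "continuous_on UNIV (\<lambda>s. \<Prod>w\<in>S. (t(x := s)) w ^ b w)" for S b by (intro continuous_on_prod)
  thus ?thesis unfolding c ev_def mono_val_def by (intro continuous_on_sum continuous_on_mult continuous_on_const)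
qed

text \<open>At a point supported on a face, every monomial whose support is not a face vanishes, so
  those coefficients may be dropped.\<close>

lemma hpoly_restrict:
  assumes X: "\<forall>\<tau>\<in>G. finite \<tau>" "\<forall>\<tau>\<in>G. \<forall>\<sigma>\<subseteq>\<tau>. \<sigma> \<in> G" "\<Union>G \<subseteq> Y" "finite Y" and f: "hpoly Y d f"
  shows "\<exists>c. (\<forall>a. c a \<noteq> 0 \<longrightarrow> a \<in> expo G d) \<and> (\<forall>t. rsupp t \<in> G \<longrightarrow> f t = ev (expo G d) c t)"
proof -
  from f obtain c where c: "\<And>t. f t = ev (expo (Pow Y) d) c t" unfolding hpoly_def by blast
  define c' where "c' a = (if a \<in> expo G d then c a else 0)" for a
  have "f t = ev (expo G d) c' t" if t: "rsupp t \<in> G" for t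
  proof -
    have "(\<Sum>a\<in>expo (Pow Y) d. c a * mono_val a t) = (\<Sum>a\<in>expo G d. c a * mono_val a t)"
    proof (rule sum.mono_neutral_right)
      show "finite (expo (Pow Y) d)" using finite_exponents X(4) by blast
      show "expo G d \<subseteq> expo (Pow Y) d" using X(3) by (auto simp: expo_def)
      show "\<forall>a\<in>expo (Pow Y) d - expo G d. c a * mono_val a t = 0"
      proof
        fix a assume a: "a \<in> expo (Pow Y) d - expo G d"
        hence "finite (supp a)" using X(4) finite_subset by (auto simp: expo_def)
        moreover have "\<not> supp a \<subseteq> rsupp t" using a t X(2) by (auto simp: expo_def)
        ultimately show "c a * mono_val a t = 0" using mono_val_nz[of a t] by auto
      qed
    qed
    thus ?thesis by (simp add: c ev_def c'_def)
  qed
  thus ?thesis by (intro exI[of _ c']) (auto simp: c'_def)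
qed

section \<open>Grading of the Koszul complex\<close>

definition kslice :: "nat \<Rightarrow> (nat set \<times> ('x \<Rightarrow> nat)) set \<Rightarrow> nat \<Rightarrow> (nat set \<times> ('x \<Rightarrow> nat)) set" where
  "kslice n U m = {(T, a)\<in>U. edeg a + n = m + card T}"

text \<open>A boundary term raises \<open>edeg a\<close> and \<open>card T\<close> by one each, so
  their difference is a grading; the summand \<open>n\<close> in \<open>kslice\<close> keeps the
  index a natural number.\<close>

lemma kslice_step:
  assumes "finite T" "finite (supp a)" "k \<in> T" "w \<in> supp a" "(T - {k}, a(w := a w - 1)) \<in> U"
  shows "(T - {k}, a(w := a w - 1)) \<in> kslice n U m \<longleftrightarrow> edeg a + n = m + card T"
  using assms(5) edeg_dec[OF assms(2,4)] card_Suc_Diff1[OF assms(1,3)] by (auto simp: kslice_def)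

lemma kbd_kslice:
  assumes "kfin U" "\<And>T a. z T a \<noteq> 0 \<Longrightarrow> (T, a) \<in> U" "(T, a) \<in> kslice n U m"
  shows "kbd lam (kslice n U m) (krestrict (kslice n U m) z) T a = kbd lam U z T a"
proof -
  have U: "(T, a) \<in> U" "edeg a + n = m + card T" using assms(3) by (auto simp: kslice_def)
  hence f: "finite T" "finite (supp a)" using assms(1) by (auto simp: kfin_def)
  have "krestrict (kslice n U m) z (T - {k}) (a(w := a w - 1)) = z (T - {k}) (a(w := a w - 1))"
    if "k \<in> T" "w \<in> supp a" for k w
    using kslice_step[OF f that] U(2) assms(2) unfolding krestrict_def by metis
  thus ?thesis using U assms(3) unfolding kbd_def
    by (auto intro!: sum.cong arg_cong2[of _ _ _ _ "(*)"] lin_shift_cong)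
qed

lemma kacyclic_kslice:
  assumes fin: "kfin U" and ac: "kacyclic lam n U" shows "kacyclic lam n (kslice n U m)"
  unfolding kacyclic_def
proof (intro allI impI, elim conjE)
  let ?S = "kslice n U m"
  fix k z assume k: "k < n" and z: "chain ?S k z" "\<forall>T a. kbd lam ?S z T a = 0"
  have zs: "(T, a) \<in> ?S \<and> card T = k" if "z T a \<noteq> 0" for T a using z(1) that by (auto simp: chain_def)
  have zU: "(T, a) \<in> U" if "z T a \<noteq> 0" for T a using zs[OF that] by (simp add: kslice_def)
  have rz: "krestrict ?S z = z" using zs by (auto simp: krestrict_def fun_eq_iff)
  have zc: "chain U k z" using zs zU unfolding chain_def by blast
  have "kbd lam U z T a = 0" for T a
  proof (cases "(T, a) \<in> ?S")
    case True
    thus ?thesis using kbd_kslice[OF fin zU True, of z lam] z(2) rz by simp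
  next
    case False
    show ?thesis
    proof (cases "(T, a) \<in> U")
      case U: True
      hence f: "finite T" "finite (supp a)" using fin by (auto simp: kfin_def)
      have "z (T - {j}) (a(w := a w - 1)) = 0" if "j \<in> T" "w \<in> supp a" for j w
      proof (rule ccontr)
        assume nz: "z (T - {j}) (a(w := a w - 1)) \<noteq> 0"
        with kslice_step[OF f that zU[OF nz], of n m] zs[OF nz] U False show False by (auto simp: kslice_def)
      qed
      thus ?thesis unfolding kbd_def by (auto intro!: sum.neutral lin_shift_zero)
    qed (simp add: kbd_outside)
  qed
  then obtain b where b: "\<And>T a. b T a \<noteq> 0 \<Longrightarrow> (T, a) \<in> U \<and> Suc (card T) = k" "\<And>T a. kbd lam U b T a = z T a"
    using kacyclicD[OF ac k zc] by blast
  have bU: "b T a \<noteq> 0 \<Longrightarrow> (T, a) \<in> U" for T a using b(1) by blast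
  show "\<exists>b. (\<forall>T a. b T a \<noteq> 0 \<longrightarrow> (T, a) \<in> ?S \<and> Suc (card T) = k) \<and> (\<forall>T a. kbd lam ?S b T a = z T a)"
  proof (intro exI[of _ "krestrict ?S b"] conjI allI impI)
    fix T a
    show "krestrict ?S b T a \<noteq> 0 \<Longrightarrow> (T, a) \<in> ?S" "krestrict ?S b T a \<noteq> 0 \<Longrightarrow> Suc (card T) = k"
      using b(1)[of T a] by (auto simp: krestrict_def split: if_splits)
    show "kbd lam ?S (krestrict ?S b) T a = z T a"
    proof (cases "(T, a) \<in> ?S")
      case True thus ?thesis using kbd_kslice[OF fin bU True, where z=b and lam=lam] b(2) by simp
    next
      case False thus ?thesis using zs[of T a] by (cases "z T a = 0") (auto simp: kbd_outside)
    qed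
  qed
qed

text \<open>Primitives of the slices are put together by reading each value in its own slice. Its
  index \<open>edeg a + n - card T\<close> is exact because \<open>card T <= n\<close>.\<close>

lemma kacyclic_from_kslices:
  assumes fin: "kfin U" and card: "\<And>T a. (T, a) \<in> U \<Longrightarrow> card T \<le> n"
    and ac: "\<And>m. kacyclic lam n (kslice n U m)"
  shows "kacyclic lam n U"
  unfolding kacyclic_def
proof (intro allI impI, elim conjE)
  fix k z assume k: "k < n" and z: "chain U k z" "\<forall>T a. kbd lam U z T a = 0"
  let ?S = "kslice n U"
  have zs: "(T, a) \<in> U \<and> card T = k" if "z T a \<noteq> 0" for T a using z(1) that by (auto simp: chain_def)
  have zU: "z T a \<noteq> 0 \<Longrightarrow> (T, a) \<in> U" for T a using zs by blast
  have "\<exists>b. (\<forall>T a. b T a \<noteq> 0 \<longrightarrow> (T, a) \<in> ?S m \<and> Suc (card T) = k) \<and>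
      (\<forall>T a. kbd lam (?S m) b T a = krestrict (?S m) z T a)" for m
  proof -
    have "chain (?S m) k (krestrict (?S m) z)" using zs by (auto simp: chain_def krestrict_def)
    moreover have "kbd lam (?S m) (krestrict (?S m) z) T a = 0" for T a
      using kbd_kslice[OF fin zU, where z=z and lam=lam and T=T and a=a and n=n and m=m] z(2) by (cases "(T, a) \<in> ?S m") (auto simp: kbd_outside)
    ultimately show ?thesis using ac[of m] k unfolding kacyclic_def by blast
  qed
  then obtain B where B: "\<And>m T a. B m T a \<noteq> 0 \<Longrightarrow> (T, a) \<in> ?S m \<and> Suc (card T) = k"
      "\<And>m T a. kbd lam (?S m) (B m) T a = krestrict (?S m) z T a" by metis
  define b where "b T a = B (edeg a + n - card T) T a" for T a
  have bB: "krestrict (?S m) b = B m" for m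
  proof (intro ext)
    fix T a show "krestrict (?S m) b T a = B m T a"
    proof (cases "(T, a) \<in> ?S m")
      case True
      hence "edeg a + n - card T = m" by (simp add: kslice_def)
      thus ?thesis using True by (simp add: krestrict_def b_def)
    next
      case False thus ?thesis using B(1)[of m T a] by (auto simp: krestrict_def)
    qed
  qed
  have bs: "(T, a) \<in> U \<and> Suc (card T) = k" if "b T a \<noteq> 0" for T a
    using B(1)[of "edeg a + n - card T" T a] that by (auto simp: b_def kslice_def)
  hence bU: "b T a \<noteq> 0 \<Longrightarrow> (T, a) \<in> U" for T a by blast
  have "kbd lam U b T a = z T a" for T a
  proof (cases "(T, a) \<in> U")
    case True
    define m where "m = edeg a + n - card T"
    have S: "(T, a) \<in> ?S m" using True card[OF True] by (simp add: kslice_def m_def)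
    show ?thesis using kbd_kslice[OF fin bU S, where z=b and lam=lam] B(2)[of m T a] S by (simp add: bB krestrict_def)
  next
    case False thus ?thesis using zU[of T a] by (auto simp: kbd_outside)
  qed
  thus "\<exists>b. (\<forall>T a. b T a \<noteq> 0 \<longrightarrow> (T, a) \<in> U \<and> Suc (card T) = k) \<and> (\<forall>T a. kbd lam U b T a = z T a)"
    using bs by blast
qed

section \<open>Push-forward along an edge subdivision\<close>

context stellar_step
begin

lemma rsupp_stellar_cases:
  assumes "rsupp t \<in> stellar a b w G"
  shows "t w = 0 \<and> rsupp t \<in> G \<or> t w \<noteq> 0 \<and> (rsupp t - {w}) \<union> {a, b} \<in> G"
proof -
  consider "rsupp t \<in> G" | \<tau> where "rsupp t = insert w \<tau>" "\<tau> \<union> {a, b} \<in> G"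
    using assms by (auto simp: stellar_def)
  thus ?thesis
  proof cases
    case 1
    thus ?thesis using w_fresh[OF 1] by (simp add: rsupp_def)
  next
    case 2
    have "w \<notin> \<tau>" using w_fresh[OF 2(2)] by auto
    hence "rsupp t - {w} = \<tau>" using 2 by auto
    moreover have "t w \<noteq> 0" using 2(1) by (metis insertI1 rsupp_eq_iff)
    ultimately show ?thesis using 2 by auto
  qed
qed

lemma rsupp_Psi:
  assumes "rsupp t \<in> stellar a b w G" shows "rsupp (Psi t) \<in> G"
proof -
  consider "t w = 0" "rsupp t \<in> G" | "t w \<noteq> 0" "(rsupp t - {w}) \<union> {a, b} \<in> G"
    using rsupp_stellar_cases[OF assms] by blast
  thus ?thesis
  proof cases
    case 1
    hence "Psi t = t" by (auto simp: Psi_def)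
    thus ?thesis using 1 by simp
  next
    case 2
    have "rsupp (Psi t) \<subseteq> (rsupp t - {w}) \<union> {a, b}" by (auto simp: rsupp_def Psi_def)
    thus ?thesis using fanD(5)[OF f 2(2)] by blast
  qed
qed

text \<open>Polynomial identities are tested at coefficients of either sign, which takes this
  version without nonnegativity.\<close>

lemma vval_Psi: assumes fin: "finite (rsupp t)" shows "vval (Psi t) = vval t"
proof -
  let ?S = "rsupp t \<union> {a,b,w}"
  define D where "D x = (if x = a then \<alpha> * t w else 0) + (if x = b then \<beta> * t w else 0) - (if x = w then t w else 0)" for x
  have "Psi t x = t x + D x" for x using ab w_neq by (auto simp: Psi_def D_def)
  hence "(\<Sum>x\<in>?S. Psi t x *\<^sub>R x) = (\<Sum>x\<in>?S. t x *\<^sub>R x) + (\<Sum>x\<in>?S. D x *\<^sub>R x)"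
    by (simp add: scaleR_add_left sum.distrib)
  also have "(\<Sum>x\<in>?S. D x *\<^sub>R x) = (\<Sum>x\<in>?S. (if x = a then (\<alpha> * t w) *\<^sub>R a else 0) + (if x = b then (\<beta> * t w) *\<^sub>R b else 0) - (if x = w then t w *\<^sub>R w else 0))"
    by (rule sum.cong) (use ab w_neq in \<open>auto simp: D_def\<close>)
  also have "\<dots> = 0" using fin by (simp add: sum.distrib sum_subtractf w_def scaleR_add_right mult.commute)
  finally show "vval (Psi t) = vval t"
    using fin by (subst (1 2) vval_eq[of ?S]) (auto simp: rsupp_def Psi_def)
qed

text \<open>
  On a cone containing \<open>a\<close> and \<open>b\<close>, the functions \<open>side1\<close> and \<open>side2\<close> give the coordinates in the two
  cones into which it is cut. The push-forward of a piecewise polynomial is the divided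
  difference \<open>(p h\<^sub>1 - q h\<^sub>2) / (p - q)\<close> of its two branches; it is again a polynomial because the branches
  agree where \<open>p = q\<close>.
\<close>

definition side1 :: "('b \<Rightarrow> real) \<Rightarrow> 'b \<Rightarrow> real" where
  "side1 t = t(a := t a - \<alpha> / \<beta> * t b, b := 0, w := t b / \<beta>)"

definition side2 :: "('b \<Rightarrow> real) \<Rightarrow> 'b \<Rightarrow> real" where
  "side2 t = t(a := 0, b := t b - \<beta> / \<alpha> * t a, w := t a / \<alpha>)"

definition is_push :: "(('b \<Rightarrow> real) \<Rightarrow> real) \<Rightarrow> (('b \<Rightarrow> real) \<Rightarrow> real) \<Rightarrow> bool" where
  "is_push h g \<longleftrightarrow> (\<forall>t. (t a / \<alpha> - t b / \<beta>) * g t = t a / \<alpha> * h (side1 t) - t b / \<beta> * h (side2 t))"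

lemma finite_vertices: "finite (\<Union>G)" using fanD(3,4)[OF f] by blast

lemma edge_vertices: "a \<in> \<Union>G" "b \<in> \<Union>G" "w \<notin> \<Union>G" using ab(2) w_fresh by blast+

text \<open>Induction over monomials. The divided difference of the two branches of \<open>h\<close>
  is carried along, because a factor \<open>t w\<close> exchanges its role with that of the
  push.\<close>

lemma push_exists:
  assumes h: "hpoly (insert w (\<Union>G)) d h"
  shows "\<exists>g. hpoly (\<Union>G) d g \<and> is_push h g"
proof -
  let ?X = "\<Union>G" and ?Y = "insert w (\<Union>G)"
  let ?p = "\<lambda>t. t a / \<alpha>" and ?q = "\<lambda>t. t b / \<beta>"
  note H = hpoly_zero[OF finite_vertices] hpoly_add[OF finite_vertices] hpoly_scale[OF finite_vertices] hpoly_sum[OF finite_vertices] hpoly_one[OF finite_vertices]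
  note M = hpoly_coord_mult[OF finite_vertices]
  \<comment> \<open>\<open>D\<close> is the divided difference of the branches, of degree
    \<open>d - 1\<close>; for constants the branches agree and \<open>D\<close> is 0.\<close>
  define good where "good d f \<longleftrightarrow> (hpoly ?X d (\<lambda>t. f (side1 t)) \<and> hpoly ?X d (\<lambda>t. f (side2 t)) \<and>
     (\<exists>g D. hpoly ?X d g \<and> is_push f g \<and> (if d = 0 then D = (\<lambda>t. 0) else hpoly ?X (d - 1) D) \<and>
       (\<forall>t. (?p t - ?q t) * D t = f (side1 t) - f (side2 t))))" for d f
  have good_mono: "good d (mono_val c)" if "c \<in> expo (Pow ?Y) d" for c d
    using finite.insertI[OF finite_vertices] that
  proof (induction rule: mono_val_induct)
    case one
    show ?case unfolding good_def is_push_def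
      by (intro conjI H exI[of _ "\<lambda>t. 1"] exI[of _ "\<lambda>t. 0"]) auto
  next
    case (mult d f x)
    then obtain g D where f1: "hpoly ?X d (\<lambda>t. f (side1 t))" and f2: "hpoly ?X d (\<lambda>t. f (side2 t))"
      and g: "hpoly ?X d g" "is_push f g" and D: "if d = 0 then D = (\<lambda>t. 0) else hpoly ?X (d - 1) D"
       "\<And>t. (?p t - ?q t) * D t = f (side1 t) - f (side2 t)"
      unfolding good_def by blast
    note gp = g(2)[unfolded is_push_def, rule_format]
    have Dm: "hpoly ?X d (\<lambda>t. t y * D t)" if "y \<in> ?X" for y
      using D(1) that M[of "d - 1" D y] H(1) by (cases d) auto
    have nz: "\<alpha> \<noteq> 0" "\<beta> \<noteq> 0" using pos by auto
    consider "x = a" | "x = b" | "x = w" | "x \<in> ?X" "x \<noteq> a" "x \<noteq> b" "x \<noteq> w" using mult(2) by blast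
    thus ?case
    proof cases
      case 1
      have "hpoly ?X (Suc d) (\<lambda>t. t a * f (side1 t) + (- \<alpha> / \<beta>) * (t b * f (side1 t)))"
        by (intro H(2,3) M f1 edge_vertices)
      hence "hpoly ?X (Suc d) (\<lambda>t. side1 t x * f (side1 t))"
        by (rule back_subst[of "hpoly ?X (Suc d)"]) (use ab w_neq in \<open>auto simp: side1_def 1 algebra_simps\<close>)
      moreover have "hpoly ?X (Suc d) (\<lambda>t. side2 t x * f (side2 t))"
        using H(1) ab w_neq by (simp add: side2_def 1)
      moreover have "hpoly ?X (Suc d) (\<lambda>t. t a * f (side1 t))" by (intro M f1 edge_vertices)
      moreover have "is_push (\<lambda>t. t x * f t) (\<lambda>t. t a * f (side1 t))"
        unfolding is_push_def using ab w_neq nz by (auto simp: 1 side1_def side2_def field_simps)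
      moreover have "hpoly ?X d (\<lambda>t. \<alpha> * f (side1 t))" by (intro H(3) f1)
      moreover have "(?p t - ?q t) * (\<alpha> * f (side1 t)) = side1 t x * f (side1 t) - side2 t x * f (side2 t)" for t
        using ab w_neq nz by (simp add: 1 side1_def side2_def field_simps)
      ultimately show ?thesis unfolding good_def by (intro conjI exI[of _ "\<lambda>t. t a * f (side1 t)"] exI[of _ "\<lambda>t. \<alpha> * f (side1 t)"]) auto
    next
      case 2
      have "hpoly ?X (Suc d) (\<lambda>t. t b * f (side2 t) + (- \<beta> / \<alpha>) * (t a * f (side2 t)))"
        by (intro H(2,3) M f2 edge_vertices)
      hence "hpoly ?X (Suc d) (\<lambda>t. side2 t x * f (side2 t))"
        by (rule back_subst[of "hpoly ?X (Suc d)"]) (use ab w_neq in \<open>auto simp: side2_def 2 algebra_simps\<close>)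
      moreover have "hpoly ?X (Suc d) (\<lambda>t. side1 t x * f (side1 t))"
        using H(1) ab w_neq by (simp add: side1_def 2)
      moreover have "hpoly ?X (Suc d) (\<lambda>t. t b * f (side2 t))" by (intro M f2 edge_vertices)
      moreover have "is_push (\<lambda>t. t x * f t) (\<lambda>t. t b * f (side2 t))"
        unfolding is_push_def using ab w_neq nz by (auto simp: 2 side1_def side2_def field_simps)
      moreover have "hpoly ?X d (\<lambda>t. \<beta> * f (side2 t))" by (intro H(3) f2)
      moreover have "(?p t - ?q t) * (\<beta> * f (side2 t)) = side1 t x * f (side1 t) - side2 t x * f (side2 t)" for t
        using ab w_neq nz by (simp add: 2 side1_def side2_def field_simps)
      ultimately show ?thesis unfolding good_def by (intro conjI exI[of _ "\<lambda>t. t b * f (side2 t)"] exI[of _ "\<lambda>t. \<beta> * f (side2 t)"]) auto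
    next
      \<comment> \<open>The branches of \<open>t w\<close> are \<open>q\<close> on the first side
        and \<open>p\<close> on the second. So the new push is \<open>p q D\<close>, and the new
        divided difference is \<open>(p + q) D - g\<close>.\<close>
      case 3
      have s: "side1 t x = ?q t" "side2 t x = ?p t" for t by (auto simp: 3 side1_def side2_def)
      have "hpoly ?X (Suc d) (\<lambda>t. (1 / \<beta>) * (t b * f (side1 t)))" by (intro H(3) M f1 edge_vertices)
      hence "hpoly ?X (Suc d) (\<lambda>t. side1 t x * f (side1 t))"
        by (rule back_subst[of "hpoly ?X (Suc d)"]) (auto simp: side1_def 3)
      moreover have "hpoly ?X (Suc d) (\<lambda>t. (1 / \<alpha>) * (t a * f (side2 t)))" by (intro H(3) M f2 edge_vertices)
      hence "hpoly ?X (Suc d) (\<lambda>t. side2 t x * f (side2 t))"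
        by (rule back_subst[of "hpoly ?X (Suc d)"]) (auto simp: side2_def 3)
      moreover have "hpoly ?X (Suc d) (\<lambda>t. (1 / (\<alpha> * \<beta>)) * (t a * (t b * D t)))" by (intro H(3) M Dm edge_vertices)
      moreover have "is_push (\<lambda>t. t x * f t) (\<lambda>t. (1 / (\<alpha> * \<beta>)) * (t a * (t b * D t)))"
        unfolding is_push_def
      proof
        fix t
        have "(?p t - ?q t) * ((1 / (\<alpha> * \<beta>)) * (t a * (t b * D t))) = ?p t * ?q t * ((?p t - ?q t) * D t)" by simp
        thus "(?p t - ?q t) * ((1 / (\<alpha> * \<beta>)) * (t a * (t b * D t))) = ?p t * (side1 t x * f (side1 t)) - ?q t * (side2 t x * f (side2 t))"
          unfolding D(2) s by (simp add: right_diff_distrib mult_ac)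
      qed
      moreover have "hpoly ?X d (\<lambda>t. (1 / \<alpha>) * (t a * D t) + ((1 / \<beta>) * (t b * D t) + (-1) * g t))"
        by (intro H(2,3) Dm g edge_vertices)
      moreover have "(?p t - ?q t) * ((1 / \<alpha>) * (t a * D t) + ((1 / \<beta>) * (t b * D t) + (-1) * g t)) =
         side1 t x * f (side1 t) - side2 t x * f (side2 t)" for t
      proof -
        have "(?p t - ?q t) * ((1 / \<alpha>) * (t a * D t) + ((1 / \<beta>) * (t b * D t) + (-1) * g t)) =
          (?p t + ?q t) * ((?p t - ?q t) * D t) - (?p t - ?q t) * g t" by (simp add: algebra_simps)
        also have "\<dots> = ?q t * f (side1 t) - ?p t * f (side2 t)" unfolding D(2) gp by (simp add: algebra_simps)
        finally show ?thesis unfolding s .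
      qed
      ultimately show ?thesis unfolding good_def
        by (intro conjI exI[of _ "\<lambda>t. (1 / (\<alpha> * \<beta>)) * (t a * (t b * D t))"]
          exI[of _ "\<lambda>t. (1 / \<alpha>) * (t a * D t) + ((1 / \<beta>) * (t b * D t) + (-1) * g t)"]) auto
    next
      case 4
      have s: "side1 t x = t x" "side2 t x = t x" for t using 4 by (auto simp: side1_def side2_def)
      have "is_push (\<lambda>t. t x * f t) (\<lambda>t. t x * g t)" unfolding is_push_def s
      proof
        fix t
        show "(?p t - ?q t) * (t x * g t) = ?p t * (t x * f (side1 t)) - ?q t * (t x * f (side2 t))"
          using gp[of t] by (metis (no_types, lifting) mult.left_commute right_diff_distrib)
      qed
      moreover have "(?p t - ?q t) * (t x * D t) = t x * f (side1 t) - t x * f (side2 t)" for t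
        using D(2)[of t] by (metis (no_types, lifting) mult.left_commute right_diff_distrib)
      ultimately show ?thesis unfolding good_def s using M[OF f1 4(1)] M[OF f2 4(1)] M[OF g(1) 4(1)] Dm[OF 4(1)]
        by (intro conjI exI[of _ "\<lambda>t. t x * g t"] exI[of _ "\<lambda>t. t x * D t"]) auto
    qed
  qed
  from h obtain c where c: "\<And>t. h t = ev (expo (Pow ?Y) d) c t" unfolding hpoly_def by blast
  have "\<forall>e\<in>expo (Pow ?Y) d. \<exists>g. hpoly ?X d g \<and> is_push (mono_val e) g"
    using good_mono unfolding good_def by blast
  then obtain g where g: "\<And>e. e \<in> expo (Pow ?Y) d \<Longrightarrow> hpoly ?X d (g e) \<and> is_push (mono_val e) (g e)" by metis
  have "hpoly ?X d (\<lambda>t. \<Sum>e\<in>expo (Pow ?Y) d. c e * g e t)" using g by (intro H) auto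
  moreover have "is_push h (\<lambda>t. \<Sum>e\<in>expo (Pow ?Y) d. c e * g e t)" unfolding is_push_def
  proof
    fix t
    have "(?p t - ?q t) * (\<Sum>e\<in>expo (Pow ?Y) d. c e * g e t) = (\<Sum>e\<in>expo (Pow ?Y) d. c e * ((?p t - ?q t) * g e t))"
      by (simp add: sum_distrib_left mult.left_commute)
    also have "\<dots> = (\<Sum>e\<in>expo (Pow ?Y) d. c e * (?p t * mono_val e (side1 t) - ?q t * mono_val e (side2 t)))"
      using g unfolding is_push_def by (intro sum.cong) auto
    also have "\<dots> = ?p t * h (side1 t) - ?q t * h (side2 t)"
      by (simp add: c ev_def sum_distrib_left right_diff_distrib sum_subtractf mult.left_commute)
    finally show "(?p t - ?q t) * (\<Sum>e\<in>expo (Pow ?Y) d. c e * g e t) = ?p t * h (side1 t) - ?q t * h (side2 t)" .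
  qed
  ultimately show ?thesis by blast
qed

end

context stellar_step
begin

text \<open>For a small nonzero coefficient at \<open>a\<close>, the first branch leaves the point
  fixed and the second has factor 0; dividing by that coefficient and passing to the limit gives the
  value at \<open>t\<close>.\<close>

lemma push_zero:
  assumes h: "hpoly (insert w (\<Union>G)) d h" and g: "hpoly (\<Union>G) d g" "is_push h g"
    and t: "t a = 0" "t b = 0" "t w = 0"
  shows "g t = h t"
proof -
  have "g (t(a := s)) = h (t(a := s))" if s: "s \<noteq> 0" for s
  proof -
    have "side1 (t(a := s)) = t(a := s)" using ab w_neq t by (auto simp: side1_def fun_eq_iff)
    moreover have "s / \<alpha> \<noteq> 0" using s pos by simp
    ultimately show ?thesis using g(2)[unfolded is_push_def, rule_format, of "t(a := s)"] ab t by simp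
  qed
  hence ev: "eventually (\<lambda>s. g (t(a := s)) = h (t(a := s))) (at 0)"
    by (auto simp: eventually_at intro: exI[of _ 1])
  have "continuous (at 0) (\<lambda>s. g (t(a := s)))" "continuous (at 0) (\<lambda>s. h (t(a := s)))"
    using hpoly_continuous[OF finite_vertices g(1)] hpoly_continuous[OF finite.insertI[OF finite_vertices] h]
    by (simp_all add: continuous_on_eq_continuous_at)
  hence "((\<lambda>s. g (t(a := s))) \<longlongrightarrow> g (t(a := 0))) (at 0)" "((\<lambda>s. h (t(a := s))) \<longlongrightarrow> h (t(a := 0))) (at 0)"
    by (auto simp: continuous_at)
  from Lim_transform_eventually[OF this(1) ev] this(2)
  have "g (t(a := 0)) = h (t(a := 0))" using tendsto_unique by (metis at_neq_bot)
  moreover have "t(a := 0) = t" using t by auto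
  ultimately show ?thesis by simp
qed

text \<open>The forms \<open>\<theta>\<close> depend only on the represented point, so they take the
  same value on both branches and pass through the divided difference. The identity holds after
  multiplication by \<open>p - q\<close> and extends to \<open>p = q\<close> by continuity.\<close>

lemma push_identity:
  fixes \<theta> :: "nat \<Rightarrow> ('b \<Rightarrow> real) \<Rightarrow> real"
  assumes F: "hpoly (\<Union>G) d F" and J: "finite J"
    and h: "\<And>j. j \<in> J \<Longrightarrow> hpoly (insert w (\<Union>G)) d' (h j)"
    and g: "\<And>j. j \<in> J \<Longrightarrow> hpoly (\<Union>G) d' (g j) \<and> is_push (h j) (g j)"
    and th: "\<And>j t. finite (rsupp t) \<Longrightarrow> \<theta> j t = L j (vval t)"
    and Lc: "\<And>j. linear (L j)"
    and eq: "\<And>t. rsupp t \<in> stellar a b w G \<Longrightarrow> F (Psi t) = (\<Sum>j\<in>J. s j * \<theta> j t * h j t)"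
    and t: "rsupp t \<in> G"
  shows "F t = (\<Sum>j\<in>J. s j * \<theta> j t * g j t)"
proof -
  define S where "S t = F t - (\<Sum>j\<in>J. s j * \<theta> j t * g j t)" for t
  have main: "(t a / \<alpha> - t b / \<beta>) * S t = 0" if t: "rsupp t \<in> G" for t
  proof -
    have tw: "t w = 0" using w_fresh[OF t] by (simp add: rsupp_def)
    have ft: "finite (rsupp t)" using fanD(4)[OF f t] .
    have P: "Psi (side1 t) = t" "Psi (side2 t) = t"
      using tw ab w_neq pos by (auto simp: Psi_def side1_def side2_def fun_eq_iff)
    have fs: "finite (rsupp (side1 t))" "finite (rsupp (side2 t))"
      by (rule finite_subset[of _ "rsupp t \<union> {a,b,w}"]; use ft in \<open>auto simp: rsupp_def side1_def side2_def\<close>)+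
    have ths: "\<theta> j (side1 t) = \<theta> j t" "\<theta> j (side2 t) = \<theta> j t" for j
      using vval_Psi[OF fs(1)] vval_Psi[OF fs(2)] P th fs ft by auto
    \<comment> \<open>If \<open>t a = 0\<close>, the support of \<open>side1 t\<close> may fail to
      be a face, but then the factor is 0.\<close>
    have E1: "t a / \<alpha> * F t = t a / \<alpha> * (\<Sum>j\<in>J. s j * \<theta> j t * h j (side1 t))"
    proof (cases "t a = 0")
      case False
      have "rsupp (side1 t) \<in> stellar a b w G"
      proof (cases "t b = 0")
        case True
        have "side1 t = t" using True tw by (auto simp: side1_def fun_eq_iff)
        moreover have "b \<notin> rsupp t" using True by (simp add: rsupp_def)
        ultimately show ?thesis using t by (auto simp: stellar_def)
      next
        case b: False
        have "rsupp (side1 t) \<subseteq> insert w (rsupp t - {b})" using False ab by (auto simp: rsupp_def side1_def)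
        moreover have "insert w (rsupp t - {b}) \<in> stellar a b w G"
          using facet_child(1)[OF t] False b by (simp add: rsupp_def)
        ultimately show ?thesis using fanD(5)[OF fan_stellar] by blast
      qed
      from eq[OF this] show ?thesis by (simp add: P ths)
    qed simp
    have E2: "t b / \<beta> * F t = t b / \<beta> * (\<Sum>j\<in>J. s j * \<theta> j t * h j (side2 t))"
    proof (cases "t b = 0")
      case False
      have "rsupp (side2 t) \<in> stellar a b w G"
      proof (cases "t a = 0")
        case True
        have "side2 t = t" using True tw by (auto simp: side2_def fun_eq_iff)
        moreover have "a \<notin> rsupp t" using True by (simp add: rsupp_def)
        ultimately show ?thesis using t by (auto simp: stellar_def)
      next
        case a: False
        have "rsupp (side2 t) \<subseteq> insert w (rsupp t - {a})" using False ab by (auto simp: rsupp_def side2_def)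
        moreover have "insert w (rsupp t - {a}) \<in> stellar a b w G"
          using stellar_step.facet_child(1)[OF swap(1) t] False a swap(2,3) by (simp add: rsupp_def)
        ultimately show ?thesis using fanD(5)[OF fan_stellar] by blast
      qed
      from eq[OF this] show ?thesis by (simp add: P ths)
    qed simp
    have "(t a / \<alpha> - t b / \<beta>) * (\<Sum>j\<in>J. s j * \<theta> j t * g j t) =
       (\<Sum>j\<in>J. s j * \<theta> j t * ((t a / \<alpha> - t b / \<beta>) * g j t))"
      by (simp add: sum_distrib_left mult.left_commute)
    also have "\<dots> = (\<Sum>j\<in>J. s j * \<theta> j t * (t a / \<alpha> * h j (side1 t) - t b / \<beta> * h j (side2 t)))"
      using g unfolding is_push_def by (intro sum.cong) auto
    also have "\<dots> = t a / \<alpha> * (\<Sum>j\<in>J. s j * \<theta> j t * h j (side1 t)) - t b / \<beta> * (\<Sum>j\<in>J. s j * \<theta> j t * h j (side2 t))"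
      by (simp add: sum_distrib_left right_diff_distrib sum_subtractf mult.left_commute)
    finally have E3: "(t a / \<alpha> - t b / \<beta>) * (\<Sum>j\<in>J. s j * \<theta> j t * g j t) = \<dots>" .
    have "(t a / \<alpha> - t b / \<beta>) * F t = t a / \<alpha> * F t - t b / \<beta> * F t" by (rule left_diff_distrib)
    thus ?thesis unfolding S_def right_diff_distrib[of "t a / \<alpha> - t b / \<beta>"] E3 E1 E2 by simp
  qed
  have "S t = 0"
  proof (cases "t a / \<alpha> = t b / \<beta>")
    case False thus ?thesis using main[OF t] by simp
  next
    case eqpq: True
    have tw: "t w = 0" using w_fresh[OF t] by (simp add: rsupp_def)
    show ?thesis
    proof (cases "t a = 0")
      case True
      hence tb: "t b = 0" using eqpq pos by simp
      have "t \<in> {t. rsupp t \<in> stellar a b w G}" using t True by (auto simp: stellar_def rsupp_def)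
      moreover have "Psi t = t" using tw by (auto simp: Psi_def)
      ultimately have "F t = (\<Sum>j\<in>J. s j * \<theta> j t * h j t)" using eq[of t] by simp
      also have "\<dots> = (\<Sum>j\<in>J. s j * \<theta> j t * g j t)"
      proof (rule sum.cong[OF refl])
        fix j assume j: "j \<in> J"
        have "g j t = h j t" using push_zero[OF h[OF j] _ _ True tb tw, of "g j"] g[OF j] by blast
        thus "s j * \<theta> j t * h j t = s j * \<theta> j t * g j t" by simp
      qed
      finally show ?thesis by (simp add: S_def)
    next
      case False
      \<comment> \<open>Changing the nonzero coefficient at \<open>a\<close> stays in the same face
        and leaves the wall \<open>p = q\<close>.\<close>
      have Sz: "S (t(a := x)) = 0" if x: "x \<noteq> t a" "x \<noteq> 0" for x
      proof -
        have "rsupp (t(a := x)) = rsupp t" using x False by (auto simp: rsupp_def)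
        moreover have "x / \<alpha> \<noteq> t b / \<beta>" unfolding eqpq[symmetric] using x pos by simp
        ultimately show ?thesis using main[of "t(a := x)"] t ab by auto
      qed
      hence ev: "eventually (\<lambda>x. S (t(a := x)) = 0) (at (t a))"
        unfolding eventually_at using False by (intro exI[of _ "\<bar>t a\<bar>"]) (auto simp: dist_real_def)
      have fx: "finite (rsupp (t(a := x)))" for x
        by (rule finite_subset[of _ "insert a (rsupp t)"]) (use fanD(4)[OF f t] in \<open>auto simp: rsupp_def\<close>)
      have cth: "continuous_on UNIV (\<lambda>x. \<theta> j (t(a := x)))" for j
      proof -
        have "vval (t(a := x)) = (\<Sum>y\<in>insert a (rsupp t). (t(a := x)) y *\<^sub>R y)" for x
          by (rule vval_eq) (use fanD(4)[OF f t] in \<open>auto simp: rsupp_def\<close>)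
        hence "\<theta> j (t(a := x)) = (\<Sum>y\<in>insert a (rsupp t). (t(a := x)) y * L j y)" for x
          unfolding th[OF fx] by (simp add: linear_sum[OF Lc] linear_cmul[OF Lc])
        moreover have "continuous_on UNIV (\<lambda>x. \<Sum>y\<in>insert a (rsupp t). (t(a := x)) y * L j y)"
        proof (intro continuous_on_sum continuous_on_mult continuous_on_const)
          fix y show "continuous_on UNIV (\<lambda>x. (t(a := x)) y)" by (cases "y = a") (auto intro: continuous_intros)
        qed
        ultimately show ?thesis by simp
      qed
      have "continuous_on UNIV (\<lambda>x. S (t(a := x)))" unfolding S_def
        by (intro continuous_on_diff continuous_on_sum continuous_on_mult continuous_on_const cth hpoly_continuous[OF finite_vertices F] hpoly_continuous[OF finite_vertices conjunct1[OF g]])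
      hence "isCont (\<lambda>x. S (t(a := x))) (t a)" by (simp add: continuous_on_eq_continuous_at)
      hence "((\<lambda>x. S (t(a := x))) \<longlongrightarrow> S (t(a := t a))) (at (t a))" by (rule isContD)
      from tendsto_unique[OF _ Lim_transform_eventually[OF this ev] tendsto_const] show ?thesis by simp
    qed
  qed
  thus ?thesis by (simp add: S_def)
qed

end

lemma kos_kfin: "finite N \<Longrightarrow> \<forall>\<tau>\<in>X. finite \<tau> \<Longrightarrow> kfin (kos N X)"
  using finite_subset by (auto simp: kfin_def kos_def)

text \<open>Pull a cycle back along \<open>Psi\<close>, find a primitive on the subdivided fan, and
  push the primitive forward. Since \<open>Psi\<close> preserves the linear forms, both transfers
  respect the boundary.\<close>

lemma stellar_descent:
  fixes v :: "nat \<Rightarrow> 'b::real_vector"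
  assumes N: "finite N" and s: "stellar_step (v ` N) G a b \<alpha> \<beta>"
    and ac: "kacyclic (coord v N) (card N) (kos N (stellar a b (stellar_step.w a b \<alpha> \<beta>) G))"
  shows "kacyclic (coord v N) (card N) (kos N G)"
proof -
  interpret stellar_step "v ` N" G a b \<alpha> \<beta> by fact
  let ?lam = "coord v N" and ?n = "card N"
  let ?G = "stellar a b w G"
  have fG: "\<forall>\<tau>\<in>G. finite \<tau>" "\<forall>\<tau>\<in>G. \<forall>\<sigma>\<subseteq>\<tau>. \<sigma> \<in> G" "finite G" using fanD[OF f] by auto
  have fG': "\<forall>\<tau>\<in>?G. finite \<tau>" "\<forall>\<tau>\<in>?G. \<forall>\<sigma>\<subseteq>\<tau>. \<sigma> \<in> ?G" "finite ?G" using fanD[OF fan_stellar] by auto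
  define \<theta> where "\<theta> j t = (\<Sum>x\<in>rsupp t. ?lam j x * t x)" for j t
  define L where "L j = dualf (v ` N) (v j)" for j
  have Ll: "linear (L j)" for j unfolding L_def by (rule linear_dualf(1)[OF fanD(2)[OF f]])
  have th: "\<theta> j t = L j (vval t)" for j t
    unfolding \<theta>_def vval_def linear_vsum[OF Ll] by (simp add: coord_def L_def mult.commute)
  show ?thesis
  proof (rule kacyclic_from_kslices[OF kos_kfin[OF N fG(1)]])
    show "(T, c) \<in> kos N G \<Longrightarrow> card T \<le> ?n" for T c using card_mono[OF N] by (auto simp: kos_def)
    fix m
    have ac': "kacyclic ?lam ?n (kslice ?n (kos N ?G) m)" by (rule kacyclic_kslice[OF kos_kfin[OF N fG'(1)] ac])
    show "kacyclic ?lam ?n (kslice ?n (kos N G) m)"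
      unfolding kacyclic_def
    proof (intro allI impI, elim conjE)
      let ?S = "kslice ?n (kos N G) m" and ?S' = "kslice ?n (kos N ?G) m"
      fix k z assume k: "k < ?n" and z: "chain ?S k z" and zc: "\<forall>T e. kbd ?lam ?S z T e = 0"
      let ?goal = "\<exists>b. (\<forall>T e. b T e \<noteq> 0 \<longrightarrow> (T, e) \<in> ?S \<and> Suc (card T) = k) \<and> (\<forall>T e. kbd ?lam ?S b T e = z T e)"
      \<comment> \<open>The polynomial degree of chains of exterior degree \<open>k\<close> in slice
        \<open>m\<close>; for \<open>m + k < n\<close> there are no such chains.\<close>
      define d where "d = m + k - ?n"
      show ?goal
      proof (cases "m + k < ?n")
        case True
        have "z T e = 0" for T e using z True by (force simp: chain_def kslice_def)
        thus ?thesis by (intro exI[of _ "\<lambda>T e. 0"]) (auto simp: kbd_def lin_shift_def)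
      next
        case False
        hence mk: "m + k = d + ?n" by (simp add: d_def)
        have S: "(T, e) \<in> ?S \<longleftrightarrow> T \<subseteq> N \<and> e \<in> expo G d" if "card T = k" for T e
          using that mk by (auto simp: kslice_def kos_def expo_def)
        have S': "(T, e) \<in> ?S' \<longleftrightarrow> T \<subseteq> N \<and> e \<in> expo ?G d" if "card T = k" for T e
          using that mk by (auto simp: kslice_def kos_def expo_def)
        have SS: "(T, e) \<in> ?S \<longleftrightarrow> T \<subseteq> N \<and> e \<in> expo G (Suc d)" if "card T = Suc k" for T e
          using that mk by (auto simp: kslice_def kos_def expo_def)
        have SS': "(T, e) \<in> ?S' \<longleftrightarrow> T \<subseteq> N \<and> e \<in> expo ?G (Suc d)" if "card T = Suc k" for T e
          using that mk by (auto simp: kslice_def kos_def expo_def)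
        have zs: "z T e \<noteq> 0 \<Longrightarrow> T \<subseteq> N \<and> card T = k \<and> e \<in> expo G d" for T e
          using z S unfolding chain_def by blast
        define F where "F T t = ev (expo G d) (z T) t" for T t
        have F: "hpoly (\<Union>G) d (F T)" for T
        proof -
          have "F T t = ev (expo (Pow (\<Union>G)) d) (z T) t" for t unfolding F_def ev_def
            by (rule sum.mono_neutral_left) (use finite_exponents[OF finite_vertices] zs in \<open>auto simp: expo_def\<close>)
          thus ?thesis unfolding hpoly_def by blast
        qed
        have FP: "hpoly (insert w (\<Union>G)) d (\<lambda>t. F T (Psi t))" for T
        proof (rule hpoly_subst[OF finite.insertI[OF finite_vertices] finite_vertices F])
          fix x t assume x: "x \<in> \<Union>G"
          let ?M = "\<lambda>x y. (if y = x then 1 else 0) + (if y = w then (if x = a then \<alpha> else if x = b then \<beta> else 0) else 0)"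
          have "x \<noteq> w" using x edge_vertices by auto
          have "(\<Sum>y\<in>insert w (\<Union>G). ?M x y * t y) =
              (\<Sum>y\<in>insert w (\<Union>G). (if y = x then t x else 0) + (if y = w then (if x = a then \<alpha> else if x = b then \<beta> else 0) * t w else 0))"
            by (rule sum.cong) (auto simp: distrib_right)
          also have "\<dots> = Psi t x" using x finite_vertices \<open>x \<noteq> w\<close> ab by (simp add: sum.distrib Psi_def)
          finally show "Psi t x = (\<Sum>y\<in>insert w (\<Union>G). ?M x y * t y)" by simp
        qed
        have "\<exists>c. (\<forall>e. c e \<noteq> 0 \<longrightarrow> e \<in> expo ?G d) \<and> (\<forall>t. rsupp t \<in> ?G \<longrightarrow> F T (Psi t) = ev (expo ?G d) c t)" for T
        proof (rule hpoly_restrict[OF fG'(1,2) _ finite.insertI[OF finite_vertices] FP])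
          show "\<Union>?G \<subseteq> insert w (\<Union>G)" by (auto simp: stellar_def)
        qed
        then obtain C where C: "\<And>T e. C T e \<noteq> 0 \<Longrightarrow> e \<in> expo ?G d"
          "\<And>T t. rsupp t \<in> ?G \<Longrightarrow> F T (Psi t) = ev (expo ?G d) (C T) t" by metis
        define z' where "z' T = (if T \<subseteq> N \<and> card T = k then C T else (\<lambda>e. 0))" for T
        have z'c: "chain ?S' k z'" unfolding chain_def using C(1) S' by (auto simp: z'_def split: if_splits)
        have F0: "F T t = 0" if "\<not> (T \<subseteq> N \<and> card T = k)" for T t
          unfolding F_def ev_def using zs that by (intro sum.neutral) force
        have evz': "ev (expo ?G d) (z' T) t = F T (Psi t)" if "rsupp t \<in> ?G" for T t
        proof (cases "T \<subseteq> N \<and> card T = k")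
          case True thus ?thesis using C(2)[OF that, of T] by (simp add: z'_def)
        next
          case False thus ?thesis using F0[OF False] unfolding z'_def ev_def by (subst if_not_P) auto
        qed
        have fT: "T \<subseteq> N \<Longrightarrow> finite T" for T using N finite_subset by blast
        have z'cyc: "kbd ?lam ?S' z' T e = 0" for T e
        proof (cases "(T, e) \<in> ?S' \<and> card T = Suc k")
          case True
          hence T: "T \<subseteq> N" "e \<in> expo ?G (Suc d)" using SS' by auto
          define c where "c e = (\<Sum>j\<in>T. ksign j T * lin_shift ?lam j (z' (T - {j})) e)" for e
          \<comment> \<open>The boundary of \<open>z'\<close> is tested by evaluation, where it
            becomes the boundary of \<open>z\<close> at the point \<open>Psi t\<close>.\<close>
          have "c e = 0"
          proof (rule ev_expo_eq_0_imp[OF fG'(3,1,2) _ T(2)])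
            fix t assume t: "rsupp t \<in> ?G"
            have tP: "rsupp (Psi t) \<in> G" by (rule rsupp_Psi[OF t])
            have "ev (expo ?G (Suc d)) c t = (\<Sum>j\<in>T. ksign j T * ev (expo ?G (Suc d)) (lin_shift ?lam j (z' (T - {j}))) t)"
              unfolding ev_def c_def sum_distrib_left sum_distrib_right by (subst sum.swap) (simp add: mult.assoc)
            also have "\<dots> = (\<Sum>j\<in>T. ksign j T * (\<theta> j t * F (T - {j}) (Psi t)))"
              by (simp add: ev_lin_shift[OF fG'(3,1,2) t] evz'[OF t] \<theta>_def)
            also have "\<dots> = (\<Sum>j\<in>T. ksign j T * ev (expo G (Suc d)) (lin_shift ?lam j (z (T - {j}))) (Psi t))"
              using vval_Psi fG'(1) t by (simp add: ev_lin_shift[OF fG(3,1,2) tP] F_def[symmetric] \<theta>_def[symmetric] th)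
            also have "\<dots> = ev (expo G (Suc d)) (\<lambda>e. \<Sum>j\<in>T. ksign j T * lin_shift ?lam j (z (T - {j})) e) (Psi t)"
              unfolding ev_def sum_distrib_left sum_distrib_right by (subst sum.swap) (simp add: mult.assoc)
            also have "\<dots> = 0" unfolding ev_def
            proof (rule sum.neutral, rule ballI)
              fix e assume "e \<in> expo G (Suc d)"
              hence "(T, e) \<in> ?S" using SS True T by auto
              hence "(\<Sum>j\<in>T. ksign j T * lin_shift ?lam j (z (T - {j})) e) = 0"
                using zc[rule_format, of T e] by (simp add: kbd_def)
              thus "(\<Sum>j\<in>T. ksign j T * lin_shift ?lam j (z (T - {j})) e) * mono_val e (Psi t) = 0" by simp
            qed
            finally show "ev (expo ?G (Suc d)) c t = 0" .
          qed
          thus ?thesis using True by (simp add: kbd_def c_def)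
        next
          case False
          show ?thesis
          proof (cases "(T, e) \<in> ?S'")
            case True
            hence "T \<subseteq> N" by (auto simp: kslice_def kos_def)
            hence "z' (T - {j}) = (\<lambda>e. 0)" if "j \<in> T" for j
              using that False True card_Suc_Diff1[OF fT[OF \<open>T \<subseteq> N\<close>] that] by (auto simp: z'_def)
            thus ?thesis by (simp add: kbd_def lin_shift_def)
          qed (simp add: kbd_outside)
        qed
        obtain b' where b': "\<And>T e. b' T e \<noteq> 0 \<Longrightarrow> (T, e) \<in> ?S' \<and> Suc (card T) = k" "\<And>T e. kbd ?lam ?S' b' T e = z' T e"
          using kacyclicD[OF ac' k z'c z'cyc] by blast
        define d' where "d' = d - 1"
        have b'e: "T \<subseteq> N \<and> e \<in> expo ?G d' \<and> d = Suc d' \<and> Suc (card T) = k" if "b' T e \<noteq> 0" for T e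
          using b'(1)[OF that] mk by (auto simp: kslice_def kos_def expo_def d'_def)
        define h where "h T t = ev (expo ?G d') (b' T) t" for T t
        have hh: "hpoly (insert w (\<Union>G)) d' (h T)" for T
        proof -
          have "\<tau> \<subseteq> insert w (\<Union>G)" if "\<tau> \<in> ?G" for \<tau> using that unfolding stellar_def by blast
          hence sub: "expo ?G d' \<subseteq> expo (Pow (insert w (\<Union>G))) d'" unfolding expo_def by auto
          have "h T t = ev (expo (Pow (insert w (\<Union>G))) d') (b' T) t" for t unfolding h_def ev_def
          proof (rule sum.mono_neutral_left[OF finite_exponents[OF finite.insertI[OF finite_vertices]] sub], rule ballI)
            fix e assume "e \<in> expo (Pow (insert w (\<Union>G))) d' - expo ?G d'"
            hence "b' T e = 0" using b'e[of T e] by auto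
            thus "b' T e * mono_val e t = 0" by simp
          qed
          thus ?thesis unfolding hpoly_def by blast
        qed
        \<comment> \<open>By truncated subtraction \<open>d'\<close> is 0 also for
          \<open>d = 0\<close>. All of \<open>b'\<close> vanishes then, and a push of 0 is chosen to
          be 0 so that this case is consistent.\<close>
        have "\<exists>g. hpoly (\<Union>G) d' g \<and> is_push (h T) g \<and> (h T = (\<lambda>t. 0) \<longrightarrow> g = (\<lambda>t. 0))" for T
        proof (cases "h T = (\<lambda>t. 0)")
          case True
          thus ?thesis using hpoly_zero[OF finite_vertices] by (intro exI[of _ "\<lambda>t. 0"]) (simp add: is_push_def)
        next
          case False thus ?thesis using push_exists[OF hh] by blast
        qed
        then obtain g where g: "\<And>T. hpoly (\<Union>G) d' (g T) \<and> is_push (h T) (g T)"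
          and g0: "\<And>T. h T = (\<lambda>t. 0) \<Longrightarrow> g T = (\<lambda>t. 0)" by metis
        have h0: "h T t = 0" if "\<And>e. b' T e = 0" for T t using that by (simp add: h_def ev_def)
        have evd: "ev (expo ?G d) (lin_shift ?lam j (b' T)) t = \<theta> j t * h T t" if "rsupp t \<in> ?G" for j T t
        proof (cases "d = Suc d'")
          case True thus ?thesis by (simp add: ev_lin_shift[OF fG'(3,1,2) that] \<theta>_def h_def)
        next
          case False
          hence "b' T e = 0" for T e using b'e[of T e] by auto
          thus ?thesis by (simp add: h0 lin_shift_def ev_def)
        qed
        have id': "F T (Psi t) = (\<Sum>j\<in>T. ksign j T * \<theta> j t * h (T - {j}) t)" if T: "T \<subseteq> N" "card T = k" and t: "rsupp t \<in> ?G" for T t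
        proof -
          have "F T (Psi t) = ev (expo ?G d) (z' T) t" using evz'[OF t] by simp
          also have "\<dots> = ev (expo ?G d) (\<lambda>e. \<Sum>j\<in>T. ksign j T * lin_shift ?lam j (b' (T - {j})) e) t"
            unfolding ev_def
          proof (rule sum.cong[OF refl])
            fix e assume "e \<in> expo ?G d"
            hence "(T, e) \<in> ?S'" using S' T by auto
            thus "z' T e * mono_val e t = (\<Sum>j\<in>T. ksign j T * lin_shift ?lam j (b' (T - {j})) e) * mono_val e t"
              using b'(2)[of T e] by (simp add: kbd_def)
          qed
          also have "\<dots> = (\<Sum>j\<in>T. ksign j T * ev (expo ?G d) (lin_shift ?lam j (b' (T - {j}))) t)"
            unfolding ev_def sum_distrib_left sum_distrib_right by (subst sum.swap) (simp add: mult.assoc)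
          finally show ?thesis by (simp add: evd[OF t] mult.assoc)
        qed
        have id: "F T t = (\<Sum>j\<in>T. ksign j T * \<theta> j t * g (T - {j}) t)" if T: "T \<subseteq> N" "card T = k" and t: "rsupp t \<in> G" for T t
          by (rule push_identity[OF F fT[OF T(1)] hh g th Ll id'[OF T] t])
        have "\<exists>c. (\<forall>e. c e \<noteq> 0 \<longrightarrow> e \<in> expo G d') \<and> (\<forall>t. rsupp t \<in> G \<longrightarrow> g T t = ev (expo G d') c t)" for T
          by (rule hpoly_restrict[OF fG(1,2) order_refl finite_vertices]) (use g in blast)
        then obtain B where B: "\<And>T e. B T e \<noteq> 0 \<Longrightarrow> e \<in> expo G d'" "\<And>T t. rsupp t \<in> G \<Longrightarrow> g T t = ev (expo G d') (B T) t" by metis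
        define bb where "bb T = (if d = Suc d' \<and> T \<subseteq> N \<and> Suc (card T) = k then B T else (\<lambda>e. 0))" for T
        have bbs: "(T, e) \<in> ?S \<and> Suc (card T) = k" if "bb T e \<noteq> 0" for T e
          using that B(1)[of T e] mk by (auto simp: bb_def kslice_def kos_def expo_def split: if_splits)
        have "kbd ?lam ?S bb T e = z T e" for T e
        proof (cases "(T, e) \<in> ?S \<and> card T = k")
          case True
          hence T: "T \<subseteq> N" "card T = k" "e \<in> expo G d" using S by auto
          define c where "c e = (\<Sum>j\<in>T. ksign j T * lin_shift ?lam j (bb (T - {j})) e) - z T e" for e
          have "c e = 0"
          proof (rule ev_expo_eq_0_imp[OF fG(3,1,2) _ T(3)])
            fix t assume t: "rsupp t \<in> G"
            have evb: "ev (expo G d) (lin_shift ?lam j (bb (T - {j}))) t = \<theta> j t * g (T - {j}) t" if j: "j \<in> T" for j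
            proof (cases "d = Suc d'")
              case d: True
              have "bb (T - {j}) = B (T - {j})" using T d card_Suc_Diff1[OF fT[OF T(1)] j] by (auto simp: bb_def)
              thus ?thesis unfolding d by (simp add: ev_lin_shift[OF fG(3,1,2) t] \<theta>_def B(2)[OF t])
            next
              case False
              hence "b' T e = 0" for T e using b'e[of T e] by auto
              hence "h (T - {j}) = (\<lambda>t. 0)" using h0 by blast
              hence "g (T - {j}) = (\<lambda>t. 0)" by (rule g0)
              thus ?thesis using False by (simp add: bb_def lin_shift_def ev_def)
            qed
            have "ev (expo G d) c t = (\<Sum>j\<in>T. ksign j T * ev (expo G d) (lin_shift ?lam j (bb (T - {j}))) t) - F T t"
              unfolding ev_def c_def F_def left_diff_distrib sum_subtractf sum_distrib_left sum_distrib_right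
              by (subst sum.swap) (simp add: mult.assoc)
            also have "\<dots> = 0" using id[OF T(1,2) t] by (simp add: evb mult.assoc)
            finally show "ev (expo G d) c t = 0" .
          qed
          thus ?thesis using True by (simp add: kbd_def c_def)
        next
          case False
          have "kbd ?lam ?S bb T e = 0"
          proof (rule ccontr)
            assume nz: "kbd ?lam ?S bb T e \<noteq> 0"
            have "kfin ?S" using kos_kfin[OF N fG(1)] by (auto simp: kfin_def kslice_def)
            have "\<And>T e. bb T e \<noteq> 0 \<Longrightarrow> Suc (card T) = k" using bbs by simp
            from kbd_level[OF \<open>kfin ?S\<close> this nz] False show False by simp
          qed
          thus ?thesis using False z unfolding chain_def by metis
        qed
        thus ?goal using bbs by blast
      qed
    qed
  qed
qed

theorem fan_acyclic:
  fixes v :: "nat \<Rightarrow> 'b::real_vector"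
  assumes N: "finite N" "inj_on v N" and f: "fan (v ` N) G"
  shows "kacyclic (coord v N) (card N) (kos N G)"
proof -
  obtain G' where "estep\<^sup>*\<^sup>* G G'" and ac: "kacyclic (coord v N) (card N) (kos N G')"
    using exists_acyclic_refinement[OF N f] by blast
  thus ?thesis using f
  proof (induction rule: converse_rtranclp_induct)
    case (step y z)
    obtain a b \<alpha> \<beta> where s: "stellar_step (v ` N) y a b \<alpha> \<beta>" "z = stellar a b (stellar_step.w a b \<alpha> \<beta>) y"
      using estepE[OF step.prems(2) step.hyps(1)] .
    have "kacyclic (coord v N) (card N) (kos N z)"
      using step.IH[OF ac] stellar_step.fan_stellar[OF s(1)] s(2) by simp
    thus ?case using stellar_descent[OF N(1) s(1)] s(2) by simp
  qed
qed

section \<open>Carriers and nonnegativity of local h-polynomials\<close>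

lemma kacyclic_cong:
  assumes "\<And>T a k x. (T, a) \<in> U \<Longrightarrow> k \<in> T \<Longrightarrow> x \<in> supp a \<Longrightarrow> lam k x = lam' k x"
  shows "kacyclic lam n U \<longleftrightarrow> kacyclic lam' n U"
proof -
  have "kbd lam U z T a = kbd lam' U z T a" for z T a
    using assms unfolding kbd_def lin_shift_def by (auto intro!: sum.cong arg_cong2[of _ _ _ _ "(*)"])
  thus ?thesis unfolding kacyclic_def by simp
qed

definition isign :: "nat \<Rightarrow> nat set \<Rightarrow> real" where "isign x T = (-1) ^ card {j\<in>T. x < j}"

lemma isign_sq: "isign x T * isign x T = 1"
  by (simp add: isign_def flip: power_add)

lemma kbd_insert:
  assumes T: "x \<notin> T" "finite T" and U: "(T, a) \<in> U'" and U': "\<And>T a. (T, a) \<in> U' \<Longrightarrow> x \<notin> T"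
    and z: "\<And>T a. z T a \<noteq> 0 \<Longrightarrow> (T, a) \<in> {(insert x T, a) | T a. (T, a) \<in> U'}"
  shows "kbd lam U' (\<lambda>S a. if x \<in> S then 0 else isign x S * z (insert x S) a) T a =
     isign x T * kbd lam {(insert x T, a) | T a. (T, a) \<in> U'} z (insert x T) a"
proof -
  let ?U = "{(insert x T, a) | T a. (T, a) \<in> U'}"
  define e where "e k = (if x < k then -1 else (1::real))" for k
  have ee: "e k * e k = 1" for k by (simp add: e_def)
  have e1: "ksign k (insert x T) = ksign k T * e k" if "k \<in> T" for k
  proof (cases "x < k")
    case True
    hence "{j \<in> insert x T. j < k} = insert x {j \<in> T. j < k}" by auto
    thus ?thesis using True T by (simp add: ksign_def e_def)
  next
    case False
    hence "{j \<in> insert x T. j < k} = {j \<in> T. j < k}" by auto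
    thus ?thesis using False by (simp add: ksign_def e_def)
  qed
  have e2: "isign x T = isign x (T - {k}) * e k" if "k \<in> T" for k
  proof (cases "x < k")
    case True
    hence "{j \<in> T. x < j} = insert k {j \<in> T - {k}. x < j}" using that by auto
    thus ?thesis using True T by (simp add: isign_def e_def)
  next
    case False
    hence "{j \<in> T. x < j} = {j \<in> T - {k}. x < j}" by auto
    thus ?thesis using False by (simp add: isign_def e_def)
  qed
  have zx: "lin_shift lam x (z (insert x T - {x})) a = 0"
  proof (rule lin_shift_zero, rule ccontr)
    fix w assume "z (insert x T - {x}) (a(w := a w - 1)) \<noteq> 0"
    from z[OF this] T(1) show False by auto
  qed
  have "(insert x T, a) \<in> ?U" using U by blast
  hence "kbd lam ?U z (insert x T) a = (\<Sum>k\<in>insert x T. ksign k (insert x T) * lin_shift lam k (z (insert x T - {k})) a)"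
    by (simp add: kbd_def)
  also have "\<dots> = (\<Sum>k\<in>T. ksign k (insert x T) * lin_shift lam k (z (insert x T - {k})) a)"
    using T zx by simp
  also have "\<dots> = (\<Sum>k\<in>T. ksign k T * e k * lin_shift lam k (z (insert x (T - {k}))) a)"
  proof (rule sum.cong[OF refl])
    fix k assume k: "k \<in> T"
    hence "insert x T - {k} = insert x (T - {k})" using T(1) by auto
    thus "ksign k (insert x T) * lin_shift lam k (z (insert x T - {k})) a =
      ksign k T * e k * lin_shift lam k (z (insert x (T - {k}))) a" by (simp add: e1[OF k])
  qed
  finally have R: "kbd lam ?U z (insert x T) a = \<dots>" .
  have "kbd lam U' (\<lambda>S a. if x \<in> S then 0 else isign x S * z (insert x S) a) T a =
      (\<Sum>k\<in>T. ksign k T * (isign x (T - {k}) * lin_shift lam k (z (insert x (T - {k}))) a))"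
    using U T(1) by (auto simp: kbd_def lin_shift_def sum_distrib_left mult_ac intro!: sum.cong)
  also have "\<dots> = (\<Sum>k\<in>T. isign x T * (ksign k T * e k * lin_shift lam k (z (insert x (T - {k}))) a))"
  proof (rule sum.cong[OF refl])
    fix k assume k: "k \<in> T"
    have "isign x (T - {k}) = isign x T * e k" using e2[OF k] ee[of k] by (metis mult.assoc mult.right_neutral)
    thus "ksign k T * (isign x (T - {k}) * lin_shift lam k (z (insert x (T - {k}))) a) =
      isign x T * (ksign k T * e k * lin_shift lam k (z (insert x (T - {k}))) a)" by simp
  qed
  finally show ?thesis unfolding R sum_distrib_left .
qed

text \<open>A common exterior generator shifts the exterior degree by one, so acyclicity reaches one
  degree further.\<close>

lemma kacyclic_insert:
  assumes U': "\<And>T a. (T, a) \<in> U' \<Longrightarrow> x \<notin> T \<and> finite T" and ac: "kacyclic lam n U'"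
  shows "kacyclic lam (Suc n) {(insert x T, a) | T a. (T, a) \<in> U'}"
  unfolding kacyclic_def
proof (intro allI impI, elim conjE)
  let ?U = "{(insert x T, a) | T a. (T, a) \<in> U'}"
  fix k z assume k: "k < Suc n" and z: "chain ?U k z" "\<forall>T a. kbd lam ?U z T a = 0"
  have zs: "(T, a) \<in> ?U \<and> card T = k" if "z T a \<noteq> 0" for T a using z(1) that unfolding chain_def by blast
  hence zU: "z T a \<noteq> 0 \<Longrightarrow> (T, a) \<in> ?U" for T a by blast
  define z' where "z' S a = (if x \<in> S then 0 else isign x S * z (insert x S) a)" for S a
  have z's: "(S, a) \<in> U' \<and> Suc (card S) = k" if nz: "z' S a \<noteq> 0" for S a
  proof -
    have x: "x \<notin> S" "z (insert x S) a \<noteq> 0" using nz by (auto simp: z'_def split: if_splits)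
    from zs[OF x(2)] obtain T where T: "(T, a) \<in> U'" "insert x S = insert x T" "card (insert x S) = k" by auto
    have "S = T" using T(2) x(1) U'[OF T(1)] by (metis Diff_insert_absorb)
    thus ?thesis using T U'[OF T(1)] by auto
  qed
  let ?goal = "\<exists>b. (\<forall>T a. b T a \<noteq> 0 \<longrightarrow> (T, a) \<in> ?U \<and> Suc (card T) = k) \<and> (\<forall>T a. kbd lam ?U b T a = z T a)"
  show ?goal
  proof (cases k)
    case 0
    have "z T a = 0" for T a
    proof (rule ccontr)
      assume "z T a \<noteq> 0"
      from zs[OF this] 0 obtain T' where "(T', a) \<in> U'" "card (insert x T') = 0" by auto
      thus False using U'[of T' a] by simp
    qed
    thus ?thesis by (intro exI[of _ "\<lambda>T a. 0"]) (auto simp: kbd_def lin_shift_def)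
  next
    case (Suc k')
    have ch: "chain U' k' z'" using z's Suc unfolding chain_def by auto
    have "kbd lam U' z' T a = 0" for T a
    proof (cases "(T, a) \<in> U'")
      case True
      from kbd_insert[of x T a U' z lam] U'[OF True] True U' zU z(2) show ?thesis unfolding z'_def by simp
    qed (simp add: kbd_outside)
    then obtain b' where b': "\<And>T a. b' T a \<noteq> 0 \<Longrightarrow> (T, a) \<in> U' \<and> Suc (card T) = k'" "\<And>T a. kbd lam U' b' T a = z' T a"
      using kacyclicD[OF ac _ ch] k Suc by (metis Suc_less_SucD)
    define b where "b T a = (if x \<in> T then isign x (T - {x}) * b' (T - {x}) a else 0)" for T a
    have bs: "(T, a) \<in> ?U \<and> Suc (card T) = k" if nz: "b T a \<noteq> 0" for T a
    proof -
      have x: "x \<in> T" "b' (T - {x}) a \<noteq> 0" using nz by (auto simp: b_def split: if_splits)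
      from b'(1)[OF x(2)] have 1: "(T - {x}, a) \<in> U'" "Suc (card (T - {x})) = k'" by auto
      have "T = insert x (T - {x})" using x by auto
      hence "(T, a) \<in> ?U" using 1 by blast
      moreover have "finite T" using U'[OF 1(1)] by simp
      ultimately show ?thesis using 1 Suc card_Suc_Diff1[of T x] x by simp
    qed
    hence bU: "b T a \<noteq> 0 \<Longrightarrow> (T, a) \<in> ?U" for T a by blast
    have bb: "(\<lambda>S a. if x \<in> S then 0 else isign x S * b (insert x S) a) = b'"
    proof (intro ext)
      fix S a
      show "(if x \<in> S then 0 else isign x S * b (insert x S) a) = b' S a"
      proof (cases "x \<in> S")
        case True
        thus ?thesis using b'(1)[of S a] U'[of S a] by (cases "b' S a = 0") auto
      next
        case False
        thus ?thesis using isign_sq[of x S] by (simp add: b_def flip: mult.assoc)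
      qed
    qed
    have "kbd lam ?U b T a = z T a" for T a
    proof (cases "(T, a) \<in> ?U")
      case True
      then obtain T' where T': "T = insert x T'" "(T', a) \<in> U'" by auto
      have f: "x \<notin> T'" "finite T'" using U'[OF T'(2)] by auto
      have "isign x T' * kbd lam ?U b T a = kbd lam U' b' T' a"
        using kbd_insert[OF f T'(2) _ bU, where lam=lam and z=b] U' T'(1) bb by simp
      also have "\<dots> = isign x T' * z T a" using b'(2) f T'(1) by (simp add: z'_def)
      finally show ?thesis by (simp add: isign_def)
    next
      case False
      hence "z T a = 0" using zU[of T a] by argo
      thus ?thesis using kbd_outside[OF False] by simp
    qed
    thus ?thesis using bs by blast
  qed
qed

definition icar :: "(nat \<Rightarrow> 'x \<Rightarrow> real) \<Rightarrow> nat set \<Rightarrow> 'x set \<Rightarrow> nat set" where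
  "icar lam N \<tau> = {k\<in>N. \<exists>x\<in>\<tau>. lam k x \<noteq> 0}"

lemma icar_mono: "\<sigma> \<subseteq> \<tau> \<Longrightarrow> icar lam N \<sigma> \<subseteq> icar lam N \<tau>"
  by (auto simp: icar_def)

text \<open>
  The set \<open>S\<close> imposes the carrier condition on \<open>T\<close> one coordinate at a time, starting from the full
  Koszul complex at \<open>S = {}\<close>.
\<close>

definition cube :: "(nat \<Rightarrow> 'x \<Rightarrow> real) \<Rightarrow> nat set \<Rightarrow> 'x set set \<Rightarrow> nat set \<Rightarrow> nat set \<Rightarrow> (nat set \<times> ('x \<Rightarrow> nat)) set" where
  "cube lam N G M S = {(T, a). T \<subseteq> M \<and> supp a \<in> G \<and> icar lam N (supp a) \<subseteq> M \<and> T \<inter> S \<subseteq> icar lam N (supp a)}"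

lemma cube_kfin:
  assumes "finite N" "M \<subseteq> N" "\<forall>\<tau>\<in>G. finite \<tau>" shows "kfin (cube lam N G M S)"
proof -
  have "finite T" if "T \<subseteq> M" for T using that assms(1,2) by (meson finite_subset)
  thus ?thesis using assms(3) unfolding kfin_def cube_def by auto
qed

lemma cube_kconvex:
  assumes G: "\<forall>\<tau>\<in>G. \<forall>\<sigma>\<subseteq>\<tau>. \<sigma> \<in> G" and MN: "M \<subseteq> N"
  shows "kconvex lam (cube lam N G M S)"
  unfolding kconvex_def
proof (intro allI impI)
  fix T j k u w and a :: "'a \<Rightarrow> nat"
  let ?b = "a(w := a w - 1)" and ?c = "a(w := a w - 1, u := (a(w := a w - 1)) u - 1)"
  assume h: "(T, a) \<in> cube lam N G M S" "k \<in> T" "j \<in> T - {k}" "w \<in> supp a" "u \<in> supp ?b" "lam j u \<noteq> 0"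
    "(T - {k} - {j}, ?c) \<in> cube lam N G M S"
  have s: "supp ?b \<subseteq> supp a" "supp ?c \<subseteq> supp ?b" by (rule supp_dec_subset)+
  have T: "T \<subseteq> M" "supp a \<in> G" "icar lam N (supp a) \<subseteq> M" using h(1) unfolding cube_def by auto
  have "j \<in> icar lam N (supp ?b)" using h(3,5,6) T(1) MN unfolding icar_def by blast
  moreover have "(T - {k} - {j}) \<inter> S \<subseteq> icar lam N (supp ?b)"
    using h(7) icar_mono[OF s(2), of lam N] unfolding cube_def by blast
  ultimately have "(T - {k}) \<inter> S \<subseteq> icar lam N (supp ?b)" by blast
  moreover have "supp ?b \<in> G" using G T(2) s(1) by blast
  moreover have "icar lam N (supp ?b) \<subseteq> M" using icar_mono[OF s(1), of lam N] T(3) by blast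
  ultimately show "(T - {k}, ?b) \<in> cube lam N G M S" using T(1) unfolding cube_def by blast
qed

text \<open>Imposing the condition for one more \<open>x\<close> removes the pairs with
  \<open>x\<close> in \<open>T\<close> but not in the carrier. They form a quotient, and up to the
  generator \<open>x\<close> they are the complex of the smaller face \<open>M - {x}\<close>; both
  this quotient and the whole are acyclic by induction, hence so is the rest.\<close>

theorem cube_acyclic:
  assumes N: "finite N" and G: "\<forall>\<tau>\<in>G. finite \<tau>" "\<forall>\<tau>\<in>G. \<forall>\<sigma>\<subseteq>\<tau>. \<sigma> \<in> G"
    and ac: "\<And>M. M \<subseteq> N \<Longrightarrow> kacyclic lam (card M) (kos M {\<tau>\<in>G. icar lam N \<tau> \<subseteq> M})"
    and S: "S \<subseteq> M" "M \<subseteq> N"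
  shows "kacyclic lam (card M) (cube lam N G M S)"
proof -
  have "finite S" using N S by (meson finite_subset)
  thus ?thesis using S
  proof (induction S arbitrary: M rule: finite_induct)
    case empty
    have "cube lam N G M {} = kos M {\<tau>\<in>G. icar lam N \<tau> \<subseteq> M}" by (auto simp: cube_def kos_def)
    thus ?case using ac empty by simp
  next
    case (insert x S)
    let ?C = "icar lam N"
    have x: "x \<in> M" "S \<subseteq> M" "S \<subseteq> M - {x}" "M - {x} \<subseteq> N" using insert by auto
    have fM: "finite M" using N insert.prems by (meson finite_subset)
    define U1 where "U1 = {(T, a)\<in>cube lam N G M S. x \<in> T \<and> x \<notin> ?C (supp a)}"
    define U2 where "U2 = cube lam N G M (insert x S)"
    have un: "U1 \<union> U2 = cube lam N G M S" by (auto simp: U1_def U2_def cube_def)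
    have dis: "U1 \<inter> U2 = {}" by (auto simp: U1_def U2_def cube_def)
    have cl: "kclosed lam U2 U1" unfolding kclosed_def
    proof (intro allI impI notI)
      fix T a k w assume h: "(T, a) \<in> U1" "k \<in> T" "w \<in> supp a" "lam k w \<noteq> 0" "(T - {k}, a(w := a w - 1)) \<in> U2"
      have 1: "x \<in> T" "x \<notin> ?C (supp a)" "T \<subseteq> M" using h(1) by (auto simp: U1_def cube_def)
      have "k \<in> ?C (supp a)" using h(2-4) 1(3) insert.prems(2) unfolding icar_def by blast
      hence "k \<noteq> x" using 1(2) by blast
      hence "x \<in> ?C (supp (a(w := a w - 1)))" using h(5) 1(1) unfolding U2_def cube_def by blast
      thus False using icar_mono[OF supp_dec_subset[of a w], of lam N] 1(2) by blast
    qed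
    \<comment> \<open>A carrier that avoids \<open>x\<close> lies in \<open>M - {x}\<close>, so the
      removed pairs live over that face.\<close>
    have eqU1: "U1 = {(insert x T, a) | T a. (T, a) \<in> cube lam N G (M - {x}) S}"
    proof (intro equalityI subrelI)
      fix T a assume "(T, a) \<in> U1"
      hence h: "T \<subseteq> M" "supp a \<in> G" "?C (supp a) \<subseteq> M" "T \<inter> S \<subseteq> ?C (supp a)" "x \<in> T" "x \<notin> ?C (supp a)"
        by (auto simp: U1_def cube_def)
      hence "(T - {x}, a) \<in> cube lam N G (M - {x}) S" unfolding cube_def by blast
      moreover have "T = insert x (T - {x})" using h by auto
      ultimately show "(T, a) \<in> {(insert x T, a) | T a. (T, a) \<in> cube lam N G (M - {x}) S}" by blast
    next
      fix T a assume "(T, a) \<in> {(insert x T, a) | T a. (T, a) \<in> cube lam N G (M - {x}) S}"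
      then obtain T' where "T = insert x T'" "(T', a) \<in> cube lam N G (M - {x}) S" by auto
      thus "(T, a) \<in> U1" using x insert.hyps by (auto simp: U1_def cube_def)
    qed
    have "kacyclic lam (Suc (card (M - {x}))) U1" unfolding eqU1
    proof (rule kacyclic_insert)
      show "(T, a) \<in> cube lam N G (M - {x}) S \<Longrightarrow> x \<notin> T \<and> finite T" for T a
        using finite_subset[of T, OF _ fM] unfolding cube_def by auto
      show "kacyclic lam (card (M - {x})) (cube lam N G (M - {x}) S)" by (rule insert.IH[OF x(3,4)])
    qed
    hence ac1: "kacyclic lam (card M) U1" using card_Suc_Diff1[OF fM x(1)] by simp
    have acS: "kacyclic lam (card M) (U1 \<union> U2)" unfolding un by (rule insert.IH[OF x(2) insert.prems(2)])
    have "kacyclic lam (card M) U2"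
    proof (rule kacyclic_sub[OF _ _ cl dis ac1 acS])
      show "kfin (U1 \<union> U2)" unfolding un by (rule cube_kfin[OF N insert.prems(2) G(1)])
      show "kconvex lam (U1 \<union> U2)" unfolding un by (rule cube_kconvex[OF G(2) insert.prems(2)])
    qed
    thus ?case by (simp add: U2_def)
  qed
qed

section \<open>Faces of the simplicial cone and restricted fans\<close>

lemma coord_expand:
  assumes N: "finite N" "inj_on v N" and ind: "independent (v ` N)" and y: "y \<in> span (v ` N)"
  shows "y = (\<Sum>k\<in>N. coord v N k y *\<^sub>R v k)"
  using dualf_expand[OF _ ind y] N sum.reindex[OF N(2), of "\<lambda>x. dualf (v ` N) x y *\<^sub>R x"] by (simp add: coord_def)

lemma coord_unique:
  assumes N: "finite N" "inj_on v N" and ind: "independent (v ` N)" and k: "k \<in> N"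
  shows "coord v N k (\<Sum>j\<in>N. c j *\<^sub>R v j) = c k"
proof -
  have l: "linear (coord v N k)" unfolding coord_def by (rule linear_dualf(1)[OF ind])
  have "coord v N k (v j) = (if j = k then 1 else 0)" if "j \<in> N" for j
    using linear_dualf(2)[OF ind, of "v j" "v k"] that k N(2) by (auto simp: coord_def inj_on_def)
  hence "(\<Sum>j\<in>N. c j * coord v N k (v j)) = (\<Sum>j\<in>N. if j = k then c k else 0)" by (intro sum.cong) auto
  thus ?thesis using k N l by (simp add: linear_sum linear_cmul)
qed

lemma coord_linear: "independent (v ` N) \<Longrightarrow> linear (coord v N k)"
  unfolding coord_def by (rule linear_dualf(1))

lemma fcone_coord:
  assumes N: "finite N" "inj_on v N" and ind: "independent (v ` N)" and k: "k \<in> N" and y: "y \<in> fcone (v ` N)"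
  shows "coord v N k y \<ge> 0"
  using y k fcone_dualf[OF _ ind, of y] N by (auto simp: coord_def)

lemma fcone_face:
  assumes N: "finite N" "inj_on v N" and ind: "independent (v ` N)" and M: "M \<subseteq> N"
  shows "y \<in> fcone (v ` M) \<longleftrightarrow> y \<in> fcone (v ` N) \<and> (\<forall>k\<in>N-M. coord v N k y = 0)"
proof
  have fM: "finite M" using N M by (meson finite_subset)
  assume "y \<in> fcone (v ` M)"
  then obtain t where t: "y = (\<Sum>x\<in>v ` M. t x *\<^sub>R x)" "\<forall>x\<in>v ` M. t x \<ge> 0" using fM by (auto simp: fcone_eq)
  have "inj_on v M" using N(2) M inj_on_subset by blast
  hence "y = (\<Sum>k\<in>M. t (v k) *\<^sub>R v k)" using t(1) by (simp add: sum.reindex)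
  also have "\<dots> = (\<Sum>k\<in>N. (if k \<in> M then t (v k) else 0) *\<^sub>R v k)"
    using N M by (intro sum.mono_neutral_cong_left) auto
  finally have y: "y = \<dots>" .
  have "y \<in> fcone (v ` N)" unfolding y using t(2) N by (intro fcone_sum fcone_scale fcone_base) auto
  moreover have "coord v N k y = 0" if "k \<in> N - M" for k
    using coord_unique[OF N ind, of k "\<lambda>k. if k \<in> M then t (v k) else 0"] that y by auto
  ultimately show "y \<in> fcone (v ` N) \<and> (\<forall>k\<in>N-M. coord v N k y = 0)" by blast
next
  have fM: "finite M" using N M by (meson finite_subset)
  assume h: "y \<in> fcone (v ` N) \<and> (\<forall>k\<in>N-M. coord v N k y = 0)"
  have "y = (\<Sum>k\<in>N. coord v N k y *\<^sub>R v k)"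
    using h fcone_subset_span N by (intro coord_expand[OF N ind]) blast
  also have "\<dots> = (\<Sum>k\<in>M. coord v N k y *\<^sub>R v k)" using h N M by (intro sum.mono_neutral_right) auto
  finally have y: "y = \<dots>" .
  show "y \<in> fcone (v ` M)"
    using fcone_coord[OF N ind, of _ y] h M fM by (subst y, intro fcone_sum fcone_scale fcone_base) auto
qed

lemma fan_face:
  assumes N: "finite N" "inj_on v N" and f: "fan (v ` N) G" and M: "M \<subseteq> N"
  shows "fan (v ` M) {\<tau>\<in>G. icar (coord v N) N \<tau> \<subseteq> M}"
proof -
  let ?G = "{\<tau>\<in>G. icar (coord v N) N \<tau> \<subseteq> M}"
  have ind: "independent (v ` N)" using fanD(2)[OF f] .
  have fM: "finite M" using N M by (meson finite_subset)
  have sub: "cpos ?G \<subseteq> cpos G" by (auto simp: cpos_def)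
  have img: "vval ` cpos ?G = fcone (v ` M)"
  proof (intro equalityI subsetI)
    fix y assume "y \<in> vval ` cpos ?G"
    then obtain t where t: "y = vval t" "\<forall>x. t x \<ge> 0" "rsupp t \<in> G" "icar (coord v N) N (rsupp t) \<subseteq> M" by (auto simp: cpos_def)
    have "x \<in> fcone (v ` M)" if x: "x \<in> rsupp t" for x
    proof -
      have "x \<in> fcone (v ` N)" using fan_face_subset[OF f t(3)] x by blast
      moreover have "coord v N k x = 0" if "k \<in> N - M" for k using t(4) x that unfolding icar_def by blast
      ultimately show ?thesis using fcone_face[OF N ind M] by blast
    qed
    thus "y \<in> fcone (v ` M)" unfolding t(1) vval_def using t(2) fM by (intro fcone_sum fcone_scale) auto
  next
    fix y assume y: "y \<in> fcone (v ` M)"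
    hence yN: "y \<in> fcone (v ` N)" "\<forall>k\<in>N-M. coord v N k y = 0" using fcone_face[OF N ind M] by auto
    obtain t where t: "t \<in> cpos G" "vval t = y" using fan_cover[OF f yN(1)] .
    hence t': "\<forall>x. t x \<ge> 0" "rsupp t \<in> G" by (auto simp: cpos_def)
    \<comment> \<open>The coordinate is nonnegative on the cone, so a positive combination on which
      it vanishes involves only points on which it vanishes.\<close>
    have "coord v N k x = 0" if k: "k \<in> N - M" and x: "x \<in> rsupp t" for k x
    proof -
      have "0 = coord v N k y" using yN(2) k by simp
      also have "\<dots> = (\<Sum>x\<in>rsupp t. t x * coord v N k x)"
        unfolding t(2)[symmetric] vval_def by (rule linear_vsum[OF coord_linear[OF ind]])
      finally have "(\<Sum>x\<in>rsupp t. t x * coord v N k x) = 0" by simp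
      moreover have "t x * coord v N k x \<ge> 0" if "x \<in> rsupp t" for x
        using t' fan_face_subset[OF f t'(2)] that k fcone_coord[OF N ind, of k x] by auto
      ultimately have "t x * coord v N k x = 0"
        using sum_nonneg_eq_0_iff[OF fanD(4)[OF f t'(2)], of "\<lambda>x. t x * coord v N k x"] x by simp
      thus ?thesis using x by (simp add: rsupp_def)
    qed
    hence "icar (coord v N) N (rsupp t) \<subseteq> M" unfolding icar_def by blast
    hence "t \<in> cpos ?G" using t' by (simp add: cpos_def)
    thus "y \<in> vval ` cpos ?G" using t(2) by blast
  qed
  have bij: "bij_betw vval (cpos ?G) (fcone (v ` M))"
    unfolding bij_betw_def using img sub f inj_on_subset by (auto simp: fan_def bij_betw_def)
  have iM: "independent (v ` M)" using ind M independent_mono by (metis image_mono)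
  have sc: "\<sigma> \<in> ?G" if "\<tau> \<in> ?G" "\<sigma> \<subseteq> \<tau>" for \<sigma> \<tau>
    using that fanD(5)[OF f, of \<tau> \<sigma>] icar_mono[OF that(2), of "coord v N" N] by auto
  have fin: "finite ?G" "\<And>\<tau>. \<tau> \<in> ?G \<Longrightarrow> finite \<tau>" using fanD(3,4)[OF f] by auto
  show ?thesis unfolding fan_def
    by (intro conjI bij iM fin(1) finite_imageI[OF fM] ballI allI impI) (erule fin(2), erule (1) sc)
qed

theorem fan_cube_acyclic:
  assumes N: "finite N" "inj_on v N" and f: "fan (v ` N) G"
  shows "kacyclic (coord v N) (card N) (cube (coord v N) N G N N)"
proof (rule cube_acyclic[OF N(1)])
  show "\<forall>\<tau>\<in>G. finite \<tau>" "\<forall>\<tau>\<in>G. \<forall>\<sigma>\<subseteq>\<tau>. \<sigma> \<in> G" using fanD(4,5)[OF f] by auto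
  fix M assume M: "M \<subseteq> N"
  let ?G = "{\<tau>\<in>G. icar (coord v N) N \<tau> \<subseteq> M}"
  have ind: "independent (v ` N)" "independent (v ` M)"
    using fanD(2)[OF f] fanD(2)[OF fan_face[OF N f M]] by auto
  have fM: "finite M" "inj_on v M" using N M by (meson finite_subset inj_on_subset)+
  have "kacyclic (coord v M) (card M) (kos M ?G)" by (rule fan_acyclic[OF fM fan_face[OF N f M]])
  \<comment> \<open>Dual functionals of \<open>v\<close> M\<open>and\<close>v \<open>N\<close> are
    independent choices, but they agree on the span of the smaller face.\<close>
  moreover have "coord v M k x = coord v N k x" if "\<tau> \<in> ?G" "x \<in> \<tau>" "k \<in> M" for k x \<tau>
  proof -
    have "x \<in> span (v ` M)" using fan_span[OF fan_face[OF N f M] that(1)] that(2) by blast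
    hence "x = (\<Sum>j\<in>M. coord v M j x *\<^sub>R v j)" by (rule coord_expand[OF fM ind(2)])
    also have "\<dots> = (\<Sum>j\<in>N. (if j \<in> M then coord v M j x else 0) *\<^sub>R v j)"
      using N M by (intro sum.mono_neutral_cong_left) auto
    finally have "coord v N k x = coord v N k \<dots>" by simp
    also have "\<dots> = coord v M k x" using coord_unique[OF N ind(1), of k] M that(3) by auto
    finally show ?thesis by simp
  qed
  ultimately show "kacyclic (coord v N) (card M) (kos M ?G)"
    by (subst kacyclic_cong[of _ _ "coord v M"]) (auto simp: kos_def)
qed auto

section \<open>Dimension counts for finitely supported chains\<close>

interpretation fs: vector_space "\<lambda>(r::real) (f::'i \<Rightarrow> real) x. r * f x"
  by unfold_locales (auto simp: fun_eq_iff algebra_simps)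

definition fun_on :: "'i set \<Rightarrow> ('i \<Rightarrow> real) set" where "fun_on A = {f. \<forall>i. i \<notin> A \<longrightarrow> f i = 0}"

lemma subspace_fun_on: "fs.subspace (fun_on A)"
  by (auto simp: fs.subspace_def fun_on_def)

lemma fun_on_span:
  assumes "finite A" shows "fun_on A \<subseteq> fs.span ((\<lambda>i j. if j = i then 1 else 0) ` A)"
proof
  fix f :: "'a \<Rightarrow> real" assume f: "f \<in> fun_on A"
  let ?d = "\<lambda>i j. if j = i then 1 else (0::real)"
  have "f x = (\<Sum>i\<in>A. (\<lambda>x. f i * ?d i x)) x" for x
  proof -
    have "(\<Sum>i\<in>A. (\<lambda>x. f i * ?d i x)) x = (\<Sum>i\<in>A. f i * ?d i x)"
      using assms by (induction A rule: finite_induct) auto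
    also have "\<dots> = (\<Sum>i\<in>A. if i = x then f x else 0)" by (rule sum.cong) auto
    also have "\<dots> = f x" using assms f by (auto simp: fun_on_def)
    finally show ?thesis by simp
  qed
  hence "f = (\<Sum>i\<in>A. (\<lambda>x. f i * ?d i x))" by (intro ext)
  also have "\<dots> \<in> fs.span (?d ` A)" by (intro fs.span_sum fs.span_scale fs.span_base) auto
  finally show "f \<in> fs.span (?d ` A)" .
qed

lemma fun_on_finite_indep:
  assumes "finite A" "B \<subseteq> fun_on A" "fs.independent B" shows "finite B \<and> card B \<le> card A"
proof -
  have "finite B \<and> card B \<le> card ((\<lambda>i j. if j = i then 1 else (0::real)) ` A)"
    using assms fun_on_span[OF assms(1)] by (intro fs.independent_span_bound) auto
  thus ?thesis using card_image_le[OF assms(1)] le_trans by blast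
qed

lemma dim_fun_on_le: "finite A \<Longrightarrow> V \<subseteq> fun_on A \<Longrightarrow> fs.dim V \<le> card A"
  using fs.dim_le_card[of V "(\<lambda>i j. if j = i then 1 else (0::real)) ` A"] fun_on_span[of A] card_image_le[of A]
  by (meson finite_imageI le_trans subset_trans)

lemma dim_fun_on:
  assumes "finite A" shows "fs.dim (fun_on A) = card A"
proof -
  let ?d = "\<lambda>i j. if j = i then 1 else (0::real)"
  have inj: "inj_on ?d A" by (rule inj_onI) (metis zero_neq_one)
  have "fs.independent (?d ` A)"
  proof (rule fs.independent_if_scalars_zero)
    fix u f assume s: "(\<Sum>x\<in>?d ` A. (\<lambda>y. u x * x y)) = 0" and "f \<in> ?d ` A"
    then obtain i where i: "i \<in> A" "f = ?d i" by blast
    have "(\<Sum>x\<in>?d ` A. (\<lambda>y. u x * x y)) i = (\<Sum>j\<in>A. u (?d j) * ?d j i)"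
      unfolding sum.reindex[OF inj] using assms by (induction A rule: finite_induct) auto
    also have "\<dots> = (\<Sum>j\<in>A. if j = i then u (?d i) else 0)" by (rule sum.cong) auto
    also have "\<dots> = u f" using i assms by simp
    finally show "u f = 0" using s by simp
  qed (use assms in simp)
  hence "fs.dim (fun_on A) = card (?d ` A)"
    using fun_on_span[OF assms] by (intro fs.dim_unique[of "?d ` A"]) (auto simp: fun_on_def)
  thus ?thesis by (simp add: card_image inj)
qed

lemma rank_nullity_fun:
  fixes L :: "('i \<Rightarrow> real) \<Rightarrow> 'i \<Rightarrow> real"
  assumes A: "finite A" and add: "\<And>f g. L (f + g) = L f + L g" and sc: "\<And>c f. L (\<lambda>x. c * f x) = (\<lambda>x. c * L f x)"
  shows "fs.dim {f\<in>fun_on A. L f = 0} + fs.dim (L ` fun_on A) = card A"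
proof -
  let ?K = "{f\<in>fun_on A. L f = 0}"
  have L0: "L 0 = 0" using sc[of 0 0] by (simp add: zero_fun_def)
  have Ls: "L (\<Sum>i\<in>I. (\<lambda>x. c i * g i x)) = (\<Sum>i\<in>I. (\<lambda>x. c i * L (g i) x))" for I :: "('i \<Rightarrow> real) set" and c g
  proof (induction I rule: infinite_finite_induct)
    case (insert i I)
    have "L (\<Sum>i\<in>insert i I. (\<lambda>x. c i * g i x)) = L ((\<lambda>x. c i * g i x) + (\<Sum>i\<in>I. (\<lambda>x. c i * g i x)))"
      by (simp only: sum.insert[OF insert.hyps(1,2)])
    also have "\<dots> = (\<lambda>x. c i * L (g i) x) + (\<Sum>i\<in>I. (\<lambda>x. c i * L (g i) x))"
      by (simp only: add sc insert.IH)
    finally show ?case by (simp only: sum.insert[OF insert.hyps(1,2)])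
  next
    case empty show ?case unfolding sum.empty by (rule L0)
  next
    case (infinite I) thus ?case by (simp only: sum.infinite[OF infinite] L0)
  qed
  have Lm: "L (f - g) = L f - L g" for f g
    using add[of "f - g" g] by simp
  have subK: "fs.subspace ?K" using subspace_fun_on[of A] by (auto simp: fs.subspace_def L0 add sc fun_eq_iff)
  obtain B0 where B0: "B0 \<subseteq> ?K" "fs.independent B0" "?K \<subseteq> fs.span B0" using fs.maximal_independent_subset by blast
  have "B0 \<subseteq> fun_on A" using B0(1) by auto
  then obtain B where B: "B0 \<subseteq> B" "B \<subseteq> fun_on A" "fs.independent B" "fun_on A \<subseteq> fs.span B"
    using fs.maximal_independent_subset_extend[OF _ B0(2)] by blast
  have fB: "finite B" using fun_on_finite_indep[OF A B(2,3)] by simp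
  hence fB0: "finite B0" using B(1) finite_subset by blast
  have cB: "card B = card A" using fs.dim_unique[OF B(2) B(4) B(3) refl] dim_fun_on[OF A] by simp
  have dK: "fs.dim ?K = card B0" using fs.dim_unique[OF B0(1,3,2) refl] .
  \<comment> \<open>A basis of the kernel is extended to a basis of all functions on
    \<open>A\<close>; the images of the added vectors form a basis of the image.\<close>
  define C where "C = B - B0"
  have fC: "finite C" using fB by (simp add: C_def)
  have key: "u c = 0" if u: "L (\<Sum>c\<in>C. (\<lambda>x. u c * c x)) = 0" and c: "c \<in> C" for u c
  proof -
    have "(\<Sum>c\<in>C. (\<lambda>x. u c * c x)) \<in> fun_on A"
      using B(2) subspace_fun_on by (intro fs.subspace_sum fs.subspace_scale) (auto simp: C_def)
    hence "(\<Sum>c\<in>C. (\<lambda>x. u c * c x)) \<in> fs.span B0" using u B0(3) by blast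
    then obtain w where w: "(\<Sum>c\<in>C. (\<lambda>x. u c * c x)) = (\<Sum>b\<in>B0. (\<lambda>x. w b * b x))"
      using fs.span_finite[OF fB0] by auto
    define t where "t b = (if b \<in> B0 then - w b else u b)" for b
    have "(\<Sum>b\<in>B. (\<lambda>x. t b * b x)) = (\<Sum>b\<in>C. (\<lambda>x. t b * b x)) + (\<Sum>b\<in>B0. (\<lambda>x. t b * b x))"
      unfolding C_def by (rule sum.subset_diff[OF B(1) fB])
    also have "(\<Sum>b\<in>C. (\<lambda>x. t b * b x)) = (\<Sum>c\<in>C. (\<lambda>x. u c * c x))"
      by (rule sum.cong) (auto simp: t_def C_def)
    also have "(\<Sum>b\<in>B0. (\<lambda>x. t b * b x)) = (\<Sum>b\<in>B0. - (\<lambda>x. w b * b x))"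
      by (rule sum.cong) (auto simp: t_def fun_eq_iff)
    also have "(\<Sum>c\<in>C. (\<lambda>x. u c * c x)) + \<dots> = 0" unfolding w by (simp add: sum_negf)
    finally have "t c = 0" using fs.independentD[OF B(3) fB order_refl, of t c] c by (auto simp: C_def)
    thus ?thesis using c by (simp add: t_def C_def)
  qed
  have injC: "inj_on L C"
  proof (rule inj_onI, rule ccontr)
    fix c c' assume c: "c \<in> C" "c' \<in> C" "L c = L c'" "c \<noteq> c'"
    define u where "u x = (if x = c then 1 else 0) - (if x = c' then 1 else (0::real))" for x
    have "(\<Sum>x\<in>C. (\<lambda>y. u x * x y)) = (\<Sum>x\<in>C. (if x = c then c else 0) - (if x = c' then c' else 0))"
      by (rule sum.cong) (auto simp: u_def fun_eq_iff)
    also have "\<dots> = c - c'" using c fC by (simp add: sum_subtractf)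
    finally have "L (\<Sum>x\<in>C. (\<lambda>y. u x * x y)) = 0" using c(3) by (simp add: Lm)
    from key[OF this c(1)] c(4) show False by (simp add: u_def)
  qed
  have indC: "fs.independent (L ` C)"
  proof (rule fs.independent_if_scalars_zero)
    show "finite (L ` C)" using fC by simp
    fix u g assume s: "(\<Sum>x\<in>L ` C. (\<lambda>y. u x * x y)) = 0" and "g \<in> L ` C"
    then obtain c where c: "c \<in> C" "g = L c" by blast
    have "L (\<Sum>c\<in>C. (\<lambda>x. u (L c) * c x)) = (\<Sum>x\<in>L ` C. (\<lambda>y. u x * x y))"
      unfolding Ls sum.reindex[OF injC] by simp
    hence "L (\<Sum>c\<in>C. (\<lambda>x. u (L c) * c x)) = 0" using s by simp
    from key[OF this c(1)] show "u g = 0" using c(2) by simp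
  qed
  have spn: "L ` fun_on A \<subseteq> fs.span (L ` C)"
  proof
    fix g assume "g \<in> L ` fun_on A"
    then obtain f where f: "f \<in> fun_on A" "g = L f" by blast
    then obtain u where u: "f = (\<Sum>b\<in>B. (\<lambda>x. u b * b x))" using B(4) fs.span_finite[OF fB] by auto
    have "g = (\<Sum>b\<in>B. (\<lambda>x. u b * L b x))" unfolding f(2) u Ls ..
    also have "\<dots> = (\<Sum>b\<in>C. (\<lambda>x. u b * L b x))" unfolding C_def
      by (rule sum.mono_neutral_right[OF fB]) (use B0(1) in \<open>auto simp: fun_eq_iff\<close>)
    also have "\<dots> \<in> fs.span (L ` C)" by (intro fs.span_sum fs.span_scale fs.span_base) auto
    finally show "g \<in> fs.span (L ` C)" .
  qed
  have "fs.dim (L ` fun_on A) = card (L ` C)"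
    by (rule fs.dim_unique[OF _ spn indC refl]) (use B(2) in \<open>auto simp: C_def\<close>)
  also have "\<dots> = card C" by (rule card_image[OF injC])
  finally show ?thesis unfolding dK cB[symmetric] C_def
    using card_Diff_subset[OF fB0 B(1)] card_mono[OF fB B(1)] by simp
qed

lemma kbd_add: "kbd lam U (\<lambda>T a. y T a + z T a) T a = kbd lam U y T a + kbd lam U z T a"
  by (simp add: kbd_def lin_shift_def distrib_left sum.distrib)

lemma kbd_scale: "kbd lam U (\<lambda>T a. c * z T a) T a = c * kbd lam U z T a"
  by (simp add: kbd_def lin_shift_def sum_distrib_left mult_ac)

text \<open>Exactness below degree \<open>n\<close> makes the alternating sum of the dimensions
  below \<open>n\<close> equal to the rank of the last boundary map, which is at most the dimension
  in degree \<open>n\<close>.\<close>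

theorem acyclic_euler_nonneg:
  assumes finite_vertices: "finite U" and fin: "kfin U" and conv: "kconvex lam U" and ac: "kacyclic lam n U"
    and card: "\<And>T a. (T, a) \<in> U \<Longrightarrow> card T \<le> n"
  shows "(\<Sum>p\<in>U. (-1) ^ (n - card (fst p))) \<ge> (0::real)"
proof -
  define Uk where "Uk k = {p\<in>U. card (fst p) = k}" for k
  have fUk: "finite (Uk k)" for k using finite_vertices by (simp add: Uk_def)
  define L where "L f p = kbd lam U (\<lambda>S b. f (S, b)) (fst p) (snd p)" for f p
  have add: "L (f + g) = L f + L g" for f g by (auto simp: L_def fun_eq_iff kbd_add)
  have sc: "L (\<lambda>x. c * f x) = (\<lambda>x. c * L f x)" for c f by (auto simp: L_def fun_eq_iff kbd_scale)
  define r where "r k = fs.dim (L ` fun_on (Uk k))" for k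
  have Llev: "L f \<in> fun_on (Uk (Suc k))" if f: "f \<in> fun_on (Uk k)" for f k
    unfolding fun_on_def
  proof (intro CollectI allI impI, rule ccontr)
    fix p assume p: "p \<notin> Uk (Suc k)" "L f p \<noteq> 0"
    have "\<And>T a. f (T, a) \<noteq> 0 \<Longrightarrow> Suc (card T) = Suc k" using f by (force simp: fun_on_def Uk_def)
    from kbd_level[OF fin this p(2)[unfolded L_def]] p(1) show False by (cases p) (auto simp: Uk_def)
  qed
  have rn: "fs.dim {f\<in>fun_on (Uk k). L f = 0} + r k = card (Uk k)" for k
    unfolding r_def by (rule rank_nullity_fun[OF fUk add sc])
  have LL: "L (L f) = 0" if f: "f \<in> fun_on (Uk k)" for f k
  proof
    fix p
    have "\<And>T a. f (T, a) \<noteq> 0 \<Longrightarrow> (T, a) \<in> U" using f by (force simp: fun_on_def Uk_def)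
    from kbd_kbd[OF fin conv this] show "L (L f) p = 0 p" by (simp add: L_def)
  qed
  have ker: "{f\<in>fun_on (Uk k). L f = 0} = (case k of 0 \<Rightarrow> {0} | Suc k' \<Rightarrow> L ` fun_on (Uk k'))" if k: "k < n" for k
  proof -
    have ex: "\<exists>b. (\<forall>T a. b T a \<noteq> 0 \<longrightarrow> (T, a) \<in> U \<and> Suc (card T) = k) \<and> (\<forall>T a. kbd lam U b T a = f (T, a))"
      if f: "f \<in> fun_on (Uk k)" "L f = 0" for f
    proof -
      have "chain U k (\<lambda>T a. f (T, a))" using f(1) by (force simp: chain_def fun_on_def Uk_def)
      moreover have "kbd lam U (\<lambda>T a. f (T, a)) T a = 0" for T a using fun_cong[OF f(2), of "(T, a)"] by (simp add: L_def)
      ultimately show ?thesis using ac k unfolding kacyclic_def by blast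
    qed
    show ?thesis
    proof (cases k)
      case 0
      have "f = 0" if f: "f \<in> fun_on (Uk k)" "L f = 0" for f
      proof -
        from ex[OF f] obtain b where b: "\<forall>T a. b T a = 0" "\<forall>T a. kbd lam U b T a = f (T, a)" using 0 by auto
        have "kbd lam U b T a = 0" for T a using b(1) by (simp add: kbd_def lin_shift_def)
        thus ?thesis using b(2) by (auto simp: fun_eq_iff)
      qed
      moreover have "L 0 = 0" using sc[of 0 0] by (simp add: zero_fun_def)
      moreover have "0 \<in> fun_on (Uk k)" by (simp add: fun_on_def)
      ultimately show ?thesis using 0 by auto
    next
      case (Suc k')
      have "f \<in> L ` fun_on (Uk k')" if f: "f \<in> fun_on (Uk k)" "L f = 0" for f
      proof -
        from ex[OF f] obtain b where b: "\<forall>T a. b T a \<noteq> 0 \<longrightarrow> (T, a) \<in> U \<and> Suc (card T) = k" "\<forall>T a. kbd lam U b T a = f (T, a)" by blast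
        have "f = L (\<lambda>p. b (fst p) (snd p))" using b(2) by (auto simp: L_def fun_eq_iff)
        moreover have "(\<lambda>p. b (fst p) (snd p)) \<in> fun_on (Uk k')"
          unfolding fun_on_def
        proof (intro CollectI allI impI, rule ccontr)
          fix p assume p: "p \<notin> Uk k'" "b (fst p) (snd p) \<noteq> 0"
          from b(1) p(2) have "(fst p, snd p) \<in> U \<and> Suc (card (fst p)) = k" by blast
          thus False using p(1) Suc by (simp add: Uk_def)
        qed
        ultimately show ?thesis by blast
      qed
      thus ?thesis using Suc Llev LL by auto
    qed
  qed
  \<comment> \<open>The alternating partial sums, signed so that the last dimension counts
    positively; by exactness \<open>s (Suc m)\<close> is the rank of the boundary out of degree
    \<open>m\<close>.\<close>
  define s where "s m = (\<Sum>k<m. (-1) ^ (m - 1 - k) * real (card (Uk k)))" for m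
  have s: "s (Suc m) = real (card (Uk m)) - s m" for m
  proof -
    have "s (Suc m) = real (card (Uk m)) + (\<Sum>k<m. (-1) ^ (m - k) * real (card (Uk k)))" by (simp add: s_def)
    also have "(\<Sum>k<m. (-1) ^ (m - k) * real (card (Uk k))) = (\<Sum>k<m. - ((-1) ^ (m - 1 - k) * real (card (Uk k))))"
    proof (rule sum.cong[OF refl])
      fix k assume "k \<in> {..<m}"
      hence "m - k = Suc (m - 1 - k)" by auto
      thus "(-1) ^ (m - k) * real (card (Uk k)) = - ((-1) ^ (m - 1 - k) * real (card (Uk k)))" by simp
    qed
    finally show ?thesis by (simp add: s_def sum_negf)
  qed
  have "m < n \<Longrightarrow> s (Suc m) = real (r m)" for m
  proof (induction m)
    case 0
    have "fs.dim {f\<in>fun_on (Uk 0). L f = 0} = 0"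
      using ker[OF 0] fs.dim_unique[of "{}" "{f\<in>fun_on (Uk 0). L f = 0}" 0]
      by (simp add: fs.independent_empty fs.span_empty)
    thus ?case using s[of 0] rn[of 0] by (simp add: s_def)
  next
    case (Suc m)
    have "fs.dim {f\<in>fun_on (Uk (Suc m)). L f = 0} = r m" using ker[OF Suc.prems] by (simp add: r_def)
    thus ?case using s[of "Suc m"] rn[of "Suc m"] Suc by simp
  qed
  note sr = this
  have "s n \<le> real (card (Uk n))"
  proof (cases n)
    case 0 thus ?thesis by (simp add: s_def)
  next
    case (Suc m)
    have "L ` fun_on (Uk m) \<subseteq> fun_on (Uk n)" using Llev Suc by blast
    from dim_fun_on_le[OF fUk this] show ?thesis using sr[of m] Suc by (simp add: r_def)
  qed
  hence "s (Suc n) \<ge> 0" using s[of n] by simp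
  also have "s (Suc n) = (\<Sum>k\<le>n. \<Sum>p\<in>Uk k. (-1) ^ (n - card (fst p)))"
    unfolding s_def lessThan_Suc_atMost by (rule sum.cong) (auto simp: Uk_def mult.commute)
  also have "\<dots> = (\<Sum>p\<in>(\<Union>k\<in>{..n}. Uk k). (-1) ^ (n - card (fst p)))"
    by (rule sum.UNION_disjoint[symmetric]) (use fUk in \<open>auto simp: Uk_def\<close>)
  also have "(\<Union>k\<in>{..n}. Uk k) = U" using card by (force simp: Uk_def)
  finally show ?thesis .
qed

section \<open>Generating functions and the local h-polynomial of a fan\<close>

definition geo_fps :: "real fps" where "geo_fps = Abs_fps (\<lambda>n. if n = 0 then 0 else 1)"

lemma geo_fps_mult: "geo_fps * (1 - fps_X) = fps_X"
proof (rule fps_ext)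
  fix n show "(geo_fps * (1 - fps_X)) $ n = (fps_X :: real fps) $ n"
    by (cases n) (auto simp: right_diff_distrib geo_fps_def)
qed

lemma geo_fps_power: "geo_fps ^ s * (1 - fps_X) ^ s = fps_X ^ s"
  by (simp add: geo_fps_mult flip: power_mult_distrib)

text \<open>Each element of the support contributes an exponent of at least 1, hence a factor
  x/(1-x).\<close>

lemma card_exponents:
  assumes "finite S"
  shows "real (card {a. supp a = S \<and> edeg a = d}) = (geo_fps ^ card S) $ d"
  using assms
proof (induction S arbitrary: d rule: finite_induct)
  case empty
  have "{a::'a \<Rightarrow> nat. supp a = {} \<and> edeg a = d} = (if d = 0 then {\<lambda>_. 0} else {})"
    by (auto simp: supp_def edeg_def)
  thus ?case by simp
next
  case (insert x S)
  let ?E = "\<lambda>S d. {a::'a \<Rightarrow> nat. supp a = S \<and> edeg a = d}"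
  have fE: "finite (?E S d)" if "finite S" for S d
    by (rule finite_subset[OF _ finite_expo[of "{S}" d]]) (use that in \<open>auto simp: expo_def\<close>)
  have U: "?E (insert x S) d = (\<Union>j\<in>{1..d}. (\<lambda>b. b(x := j)) ` ?E S (d - j))"
  proof (intro equalityI subsetI)
    fix a assume a: "a \<in> ?E (insert x S) d"
    let ?b = "a(x := 0)"
    have ax: "a x \<noteq> 0" using a by (auto simp: supp_def)
    have sb: "supp ?b = S" using a insert.hyps(2) by (auto simp: supp_def)
    have "edeg a = a x + (\<Sum>w\<in>S. a w)" using a insert.hyps by (simp add: edeg_def)
    also have "(\<Sum>w\<in>S. a w) = edeg ?b" unfolding edeg_def sb using insert.hyps by (intro sum.cong) auto
    finally have e: "d = a x + edeg ?b" using a by simp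
    hence "?b \<in> ?E S (d - a x)" using sb by auto
    moreover have "a = ?b(x := a x)" by simp
    moreover have "a x \<in> {1..d}" using ax e by auto
    ultimately show "a \<in> (\<Union>j\<in>{1..d}. (\<lambda>b. b(x := j)) ` ?E S (d - j))" by blast
  next
    fix a assume "a \<in> (\<Union>j\<in>{1..d}. (\<lambda>b. b(x := j)) ` ?E S (d - j))"
    then obtain j b where j: "1 \<le> j" "j \<le> d" "a = b(x := j)" "supp b = S" "edeg b = d - j" by auto
    have s: "supp a = insert x S" using j by (auto simp: supp_def)
    have "edeg a = j + (\<Sum>w\<in>S. a w)" using insert.hyps j(3) s by (simp add: edeg_def)
    also have "(\<Sum>w\<in>S. a w) = edeg b" unfolding edeg_def j(4) j(3) using insert.hyps by (intro sum.cong) auto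
    finally have "edeg a = j + edeg b" .
    hence "edeg a = d" using j(2,5) by linarith
    thus "a \<in> ?E (insert x S) d" using s by simp
  qed
  have inj: "inj_on (\<lambda>b. b(x := j)) (?E S e)" for j e
  proof (rule inj_onI)
    fix b c assume bc: "b \<in> ?E S e" "c \<in> ?E S e" "b(x := j) = c(x := j)"
    hence "b x = 0" "c x = 0" using insert.hyps(2) by (auto simp: supp_def)
    thus "b = c" using bc(3) by (metis fun_upd_triv fun_upd_upd)
  qed
  have "card (?E (insert x S) d) = (\<Sum>j\<in>{1..d}. card ((\<lambda>b. b(x := j)) ` ?E S (d - j)))"
    unfolding U
  proof (rule card_UN_disjoint)
    show "\<forall>j\<in>{1..d}. finite ((\<lambda>b. b(x := j)) ` ?E S (d - j))" using fE[OF insert.hyps(1)] by blast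
    show "\<forall>i\<in>{1..d}. \<forall>j\<in>{1..d}. i \<noteq> j \<longrightarrow> (\<lambda>b. b(x := i)) ` ?E S (d - i) \<inter> (\<lambda>b. b(x := j)) ` ?E S (d - j) = {}"
      by (auto dest: fun_cong[of _ _ x])
  qed simp
  also have "\<dots> = (\<Sum>j\<in>{1..d}. card (?E S (d - j)))" by (simp add: card_image inj)
  finally have "real (card (?E (insert x S) d)) = (\<Sum>j\<in>{1..d}. (geo_fps ^ card S) $ (d - j))"
    by (simp add: insert.IH)
  also have "\<dots> = (\<Sum>j=0..d. geo_fps $ j * (geo_fps ^ card S) $ (d - j))"
    by (rule sum.mono_neutral_cong_left) (auto simp: geo_fps_def)
  also have "\<dots> = (geo_fps ^ card (insert x S)) $ d" using insert.hyps by (simp add: fps_mult_nth)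
  finally show ?case .
qed

lemma sum_Pow_powers:
  fixes y z :: "'a::comm_ring_1"
  assumes "finite C"
  shows "(\<Sum>T\<in>Pow C. y ^ card T * z ^ (card C - card T)) = (y + z) ^ card C"
proof -
  have "(y + z) ^ card C = (\<Sum>T\<in>Pow C. (\<Prod>x\<in>T. y) * (\<Prod>x\<in>C-T. z))"
    using prod_add[OF assms, of "\<lambda>_. y" "\<lambda>_. z"] by simp
  also have "\<dots> = (\<Sum>T\<in>Pow C. y ^ card T * z ^ (card C - card T))"
    by (intro sum.cong) (simp_all add: card_Diff_subset finite_subset[OF _ assms])
  finally show ?thesis ..
qed

text \<open>The h-polynomial with the dimension prescribed by \<open>d\<close>, written as a sum
  over faces so that sums over faces and carriers can be exchanged.\<close>

definition tri_h :: "nat \<Rightarrow> 'x set set \<Rightarrow> real poly" where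
  "tri_h d G = (\<Sum>S\<in>G. monom 1 (card S) * [:1, -1:] ^ (d - card S))"

context
  fixes v :: "nat \<Rightarrow> 'b::real_vector" and N :: "nat set" and G :: "'b set set"
  assumes N: "finite N" "inj_on v N" and f: "fan (v ` N) G"
begin

abbreviation (input) "car \<equiv> icar (coord v N) N"

definition fan_face_faces :: "nat set \<Rightarrow> 'b set set" where
  "fan_face_faces M = {\<tau>\<in>G. car \<tau> \<subseteq> M}"

lemma car_N: "car \<tau> \<subseteq> N" by (auto simp: icar_def)

lemma card_le_car: "\<tau> \<in> G \<Longrightarrow> card \<tau> \<le> card (car \<tau>)"
proof -
  assume t: "\<tau> \<in> G"
  have "inj_on v (car \<tau>)" using N(2) car_N inj_on_subset by blast
  thus ?thesis using fan_card_le[OF fan_face[OF N f car_N], of \<tau> \<tau>] t by (simp add: card_image)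
qed

text \<open>Stanley's expansion of the local h-polynomial; the exponent of 1 - x is the excess of
  the face \<open>S\<close> over its carrier.\<close>

definition stanley_poly :: "real poly" where
  "stanley_poly = (\<Sum>S\<in>G. (-1) ^ (card N - card (car S)) * monom 1 (card N - card (car S) + card S) *
     [:1, -1:] ^ (card (car S) - card S))"

text \<open>After exchanging the sums, the faces \<open>M\<close> containing the carrier of
  \<open>S\<close> contribute the binomial expansion of ((1 - x) - 1) to the power of the
  codimension of the carrier.\<close>

lemma local_h_eq_stanley:
  "(\<Sum>M\<in>Pow N. (-1) ^ (card N - card M) * tri_h (card M) (fan_face_faces M)) = stanley_poly"
proof -
  let ?n = "card N" and ?p = "[:1, -1:] :: real poly"
  have fG: "finite G" using fanD(3)[OF f] .
  have "(\<Sum>M\<in>Pow N. (-1) ^ (?n - card M) * tri_h (card M) (fan_face_faces M)) =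
     (\<Sum>M\<in>Pow N. \<Sum>S\<in>G. if car S \<subseteq> M then (-1) ^ (?n - card M) * (monom 1 (card S) * ?p ^ (card M - card S)) else 0)"
    unfolding tri_h_def fan_face_faces_def using fG
    by (intro sum.cong refl) (simp add: sum_distrib_left sum.inter_filter if_distrib[of "(*) _"] cong: if_cong)
  also have "\<dots> = (\<Sum>S\<in>G. \<Sum>M\<in>Pow N. if car S \<subseteq> M then (-1) ^ (?n - card M) * (monom 1 (card S) * ?p ^ (card M - card S)) else 0)"
    by (rule sum.swap)
  also have "\<dots> = stanley_poly" unfolding stanley_poly_def
  proof (rule sum.cong[OF refl])
    fix S assume S: "S \<in> G"
    let ?C = "car S"
    let ?D = "N - ?C"
    have fC: "finite ?C" using car_N N finite_subset by blast
    have cD: "card ?D = ?n - card ?C" using car_N fC by (simp add: card_Diff_subset)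
    have le: "card S \<le> card ?C" by (rule card_le_car[OF S])
    have "(\<Sum>M\<in>Pow N. if ?C \<subseteq> M then (-1) ^ (?n - card M) * (monom 1 (card S) * ?p ^ (card M - card S)) else 0) =
       (\<Sum>M\<in>{M\<in>Pow N. ?C \<subseteq> M}. (-1) ^ (?n - card M) * (monom 1 (card S) * ?p ^ (card M - card S)))"
      by (rule sum.inter_filter[symmetric]) (simp add: N)
    also have "\<dots> = (\<Sum>T\<in>Pow ?D. monom 1 (card S) * ?p ^ (card ?C - card S) * (?p ^ card T * (-1) ^ (card ?D - card T)))"
    proof (rule sum.reindex_bij_witness[of _ "\<lambda>T. T \<union> ?C" "\<lambda>M. M - ?C"])
      fix M assume M: "M \<in> {M\<in>Pow N. ?C \<subseteq> M}"
      show "M - ?C \<union> ?C = M" "M - ?C \<in> Pow ?D" using M by auto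
      have fM: "finite M" using M N finite_subset by auto
      have c: "card (M - ?C) = card M - card ?C" using M fC by (simp add: card_Diff_subset)
      have lM: "card ?C \<le> card M" "card M \<le> ?n" using M fM N by (auto intro: card_mono)
      have "?p ^ (card M - card S) = ?p ^ (card ?C - card S) * ?p ^ (card (M - ?C))"
        unfolding c using le lM by (simp flip: power_add)
      moreover have "card ?D - card (M - ?C) = ?n - card M" unfolding c cD using lM by simp
      ultimately show "monom 1 (card S) * ?p ^ (card ?C - card S) * (?p ^ card (M - ?C) * (-1) ^ (card ?D - card (M - ?C))) =
        (-1) ^ (?n - card M) * (monom 1 (card S) * ?p ^ (card M - card S))" by (simp add: mult_ac)
    qed (use car_N in auto)
    also have "\<dots> = monom 1 (card S) * ?p ^ (card ?C - card S) * (?p + (-1)) ^ card ?D"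
      using sum_Pow_powers[of ?D ?p "-1"] N(1) by (simp add: sum_distrib_left[symmetric])
    also have "?p + (-1) = (-1) * monom 1 1" by (simp add: monom_altdef one_pCons)
    also have "\<dots> ^ card ?D = (-1) ^ card ?D * monom 1 (card ?D)"
      by (subst power_mult_distrib) (simp add: monom_power)
    finally show "(\<Sum>M\<in>Pow N. if ?C \<subseteq> M then (-1) ^ (?n - card M) * (monom 1 (card S) * ?p ^ (card M - card S)) else 0) =
      (-1) ^ (?n - card ?C) * monom 1 (?n - card ?C + card S) * ?p ^ (card ?C - card S)"
      unfolding cD by (simp add: mult_ac mult_monom add.commute)
  qed
  finally show ?thesis .
qed

lemma fps_one_minus: "fps_of_poly ([:1, -1:] :: real poly) = 1 - fps_X"
  by (simp add: fps_of_poly_pCons)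

text \<open>The coefficient is the Euler characteristic of one slice of the carrier complex. A pair
  \<open>(T, a)\<close> of the slice has sign \<open>(-1)^(n - card T)\<close> and degree shifted by
  the same number, which is what the factor (-x)^(n - card T) records.\<close>

lemma stanley_coeff_nonneg: "coeff stanley_poly m \<ge> 0"
proof -
  let ?n = "card N" and ?lam = "coord v N"
  let ?U = "cube ?lam N G N N"
  let ?S = "kslice ?n ?U"
  have fG: "finite G" "\<forall>\<tau>\<in>G. finite \<tau>" "\<forall>\<tau>\<in>G. \<forall>\<sigma>\<subseteq>\<tau>. \<sigma> \<in> G" using fanD[OF f] by auto
  have fcar: "finite (car \<tau>)" for \<tau> using car_N N finite_subset by blast
  have ccar: "card (car \<tau>) \<le> ?n" for \<tau> using car_N N card_mono by blast
  have kf: "kfin ?U" by (rule cube_kfin[OF N(1) order_refl fG(2)])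
  have Seq: "?S m = (\<Union>S\<in>G. \<Union>T\<in>Pow (car S). {T} \<times> {a. supp a = S \<and> edeg a + ?n = m + card T})" for m
  proof (intro equalityI subsetI)
    fix p assume "p \<in> ?S m"
    then obtain T a where p: "p = (T, a)" "T \<subseteq> N" "supp a \<in> G" "T \<inter> N \<subseteq> car (supp a)" "edeg a + ?n = m + card T"
      by (auto simp: kslice_def cube_def)
    hence "T \<subseteq> car (supp a)" by blast
    thus "p \<in> (\<Union>S\<in>G. \<Union>T\<in>Pow (car S). {T} \<times> {a. supp a = S \<and> edeg a + ?n = m + card T})" using p by auto
  next
    fix p assume "p \<in> (\<Union>S\<in>G. \<Union>T\<in>Pow (car S). {T} \<times> {a. supp a = S \<and> edeg a + ?n = m + card T})"
    then obtain T a where p: "p = (T, a)" "supp a \<in> G" "T \<subseteq> car (supp a)" "edeg a + ?n = m + card T" by auto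
    have "T \<subseteq> N" using p(3) car_N by blast
    thus "p \<in> ?S m" using p car_N by (auto simp: kslice_def cube_def)
  qed
  have fin1: "finite {a::'b \<Rightarrow> nat. supp a = S \<and> edeg a + ?n = m + card T}" if "S \<in> G" for S T m
    by (rule finite_subset[OF _ finite_expo[of "{S}" "m + card T - ?n"]]) (use that fG in \<open>auto simp: expo_def\<close>)
  have finS: "finite (?S m)" for m unfolding Seq
    by (intro finite_UN_I fG(1) finite_cartesian_product fin1) (simp_all add: fcar)
  have nonneg: "(\<Sum>p\<in>?S m. (-1) ^ (?n - card (fst p))) \<ge> (0::real)" for m
  proof (rule acyclic_euler_nonneg[OF finS])
    show "kfin (?S m)" using kf by (auto simp: kfin_def kslice_def)
    show "kacyclic ?lam ?n (?S m)" by (rule kacyclic_kslice[OF kf fan_cube_acyclic[OF N f]])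
    show "card T \<le> ?n" if "(T, a) \<in> ?S m" for T a
    proof -
      have "T \<subseteq> N" using that by (auto simp: kslice_def cube_def)
      thus ?thesis using N(1) card_mono by blast
    qed
    show "kconvex ?lam (?S m)" unfolding kconvex_def
    proof (intro allI impI)
      fix T j k u w and a :: "'b \<Rightarrow> nat"
      assume h: "(T, a) \<in> ?S m" "k \<in> T" "j \<in> T - {k}" "w \<in> supp a" "u \<in> supp (a(w := a w - 1))" "?lam j u \<noteq> 0"
        "(T - {k} - {j}, a(w := a w - 1, u := (a(w := a w - 1)) u - 1)) \<in> ?S m"
      have ft: "finite T" "finite (supp a)" using h(1) kf by (auto simp: kslice_def kfin_def)
      have U: "(T, a) \<in> ?U" "(T - {k} - {j}, a(w := a w - 1, u := (a(w := a w - 1)) u - 1)) \<in> ?U"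
        using h(1,7) by (auto simp: kslice_def)
      have "(T - {k}, a(w := a w - 1)) \<in> ?U"
        using cube_kconvex[OF fG(3) order_refl, of ?lam N N] U h(2-6) unfolding kconvex_def by meson
      from kslice_step[OF ft h(2,4) this] show "(T - {k}, a(w := a w - 1)) \<in> ?S m" using h(1) by (auto simp: kslice_def)
    qed
  qed
  have "(\<Sum>p\<in>?S m. (-1) ^ (?n - card (fst p))) = coeff stanley_poly m"
  proof -
    have fin2: "finite ({T} \<times> {a. supp a = S \<and> edeg a + ?n = m + card T})" if "S \<in> G" for S T
      by (rule finite_cartesian_product[OF _ fin1[OF that]]) simp
    have "(\<Sum>p\<in>?S m. (-1) ^ (?n - card (fst p))) =
      (\<Sum>S\<in>G. \<Sum>p\<in>(\<Union>T\<in>Pow (car S). {T} \<times> {a. supp a = S \<and> edeg a + ?n = m + card T}). (-1::real) ^ (?n - card (fst p)))"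
      unfolding Seq
      by (rule sum.UNION_disjoint[OF fG(1)]) (use fcar fin2 in \<open>blast intro: finite_UN_I\<close>, blast)
    also have "\<dots> = (\<Sum>S\<in>G. \<Sum>T\<in>Pow (car S). (-1) ^ (?n - card T) * real (card {a. supp a = S \<and> edeg a + ?n = m + card T}))"
    proof (rule sum.cong[OF refl])
      fix S assume S: "S \<in> G"
      have "(\<Sum>p\<in>(\<Union>T\<in>Pow (car S). {T} \<times> {a. supp a = S \<and> edeg a + ?n = m + card T}). (-1::real) ^ (?n - card (fst p))) =
        (\<Sum>T\<in>Pow (car S). \<Sum>p\<in>{T} \<times> {a. supp a = S \<and> edeg a + ?n = m + card T}. (-1::real) ^ (?n - card (fst p)))"

        by (rule sum.UNION_disjoint) (use fcar fin2[OF S] in \<open>blast+\<close>)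
      also have "\<dots> = (\<Sum>T\<in>Pow (car S). (-1) ^ (?n - card T) * real (card {a. supp a = S \<and> edeg a + ?n = m + card T}))"
      proof (rule sum.cong[OF refl])
        fix T
        have "(\<Sum>p\<in>{T} \<times> {a. supp a = S \<and> edeg a + ?n = m + card T}. (-1::real) ^ (?n - card (fst p))) =
          (\<Sum>p\<in>{T} \<times> {a. supp a = S \<and> edeg a + ?n = m + card T}. (-1::real) ^ (?n - card T))"
          by (rule sum.cong) auto
        thus "(\<Sum>p\<in>{T} \<times> {a. supp a = S \<and> edeg a + ?n = m + card T}. (-1::real) ^ (?n - card (fst p))) =
          (-1) ^ (?n - card T) * real (card {a. supp a = S \<and> edeg a + ?n = m + card T})"
          by (simp add: card_cartesian_product)
      qed
      finally show "(\<Sum>p\<in>(\<Union>T\<in>Pow (car S). {T} \<times> {a. supp a = S \<and> edeg a + ?n = m + card T}). (-1::real) ^ (?n - card (fst p))) =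
        (\<Sum>T\<in>Pow (car S). (-1) ^ (?n - card T) * real (card {a. supp a = S \<and> edeg a + ?n = m + card T}))" .
    qed
    also have "\<dots> = (\<Sum>S\<in>G. (\<Sum>T\<in>Pow (car S). (- fps_X) ^ (?n - card T) * geo_fps ^ card S) $ m)"
    proof (rule sum.cong[OF refl])
      fix S assume S: "S \<in> G"
      show "(\<Sum>T\<in>Pow (car S). (-1) ^ (?n - card T) * real (card {a. supp a = S \<and> edeg a + ?n = m + card T})) =
        (\<Sum>T\<in>Pow (car S). (- fps_X) ^ (?n - card T) * geo_fps ^ card S) $ m"
        unfolding fps_sum_nth
      proof (rule sum.cong[OF refl])
        fix T assume "T \<in> Pow (car S)"
        hence Tn: "card T \<le> ?n" using ccar[of S] card_mono[OF fcar, of T S] by auto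
        have fS: "finite S" using S fG by blast
        have m1: "(- fps_X :: real fps) ^ j = fps_const ((-1) ^ j) * fps_X ^ j" for j
          by (simp add: power_minus[of fps_X] fps_const_power[symmetric] del: fps_const_power)
        have "((- fps_X) ^ (?n - card T) * geo_fps ^ card S) $ m =
          (-1) ^ (?n - card T) * (if m < ?n - card T then 0 else (geo_fps ^ card S) $ (m - (?n - card T)))"
          unfolding m1 by (simp add: mult.assoc fps_X_power_mult_nth)
        also have "(if m < ?n - card T then 0 else (geo_fps ^ card S) $ (m - (?n - card T))) =
          real (card {a. supp a = S \<and> edeg a + ?n = m + card T})"
        proof (cases "m < ?n - card T")
          case True
          hence "{a. supp a = S \<and> edeg a + ?n = m + card T} = {}" by auto
          thus ?thesis using True by (simp only: card.empty of_nat_0 if_True)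
        next
          case False
          hence "{a. supp a = S \<and> edeg a + ?n = m + card T} = {a. supp a = S \<and> edeg a = m - (?n - card T)}"
            using Tn by auto
          thus ?thesis using False by (simp only: card_exponents[OF fS] if_False)
        qed
        finally show "(-1) ^ (?n - card T) * real (card {a. supp a = S \<and> edeg a + ?n = m + card T}) =
          ((- fps_X) ^ (?n - card T) * geo_fps ^ card S) $ m" by simp
      qed
    qed
    also have "\<dots> = (\<Sum>S\<in>G. fps_of_poly ((-1) ^ (?n - card (car S)) * monom 1 (?n - card (car S) + card S) * [:1, -1:] ^ (card (car S) - card S)) $ m)"
    proof (rule sum.cong[OF refl])
      fix S assume S: "S \<in> G"
      let ?c = "card (car S)"
      have "(\<Sum>T\<in>Pow (car S). (- fps_X) ^ (?n - card T) * geo_fps ^ card S) =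
        (\<Sum>T\<in>Pow (car S). (- fps_X) ^ (?n - ?c) * geo_fps ^ card S * (1 ^ card T * (- fps_X) ^ (?c - card T)))"
      proof (rule sum.cong[OF refl])
        fix T assume "T \<in> Pow (car S)"
        hence "card T \<le> ?c" using card_mono[OF fcar, of T S] by auto
        hence "?n - card T = (?n - ?c) + (?c - card T)" using ccar[of S] by simp
        thus "(- fps_X) ^ (?n - card T) * geo_fps ^ card S =
          (- fps_X) ^ (?n - ?c) * geo_fps ^ card S * (1 ^ card T * (- fps_X) ^ (?c - card T))"
          by (simp add: power_add mult_ac)
      qed
      \<comment> \<open>Summing over all subsets of the carrier produces (1 - x)^c, which clears the
        denominators of the x/(1-x) because a face has at most as many vertices as its
        carrier.\<close>
      also have "\<dots> = (- fps_X) ^ (?n - ?c) * geo_fps ^ card S * (1 + (- fps_X)) ^ ?c"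
        unfolding sum_distrib_left[symmetric] sum_Pow_powers[OF fcar] ..
      also have "(1 + (- fps_X :: real fps)) ^ ?c = (1 - fps_X) ^ card S * (1 - fps_X) ^ (?c - card S)"
        using card_le_car[OF S] by (simp flip: power_add)
      also have "(- fps_X) ^ (?n - ?c) * geo_fps ^ card S * \<dots> =
         (- fps_X) ^ (?n - ?c) * (geo_fps ^ card S * (1 - fps_X) ^ card S) * (1 - fps_X) ^ (?c - card S)"
        by (simp add: mult_ac)
      also have "\<dots> = (- 1) ^ (?n - ?c) * fps_X ^ (?n - ?c + card S) * (1 - fps_X) ^ (?c - card S)"
        unfolding geo_fps_power by (simp add: power_minus[of fps_X] power_add mult_ac)
      also have "\<dots> = fps_of_poly ((-1) ^ (?n - ?c) * monom 1 (?n - ?c + card S) * [:1, -1:] ^ (?c - card S))"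
        by (simp add: fps_of_poly_mult fps_of_poly_power fps_one_minus fps_of_poly_monom fps_of_poly_uminus)
      finally show "(\<Sum>T\<in>Pow (car S). (- fps_X) ^ (?n - card T) * geo_fps ^ card S) $ m =
        fps_of_poly ((-1) ^ (?n - ?c) * monom 1 (?n - ?c + card S) * [:1, -1:] ^ (?c - card S)) $ m" by simp
    qed
    also have "\<dots> = coeff stanley_poly m"
      by (simp add: stanley_poly_def coeff_sum)
    finally show ?thesis .
  qed
  thus ?thesis using nonneg[of m] by simp
qed

theorem fan_local_h_nonneg:
  "coeff (\<Sum>M\<in>Pow N. (-1) ^ (card N - card M) * tri_h (card M) (fan_face_faces M)) m \<ge> 0"
  unfolding local_h_eq_stanley by (rule stanley_coeff_nonneg)

end

text \<open>A generic point of the cone is not in the span of a face with too few vertices.\<close>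

lemma fan_full_face:
  fixes v :: "nat \<Rightarrow> 'b::real_vector"
  assumes N: "finite N" "inj_on v N" and f: "fan (v ` N) G"
  shows "\<exists>\<tau>\<in>G. card \<tau> = card N"
proof -
  define Y where "Y = {\<tau>\<in>G. card \<tau> < card N}"
  have "\<exists>q. q \<in> fcone (v ` N) \<and> (\<forall>\<tau>\<in>Y. q \<notin> span \<tau>)"
    by (rule generic_point[OF N fanD(2)[OF f]]) (use fanD(3,4)[OF f] in \<open>auto simp: Y_def\<close>)
  then obtain q where q: "q \<in> fcone (v ` N)" "\<forall>\<tau>\<in>Y. q \<notin> span \<tau>" by blast
  obtain t where t: "t \<in> cpos G" "vval t = q" using fan_cover[OF f q(1)] .
  have r: "rsupp t \<in> G" using t by (simp add: cpos_def)
  have "q \<in> span (rsupp t)" unfolding t(2)[symmetric] vval_def by (intro span_sum span_scale span_base)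
  hence "rsupp t \<notin> Y" using q(2) by blast
  hence "card (rsupp t) \<ge> card N" using r by (simp add: Y_def)
  moreover have "card (rsupp t) \<le> card N" using fan_card_le[OF f r] N by (simp add: card_image)
  ultimately show ?thesis using r by (intro bexI[of _ "rsupp t"]) auto
qed

section \<open>Hilbert functions of edgewise subdivisions\<close>

text \<open>Raising \<open>G\<close> by one shifts the range of summation: the term
  \<open>G div m\<close> is lost and \<open>(G + m) div m\<close>, larger by one, is gained.\<close>

lemma hermite_identity:
  fixes G m :: nat
  assumes "m > 0"
  shows "(\<Sum>k<m. (G + k) div m) = G"
proof (induction G)
  case (Suc G)
  have "G div m + (\<Sum>k<m. (G + Suc k) div m) = (\<Sum>k<Suc m. (G + k) div m)"
    by (subst sum.lessThan_Suc_shift) simp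
  also have "\<dots> = G + (G + m) div m" by (simp add: Suc.IH)
  also have "(G + m) div m = G div m + 1" using assms by simp
  finally show ?case by simp
qed simp

text \<open>The partial sums \<open>esd_iota\<close> with the index moved by one, so that they start
  with the value 0.\<close>

definition iot :: "'v list \<Rightarrow> ('v \<Rightarrow> nat) \<Rightarrow> nat \<Rightarrow> nat" where
  "iot vs f j = (\<Sum>i<j. f (vs ! i))"

definition near :: "'v list \<Rightarrow> ('v \<Rightarrow> nat) \<Rightarrow> ('v \<Rightarrow> nat) \<Rightarrow> bool" where
  "near vs f g \<longleftrightarrow> (\<forall>j\<le>length vs. iot vs g j \<le> iot vs f j \<and> iot vs f j \<le> iot vs g j + 1)"

lemma iot_0 [simp]: "iot vs f 0 = 0" by (simp add: iot_def)
lemma iot_Suc: "iot vs f (Suc j) = iot vs f j + f (vs ! j)" by (simp add: iot_def)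

lemma iot_length: "distinct vs \<Longrightarrow> iot vs f (length vs) = (\<Sum>v\<in>set vs. f v)"
  unfolding iot_def by (rule sum.reindex_bij_betw[OF bij_betw_nth]) auto

lemma iot_ext:
  assumes "supp f \<subseteq> set vs" "supp g \<subseteq> set vs" "\<And>j. j \<le> length vs \<Longrightarrow> iot vs f j = iot vs g j"
  shows "f = g"
proof
  fix x show "f x = g x"
  proof (cases "x \<in> set vs")
    case True
    then obtain i where i: "i < length vs" "x = vs ! i" by (auto simp: in_set_conv_nth)
    have "iot vs f (Suc i) = iot vs g (Suc i)" "iot vs f i = iot vs g i" using assms(3) i by auto
    thus ?thesis by (simp add: iot_Suc i)
  next
    case False
    hence "x \<notin> supp f" "x \<notin> supp g" using assms by blast+
    thus ?thesis by (simp add: supp_def)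
  qed
qed

lemma near_iff:
  "(\<forall>j<length vs. esd_iota vs f j - esd_iota vs g j \<in> {0, 1}) \<longleftrightarrow> near vs f g"
proof -
  have e: "esd_iota vs f j = int (iot vs f (Suc j))" for f j
    by (simp add: esd_iota_def iot_def lessThan_Suc_atMost)
  have c: "(int a - int b \<in> {0, 1}) \<longleftrightarrow> b \<le> a \<and> a \<le> b + 1" for a b by auto
  show ?thesis unfolding near_def e c
  proof (intro iffI allI impI)
    fix j assume h: "\<forall>j<length vs. iot vs g (Suc j) \<le> iot vs f (Suc j) \<and> iot vs f (Suc j) \<le> iot vs g (Suc j) + 1"
      and j: "j \<le> length vs"
    show "iot vs g j \<le> iot vs f j \<and> iot vs f j \<le> iot vs g j + 1"
      using h[rule_format, of "j - 1"] j by (cases j) auto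
  qed auto
qed

lemma esd_iff:
  "E \<in> esd r vs \<Gamma> \<longleftrightarrow> E \<subseteq> esd_verts r vs \<Gamma> \<and> (\<Union>f\<in>E. supp f) \<in> \<Gamma> \<and> (\<forall>f\<in>E. \<forall>g\<in>E. near vs f g \<or> near vs g f)"
  unfolding esd_def near_iff by blast

section \<open>Multisets of subdivision vertices and monomials of the complex\<close>

locale ordered_complex =
  fixes vs :: "'v list" and \<Gamma> :: "'v set set"
  assumes dist: "distinct vs" and sub: "S \<in> \<Gamma> \<Longrightarrow> S \<subseteq> set vs" and down: "S \<in> \<Gamma> \<Longrightarrow> T \<subseteq> S \<Longrightarrow> T \<in> \<Gamma>"
begin

lemma edeg_face: "supp f \<in> \<Gamma> \<Longrightarrow> edeg f = (\<Sum>x\<in>set vs. f x)"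
  unfolding edeg_def by (rule sum.mono_neutral_left) (use sub in \<open>auto simp: supp_def\<close>)

lemma finite_faces: "finite \<Gamma>"
  by (rule finite_subset[of _ "Pow (set vs)"]) (use sub in auto)

lemma finite_face: "S \<in> \<Gamma> \<Longrightarrow> finite S"
  using sub finite_subset by blast

lemma esd_verts_eq: "esd_verts r vs \<Gamma> = expo \<Gamma> r"
  using edeg_face by (auto simp: esd_verts_def expo_def)

lemma finite_esd_verts: "finite (esd_verts r vs \<Gamma>)"
  unfolding esd_verts_eq using finite_expo finite_faces finite_face by blast

lemma esd_verts_supp: "f \<in> esd_verts r vs \<Gamma> \<Longrightarrow> supp f \<subseteq> set vs"
  using sub by (auto simp: esd_verts_def)

lemma finite_esd: "finite (esd r vs \<Gamma>)"
  by (rule finite_subset[of _ "Pow (esd_verts r vs \<Gamma>)"]) (auto simp: esd_iff finite_esd_verts)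

lemma finite_esd_face: "E \<in> esd r vs \<Gamma> \<Longrightarrow> finite E"
  using finite_subset[OF _ finite_esd_verts] by (auto simp: esd_iff)

lemma esd_down: "E \<in> esd r vs \<Gamma> \<Longrightarrow> E' \<subseteq> E \<Longrightarrow> E' \<in> esd r vs \<Gamma>"
  unfolding esd_iff using down[of "\<Union>f\<in>E. supp f" "\<Union>f\<in>E'. supp f"] by blast

lemma iot_vert: "f \<in> esd_verts r vs \<Gamma> \<Longrightarrow> iot vs f (length vs) = r"
  using iot_length[OF dist] by (simp add: esd_verts_def)

text \<open>Here \<open>a\<close> is a multiset of vertices of the subdivision; each vertex is
  itself an exponent, and \<open>total\<close> multiplies the corresponding monomials.\<close>

definition total :: "nat \<Rightarrow> (('v \<Rightarrow> nat) \<Rightarrow> nat) \<Rightarrow> 'v \<Rightarrow> nat" where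
  "total r a x = (\<Sum>f\<in>esd_verts r vs \<Gamma>. a f * f x)"

lemma total_supp:
  assumes "supp a \<subseteq> esd_verts r vs \<Gamma>"
  shows "supp (total r a) = (\<Union>f\<in>supp a. supp f)" "total r a x = (\<Sum>f\<in>supp a. a f * f x)"
    "edeg a = (\<Sum>f\<in>esd_verts r vs \<Gamma>. a f)"
proof -
  have "total r a x \<noteq> 0 \<longleftrightarrow> (\<exists>f\<in>esd_verts r vs \<Gamma>. a f * f x \<noteq> 0)" for x
    unfolding total_def using finite_esd_verts by simp
  thus "supp (total r a) = (\<Union>f\<in>supp a. supp f)" using assms by (auto simp: supp_def)
  show "total r a x = (\<Sum>f\<in>supp a. a f * f x)" unfolding total_def
    by (rule sum.mono_neutral_right[OF finite_esd_verts assms]) (auto simp: supp_def)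
  show "edeg a = (\<Sum>f\<in>esd_verts r vs \<Gamma>. a f)" unfolding edeg_def
    by (rule sum.mono_neutral_left[OF finite_esd_verts assms]) (auto simp: supp_def)
qed

lemma iot_total: "iot vs (total r a) j = (\<Sum>f\<in>esd_verts r vs \<Gamma>. a f * iot vs f j)"
  unfolding iot_def total_def sum_distrib_left by (rule sum.swap)

text \<open>All values \<open>\<iota>(f)(j)\<close> on a face lie in \<open>{c, c + 1}\<close>, so their average determines the largest one.\<close>

lemma esd_top_vertex:
  assumes E: "supp a \<in> esd r vs \<Gamma>" and m: "edeg a = m" "m > 0"
  shows "\<exists>h\<in>supp a. \<forall>j\<le>length vs. iot vs h j = (iot vs (total r a) j + m - 1) div m"
proof -
  let ?A = "supp a" and ?L = "length vs" and ?EV = "esd_verts r vs \<Gamma>"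
  let ?s = "\<lambda>f. \<Sum>j\<le>?L. iot vs f j"
  have A: "?A \<subseteq> ?EV" "finite ?A" using E finite_esd_face by (auto simp: esd_iff)
  \<comment> \<open>The vertices of a face are totally ordered by \<open>near\<close>, so the one
    with the largest sum of partial sums is the top.\<close>
  have "?A \<noteq> {}" using m by (auto simp: edeg_def)
  hence "Max (?s ` ?A) \<in> ?s ` ?A" using A by (intro Max_in) auto
  then obtain h where h: "h \<in> ?A" "?s h = Max (?s ` ?A)" by auto
  have hmax: "?s f \<le> ?s h" if "f \<in> ?A" for f unfolding h(2) using A that by (intro Max_ge) auto
  have nr: "near vs h f" if f: "f \<in> ?A" for f
  proof (rule ccontr)
    assume n: "\<not> near vs h f"
    hence n': "near vs f h" using E f h(1) by (auto simp: esd_iff)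
    have "iot vs f j = iot vs h j" if j: "j \<le> ?L" for j
    proof (rule ccontr)
      assume "iot vs f j \<noteq> iot vs h j"
      hence "?s h < ?s f" using n' j by (intro sum_strict_mono_ex1) (auto simp: near_def intro!: bexI[of _ j])
      thus False using hmax[OF f] by simp
    qed
    thus False using n by (simp add: near_def)
  qed
  have "iot vs h j = (iot vs (total r a) j + m - 1) div m" if j: "j \<le> ?L" for j
  proof -
    let ?q = "iot vs h j" and ?G = "iot vs (total r a) j"
    have mm: "m = (\<Sum>f\<in>?EV. a f)" using total_supp(3)[OF A(1)] m by simp
    have le: "?G \<le> m * ?q" unfolding iot_total mm sum_distrib_right
    proof (rule sum_mono)
      fix f assume "f \<in> ?EV"
      show "a f * iot vs f j \<le> a f * ?q" using nr[of f] j by (cases "a f = 0") (auto simp: near_def supp_def)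
    qed
    have "(\<Sum>f\<in>?EV. a f * ?q) < (\<Sum>f\<in>?EV. a f * (iot vs f j + 1))"
    proof (rule sum_strict_mono_ex1[OF finite_esd_verts])
      show "\<forall>f\<in>?EV. a f * ?q \<le> a f * (iot vs f j + 1)"
      proof
        fix f show "a f * ?q \<le> a f * (iot vs f j + 1)"
          using nr[of f] j by (cases "a f = 0") (auto simp: near_def supp_def simp del: add_Suc_right mult_Suc_right)
      qed
      show "\<exists>f\<in>?EV. a f * ?q < a f * (iot vs f j + 1)"
        using h(1) A(1) by (intro bexI[of _ h]) (auto simp: supp_def)
    qed
    also have "(\<Sum>f\<in>?EV. a f * (iot vs f j + 1)) = ?G + m" unfolding iot_total mm
      by (simp add: sum.distrib distrib_left)
    also have "(\<Sum>f\<in>?EV. a f * ?q) = m * ?q" unfolding mm by (simp add: sum_distrib_right)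
    finally have gt: "m * ?q < ?G + m" .
    show ?thesis by (rule div_nat_eqI[symmetric]) (use le gt m in \<open>auto simp: algebra_simps\<close>)
  qed
  thus ?thesis using h(1) by blast
qed

text \<open>The total determines the top vertex of the multiset; removing one copy of it from both
  sides reduces \<open>m\<close>.\<close>

lemma total_inj:
  assumes "supp a \<in> esd r vs \<Gamma>" "supp b \<in> esd r vs \<Gamma>" "edeg a = m" "edeg b = m" "total r a = total r b"
  shows "a = b"
  using assms
proof (induction m arbitrary: a b)
  case 0
  have "supp a = {}" "supp b = {}" using 0 finite_esd_face by (auto simp: edeg_def supp_def)
  thus ?case by (auto simp: supp_def)
next
  case (Suc m)
  let ?EV = "esd_verts r vs \<Gamma>"
  obtain h where h: "h \<in> supp a" "\<forall>j\<le>length vs. iot vs h j = (iot vs (total r a) j + Suc m - 1) div Suc m"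
    using esd_top_vertex[OF Suc.prems(1,3)] by auto
  obtain h' where h': "h' \<in> supp b" "\<forall>j\<le>length vs. iot vs h' j = (iot vs (total r b) j + Suc m - 1) div Suc m"
    using esd_top_vertex[OF Suc.prems(2,4)] by auto
  have s: "supp a \<subseteq> ?EV" "supp b \<subseteq> ?EV" using Suc.prems by (auto simp: esd_iff)
  have hEV: "h \<in> ?EV" "h' \<in> ?EV" using h h' s by auto
  have hh: "h = h'"
    using iot_ext[OF esd_verts_supp[OF hEV(1)] esd_verts_supp[OF hEV(2)]] h(2) h'(2) Suc.prems(5) by simp
  define dec where "dec c = c(h := c h - 1)" for c :: "('v \<Rightarrow> nat) \<Rightarrow> nat"
  have dec: "supp (dec c) \<in> esd r vs \<Gamma> \<and> edeg (dec c) = m \<and> (\<forall>x. total r c x = total r (dec c) x + h x)"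
    if c: "supp c \<in> esd r vs \<Gamma>" "edeg c = Suc m" "h \<in> supp c" for c
  proof (intro conjI allI)
    have sd: "supp (dec c) \<subseteq> supp c" by (auto simp: dec_def supp_def)
    thus "supp (dec c) \<in> esd r vs \<Gamma>" using esd_down c(1) by blast
    have sc: "supp c \<subseteq> ?EV" using c by (auto simp: esd_iff)
    have split: "(\<Sum>f\<in>?EV. F f (c f)) = (\<Sum>f\<in>?EV. F f (dec c f)) + F h 1"
      if "\<And>f n. F f (Suc n) = F f n + F f 1" for F :: "('v \<Rightarrow> nat) \<Rightarrow> nat \<Rightarrow> nat"
    proof -
      have "c h = Suc (c h - 1)" using c(3) by (simp add: supp_def)
      hence "F h (c h) = F h (c h - 1) + F h 1" using that by metis
      moreover have "(\<Sum>f\<in>?EV-{h}. F f (c f)) = (\<Sum>f\<in>?EV-{h}. F f (dec c f))"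
        by (rule sum.cong) (auto simp: dec_def)
      ultimately show ?thesis
        unfolding sum.remove[OF finite_esd_verts hEV(1)] by (simp add: dec_def)
    qed
    have "edeg c = edeg (dec c) + 1"
      unfolding total_supp(3)[OF sc] total_supp(3)[OF order_trans[OF sd sc]] using split[of "\<lambda>f n. n"] by simp
    thus "edeg (dec c) = m" using c by simp
    fix x show "total r c x = total r (dec c) x + h x"
      unfolding total_def using split[of "\<lambda>f n. n * f x"] by simp
  qed
  have da: "supp (dec a) \<in> esd r vs \<Gamma>" "edeg (dec a) = m" "\<And>x. total r a x = total r (dec a) x + h x"
    using dec[OF Suc.prems(1,3) h(1)] by auto
  have db: "supp (dec b) \<in> esd r vs \<Gamma>" "edeg (dec b) = m" "\<And>x. total r b x = total r (dec b) x + h x"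
    using dec[OF Suc.prems(2,4)] h'(1) hh by auto
  have "total r (dec a) = total r (dec b)"
  proof
    fix x show "total r (dec a) x = total r (dec b) x" using da(3)[of x] db(3)[of x] Suc.prems(5) by simp
  qed
  from Suc.IH[OF da(1) db(1) da(2) db(2) this] have e: "dec a = dec b" .
  show ?case
  proof
    fix f show "a f = b f"
    proof (cases "f = h")
      case True
      have "a h - 1 = b h - 1" using fun_cong[OF e, of h] by (simp add: dec_def)
      thus ?thesis using h(1) h'(1) hh True by (simp add: supp_def)
    next
      case False
      thus ?thesis using fun_cong[OF e, of f] by (simp add: dec_def)
    qed
  qed
qed

text \<open>The \<open>k\<close>-th of \<open>m\<close> nearly equal parts of \<open>g\<close>: its
  partial sums are those of \<open>g\<close>, divided by \<open>m\<close> and rounded with offset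
  \<open>k\<close>. The use of \<open>inv_into\<close> only finds the position of \<open>x\<close>
  in the list.\<close>

definition layer :: "('v \<Rightarrow> nat) \<Rightarrow> nat \<Rightarrow> nat \<Rightarrow> 'v \<Rightarrow> nat" where
  "layer g m k x = (if x \<in> set vs then
     (let i = inv_into {..<length vs} ((!) vs) x in (iot vs g (Suc i) + k) div m - (iot vs g i + k) div m) else 0)"

lemma layer_nth: "i < length vs \<Longrightarrow> layer g m k (vs ! i) = (iot vs g (Suc i) + k) div m - (iot vs g i + k) div m"
proof -
  assume i: "i < length vs"
  have "inj_on ((!) vs) {..<length vs}" using dist by (simp add: inj_on_nth)
  hence "inv_into {..<length vs} ((!) vs) (vs ! i) = i" using i by (intro inv_into_f_f) auto
  thus ?thesis using i by (simp add: layer_def)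
qed

lemma iot_layer:
  assumes "k < m" "j \<le> length vs"
  shows "iot vs (layer g m k) j = (iot vs g j + k) div m"
  using assms(2)
proof (induction j)
  case (Suc j)
  have "(iot vs g j + k) div m \<le> (iot vs g (Suc j) + k) div m" by (intro div_le_mono) (simp add: iot_Suc)
  thus ?case using Suc by (simp add: iot_Suc[of _ "layer g m k"] layer_nth)
qed (use assms in simp)

text \<open>Hermite's identity says that the partial sums of the layers add up to those of
  \<open>g\<close>; differences of consecutive partial sums give the values.\<close>

lemma sum_layer:
  assumes "m > 0" "supp g \<subseteq> set vs"
  shows "(\<Sum>k<m. layer g m k x) = g x"
proof (cases "x \<in> set vs")
  case True
  then obtain i where i: "i < length vs" "x = vs ! i" by (auto simp: in_set_conv_nth)
  have s: "(\<Sum>k<m. iot vs (layer g m k) j) = iot vs g j" if "j \<le> length vs" for j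
    using that iot_layer hermite_identity[OF assms(1), of "iot vs g j"] by simp
  have "iot vs g i + (\<Sum>k<m. layer g m k x) = (\<Sum>k<m. iot vs (layer g m k) (Suc i))"
    using i s[of i] by (simp add: iot_Suc sum.distrib)
  also have "\<dots> = iot vs g i + g x" using s[of "Suc i"] i by (simp add: iot_Suc[of _ g])
  finally show ?thesis by simp
qed (use assms in \<open>auto simp: layer_def supp_def\<close>)

lemma total_surj:
  assumes g: "supp g \<in> \<Gamma>" "edeg g = r * m"
  shows "\<exists>a. supp a \<in> esd r vs \<Gamma> \<and> edeg a = m \<and> total r a = g"
proof (cases "m = 0")
  case True
  have "finite (supp g)" using g finite_face by blast
  hence "supp g = {}" using g True by (auto simp: edeg_def supp_def)
  hence "g = (\<lambda>_. 0)" "{} \<in> \<Gamma>" using g by (auto simp: supp_def)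
  moreover have "supp (\<lambda>_::'v\<Rightarrow>nat. 0::nat) = {}" by (simp add: supp_def)
  ultimately show ?thesis using True
    by (intro exI[of _ "\<lambda>_. 0"]) (auto simp: esd_iff edeg_def total_def)
next
  case False
  hence m: "m > 0" by simp
  have sg: "supp g \<subseteq> set vs" using sub g by blast
  \<comment> \<open>Layers may coincide, so multiplicities have to be counted.\<close>
  define a where "a f = card {k\<in>{..<m}. layer g m k = f}" for f
  have sa: "supp a = layer g m ` {..<m}" unfolding supp_def a_def by auto
  have sl: "(\<Union>k\<in>{..<m}. supp (layer g m k)) = supp g"
  proof -
    have "g x \<noteq> 0 \<longleftrightarrow> (\<exists>k<m. layer g m k x \<noteq> 0)" for x
      unfolding sum_layer[OF m sg, of x, symmetric] by auto
    thus ?thesis by (auto simp: supp_def)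
  qed
  have lv: "layer g m k \<in> esd_verts r vs \<Gamma>" if k: "k < m" for k
  proof -
    have "supp (layer g m k) \<subseteq> supp g" using sl k by blast
    hence "supp (layer g m k) \<in> \<Gamma>" using down g by blast
    moreover have "(\<Sum>x\<in>set vs. layer g m k x) = (iot vs g (length vs) + k) div m"
      unfolding iot_length[OF dist, symmetric] by (rule iot_layer[OF k]) simp
    moreover have "iot vs g (length vs) = r * m" using g edeg_face iot_length[OF dist] by simp
    ultimately show ?thesis using k by (simp add: esd_verts_def)
  qed
  have "near vs (layer g m k) (layer g m l)" if "l \<le> k" "k < m" for k l
    unfolding near_def
  proof (intro allI impI conjI)
    fix j assume j: "j \<le> length vs"
    show "iot vs (layer g m l) j \<le> iot vs (layer g m k) j" using that j by (simp add: iot_layer div_le_mono)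
    have "(iot vs g j + k) div m \<le> (iot vs g j + l + m) div m" using that by (intro div_le_mono) simp
    thus "iot vs (layer g m k) j \<le> iot vs (layer g m l) j + 1" using that j by (simp add: iot_layer)
  qed
  hence near: "near vs (layer g m k) (layer g m l) \<or> near vs (layer g m l) (layer g m k)" if "k < m" "l < m" for k l
    using that by (cases "l \<le> k") auto
  have E: "supp a \<in> esd r vs \<Gamma>" unfolding esd_iff sa using lv near sl g(1) by auto
  have img: "(\<Sum>f\<in>supp a. a f * c f) = (\<Sum>k<m. c (layer g m k))" for c :: "_ \<Rightarrow> nat"
    unfolding sum.image_gen[OF finite_lessThan, of "\<lambda>k. c (layer g m k)" m "layer g m"] sa
    by (rule sum.cong) (auto simp: a_def)
  have "edeg a = m" unfolding edeg_def using img[of "\<lambda>_. 1"] by simp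
  moreover have "total r a = g"
  proof
    fix x
    have "supp a \<subseteq> esd_verts r vs \<Gamma>" using E by (simp add: esd_iff)
    thus "total r a x = g x" by (simp add: total_supp(2) img sum_layer[OF m sg])
  qed
  ultimately show ?thesis using E by blast
qed

lemma total_into:
  assumes "supp a \<in> esd r vs \<Gamma>"
  shows "supp (total r a) \<in> \<Gamma>" "edeg (total r a) = r * edeg a"
proof -
  have s: "supp a \<subseteq> esd_verts r vs \<Gamma>" using assms by (simp add: esd_iff)
  show t: "supp (total r a) \<in> \<Gamma>" using assms by (simp add: total_supp(1)[OF s] esd_iff)
  have "edeg (total r a) = (\<Sum>f\<in>esd_verts r vs \<Gamma>. a f * iot vs f (length vs))"
    unfolding edeg_face[OF t] iot_length[OF dist, symmetric] iot_total ..
  also have "\<dots> = (\<Sum>f\<in>esd_verts r vs \<Gamma>. a f * r)" by (rule sum.cong) (auto simp: iot_vert)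
  also have "\<dots> = r * edeg a" unfolding total_supp(3)[OF s] by (simp add: sum_distrib_left mult.commute)
  finally show "edeg (total r a) = r * edeg a" .
qed

theorem esd_hilbert: "card (expo (esd r vs \<Gamma>) m) = card (expo \<Gamma> (r * m))"
proof (rule bij_betw_same_card)
  show "bij_betw (total r) (expo (esd r vs \<Gamma>) m) (expo \<Gamma> (r * m))"
    unfolding bij_betw_def
  proof (intro conjI inj_onI equalityI subsetI)
    fix a b assume "a \<in> expo (esd r vs \<Gamma>) m" "b \<in> expo (esd r vs \<Gamma>) m" "total r a = total r b"
    thus "a = b" using total_inj[of a r b m] by (auto simp: expo_def)
  next
    fix g assume "g \<in> total r ` expo (esd r vs \<Gamma>) m"
    thus "g \<in> expo \<Gamma> (r * m)" using total_into by (auto simp: expo_def)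
  next
    fix g assume "g \<in> expo \<Gamma> (r * m)"
    then obtain a where "supp a \<in> esd r vs \<Gamma>" "edeg a = m" "total r a = g" using total_surj[of g r m] unfolding expo_def by blast
    thus "g \<in> total r ` expo (esd r vs \<Gamma>) m" by (auto simp: expo_def)
  qed
qed

text \<open>On a face with union of supports \<open>S\<close>, a vertex is determined by \<open>\<iota>\<close> at the elements of \<open>S\<close> other than the last one.\<close>

lemma esd_face_card_le:
  assumes E: "E \<in> esd r vs \<Gamma>" and r: "r > 0"
  shows "card E \<le> card (\<Union>f\<in>E. supp f)"
proof (cases "E = {}")
  case False
  let ?L = "length vs"
  define S where "S = (\<Union>f\<in>E. supp f)"
  define P where "P = {i. i < ?L \<and> vs ! i \<in> S}"
  have SG: "S \<in> \<Gamma>" and EV: "E \<subseteq> esd_verts r vs \<Gamma>" using E by (auto simp: esd_iff S_def)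
  have fP: "finite P" by (auto simp: P_def)
  have cP: "card P = card S"
  proof (rule bij_betw_same_card)
    show "bij_betw ((!) vs) P S" unfolding bij_betw_def
    proof
      show "inj_on ((!) vs) P" using dist by (intro inj_on_nth) (auto simp: P_def)
      show "(!) vs ` P = S" using sub[OF SG] by (auto simp: P_def in_set_conv_nth image_iff subset_iff)
    qed
  qed
  have Pne: "P \<noteq> {}"
  proof
    assume "P = {}"
    hence "S = {}" using cP finite_face[OF SG] by simp
    then obtain f where "f \<in> E" "supp f = {}" using False by (auto simp: S_def)
    thus False using EV r by (auto simp: esd_verts_def supp_def)
  qed
  define J where "J = Suc ` (P - {Max P})"
  have cJ: "card J = card S - 1" "finite J" using fP Pne by (simp_all add: J_def card_image cP)
  have JL: "j \<le> ?L" if "j \<in> J" for j using that by (auto simp: J_def P_def)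
  have out: "f (vs ! i) = 0" if "f \<in> E" "i < ?L" "i \<notin> P" for f i
    using that by (auto simp: P_def S_def supp_def)
  have last: "iot vs f j = r" if f: "f \<in> E" and j: "Max P < j" "j \<le> ?L" for f j
  proof -
    have "iot vs f ?L = iot vs f j" unfolding iot_def
    proof (rule sum.mono_neutral_right)
      show "\<forall>i\<in>{..<?L} - {..<j}. f (vs ! i) = 0"
      proof
        fix i assume i: "i \<in> {..<?L} - {..<j}"
        hence "i \<notin> P" using j Max_ge[OF fP, of i] by auto
        thus "f (vs ! i) = 0" using out[OF f] i by auto
      qed
    qed (use j in auto)
    thus ?thesis using iot_vert f EV by auto
  qed
  have ext: "f = g" if fg: "f \<in> E" "g \<in> E" and eq: "\<And>j. j \<in> J \<Longrightarrow> iot vs f j = iot vs g j" for f g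
  proof (rule iot_ext)
    show "supp f \<subseteq> set vs" "supp g \<subseteq> set vs" using esd_verts_supp EV fg by auto
    show "iot vs f j = iot vs g j" if "j \<le> ?L" for j using that
    proof (induction j)
      case (Suc j)
      consider "j \<notin> P" | "j = Max P" | "Suc j \<in> J" by (auto simp: J_def)
      thus ?case
      proof cases
        case 1 thus ?thesis using out[OF fg(1), of j] out[OF fg(2), of j] Suc by (simp add: iot_Suc)
      next
        case 2 thus ?thesis using last[OF fg(1), of "Suc j"] last[OF fg(2), of "Suc j"] Suc.prems by simp
      qed (rule eq)
    qed simp
  qed
  let ?s = "\<lambda>f. \<Sum>j\<in>J. iot vs f j"
  have near: "near vs f g \<or> near vs g f" if "f \<in> E" "g \<in> E" for f g using E that by (auto simp: esd_iff)
  \<comment> \<open>Of two vertices of a face one dominates the other, so equal sums over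
    \<open>J\<close> force equal partial sums on \<open>J\<close>, which determine the
    vertex.\<close>
  have inj: "inj_on ?s E"
  proof (rule inj_onI, rule ccontr)
    have main: False if fg: "f \<in> E" "g \<in> E" "?s f = ?s g" "f \<noteq> g" and n: "near vs f g" for f g
    proof -
      obtain j where j: "j \<in> J" "iot vs f j \<noteq> iot vs g j" using ext[OF fg(1,2)] fg(4) by blast
      have "?s g < ?s f"
        by (rule sum_strict_mono_ex1[OF cJ(2)]) (use n j JL in \<open>auto simp: near_def intro!: bexI[of _ j] le_neq_trans\<close>)
      thus False using fg(3) by simp
    qed
    fix f g assume "f \<in> E" "g \<in> E" "?s f = ?s g" "f \<noteq> g"
    thus False using near[of f g] main[of f g] main[of g f] by auto
  qed
  have fE: "finite (?s ` E)" using finite_esd_face[OF E] by blast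
  define c where "c = Min (?s ` E)"
  have "c \<in> ?s ` E" unfolding c_def using fE False by (intro Min_in) auto
  then obtain h where h: "h \<in> E" "c = ?s h" by auto
  \<comment> \<open>Each partial sum exceeds that of the lowest vertex by at most 1. The sums thus
    take at most \<open>card J + 1 = card S\<close> values.\<close>
  have "?s ` E \<subseteq> {c..c + card J}"
  proof
    fix s assume "s \<in> ?s ` E"
    then obtain f where f: "f \<in> E" "s = ?s f" by auto
    have "?s f \<le> (\<Sum>j\<in>J. iot vs h j + 1)"
    proof (rule sum_mono)
      fix j assume "j \<in> J"
      thus "iot vs f j \<le> iot vs h j + 1" using near[OF f(1) h(1)] JL[of j] by (auto simp: near_def)
    qed
    hence "s \<le> c + card J" unfolding f(2) h(2) by (simp add: sum_Suc)
    moreover have "c \<le> s" unfolding c_def using fE \<open>s \<in> ?s ` E\<close> by (rule Min_le)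
    ultimately show "s \<in> {c..c + card J}" by simp
  qed
  hence "card (?s ` E) \<le> card {c..c + card J}" by (intro card_mono) auto
  moreover have "card S > 0" using Pne fP cP by (metis card_gt_0_iff)
  ultimately show ?thesis using cJ card_image[OF inj] by (simp add: S_def)
qed simp

text \<open>The small simplex at a corner \<open>w\<close> of \<open>S\<close>: each of its vertices
  consists of r - 1 copies of \<open>w\<close> and one copy of an element of
  \<open>S\<close>.\<close>

lemma esd_full_face:
  assumes S: "S \<in> \<Gamma>" and r: "r > 0"
  shows "\<exists>E\<in>esd r vs \<Gamma>. card E = card S"
proof (cases "S = {}")
  case True
  thus ?thesis using S by (intro bexI[of _ "{}"]) (auto simp: esd_iff)
next
  case False
  then obtain w where w: "w \<in> S" by auto
  define f where "f v u = (if u = w then r - 1 else 0) + (if u = v then 1 else 0)" for v u :: 'v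
  have fS: "finite S" "S \<subseteq> set vs" using S sub finite_face by auto
  have sp: "supp (f v) \<subseteq> S" "v \<in> supp (f v)" if "v \<in> S" for v using that w by (auto simp: f_def supp_def)
  have io: "iot vs (f v) j = iot vs (\<lambda>u. if u = w then r - 1 else 0) j + iot vs (\<lambda>u. if u = v then 1 else 0) j" for v j
    unfolding iot_def f_def by (rule sum.distrib)
  define ind where "ind v j = iot vs (\<lambda>u. if u = v then 1 else (0::nat)) j" for v j
  have chi: "ind (vs ! i) j = (if i < j then 1 else 0)" if "i < length vs" "j \<le> length vs" for i j
  proof -
    have "ind (vs ! i) j = (\<Sum>k<j. if k = i then 1 else 0)" unfolding ind_def iot_def
      by (rule sum.cong) (use that nth_eq_iff_index_eq[OF dist] in auto)
    thus ?thesis by simp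
  qed
  have near: "near vs (f v) (f u) \<or> near vs (f u) (f v)" if vu: "v \<in> S" "u \<in> S" for u v
  proof -
    obtain i k where ik: "i < length vs" "v = vs ! i" "k < length vs" "u = vs ! k"
      using vu fS by (metis in_set_conv_nth subsetD)
    have "near vs (f v) (f u)" if "i \<le> k" using that ik chi unfolding near_def io ind_def[symmetric] by auto
    moreover have "near vs (f u) (f v)" if "k \<le> i" using that ik chi unfolding near_def io ind_def[symmetric] by auto
    ultimately show ?thesis by linarith
  qed
  have "(\<Sum>x\<in>set vs. f v x) = r" if "v \<in> S" for v
    using that w fS r by (auto simp: f_def sum.distrib subset_iff)
  hence "f v \<in> esd_verts r vs \<Gamma>" if "v \<in> S" for v using that sp down[OF S] by (simp add: esd_verts_def)
  moreover have "(\<Union>v\<in>S. supp (f v)) = S" using sp by blast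
  ultimately have "f ` S \<in> esd r vs \<Gamma>" using near S by (auto simp: esd_iff)
  moreover have "inj_on f S"
  proof (rule inj_onI)
    fix u v assume "f u = f v"
    hence "f u u = f v u" by simp
    thus "u = v" by (auto simp: f_def split: if_splits)
  qed
  ultimately show ?thesis by (intro bexI[of _ "f ` S"]) (auto simp: card_image)
qed

end

section \<open>Sections of polynomials and the h-polynomial of the subdivision\<close>

definition sect :: "nat \<Rightarrow> nat \<Rightarrow> 'a::comm_ring_1 poly \<Rightarrow> 'a poly" where
  "sect r i p = (\<Sum>k\<le>degree p. monom (coeff p (r * k + i)) k)"

lemma coeff_sect: "r > 0 \<Longrightarrow> coeff (sect r i p) k = coeff p (r * k + i)"
proof -
  assume r: "r > 0"
  have "k \<le> r * k" using r by simp
  hence "coeff p (r * k + i) = 0" if "degree p < k" using that by (intro coeff_eq_0) linarith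
  moreover have "coeff (sect r i p) k = (\<Sum>j\<le>degree p. if j = k then coeff p (r * j + i) else 0)"
    by (simp add: sect_def coeff_sum)
  ultimately show ?thesis by (cases "degree p < k") auto
qed

definition unity_poly :: "nat \<Rightarrow> real poly" where "unity_poly r = (\<Sum>i<r. monom 1 i)"

lemma unity_poly_fps: "fps_of_poly (unity_poly r) * (1 - fps_X) = 1 - fps_X ^ r"
proof -
  have "fps_of_poly (unity_poly r) = (\<Sum>i<r. fps_X ^ i)"
    by (simp add: unity_poly_def fps_of_poly_sum fps_of_poly_monom)
  thus ?thesis using power_diff_1_eq[of "fps_X :: real fps" r] by (simp add: algebra_simps)
qed

lemma h_poly_eq_tri_h:
  assumes "finite K" "K \<noteq> {}"
  shows "h_poly K = tri_h (cdim1 K) K"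
proof -
  let ?d = "cdim1 K"
  have le: "card S \<le> ?d" if "S \<in> K" for S unfolding cdim1_def using assms that by (intro Max_ge) auto
  have "tri_h ?d K = (\<Sum>i\<in>{..?d}. \<Sum>S\<in>{S\<in>K. card S = i}. monom 1 (card S) * [:1, -1:] ^ (?d - card S))"
    unfolding tri_h_def by (rule sum.group[symmetric]) (use assms le in auto)
  also have "\<dots> = h_poly K" unfolding h_poly_def face_num_def
  proof (rule sum.cong[OF refl])
    fix i
    have "(\<Sum>S\<in>{S\<in>K. card S = i}. monom 1 (card S) * [:1, -1:] ^ (?d - card S)) =
      (\<Sum>S\<in>{S\<in>K. card S = i}. monom (1::real) i * [:1, -1:] ^ (?d - i))" by (rule sum.cong) auto
    thus "(\<Sum>S\<in>{S\<in>K. card S = i}. monom 1 (card S) * [:1, -1:] ^ (?d - card S)) =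
      smult (real (card {S\<in>K. card S = i})) (monom 1 i * [:1, -1:] ^ (?d - i))" by (simp add: of_nat_poly)
  qed
  finally show ?thesis ..
qed

lemma tri_h_fps:
  assumes "\<And>S. S \<in> K \<Longrightarrow> card S \<le> d"
  shows "fps_of_poly (tri_h d K) = (\<Sum>S\<in>K. geo_fps ^ card S) * (1 - fps_X) ^ d"
  unfolding tri_h_def fps_of_poly_sum sum_distrib_right
proof (rule sum.cong[OF refl])
  fix S assume "S \<in> K"
  hence "d = card S + (d - card S)" using assms[of S] by simp
  hence "geo_fps ^ card S * (1 - fps_X) ^ d = (geo_fps ^ card S * (1 - fps_X) ^ card S) * (1 - fps_X) ^ (d - card S)"
    by (metis mult.assoc power_add)
  thus "fps_of_poly (monom 1 (card S) * [:1, -1:] ^ (d - card S)) = geo_fps ^ card S * (1 - fps_X) ^ d"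
    by (simp add: geo_fps_power fps_of_poly_mult fps_of_poly_power fps_one_minus fps_of_poly_monom)
qed

lemma card_expo:
  assumes "finite K" "\<And>S. S \<in> K \<Longrightarrow> finite S"
  shows "real (card (expo K m)) = (\<Sum>S\<in>K. geo_fps ^ card S) $ m"
proof -
  have "expo K m = (\<Union>S\<in>K. {a. supp a = S \<and> edeg a = m})" by (auto simp: expo_def)
  also have "card \<dots> = (\<Sum>S\<in>K. card {a. supp a = S \<and> edeg a = m})"
  proof (rule card_UN_disjoint[OF assms(1)])
    show "\<forall>S\<in>K. finite {a. supp a = S \<and> edeg a = m}"
    proof
      fix S assume "S \<in> K"
      thus "finite {a. supp a = S \<and> edeg a = m}"
        by (intro finite_subset[OF _ finite_expo[of "{S}" m]]) (use assms in \<open>auto simp: expo_def\<close>)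
    qed
  qed auto
  finally show ?thesis by (simp add: fps_sum_nth card_exponents[OF assms(2)])
qed

text \<open>Taking every r-th coefficient turns multiplication by x^r into multiplication by
  x.\<close>

lemma section_fps_power:
  fixes A B :: "real fps"
  assumes r: "r > 0" and AB: "\<And>m. A $ m = B $ (r * m)"
  shows "(A * (1 - fps_X) ^ d) $ m = (B * (1 - fps_X ^ r) ^ d) $ (r * m)"
proof (induction d arbitrary: m)
  case (Suc d)
  let ?A = "A * (1 - fps_X) ^ d" and ?B = "B * (1 - fps_X ^ r) ^ d"
  have "(A * (1 - fps_X) ^ Suc d) $ m = ?A $ m - (fps_X * ?A) $ m"
    by (simp add: algebra_simps flip: fps_sub_nth)
  also have "\<dots> = ?B $ (r * m) - (if m = 0 then 0 else ?B $ (r * (m - 1)))" by (simp add: Suc.IH)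
  also have "\<dots> = ?B $ (r * m) - (fps_X ^ r * ?B) $ (r * m)"
    using r by (cases m) (simp_all add: fps_X_power_mult_nth)
  also have "\<dots> = (B * (1 - fps_X ^ r) ^ Suc d) $ (r * m)"
    by (simp add: algebra_simps flip: fps_sub_nth)
  finally show ?case .
qed (simp add: AB)

text \<open>By \<open>esd_hilbert\<close> one Hilbert series is the r-section of the other. Clearing
  denominators takes (1 - x)^d on the subdivided side and (1 - x^r)^d on the other, and 1 - x^r is U
  times 1 - x.\<close>

theorem (in ordered_complex) esd_tri_h:
  assumes r: "r > 0" and d: "\<And>S. S \<in> \<Gamma> \<Longrightarrow> card S \<le> d"
  shows "tri_h d (esd r vs \<Gamma>) = sect r 0 (unity_poly r ^ d * tri_h d \<Gamma>)"
proof (rule poly_eqI)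
  fix m
  let ?A = "\<Sum>E\<in>esd r vs \<Gamma>. geo_fps ^ card E" and ?B = "\<Sum>S\<in>\<Gamma>. geo_fps ^ card S"
  have d': "card E \<le> d" if E: "E \<in> esd r vs \<Gamma>" for E
    using esd_face_card_le[OF E r] d[of "\<Union>f\<in>E. supp f"] E by (auto simp: esd_iff)
  have AB: "?A $ m = ?B $ (r * m)" for m
    using card_expo[of "esd r vs \<Gamma>" m, OF finite_esd finite_esd_face] card_expo[OF finite_faces finite_face, where m="r * m"]
    by (simp add: esd_hilbert)
  have "coeff (tri_h d (esd r vs \<Gamma>)) m = (?A * (1 - fps_X) ^ d) $ m"
    using tri_h_fps[of "esd r vs \<Gamma>" d] d' by (simp flip: fps_of_poly_nth)
  also have "\<dots> = (?B * (1 - fps_X ^ r) ^ d) $ (r * m)" by (rule section_fps_power[OF r AB])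
  also have "?B * (1 - fps_X ^ r) ^ d = fps_of_poly (unity_poly r ^ d * tri_h d \<Gamma>)"
    using tri_h_fps[of \<Gamma> d] d
    by (simp add: fps_of_poly_mult fps_of_poly_power mult_ac flip: unity_poly_fps power_mult_distrib)
  also have "\<dots> $ (r * m) = coeff (sect r 0 (unity_poly r ^ d * tri_h d \<Gamma>)) m" using r by (simp add: coeff_sect)
  finally show "coeff (tri_h d (esd r vs \<Gamma>)) m = coeff (sect r 0 (unity_poly r ^ d * tri_h d \<Gamma>)) m" .
qed

lemma (in ordered_complex) cdim1_esd:
  assumes r: "r > 0" and d: "\<And>S. S \<in> \<Gamma> \<Longrightarrow> card S \<le> d" and S: "S \<in> \<Gamma>" "card S = d"
  shows "cdim1 (esd r vs \<Gamma>) = d"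
  unfolding cdim1_def
proof (rule Max_eqI)
  show "finite (card ` esd r vs \<Gamma>)" using finite_esd by blast
  fix y assume "y \<in> card ` esd r vs \<Gamma>"
  then obtain E where E: "E \<in> esd r vs \<Gamma>" "y = card E" by auto
  thus "y \<le> d" using esd_face_card_le[OF E(1) r] d[of "\<Union>f\<in>E. supp f"] by (auto simp: esd_iff)
next
  show "d \<in> card ` esd r vs \<Gamma>" using esd_full_face[OF S(1) r] S(2) by (metis imageI)
qed

text \<open>The full simplex has h-polynomial (x + (1 - x))^n = 1.\<close>

lemma esd_simplex_h_eq:
  assumes r: "r > 0"
  shows "esd_simplex_h n r = sect r 0 (unity_poly r ^ n)"
proof -
  interpret ordered_complex "[0..<n]" "Pow {0..<n}" by unfold_locales auto
  have c: "card S \<le> n" if "S \<in> Pow {0..<n}" for S using card_mono[of "{0..<n}" S] that by auto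
  have "tri_h n (Pow {0..<n}) = (monom 1 1 + [:1, -1:]) ^ n"
    using sum_Pow_powers[of "{0..<n}" "monom 1 1" "[:1, -1:] :: real poly"] by (simp add: tri_h_def monom_power)
  also have "monom 1 1 + [:1, -1:] = (1 :: real poly)" by (simp add: monom_altdef one_pCons)
  finally have t: "tri_h n (Pow {0..<n}) = 1" by simp
  have "esd r [0..<n] (Pow {0..<n}) \<noteq> {}" using esd_full_face[OF _ r, of "{}"] by auto
  hence "esd_simplex_h n r = tri_h n (esd r [0..<n] (Pow {0..<n}))"
    unfolding esd_simplex_h_def using h_poly_eq_tri_h[OF finite_esd] cdim1_esd[OF r c, of "{0..<n}"] by simp
  also have "\<dots> = sect r 0 (unity_poly r ^ n)" using esd_tri_h[OF r c] t by simp
  finally show ?thesis .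
qed

section \<open>Sections of polynomials in the upper half plane\<close>

definition cv :: "real poly \<Rightarrow> complex \<Rightarrow> complex" where
  "cv p z = poly (map_poly of_real p) z"

lemma cv_0 [simp]: "cv 0 z = 0" by (simp add: cv_def)

lemma cv_pCons [simp]: "cv (pCons a p) z = of_real a + z * cv p z"
  by (simp add: cv_def map_poly_pCons)

lemma cv_add [simp]: "cv (p + q) z = cv p z + cv q z"
proof -
  have "map_poly complex_of_real (p + q) = map_poly of_real p + map_poly of_real q"
    by (rule poly_eqI) (simp add: coeff_map_poly)
  thus ?thesis by (simp add: cv_def)
qed

lemma cv_smult [simp]: "cv (smult c p) z = of_real c * cv p z"
  by (induction p) (simp_all add: algebra_simps)

lemma cv_minus [simp]: "cv (p - q) z = cv p z - cv q z"
  using cv_add[of "p - q" q z] by (simp add: algebra_simps)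

lemma cv_sum [simp]: "cv (\<Sum>i\<in>A. f i) z = (\<Sum>i\<in>A. cv (f i) z)"
  by (induction A rule: infinite_finite_induct) auto

lemma cv_mult [simp]: "cv (p * q) z = cv p z * cv q z"
  by (induction p) (simp_all add: algebra_simps)

lemma cv_1 [simp]: "cv 1 z = 1" by (simp add: one_pCons)

lemma cv_of_real: "cv p (of_real x) = of_real (poly p x)"
  by (induction p) auto

lemma cv_cnj: "cv p (cnj z) = cnj (cv p z)"
  by (induction p) auto

section \<open>The cone spanned by 1 and z, that is, arguments between 0 and arg z\<close>

definition ucone :: "complex \<Rightarrow> complex set" where
  "ucone z = {of_real a + of_real b * z | a b. a \<ge> 0 \<and> b \<ge> 0}"

lemma uconeI: "a \<ge> 0 \<Longrightarrow> b \<ge> 0 \<Longrightarrow> w = of_real a + of_real b * z \<Longrightarrow> w \<in> ucone z"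
  by (auto simp: ucone_def)

lemma ucone_add: "v \<in> ucone z \<Longrightarrow> w \<in> ucone z \<Longrightarrow> v + w \<in> ucone z"
proof -
  assume "v \<in> ucone z" "w \<in> ucone z"
  then obtain a b c d where "a \<ge> 0" "b \<ge> 0" "c \<ge> 0" "d \<ge> 0"
    "v = of_real a + of_real b * z" "w = of_real c + of_real d * z" by (auto simp: ucone_def)
  thus ?thesis by (intro uconeI[of "a + c" "b + d"]) (auto simp: algebra_simps)
qed

lemma ucone_scale: "c \<ge> 0 \<Longrightarrow> w \<in> ucone z \<Longrightarrow> of_real c * w \<in> ucone z"
proof -
  assume c: "c \<ge> 0" and "w \<in> ucone z"
  then obtain a b where "a \<ge> 0" "b \<ge> 0" "w = of_real a + of_real b * z" by (auto simp: ucone_def)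
  thus ?thesis using c by (intro uconeI[of "c * a" "c * b"]) (auto simp: algebra_simps)
qed

lemma ucone_real: "c \<ge> 0 \<Longrightarrow> of_real c \<in> ucone z"
  by (rule uconeI[of c 0]) auto

lemma ucone_zero [simp]: "0 \<in> ucone z"
  using ucone_real[of 0 z] by simp

lemma ucone_sum: "(\<And>i. i \<in> A \<Longrightarrow> f i \<in> ucone z) \<Longrightarrow> (\<Sum>i\<in>A. f i) \<in> ucone z"
  by (induction A rule: infinite_finite_induct) (auto intro: ucone_add)

lemma ucone_norm: "w * cnj w \<in> ucone z"
  unfolding complex_norm_square[symmetric] using ucone_real[of "(cmod w)\<^sup>2"] by simp

text \<open>Reflection of the cone in its bisector: an argument t becomes arg z - t.\<close>

lemma ucone_reflect: "w \<in> ucone z \<Longrightarrow> z * cnj w \<in> ucone z"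
proof -
  assume "w \<in> ucone z"
  then obtain a b where ab: "a \<ge> 0" "b \<ge> 0" "w = of_real a + of_real b * z" by (auto simp: ucone_def)
  have "z * cnj w = of_real a * z + of_real b * (z * cnj z)" unfolding ab(3) by (simp add: algebra_simps)
  also have "\<dots> = of_real (b * (cmod z)\<^sup>2) + of_real a * z"
    by (simp only: of_real_mult complex_norm_square add.commute)
  finally show ?thesis using ab by (intro uconeI[of "b * (cmod z)\<^sup>2" a]) auto
qed

lemma ucone_pointed:
  assumes z: "Im z > 0" and s: "c \<ge> 0" "w \<in> ucone z" "of_real c + w = 0"
  shows "c = 0"
proof -
  obtain a b where ab: "a \<ge> 0" "b \<ge> 0" "w = of_real a + of_real b * z" using s(2) by (auto simp: ucone_def)
  have "b * Im z = 0" using arg_cong[OF s(3), of Im] ab(3) by simp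
  hence "b = 0" using z by simp
  thus ?thesis using arg_cong[OF s(3), of Re] ab s(1) by simp
qed

lemma ucone_antisym:
  assumes z: "Im z > 0" and v: "v \<in> ucone z" and w: "w \<in> ucone z" and s: "v + w = 0"
  shows "v = 0"
proof -
  obtain a b where ab: "a \<ge> 0" "b \<ge> 0" "v = of_real a + of_real b * z" using v by (auto simp: ucone_def)
  have "of_real b * z + w \<in> ucone z" by (rule ucone_add[OF _ w], rule uconeI[of 0 b]) (use ab in auto)
  moreover have "of_real a + (of_real b * z + w) = 0" using s ab by (simp add: add.assoc)
  ultimately have a: "a = 0" using ucone_pointed[OF z ab(1)] by blast
  obtain c d where cd: "c \<ge> 0" "d \<ge> 0" "w = of_real c + of_real d * z" using w by (auto simp: ucone_def)
  have "(b + d) * Im z = 0" using arg_cong[OF s, of Im] ab cd by (simp add: algebra_simps)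
  thus ?thesis using z a ab cd by simp
qed

text \<open>The arguments of \<open>c\<^sub>0, \<dots>, c\<^sub>r\<^sub>-\<^sub>1\<close> decrease, and they differ by at most \<open>arg z\<close>.\<close>

definition arranged :: "nat \<Rightarrow> complex \<Rightarrow> (nat \<Rightarrow> complex) \<Rightarrow> bool" where
  "arranged r z c \<longleftrightarrow> (\<forall>i k. i \<le> k \<longrightarrow> k < r \<longrightarrow> c i * cnj (c k) \<in> ucone z)"

lemma arranged_sum:
  assumes "arranged r z c" "\<And>s t. s \<in> S \<Longrightarrow> t \<in> T \<Longrightarrow> s \<le> t \<and> t < r"
  shows "(\<Sum>s\<in>S. c s) * cnj (\<Sum>t\<in>T. c t) \<in> ucone z"
  unfolding cnj_sum sum_product by (intro ucone_sum) (use assms in \<open>auto simp: arranged_def\<close>)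

text \<open>\<open>A\<close> and \<open>C\<close> are the entries before and after the middle block;
  \<open>Y\<close> and \<open>X\<close> are the middle entries counted with and without the factor
  z. Each product in the expansion lies in the cone.\<close>

lemma ucone_window:
  assumes h: "A * cnj X \<in> ucone z" "A * cnj Y \<in> ucone z" "X * cnj C \<in> ucone z" "Y * cnj C \<in> ucone z"
    and YX: "z * (Y * cnj X) \<in> ucone z"
  shows "(A + z * (Y + C)) * cnj (A + X + z * C) \<in> ucone z"
proof -
  have "(A + z * (Y + C)) * cnj (A + X + z * C) =
    (A + z * C) * cnj (A + z * C) + A * cnj X + z * cnj (A * cnj Y) + z * cnj (X * cnj C) +
    z * (Y * cnj X) + of_real ((cmod z)\<^sup>2) * (Y * cnj C)"
    unfolding complex_norm_square by (simp add: algebra_simps)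
  also have "\<dots> \<in> ucone z"
    by (intro ucone_add ucone_norm ucone_reflect ucone_scale h YX) simp
  finally show ?thesis .
qed

section \<open>Sections of a product with U or D, formed from the sections of the other
  factor\<close>

definition windowU :: "nat \<Rightarrow> complex \<Rightarrow> (nat \<Rightarrow> complex) \<Rightarrow> nat \<Rightarrow> complex" where
  "windowU r z c j = (\<Sum>k\<le>j. c k) + z * (\<Sum>k\<in>{j<..<r}. c k)"

definition windowD :: "nat \<Rightarrow> complex \<Rightarrow> (nat \<Rightarrow> complex) \<Rightarrow> nat \<Rightarrow> complex" where
  "windowD r z c j = (\<Sum>k<j. c k) + z * (\<Sum>k\<in>{j<..<r}. c k)"

text \<open>From index \<open>i\<close> to index \<open>k\<close> the entries in between lose their
  factor z; both windows have the same middle block.\<close>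

lemma arranged_windowU:
  assumes c: "arranged r z c" shows "arranged r z (windowU r z c)"
  unfolding arranged_def
proof (intro allI impI)
  fix i k assume ik: "i \<le> k" "k < r"
  show "windowU r z c i * cnj (windowU r z c k) \<in> ucone z"
  proof (cases "i = k")
    case False
    hence ik: "i < k" "k < r" using ik by auto
    let ?A = "\<Sum>s\<le>i. c s" and ?X = "\<Sum>s\<in>{i<..k}. c s" and ?C = "\<Sum>s\<in>{k<..<r}. c s"
    have "{..k} = {..i} \<union> {i<..k}" "{i<..<r} = {i<..k} \<union> {k<..<r}" using ik by auto
    hence e: "(\<Sum>s\<le>k. c s) = ?A + ?X" "(\<Sum>s\<in>{i<..<r}. c s) = ?X + ?C"
      by (simp_all add: sum.union_disjoint[symmetric] ivl_disj_int)
    have "z * (?X * cnj ?X) = of_real ((cmod ?X)\<^sup>2) * z"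
      by (simp only: complex_norm_square mult_ac)
    also have "\<dots> \<in> ucone z" by (rule uconeI[of 0 "(cmod ?X)\<^sup>2"]) auto
    finally show ?thesis unfolding windowU_def e
      by (intro ucone_window arranged_sum[OF c]) (use ik in auto)
  qed (simp add: ucone_norm)
qed

text \<open>The windows omit their own index, so the middle blocks differ: one misses entry
  \<open>k\<close>, the other entry \<open>i\<close>.\<close>

lemma arranged_windowD:
  assumes c: "arranged r z c" shows "arranged r z (windowD r z c)"
  unfolding arranged_def
proof (intro allI impI)
  fix i k assume ik: "i \<le> k" "k < r"
  show "windowD r z c i * cnj (windowD r z c k) \<in> ucone z"
  proof (cases "i = k")
    case False
    hence ik: "i < k" "k < r" using ik by auto
    let ?A = "\<Sum>s<i. c s" and ?C = "\<Sum>s\<in>{k<..<r}. c s"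
    let ?X = "\<Sum>s\<in>{i..<k}. c s" and ?Y = "\<Sum>s\<in>{i<..k}. c s" and ?B = "\<Sum>s\<in>{i<..<k}. c s"
    have "{..<k} = {..<i} \<union> {i..<k}" "{i<..<r} = {i<..k} \<union> {k<..<r}" using ik by auto
    hence e: "(\<Sum>s<k. c s) = ?A + ?X" "(\<Sum>s\<in>{i<..<r}. c s) = ?Y + ?C"
      by (simp_all add: sum.union_disjoint[symmetric] ivl_disj_int)
    have "{i..<k} = insert i {i<..<k}" "{i<..k} = insert k {i<..<k}" using ik by auto
    hence e': "?X = c i + ?B" "?Y = c k + ?B" by simp_all
    have o: "c i * cnj ?B \<in> ucone z" "?B * cnj (c k) \<in> ucone z" "c i * cnj (c k) \<in> ucone z"
      using arranged_sum[OF c, of "{i}" "{i<..<k}"] arranged_sum[OF c, of "{i<..<k}" "{k}"] c ik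
      by (auto simp: arranged_def)
    have "z * (?Y * cnj ?X) = z * cnj (c i * cnj (c k)) + z * cnj (?B * cnj (c k)) + z * cnj (c i * cnj ?B) +
      of_real ((cmod ?B)\<^sup>2) * z" unfolding e' complex_norm_square by (simp add: algebra_simps)
    also have "\<dots> \<in> ucone z"
      by (intro ucone_add ucone_reflect o uconeI[of 0 "(cmod ?B)\<^sup>2"]) auto
    finally show ?thesis unfolding windowD_def e
      by (intro ucone_window arranged_sum[OF c]) (use ik in auto)
  qed (simp add: ucone_norm)
qed

text \<open>Divide by the nonzero entry of largest key: every summand then lies in the pointed cone,
  and this entry contributes a positive real number, so the sum cannot vanish.\<close>

lemma ordered_sum_zero:
  fixes key :: "nat \<Rightarrow> nat"
  assumes z: "Im z > 0" and I: "finite I" "\<And>s t. s \<in> I \<Longrightarrow> t \<in> I \<Longrightarrow> key s \<le> key t \<Longrightarrow> w s * cnj (w t) \<in> ucone z"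
    and zero: "(\<Sum>s\<in>I. w s) = 0" and s: "s \<in> I"
  shows "w s = 0"
proof (rule ccontr)
  assume ns: "w s \<noteq> 0"
  define J where "J = {s\<in>I. w s \<noteq> 0}"
  have J: "finite J" "J \<noteq> {}" using I(1) s ns by (auto simp: J_def)
  hence "Max (key ` J) \<in> key ` J" by (intro Max_in) auto
  then obtain t where t: "t \<in> J" "key t = Max (key ` J)" by auto
  have "w s * cnj (w t) \<in> ucone z" if "s \<in> I" for s
  proof (cases "w s = 0")
    case False
    hence "key s \<le> key t" using that J unfolding t(2) by (intro Max_ge) (auto simp: J_def)
    thus ?thesis using I(2) that t(1) by (auto simp: J_def)
  qed simp
  hence o: "(\<Sum>s\<in>I-{t}. w s * cnj (w t)) \<in> ucone z" by (intro ucone_sum) auto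
  have tI: "t \<in> I" using t by (simp add: J_def)
  have "0 = (\<Sum>s\<in>I. w s * cnj (w t))" using zero by (simp flip: sum_distrib_right)
  also have "\<dots> = of_real ((cmod (w t))\<^sup>2) + (\<Sum>s\<in>I-{t}. w s * cnj (w t))"
    unfolding complex_norm_square by (rule sum.remove[OF I(1) tI])
  finally have "of_real ((cmod (w t))\<^sup>2) + (\<Sum>s\<in>I-{t}. w s * cnj (w t)) = 0" ..
  from ucone_pointed[OF z _ o this] have "(cmod (w t))\<^sup>2 = 0" by simp
  thus False using t by (simp add: J_def)
qed

text \<open>Both windows are sums of numbers ordered by argument. The entries behind
  \<open>j\<close>, which carry the factor z, come first; hence the key adds \<open>r\<close> to the
  remaining indices.\<close>

lemma window_zero:
  assumes z: "Im z > 0" and c: "arranged r z c" and j: "j < r"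
  shows "windowU r z c j = 0 \<Longrightarrow> k < r \<Longrightarrow> c k = 0"
    and "windowD r z c j = 0 \<Longrightarrow> k < r \<Longrightarrow> k \<noteq> j \<Longrightarrow> c k = 0"
proof -
  let ?w = "\<lambda>k. if k \<le> j then c k else z * c k" and ?key = "\<lambda>k. if k \<le> j then k + r else k"
  have z0: "z \<noteq> 0" using z by auto
  have o: "?w s * cnj (?w t) \<in> ucone z" if st: "s < r" "t < r" "?key s \<le> ?key t" for s t
  proof -
    have m: "i \<le> k \<Longrightarrow> k < r \<Longrightarrow> c i * cnj (c k) \<in> ucone z" for i k using c by (simp add: arranged_def)
    consider "s \<le> j" "t \<le> j" "s \<le> t" | "j < s" "j < t" "s \<le> t" | "j < s" "t \<le> j"
      using st by (auto split: if_splits)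
    thus ?thesis
    proof cases
      case 1 thus ?thesis using m st by auto
    next
      case 2
      have "?w s * cnj (?w t) = of_real ((cmod z)\<^sup>2) * (c s * cnj (c t))"
        using 2 unfolding complex_norm_square by (simp add: algebra_simps)
      thus ?thesis using ucone_scale[OF _ m[OF 2(3) st(2)], of "(cmod z)\<^sup>2"] by simp
    next
      case 3
      have e: "?w s * cnj (?w t) = z * cnj (c t * cnj (c s))" using 3 by (simp add: algebra_simps)
      show ?thesis unfolding e by (rule ucone_reflect, rule m) (use 3 st in auto)
    qed
  qed
  have nz: "c k = 0" if "?w k = 0" for k using that z0 by (auto split: if_splits)
  have sU: "(\<Sum>k<r. ?w k) = windowU r z c j"
  proof -
    have "{..<r} = {..j} \<union> {j<..<r}" using j by auto
    thus ?thesis by (simp add: windowU_def sum.union_disjoint ivl_disj_int sum_distrib_left)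
  qed
  show "c k = 0" if h: "windowU r z c j = 0" "k < r"
    by (rule nz, rule ordered_sum_zero[OF z, of "{..<r}" ?key]) (use o h sU in auto)
  have sD: "(\<Sum>k\<in>{..<r}-{j}. ?w k) = windowD r z c j"
  proof -
    have "{..<r} - {j} = {..<j} \<union> {j<..<r}" using j by auto
    moreover have "{..<j} \<inter> {j<..<r} = {}" by auto
    ultimately show ?thesis by (simp add: windowD_def sum.union_disjoint sum_distrib_left)
  qed
  show "c k = 0" if h: "windowD r z c j = 0" "k < r" "k \<noteq> j"
    by (rule nz, rule ordered_sum_zero[OF z, of "{..<r} - {j}" ?key]) (use o h sD in auto)
qed

section \<open>Sections of the products of powers of x, U and D\<close>

lemma sect_diff: "r > 0 \<Longrightarrow> sect r i (p - q) = sect r i p - sect r i q"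
  by (rule poly_eqI) (simp add: coeff_sect)

lemma sect_smult: "r > 0 \<Longrightarrow> sect r i (smult c p) = smult c (sect r i p)"
  by (rule poly_eqI) (simp add: coeff_sect)

lemma sect_sum: "r > 0 \<Longrightarrow> sect r i (\<Sum>x\<in>A. f x) = (\<Sum>x\<in>A. sect r i (f x))"
  by (rule poly_eqI) (simp add: coeff_sect coeff_sum)

lemma sect_monom_mult:
  assumes "i < r" "j \<le> r"
  shows "sect r i (monom 1 j * p) = (if j \<le> i then sect r (i - j) p else pCons 0 (sect r (r + i - j) p))"
proof (rule poly_eqI)
  fix k
  have r: "r > 0" using assms by simp
  show "coeff (sect r i (monom 1 j * p)) k = coeff (if j \<le> i then sect r (i - j) p else pCons 0 (sect r (r + i - j) p)) k"
  proof (cases k)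
    case 0 thus ?thesis using r by (auto simp: coeff_sect coeff_monom_mult)
  next
    case (Suc l)
    have "r * k + i - j = r * k + (i - j)" if "j \<le> i" using that by simp
    moreover have "r * k + i - j = r * l + (r + i - j)" "j \<le> r * k + i" using Suc assms by auto
    ultimately show ?thesis using r Suc by (auto simp: coeff_sect coeff_monom_mult)
  qed
qed

definition secs :: "nat \<Rightarrow> real poly \<Rightarrow> complex \<Rightarrow> nat \<Rightarrow> complex" where
  "secs r p z i = cv (sect r i p) z"

definition diff_poly :: "nat \<Rightarrow> real poly" where "diff_poly r = unity_poly r - 1"

lemma secs_monom:
  "i < r \<Longrightarrow> j \<le> r \<Longrightarrow> secs r (monom 1 j * p) z i = (if j \<le> i then secs r p z (i - j) else z * secs r p z (r + i - j))"
  by (simp add: secs_def sect_monom_mult)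

lemma secs_unity:
  assumes i: "i < r" shows "secs r (unity_poly r * p) z i = windowU r z (secs r p z) i"
proof -
  have r: "r > 0" using i by simp
  have "secs r (unity_poly r * p) z i = (\<Sum>j<r. secs r (monom 1 j * p) z i)"
    by (simp add: secs_def unity_poly_def sum_distrib_right sect_sum[OF r])
  also have "\<dots> = (\<Sum>j<r. if j \<le> i then secs r p z (i - j) else z * secs r p z (r + i - j))"
    by (rule sum.cong) (auto simp: secs_monom[OF i])
  also have "{..<r} = {..i} \<union> {i<..<r}" using i by auto
  also have "(\<Sum>j\<in>\<dots>. if j \<le> i then secs r p z (i - j) else z * secs r p z (r + i - j)) =
     (\<Sum>j\<le>i. secs r p z (i - j)) + z * (\<Sum>j\<in>{i<..<r}. secs r p z (r + i - j))"
    by (simp add: sum.union_disjoint ivl_disj_int sum_distrib_left)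
  also have "(\<Sum>j\<le>i. secs r p z (i - j)) = (\<Sum>k\<le>i. secs r p z k)"
    by (rule sum.reindex_bij_witness[of _ "\<lambda>k. i - k" "\<lambda>k. i - k"]) auto
  also have "(\<Sum>j\<in>{i<..<r}. secs r p z (r + i - j)) = (\<Sum>k\<in>{i<..<r}. secs r p z k)"
    by (rule sum.reindex_bij_witness[of _ "\<lambda>k. r + i - k" "\<lambda>k. r + i - k"]) auto
  finally show ?thesis by (simp add: windowU_def)
qed

lemma secs_diff:
  assumes i: "i < r" shows "secs r (diff_poly r * p) z i = windowD r z (secs r p z) i"
proof -
  have r: "r > 0" using i by simp
  have "secs r (diff_poly r * p) z i = windowU r z (secs r p z) i - secs r p z i"
    unfolding secs_unity[OF i, symmetric] by (simp add: diff_poly_def left_diff_distrib secs_def sect_diff[OF r])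
  thus ?thesis by (simp add: windowU_def windowD_def lessThan_Suc_atMost[symmetric])
qed

lemma arranged_cong: "arranged r z c \<Longrightarrow> (\<And>i. i < r \<Longrightarrow> c' i = c i) \<Longrightarrow> arranged r z c'"
  by (auto simp: arranged_def)

text \<open>A cyclic shift in which the entries that wrap around gain the factor z. Arguments spread
  over at most arg z remain ordered in this way.\<close>

lemma arranged_monom:
  assumes c: "arranged r z (secs r p z)" and j: "j \<le> r"
  shows "arranged r z (secs r (monom 1 j * p) z)"
  unfolding arranged_def
proof (intro allI impI)
  fix i k assume ik: "i \<le> k" "k < r"
  have m: "s \<le> t \<Longrightarrow> t < r \<Longrightarrow> secs r p z s * cnj (secs r p z t) \<in> ucone z" for s t using c by (simp add: arranged_def)
  consider "j \<le> i" | "i < j" "j \<le> k" | "k < j" by linarith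
  thus "secs r (monom 1 j * p) z i * cnj (secs r (monom 1 j * p) z k) \<in> ucone z"
  proof cases
    case 1 thus ?thesis using ik j m[of "i - j" "k - j"] by (simp add: secs_monom)
  next
    case 2
    have "z * cnj (secs r p z (k - j) * cnj (secs r p z (r + i - j))) \<in> ucone z"
      by (rule ucone_reflect, rule m) (use 2 ik j in auto)
    moreover have "secs r (monom 1 j * p) z i * cnj (secs r (monom 1 j * p) z k) =
      z * cnj (secs r p z (k - j) * cnj (secs r p z (r + i - j)))" using 2 ik j by (simp add: secs_monom)
    ultimately show ?thesis by (simp only:)
  next
    case 3
    have "of_real ((cmod z)\<^sup>2) * (secs r p z (r + i - j) * cnj (secs r p z (r + k - j))) \<in> ucone z"
      by (rule ucone_scale[OF _ m]) (use 3 ik j in auto)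
    moreover have "secs r (monom 1 j * p) z i * cnj (secs r (monom 1 j * p) z k) =
      of_real ((cmod z)\<^sup>2) * (secs r p z (r + i - j) * cnj (secs r p z (r + k - j)))"
      using 3 ik j unfolding complex_norm_square by (simp add: secs_monom)
    ultimately show ?thesis by (simp only:)
  qed
qed

lemma secs_1: "r > 0 \<Longrightarrow> i < r \<Longrightarrow> secs r 1 z i = (if i = 0 then 1 else 0)"
proof -
  assume r: "r > 0" "i < r"
  have "sect r i 1 = (if i = 0 then 1 else (0 :: real poly))"
    by (rule poly_eqI) (use r in \<open>auto simp: coeff_sect\<close>)
  thus ?thesis by (cases "i = 0") (simp_all add: secs_def)
qed

definition chain_poly :: "nat \<Rightarrow> nat \<Rightarrow> nat \<Rightarrow> nat \<Rightarrow> real poly" where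
  "chain_poly r i a b = monom 1 i * (diff_poly r ^ b * unity_poly r ^ a)"

lemma arranged_powers:
  assumes r: "r > 0"
  shows "arranged r z (secs r (diff_poly r ^ b * unity_poly r ^ a) z)"
proof (induction b)
  case 0
  show ?case
  proof (induction a)
    case 0
    show ?case using r by (auto simp: arranged_def secs_1 ucone_real[of 1, simplified])
  next
    case (Suc a)
    show ?case by (intro arranged_cong[OF arranged_windowU[OF Suc.IH]]) (simp add: secs_unity)
  qed
next
  case (Suc b)
  show ?case by (intro arranged_cong[OF arranged_windowD[OF Suc.IH]]) (simp add: secs_diff mult.assoc)
qed

lemma arranged_chain_poly:
  assumes "r > 0" "i \<le> r" shows "arranged r z (secs r (chain_poly r i a b) z)"
  unfolding chain_poly_def by (rule arranged_monom[OF arranged_powers[OF assms(1)] assms(2)])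

section \<open>Nonvanishing and argument comparisons in the upper half plane\<close>

context
  fixes z :: complex and r :: nat
  assumes z: "Im z > 0" and r: "r > 0"
begin

lemma unity_power_nonzero: "j < r \<Longrightarrow> secs r (unity_poly r ^ Suc a) z j \<noteq> 0"
proof (induction a arbitrary: j)
  case 0
  show ?case
  proof
    assume "secs r (unity_poly r ^ Suc 0) z j = 0"
    hence "windowU r z (secs r 1 z) j = 0" using secs_unity[OF 0, of 1] by simp
    from window_zero(1)[OF z _ 0 this r] arranged_powers[OF r, of z 0 0] show False using r by (simp add: secs_1)
  qed
next
  case (Suc a)
  show ?case
  proof
    assume "secs r (unity_poly r ^ Suc (Suc a)) z j = 0"
    hence "windowU r z (secs r (unity_poly r ^ Suc a) z) j = 0" using secs_unity[OF Suc.prems, of "unity_poly r ^ Suc a"] by simp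
    from window_zero(1)[OF z _ Suc.prems this r] arranged_powers[OF r, of z 0 "Suc a"] show False using Suc.IH[OF r] by simp
  qed
qed

text \<open>The window for D omits index \<open>j\<close>, so a nonzero section at another index is
  required.\<close>

lemma diff_nonzero:
  assumes c: "arranged r z (secs r p z)" and j: "j < r" and k: "k < r" "k \<noteq> j" "secs r p z k \<noteq> 0"
  shows "secs r (diff_poly r * p) z j \<noteq> 0"
  using window_zero(2)[OF z c j _ k(1,2)] k(3) by (auto simp: secs_diff[OF j])

lemma powers_nonzero: "j < r \<Longrightarrow> b = 0 \<or> r \<ge> 2 \<Longrightarrow> secs r (diff_poly r ^ b * unity_poly r ^ Suc a) z j \<noteq> 0"
proof (induction b arbitrary: j)
  case 0
  thus ?case using unity_power_nonzero by (simp del: power_Suc)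
next
  case (Suc b)
  obtain k where k: "k < r" "k \<noteq> j" using Suc.prems by (metis One_nat_def less_2_cases_iff less_le_trans nat.distinct(1) pos2)
  show ?case
    using diff_nonzero[OF arranged_powers[OF r] Suc.prems(1) k Suc.IH[OF k(1)]] Suc.prems(2)
    by (simp add: mult.assoc del: power_Suc) (simp add: mult.assoc)
qed

lemma chain_poly_nonzero:
  assumes "j < r" "b = 0 \<or> r \<ge> 2" "i \<le> r"
  shows "secs r (chain_poly r i (Suc a) b) z j \<noteq> 0"
  unfolding chain_poly_def secs_monom[OF assms(1,3)] using powers_nonzero assms z by auto

text \<open>Powers of D alone can have vanishing sections: for r = 2 one has D = x, and the odd
  section of its powers vanishes every other time. From r = 3 on, a second positive index is
  available at each step.\<close>

lemma diff_power_nonzero: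
  assumes "r \<ge> 2" "r = 2 \<longrightarrow> b = 0"
  shows "\<exists>k<r. k > 0 \<and> secs r (diff_poly r ^ Suc b) z k \<noteq> 0"
  using assms(2)
proof (induction b)
  case 0
  have "arranged r z (secs r 1 z)" using arranged_powers[OF r, of z 0 0] by simp
  from diff_nonzero[OF this, of 1 0] show ?case using assms r by (intro exI[of _ 1]) (auto simp: secs_1)
next
  case (Suc b)
  then obtain k where k: "k < r" "k > 0" "secs r (diff_poly r ^ Suc b) z k \<noteq> 0" by auto
  have "arranged r z (secs r (diff_poly r ^ Suc b) z)" using arranged_powers[OF r, of z "Suc b" 0] by simp
  from diff_nonzero[OF this, of "if k = 1 then 2 else 1" k] k Suc.prems assms
  show ?case by (intro exI[of _ "if k = 1 then 2 else 1"]) auto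
qed

lemma chain_poly_0_nonzero:
  assumes n: "2 \<le> n" "n \<le> r" shows "secs r (chain_poly r 0 0 n) z 0 \<noteq> 0"
proof -
  obtain b where b: "n = Suc (Suc b)" using n by (metis Suc_le_D numeral_2_eq_2 Suc_le_mono)
  obtain k where k: "k < r" "k > 0" "secs r (diff_poly r ^ Suc b) z k \<noteq> 0"
    using diff_power_nonzero[of b] n b by auto
  have "arranged r z (secs r (diff_poly r ^ Suc b) z)" using arranged_powers[OF r, of z "Suc b" 0] by simp
  from diff_nonzero[OF this r k(1) _ k(3)] k(2) show ?thesis by (simp add: chain_poly_def b)
qed

text \<open>For j > 0 the 0-th section after the shift is z times section \<open>r - j\<close>
  before it, and section 0 exceeds that section in argument by at most arg z.\<close>

lemma chain_shift:
  assumes "i + j \<le> r"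
  shows "secs r (chain_poly r (i + j) a b) z 0 * cnj (secs r (chain_poly r i a b) z 0) \<in> ucone z"
proof -
  have c: "arranged r z (secs r (chain_poly r i a b) z)" by (rule arranged_chain_poly[OF r]) (use assms in simp)
  have e: "chain_poly r (i + j) a b = monom 1 j * chain_poly r i a b"
    by (simp add: chain_poly_def mult.assoc[symmetric] mult_monom add.commute)
  show ?thesis
  proof (cases "j = 0")
    case True thus ?thesis by (simp add: ucone_norm)
  next
    case False
    have "secs r (chain_poly r i a b) z 0 * cnj (secs r (chain_poly r i a b) z (r - j)) \<in> ucone z"
      using c False r by (simp add: arranged_def)
    from ucone_reflect[OF this] show ?thesis unfolding e using False assms r by (simp add: secs_monom algebra_simps)
  qed
qed

text \<open>With \<open>T\<close> the sum of the sections of positive index, the 0-th sections of U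
  p, D p and x U p are \<open>c0 + z T\<close>, \<open>z T\<close> and \<open>z (c0 + T)\<close>. So
  D is caught between U and x U.\<close>

lemma chain_up:
  assumes "i < r"
  shows "secs r (chain_poly r i a (Suc b)) z 0 * cnj (secs r (chain_poly r i (Suc a) b) z 0) \<in> ucone z"
    and "secs r (chain_poly r (Suc i) (Suc a) b) z 0 * cnj (secs r (chain_poly r i a (Suc b)) z 0) \<in> ucone z"
proof -
  let ?p = "chain_poly r i a b" let ?c = "secs r ?p z"
  have c: "arranged r z ?c" by (rule arranged_chain_poly[OF r]) (use assms in simp)
  have e: "chain_poly r i a (Suc b) = diff_poly r * ?p" "chain_poly r i (Suc a) b = unity_poly r * ?p"
    by (simp_all add: chain_poly_def mult_ac)
  have e': "chain_poly r (Suc i) (Suc a) b = monom 1 1 * (unity_poly r * ?p)"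
    unfolding e(2)[symmetric] by (simp add: chain_poly_def mult.assoc[symmetric] mult_monom)
  let ?T = "\<Sum>k\<in>{0<..<r}. ?c k"
  have o: "?c 0 * cnj ?T \<in> ucone z" using arranged_sum[OF c, of "{0}" "{0<..<r}"] by auto
  have D: "secs r (diff_poly r * ?p) z 0 = z * ?T" by (simp add: secs_diff[OF r] windowD_def)
  have U: "secs r (unity_poly r * ?p) z 0 = ?c 0 + z * ?T" by (simp add: secs_unity[OF r] windowU_def)
  have "secs r (unity_poly r * ?p) z (r - 1) = (\<Sum>k\<le>r-1. ?c k)"
  proof -
    have "{r - 1<..<r} = {}" by auto
    thus ?thesis using r by (simp add: secs_unity windowU_def)
  qed
  also have "{..r - 1} = insert 0 {0<..<r}" using r by auto
  finally have X: "secs r (monom 1 1 * (unity_poly r * ?p)) z 0 = z * (?c 0 + ?T)"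
    using r by (subst secs_monom) auto
  have "z * ?T * cnj (?c 0 + z * ?T) = (z * ?T) * cnj (z * ?T) + z * cnj (?c 0 * cnj ?T)" by (simp add: algebra_simps)
  also have "\<dots> \<in> ucone z" by (intro ucone_add ucone_norm ucone_reflect o)
  finally show "secs r (chain_poly r i a (Suc b)) z 0 * cnj (secs r (chain_poly r i (Suc a) b) z 0) \<in> ucone z"
    unfolding e D U .
  have "z * (?c 0 + ?T) * cnj (z * ?T) = of_real ((cmod z)\<^sup>2) * (?c 0 * cnj ?T) + (z * ?T) * cnj (z * ?T)"
    unfolding complex_norm_square by (simp add: algebra_simps)
  also have "\<dots> \<in> ucone z" by (intro ucone_add ucone_norm ucone_scale o) simp
  finally show "secs r (chain_poly r (Suc i) (Suc a) b) z 0 * cnj (secs r (chain_poly r i a (Suc b)) z 0) \<in> ucone z"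
    unfolding e(1) e' D X .
qed

end

section \<open>Arguments and interlacing\<close>

lemma map_poly_of_real_degree: "degree (map_poly complex_of_real p) = degree p"
  by (rule degree_map_poly) simp

lemma real_rooted_iff: "real_rooted p \<longleftrightarrow> p = 0 \<or> (\<forall>z. Im z > 0 \<longrightarrow> cv p z \<noteq> 0)"
proof -
  have "z \<in> \<real>" if h: "\<forall>z. Im z > 0 \<longrightarrow> cv p z \<noteq> 0" "cv p z = 0" for z
  proof -
    have "\<not> Im z > 0" "\<not> Im (cnj z) > 0" using h cv_cnj[of p z] by auto
    thus ?thesis by (simp add: complex_is_Real_iff)
  qed
  thus ?thesis unfolding real_rooted_def cv_def[symmetric] by (auto simp: complex_is_Real_iff)
qed

lemma real_rooted_factor:
  assumes "real_rooted p" "p \<noteq> 0"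
  shows "p = smult (lead_coeff p) (\<Prod>x\<in>#proots p. [:-x, 1:])"
  using assms
proof (induction "degree p" arbitrary: p rule: less_induct)
  case less
  show ?case
  proof (cases "degree p = 0")
    case True
    then obtain c where "p = [:c:]" by (rule degree_eq_zeroE)
    thus ?thesis by simp
  next
    case False
    have "\<exists>z. cv p z = 0" unfolding cv_def
      by (rule fundamental_theorem_of_algebra) (simp add: constant_degree map_poly_of_real_degree False)
    then obtain z where "cv p z = 0" ..
    moreover from this obtain x where "z = of_real x"
      using less.prems unfolding real_rooted_def cv_def by (metis Reals_cases)
    ultimately have "poly p x = 0" by (simp add: cv_of_real)
    then obtain q where q: "p = [:-x, 1:] * q" by (auto simp: poly_eq_0_iff_dvd)
    have q0: "q \<noteq> 0" using q less.prems by auto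
    have "degree p = Suc (degree q)" unfolding q using q0 by (subst degree_mult_eq) auto
    moreover have "real_rooted q" using less.prems unfolding real_rooted_iff q by (auto simp del: mult_pCons_left)
    ultimately have IH: "q = smult (lead_coeff q) (\<Prod>x\<in>#proots q. [:-x, 1:])" using less.hyps q0 by simp
    have "proots p = {#x#} + proots q" unfolding q using q0 by (subst proots_mult) auto
    moreover have "lead_coeff p = lead_coeff q" unfolding q lead_coeff_mult by simp
    ultimately have "smult (lead_coeff p) (\<Prod>x\<in>#proots p. [:-x, 1:]) = [:-x, 1:] * smult (lead_coeff q) (\<Prod>x\<in>#proots q. [:-x, 1:])"
      by (simp del: mult_pCons_left)
    thus ?thesis using IH q by simp
  qed
qed

text \<open>A continuous branch of the argument of p in the closed upper half plane away from the
  roots. On the real axis each root to the right of the point contributes pi.\<close>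

definition argsum :: "real poly \<Rightarrow> complex \<Rightarrow> real" where
  "argsum p z = (\<Sum>x\<in>#proots p. Arg2pi (z - of_real x))"

text \<open>Nonnegative coefficients exclude positive roots, so \<open>argsum\<close> vanishes on
  the positive real axis, which normalizes the comparison of two branches.\<close>

definition stable :: "real poly \<Rightarrow> bool" where
  "stable p \<longleftrightarrow> p \<noteq> 0 \<and> (\<forall>k. coeff p k \<ge> 0) \<and> (\<forall>z. Im z > 0 \<longrightarrow> cv p z \<noteq> 0)"

lemma stable_real_rooted: "stable p \<Longrightarrow> real_rooted p"
  by (auto simp: stable_def real_rooted_iff)

lemma stable_roots: "stable p \<Longrightarrow> x \<in># proots p \<Longrightarrow> x \<le> 0"
proof (rule ccontr)
  assume p: "stable p" and x: "x \<in># proots p" "\<not> x \<le> 0"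
  have p0: "p \<noteq> 0" and nn: "\<And>k. coeff p k \<ge> 0" using p by (auto simp: stable_def)
  have "lead_coeff p > 0" using p0 nn[of "degree p"] by (metis leading_coeff_0_iff order_le_less)
  hence "0 < lead_coeff p * x ^ degree p" using x(2) by simp
  also have "\<dots> \<le> (\<Sum>k\<le>degree p. coeff p k * x ^ k)"
    by (rule member_le_sum) (use nn x in \<open>auto intro!: mult_nonneg_nonneg\<close>)
  also have "\<dots> = poly p x" by (simp add: poly_altdef)
  finally show False using x(1) p0 by simp
qed

lemma cv_polar:
  assumes p: "stable p" and z: "Im z > 0"
  obtains \<rho> where "\<rho> > 0" "cv p z = of_real \<rho> * cis (argsum p z)"
proof -
  have m: "cv (\<Prod>x\<in>#M. [:-x, 1:]) z = of_real (\<Prod>x\<in>#M. cmod (z - of_real x)) * cis (\<Sum>x\<in>#M. Arg2pi (z - of_real x))" for M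
  proof (induction M)
    case (add x M)
    have "z - of_real x = of_real (cmod (z - of_real x)) * cis (Arg2pi (z - of_real x))"
      using Arg2pi_eq[of "z - of_real x"] by (simp add: cis_conv_exp)
    moreover have "cv [:-x, 1:] z = z - of_real x" by simp
    ultimately have "cv (\<Prod>x\<in>#add_mset x M. [:-x, 1:]) z =
      (of_real (cmod (z - of_real x)) * cis (Arg2pi (z - of_real x))) * cv (\<Prod>x\<in>#M. [:-x, 1:]) z"
      by (simp del: mult_pCons_left cv_pCons)
    thus ?case unfolding add.IH by (simp add: cis_mult[symmetric] mult_ac)
  qed simp
  have "lead_coeff p > 0" using p by (metis stable_def leading_coeff_0_iff order_le_less)
  moreover have "(\<Prod>x\<in>#M. cmod (z - of_real x)) > 0" for M
  proof (induction M)
    case (add x M)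
    have "z - of_real x \<noteq> 0" using z by (auto simp: complex_eq_iff)
    thus ?case using add by simp
  qed simp
  moreover have "cv p z = of_real (lead_coeff p * (\<Prod>x\<in>#proots p. cmod (z - of_real x))) * cis (argsum p z)"
    using arg_cong[OF real_rooted_factor[OF stable_real_rooted[OF p]], of "\<lambda>p. cv p z"] p m
    by (simp add: stable_def argsum_def)
  ultimately show ?thesis using that by (metis mult_pos_pos)
qed

text \<open>The two sines are the signs of the coordinates of the point in the basis 1, z;
  membership in the cone is thereby expressed without choosing a representative of the
  angle.\<close>

lemma ucone_cis:
  assumes z: "Im z > 0" and \<rho>: "\<rho> > 0"
  shows "of_real \<rho> * cis t \<in> ucone z \<longleftrightarrow> sin t \<ge> 0 \<and> sin (Arg2pi z - t) \<ge> 0"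
proof -
  let ?\<theta> = "Arg2pi z" and ?R = "cmod z"
  have zz: "Re z = ?R * cos ?\<theta>" "Im z = ?R * sin ?\<theta>" by (simp_all add: cos_Arg2pi sin_Arg2pi)
  have pos: "?R > 0" "sin ?\<theta> > 0" using z zz(2) by (auto simp: zero_less_mult_iff)
  show ?thesis
  proof
    assume "of_real \<rho> * cis t \<in> ucone z"
    then obtain a b where ab: "a \<ge> 0" "b \<ge> 0" "of_real \<rho> * cis t = of_real a + of_real b * z" by (auto simp: ucone_def)
    have re: "\<rho> * cos t = a + b * (?R * cos ?\<theta>)" "\<rho> * sin t = b * (?R * sin ?\<theta>)"
      using arg_cong[OF ab(3), of Re] arg_cong[OF ab(3), of Im] zz by auto
    have "\<rho> * sin t \<ge> 0" unfolding re using ab pos by simp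
    moreover have "\<rho> * sin (?\<theta> - t) = sin ?\<theta> * (\<rho> * cos t) - cos ?\<theta> * (\<rho> * sin t)"
      by (simp add: sin_diff algebra_simps)
    hence "\<rho> * sin (?\<theta> - t) = a * sin ?\<theta>" unfolding re by (simp add: algebra_simps)
    hence "\<rho> * sin (?\<theta> - t) \<ge> 0" using ab pos by simp
    ultimately show "sin t \<ge> 0 \<and> sin (?\<theta> - t) \<ge> 0" using \<rho> by (simp add: zero_le_mult_iff)
  next
    assume s: "sin t \<ge> 0 \<and> sin (?\<theta> - t) \<ge> 0"
    let ?b = "\<rho> * sin t / (?R * sin ?\<theta>)" and ?a = "\<rho> * sin (?\<theta> - t) / sin ?\<theta>"
    show "of_real \<rho> * cis t \<in> ucone z"
    proof (rule uconeI[of ?a ?b])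
      have b: "?b * (?R * c) = \<rho> * sin t * c / sin ?\<theta>" for c using pos by (simp add: field_simps)
      have "\<rho> * cos t = ?a + ?b * (?R * cos ?\<theta>)"
        unfolding b using pos by (simp add: field_simps sin_diff)
      moreover have "\<rho> * sin t = ?b * (?R * sin ?\<theta>)" unfolding b using pos by simp
      moreover have "Re (of_real \<rho> * cis t) = \<rho> * cos t" "Im (of_real \<rho> * cis t) = \<rho> * sin t"
        "Re (of_real ?a + of_real ?b * z) = ?a + ?b * Re z" "Im (of_real ?a + of_real ?b * z) = ?b * Im z" by simp_all
      ultimately show "of_real \<rho> * cis t = of_real ?a + of_real ?b * z"
        unfolding complex_eq_iff zz by (simp only:)
    qed (use s pos \<rho> in auto)
  qed
qed

lemma stable_ucone_iff:
  assumes fg: "stable f" "stable g" and z: "Im z > 0"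
  shows "cv g z * cnj (cv f z) \<in> ucone z \<longleftrightarrow>
    sin (argsum g z - argsum f z) \<ge> 0 \<and> sin (Arg2pi z - (argsum g z - argsum f z)) \<ge> 0"
proof -
  obtain a where a: "a > 0" "cv f z = of_real a * cis (argsum f z)" using cv_polar[OF fg(1) z] .
  obtain b where b: "b > 0" "cv g z = of_real b * cis (argsum g z)" using cv_polar[OF fg(2) z] .
  have e: "cv g z * cnj (cv f z) = of_real (b * a) * cis (argsum g z - argsum f z)"
    unfolding a b by (simp add: cis_cnj cis_mult mult_ac flip: diff_conv_add_uminus)
  show ?thesis unfolding e by (rule ucone_cis[OF z]) (use a(1) b(1) in simp)
qed

definition args_le :: "real poly \<Rightarrow> real poly \<Rightarrow> bool" where
  "args_le f g \<longleftrightarrow> (\<forall>z. Im z > 0 \<longrightarrow> argsum f z \<le> argsum g z)"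

definition args_close :: "real poly \<Rightarrow> real poly \<Rightarrow> bool" where
  "args_close f g \<longleftrightarrow> (\<forall>z. Im z > 0 \<longrightarrow> argsum g z \<le> argsum f z + Arg2pi z)"

lemma args_ucone:
  assumes "stable f" "stable g" "args_le f g" "args_close f g" "Im z > 0"
  shows "cv g z * cnj (cv f z) \<in> ucone z"
proof -
  let ?d = "argsum g z - argsum f z"
  have d: "0 \<le> ?d" "?d \<le> Arg2pi z" using assms unfolding args_le_def args_close_def by (simp_all add: algebra_simps)
  have "Arg2pi z < pi" using Arg2pi_lt_pi assms(5) by blast
  hence "sin ?d \<ge> 0" "sin (Arg2pi z - ?d) \<ge> 0" using d by (auto intro!: sin_ge_zero)
  thus ?thesis using stable_ucone_iff[OF assms(1,2,5)] by blast
qed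

lemma continuous_on_argsum:
  assumes "continuous_on S \<gamma>" "\<And>s x. s \<in> S \<Longrightarrow> x \<in># proots p \<Longrightarrow> Im (\<gamma> s) \<ge> 0 \<and> \<gamma> s \<noteq> of_real x"
  shows "continuous_on S (\<lambda>s. argsum p (\<gamma> s))"
proof -
  have "continuous_on S (\<lambda>s. \<Sum>x\<in>#M. Arg2pi (\<gamma> s - of_real x))" if "set_mset M \<subseteq> set_mset (proots p)" for M
    using that
  proof (induction M)
    case (add x M)
    have "continuous_on S (\<lambda>s. Arg2pi (\<gamma> s - of_real x))"
      by (rule continuous_on_compose2[OF continuous_on_upperhalf_Arg2pi])
        (use assms add.prems in \<open>auto intro!: continuous_intros\<close>)
    thus ?case using add by (auto intro!: continuous_intros)
  qed simp
  thus ?thesis unfolding argsum_def by blast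
qed

text \<open>
  The difference of the two argument sums vanishes on the positive real axis and avoids \<open>\<plusminus>\<pi>\<close> in the
  open upper half plane, so by continuity along a circular arc it stays in the principal range.
\<close>

lemma ucone_args:
  assumes fg: "stable f" "stable g" and Q: "\<And>z. Im z > 0 \<Longrightarrow> cv g z * cnj (cv f z) \<in> ucone z"
  shows "args_le f g" "args_close f g"
proof -
  have "0 \<le> argsum g z - argsum f z \<and> argsum g z - argsum f z \<le> Arg2pi z" if z: "Im z > 0" for z
  proof -
    let ?\<theta> = "Arg2pi z" and ?R = "cmod z"
    define \<gamma> where "\<gamma> \<phi> = of_real ?R * cis \<phi>" for \<phi>
    define \<delta> where "\<delta> \<phi> = argsum g (\<gamma> \<phi>) - argsum f (\<gamma> \<phi>)" for \<phi>
    have R: "?R > 0" using z by auto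
    have \<theta>: "0 < ?\<theta>" "?\<theta> < pi" using Arg2pi_lt_pi[of z] z by auto
    have \<gamma>0: "\<gamma> 0 = of_real ?R" by (simp add: \<gamma>_def)
    have up: "Im (\<gamma> \<phi>) > 0" if "0 < \<phi>" "\<phi> \<le> ?\<theta>" for \<phi>
      using that \<theta> R sin_gt_zero[of \<phi>] by (simp add: \<gamma>_def)
    have ne: "Im (\<gamma> \<phi>) \<ge> 0 \<and> \<gamma> \<phi> \<noteq> of_real x" if p: "stable p" "x \<in># proots p" "\<phi> \<in> {0..?\<theta>}" for p x \<phi>
    proof (cases "\<phi> = 0")
      case True
      have "?R \<noteq> x" using stable_roots[OF p(1,2)] R by linarith
      thus ?thesis using True \<gamma>0 by simp
    next
      case False
      hence "Im (\<gamma> \<phi>) > 0" using up p(3) by auto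
      thus ?thesis by auto
    qed
    have "continuous_on {0..?\<theta>} \<gamma>" unfolding \<gamma>_def by (intro continuous_intros)
    hence cont: "continuous_on {0..?\<theta>} \<delta>"
      unfolding \<delta>_def using ne fg by (intro continuous_intros continuous_on_argsum) blast+
    have "argsum p (of_real ?R) = 0" if p: "stable p" for p
    proof -
      have "(\<Sum>x\<in>#M. Arg2pi (of_real ?R - of_real x)) = 0" if "set_mset M \<subseteq> set_mset (proots p)" for M
        using that
      proof (induction M)
        case (add x M)
        hence "x \<le> 0" using stable_roots[OF p] by auto
        hence "\<not> ?R - x < 0" using R by linarith
        hence "Arg2pi (of_real (?R - x)) = 0" by (simp only: Arg2pi_of_real if_False)
        thus ?case using add by simp
      qed simp
      thus ?thesis unfolding argsum_def by blast
    qed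
    hence \<delta>0: "\<delta> 0 = 0" using fg by (simp add: \<delta>_def \<gamma>0)
    have sn: "sin (\<delta> \<phi>) \<ge> 0 \<and> sin (Arg2pi (\<gamma> \<phi>) - \<delta> \<phi>) \<ge> 0" if "0 < \<phi>" "\<phi> \<le> ?\<theta>" for \<phi>
      using stable_ucone_iff[OF fg up[OF that]] Q[OF up[OF that]] by (simp add: \<delta>_def)
    \<comment> \<open>At distance pi the second sine would be the negative of the sine of the
      argument of a point in the open upper half plane.\<close>
    have npi: "\<bar>\<delta> \<phi>\<bar> \<noteq> pi" if "0 \<le> \<phi>" "\<phi> \<le> ?\<theta>" for \<phi>
    proof
      assume h: "\<bar>\<delta> \<phi>\<bar> = pi"
      hence p: "0 < \<phi>" using \<delta>0 that by (cases "\<phi> = 0") auto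
      have "sin (Arg2pi (\<gamma> \<phi>)) > 0" using up[OF p that(2)] Arg2pi_lt_pi sin_gt_zero by blast
      moreover have "\<delta> \<phi> = pi \<or> \<delta> \<phi> = - pi" using h by linarith
      hence "sin (Arg2pi (\<gamma> \<phi>) - \<delta> \<phi>) = - sin (Arg2pi (\<gamma> \<phi>))" by (auto simp: sin_diff sin_add)
      ultimately show False using sn[OF p that(2)] by simp
    qed
    have lt: "\<bar>\<delta> ?\<theta>\<bar> < pi"
    proof (rule ccontr)
      assume "\<not> \<bar>\<delta> ?\<theta>\<bar> < pi"
      hence "\<exists>\<phi>\<ge>0. \<phi> \<le> ?\<theta> \<and> \<bar>\<delta> \<phi>\<bar> = pi"
        by (intro IVT') (use \<theta> \<delta>0 cont in \<open>auto intro!: continuous_intros\<close>)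
      thus False using npi by blast
    qed
    have gz: "\<gamma> ?\<theta> = z" unfolding \<gamma>_def using Arg2pi_eq[of z] by (simp add: cis_conv_exp)
    have s: "sin (\<delta> ?\<theta>) \<ge> 0" "sin (?\<theta> - \<delta> ?\<theta>) \<ge> 0" using sn[of ?\<theta>] \<theta> gz by auto
    have "\<delta> ?\<theta> \<ge> 0"
    proof (rule ccontr)
      assume "\<not> \<delta> ?\<theta> \<ge> 0"
      hence "sin (- \<delta> ?\<theta>) > 0" using lt by (intro sin_gt_zero) auto
      thus False using s by simp
    qed
    moreover have "\<delta> ?\<theta> \<le> ?\<theta>"
    proof (rule ccontr)
      assume "\<not> \<delta> ?\<theta> \<le> ?\<theta>"
      hence "sin (\<delta> ?\<theta> - ?\<theta>) > 0" using lt \<theta> by (intro sin_gt_zero) auto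
      moreover have "sin (?\<theta> - \<delta> ?\<theta>) = - sin (\<delta> ?\<theta> - ?\<theta>)" using sin_minus[of "\<delta> ?\<theta> - ?\<theta>"] by simp
      ultimately show False using s by simp
    qed
    ultimately show ?thesis by (simp add: \<delta>_def gz)
  qed
  thus "args_le f g" "args_close f g" by (force simp: args_le_def args_close_def)+
qed

section \<open>Root counts from arguments at the real axis\<close>

definition nroots :: "real poly \<Rightarrow> real \<Rightarrow> nat" where
  "nroots p x = size (filter_mset (\<lambda>a. x < a) (proots p))"

lemma argsum_of_real:
  shows "argsum p (of_real x) = pi * nroots p x"
proof -
  have "(\<Sum>a\<in>#M. Arg2pi (of_real x - of_real a)) = pi * size (filter_mset (\<lambda>a. x < a) M)" for M
  proof (induction M)
    case (add a M)
    have "Arg2pi (of_real x - of_real a) = (if x < a then pi else 0)"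
      using Arg2pi_of_real[of "x - a"] by simp
    thus ?case using add by (simp add: algebra_simps)
  qed simp
  thus ?thesis by (simp add: argsum_def nroots_def)
qed

text \<open>Let z approach the real point \<open>x\<close> from above: the argument sums tend to pi
  times the root counts, and \<open>Arg2pi z\<close> tends to 0 or pi. Avoiding 0 and the roots
  keeps all of them continuous.\<close>

lemma args_nroots_aux:
  assumes fg: "f \<noteq> 0" "g \<noteq> 0" and a: "args_le f g" "args_close f g" and x: "x \<noteq> 0" "poly f x \<noteq> 0" "poly g x \<noteq> 0"
  shows "nroots f x \<le> nroots g x" "nroots g x \<le> nroots f x + 1"
proof -
  define \<gamma> where "\<gamma> y = Complex x y" for y
  have im: "Im (\<gamma> y) = y" for y by (simp add: \<gamma>_def)
  have \<gamma>0: "\<gamma> 0 = of_real x" by (simp add: \<gamma>_def complex_of_real_def)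
  have c: "continuous_on {0..1} \<gamma>" unfolding \<gamma>_def Complex_eq by (intro continuous_intros)
  have cp: "continuous_on {0..1} (\<lambda>y. argsum p (\<gamma> y))" if "p \<noteq> 0" "poly p x \<noteq> 0" for p
  proof (rule continuous_on_argsum[OF c])
    fix s a assume "s \<in> {0..1::real}" "a \<in># proots p"
    thus "Im (\<gamma> s) \<ge> 0 \<and> \<gamma> s \<noteq> of_real a" using that by (auto simp: \<gamma>_def complex_eq_iff)
  qed
  have ca: "continuous_on {0..1} (\<lambda>y. Arg2pi (\<gamma> y))"
    by (rule continuous_on_compose2[OF continuous_on_upperhalf_Arg2pi c]) (use x in \<open>auto simp: \<gamma>_def complex_eq_iff\<close>)
  have cl: "closure {0<..1::real} = {0..1}" by simp
  have "argsum f (\<gamma> 0) - argsum g (\<gamma> 0) \<le> 0"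
    by (rule continuous_le_on_closure[where S="{0<..1}"], unfold cl)
      (use cp fg x a im in \<open>auto intro!: continuous_intros simp: args_le_def\<close>)
  hence "pi * nroots f x \<le> pi * nroots g x" by (simp add: \<gamma>0 argsum_of_real)
  thus "nroots f x \<le> nroots g x" by simp
  have "argsum g (\<gamma> 0) - argsum f (\<gamma> 0) - Arg2pi (\<gamma> 0) \<le> 0"
    by (rule continuous_le_on_closure[where S="{0<..1}"], unfold cl)
      (use cp ca fg x a im in \<open>auto intro!: continuous_intros simp: args_close_def algebra_simps\<close>)
  hence "pi * nroots g x \<le> pi * nroots f x + Arg2pi (of_real x)" by (simp add: \<gamma>0 argsum_of_real)
  also have "\<dots> \<le> pi * (nroots f x + 1)" by (simp add: Arg2pi_of_real algebra_simps)
  finally have "real (nroots g x) \<le> real (nroots f x + 1)"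
    by (subst (asm) mult_le_cancel_left_pos) (auto simp: mult.commute)
  thus "nroots g x \<le> nroots f x + 1" by linarith
qed

text \<open>Root counts with strict inequality are continuous from the right, so an exceptional
  point is replaced by one slightly to its right.\<close>

lemma args_nroots:
  assumes fg: "f \<noteq> 0" "g \<noteq> 0" and a: "args_le f g" "args_close f g"
  shows "nroots f x \<le> nroots g x" "nroots g x \<le> nroots f x + 1"
proof -
  let ?S = "{y. poly (f * g * [:0, 1:]) y = 0}"
  have fin: "finite ?S" by (rule poly_roots_finite) (use fg in auto)
  obtain e where e: "e > 0" "\<forall>y\<in>?S. y \<noteq> x \<longrightarrow> e \<le> dist x y" using finite_set_avoid[OF fin, of x] by blast
  let ?x = "x + e / 2"
  have nS: "y \<notin> ?S" if "x < y" "y \<le> ?x" for y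
  proof
    assume "y \<in> ?S"
    from e(2)[rule_format, OF this] have "e \<le> dist x y" using that by simp
    thus False using that e(1) by (simp add: dist_real_def)
  qed
  have n: "nroots p x = nroots p ?x" if p: "p = f \<or> p = g" for p
  proof -
    have "filter_mset (\<lambda>a. x < a) (proots p) = filter_mset (\<lambda>a. ?x < a) (proots p)"
    proof (rule filter_mset_cong[OF refl])
      fix a assume "a \<in># proots p"
      hence "a \<in> ?S" using p fg by auto
      thus "x < a \<longleftrightarrow> ?x < a" using nS[of a] e(1) by linarith
    qed
    thus ?thesis by (simp add: nroots_def)
  qed
  have "?x \<notin> ?S" using nS[of ?x] e(1) by simp
  hence "?x \<noteq> 0" "poly f ?x \<noteq> 0" "poly g ?x \<noteq> 0" by auto
  from args_nroots_aux[OF fg a this] show "nroots f x \<le> nroots g x" "nroots g x \<le> nroots f x + 1"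
    using n by auto
qed

lemma roots_desc_gt_iff:
  "i < length (roots_desc p) \<Longrightarrow> x < roots_desc p ! i \<longleftrightarrow> i < nroots p x"
proof -
  let ?xs = "roots_desc p"
  assume i: "i < length ?xs"
  have m: "mset ?xs = proots p" by (simp add: roots_desc_def)
  have s: "sorted (rev (map (\<lambda>a. a) ?xs))" by (simp add: roots_desc_def)
  have "nroots p x = length (takeWhile (\<lambda>a. x < a) ?xs)"
    unfolding nroots_def m[symmetric] mset_filter[symmetric] filter_equals_takeWhile_sorted_rev[OF s] by simp
  moreover have "x < ?xs ! i" if "i < length (takeWhile (\<lambda>a. x < a) ?xs)"
    using that by (metis nth_mem set_takeWhileD takeWhile_nth)
  moreover have "i < length (takeWhile (\<lambda>a. x < a) ?xs)" if h: "x < ?xs ! i"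
  proof (rule ccontr)
    let ?l = "length (takeWhile (\<lambda>a. x < a) ?xs)"
    assume "\<not> i < ?l"
    hence l: "?l \<le> i" "?l < length ?xs" using i by auto
    have "\<not> x < ?xs ! ?l" by (rule nth_length_takeWhile) (use l in simp)
    moreover have "?xs ! i \<le> ?xs ! ?l" using s l i by (simp add: sorted_rev_iff_nth_mono)
    ultimately show False using h by simp
  qed
  ultimately show ?thesis by auto
qed

lemma nroots_below:
  assumes "\<And>a. a \<in># proots p \<Longrightarrow> x < a"
  shows "nroots p x = length (roots_desc p)"
proof -
  have "filter_mset (\<lambda>a. x < a) (proots p) = proots p" by (rule filter_mset_eq_conv[THEN iffD2]) (use assms in auto)
  moreover have "size (mset (roots_desc p)) = size (proots p)" by (simp add: roots_desc_def)
  ultimately show ?thesis by (simp add: nroots_def)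
qed

theorem args_interlaces:
  assumes fg: "stable f" "stable g" and a: "args_le f g" "args_close f g"
  shows "interlaces f g"
proof -
  have nz: "f \<noteq> 0" "g \<noteq> 0" using fg by (auto simp: stable_def)
  let ?a = "roots_desc f" and ?b = "roots_desc g"
  note N = args_nroots[OF nz a]
  \<comment> \<open>A point to the left of all roots, where the root counts are the numbers of all
    roots.\<close>
  define x where "x = Min (insert 0 (set_mset (proots f + proots g))) - 1"
  have "x < y" if "y \<in># proots f + proots g" for y
  proof -
    have "Min (insert 0 (set_mset (proots f + proots g))) \<le> y" by (rule Min_le) (use that in auto)
    thus ?thesis by (simp add: x_def)
  qed
  hence "nroots f x = length ?a" "nroots g x = length ?b" by (auto intro!: nroots_below)
  hence len: "length ?b = length ?a \<or> length ?b = Suc (length ?a)" "length ?a \<le> length ?b" using N[of x] by auto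
  have "?a ! i \<le> ?b ! i" if i: "i < length ?a" for i
  proof (rule ccontr)
    assume "\<not> ?a ! i \<le> ?b ! i"
    hence "i < nroots f (?b ! i)" using roots_desc_gt_iff[OF i, of "?b ! i"] by simp
    hence "i < nroots g (?b ! i)" using N(1)[of "?b ! i"] by simp
    thus False using roots_desc_gt_iff[of i g "?b ! i"] i len by simp
  qed
  moreover have "?b ! Suc i \<le> ?a ! i" if i: "Suc i < length ?b" for i
  proof (rule ccontr)
    assume "\<not> ?b ! Suc i \<le> ?a ! i"
    hence "Suc i < nroots g (?a ! i)" using roots_desc_gt_iff[OF i, of "?a ! i"] by simp
    hence "i < nroots f (?a ! i)" using N(2)[of "?a ! i"] by simp
    thus False using roots_desc_gt_iff[of i f "?a ! i"] i len by auto
  qed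
  ultimately show ?thesis using len stable_real_rooted fg by (auto simp: interlaces_def Let_def)
qed

section \<open>Comparing the sections of \<open>x^i U^a D^b\<close> with E\<close>

lemma coeff_unity_poly: "coeff (unity_poly r) k = (if k < r then 1 else 0)"
  by (simp add: unity_poly_def coeff_sum)

lemma coeff_diff_poly: "coeff (diff_poly r) k = (if 0 < k \<and> k < r then 1 else 0)" if "r > 0"
  using that by (auto simp: diff_poly_def coeff_unity_poly)

lemma coeff_mult_nonneg:
  fixes p q :: "real poly"
  shows "(\<And>k. coeff p k \<ge> 0) \<Longrightarrow> (\<And>k. coeff q k \<ge> 0) \<Longrightarrow> coeff (p * q) k \<ge> 0"
  by (auto simp: coeff_mult intro!: sum_nonneg mult_nonneg_nonneg)

lemma coeff_power_nonneg:
  fixes p :: "real poly"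
  shows "(\<And>k. coeff p k \<ge> 0) \<Longrightarrow> coeff (p ^ n) k \<ge> 0"
  by (induction n arbitrary: k) (auto intro!: coeff_mult_nonneg simp: coeff_pCons one_pCons split: nat.splits)

lemma coeff_chain_poly_nonneg: "r > 0 \<Longrightarrow> coeff (chain_poly r i a b) k \<ge> 0"
  unfolding chain_poly_def
  by (intro coeff_mult_nonneg coeff_power_nonneg) (auto simp: coeff_unity_poly coeff_diff_poly)

context
  fixes r n :: nat
  assumes n: "0 < n" "n \<le> r"
begin

abbreviation (input) "spoly i a b \<equiv> sect r 0 (chain_poly r i a b)"

lemma r_pos: "r > 0" using n by simp

text \<open>The one degenerate term of the expansion, arising for n = 1 from the empty face.\<close>

lemma spoly_0_0_1: "spoly 0 0 1 = 0"
  by (rule poly_eqI) (use r_pos in \<open>auto simp: coeff_sect chain_poly_def coeff_diff_poly\<close>)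

lemma stable_spoly:
  assumes "i \<le> r" "a > 0 \<and> (b = 0 \<or> r \<ge> 2) \<or> a = 0 \<and> i = 0 \<and> 2 \<le> b \<and> b \<le> r"
  shows "stable (spoly i a b)"
proof -
  have nz: "cv (spoly i a b) z \<noteq> 0" if z: "Im z > 0" for z
  proof (cases a)
    case 0
    thus ?thesis using chain_poly_0_nonzero[OF z r_pos, of b] assms by (simp add: secs_def)
  next
    case (Suc a')
    thus ?thesis using chain_poly_nonzero[OF z r_pos r_pos, of b i a'] assms by (auto simp: secs_def)
  qed
  have "spoly i a b \<noteq> 0" using nz[of \<i>] by auto
  thus ?thesis using nz r_pos coeff_chain_poly_nonneg[OF r_pos] by (simp add: stable_def coeff_sect)
qed

lemma args_shift:
  assumes "j \<le> r"
  shows "args_le (spoly 0 n 0) (spoly j n 0)" "args_close (spoly 0 n 0) (spoly j n 0)"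
  using ucone_args[OF stable_spoly stable_spoly] chain_shift[OF _ r_pos, of _ 0 j] assms n
  by (auto simp: secs_def)

lemma args_up:
  assumes "i < r" "stable (spoly i a (Suc b))" "r \<ge> 2"
  shows "args_le (spoly i (Suc a) b) (spoly i a (Suc b))" "args_le (spoly i a (Suc b)) (spoly (Suc i) (Suc a) b)"
proof -
  have s: "stable (spoly i (Suc a) b)" "stable (spoly (Suc i) (Suc a) b)" using assms by (auto intro!: stable_spoly)
  show "args_le (spoly i (Suc a) b) (spoly i a (Suc b))"
    by (rule ucone_args(1)[OF s(1) assms(2)]) (use chain_up(1)[OF _ r_pos assms(1)] in \<open>simp add: secs_def\<close>)
  show "args_le (spoly i a (Suc b)) (spoly (Suc i) (Suc a) b)"
    by (rule ucone_args(1)[OF assms(2) s(2)]) (use chain_up(2)[OF _ r_pos assms(1)] in \<open>simp add: secs_def\<close>)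
qed

lemma args_le_trans: "args_le f g \<Longrightarrow> args_le g h \<Longrightarrow> args_le f h"
  unfolding args_le_def by (meson order_trans)

lemma args_down_chain:
  assumes "a + b = n" "i \<le> a" "stable (spoly i a b)"
  shows "args_le (spoly i n 0) (spoly i a b)"
  using assms
proof (induction b arbitrary: a)
  case 0
  thus ?case by (simp add: args_le_def)
next
  case (Suc b)
  \<comment> \<open>For r = 1 the only polynomial with a factor D is the vanishing one, which is not
    stable.\<close>
  have r2: "r \<ge> 2"
  proof (rule ccontr)
    assume "\<not> r \<ge> 2"
    hence "a = 0" "b = 0" "i = 0" using n Suc.prems by auto
    thus False using Suc.prems(3) spoly_0_0_1 by (simp add: stable_def)
  qed
  have s: "stable (spoly i (Suc a) b)" by (rule stable_spoly) (use Suc.prems n r2 in auto)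
  show ?case
    by (rule args_le_trans[OF Suc.IH args_up(1)]) (use Suc.prems n s r2 in auto)
qed

text \<open>Trade the factors D for factors x U one at a time; each trade raises \<open>i\<close>
  and \<open>a\<close> together, so the bound \<open>i <= a\<close> persists.\<close>

lemma args_up_chain:
  assumes "a + b = n" "i \<le> a" "stable (spoly i a b)"
  shows "args_le (spoly i a b) (spoly (i + b) n 0)"
  using assms
proof (induction b arbitrary: a i)
  case 0
  thus ?case by (simp add: args_le_def)
next
  case (Suc b)
  have r2: "r \<ge> 2"
  proof (rule ccontr)
    assume "\<not> r \<ge> 2"
    hence "a = 0" "b = 0" "i = 0" using n Suc.prems by auto
    thus False using Suc.prems(3) spoly_0_0_1 by (simp add: stable_def)
  qed
  have s: "stable (spoly (Suc i) (Suc a) b)" by (rule stable_spoly) (use Suc.prems n r2 in auto)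
  have "args_le (spoly (Suc i) (Suc a) b) (spoly (Suc i + b) n 0)" by (rule Suc.IH) (use Suc.prems s in auto)
  thus ?case using args_le_trans[OF args_up(2)] Suc.prems n r2 by simp
qed

lemma spoly_ucone:
  assumes ab: "a + b = n" "i \<le> a" and z: "Im z > 0"
  shows "cv (spoly i a b) z * cnj (cv (spoly 0 n 0) z) \<in> ucone z"
    and "spoly i a b = 0 \<or> cv (spoly i a b) z \<noteq> 0"
proof -
  consider "stable (spoly i a b)" | "a = 0" "n = 1" "b = 1" "i = 0"
  proof (cases "a = 0 \<and> n = 1")
    case False
    have "stable (spoly i a b)" by (rule stable_spoly) (use ab n False in auto)
    thus ?thesis using that by blast
  qed (use that ab in auto)
  hence "cv (spoly i a b) z * cnj (cv (spoly 0 n 0) z) \<in> ucone z \<and> (spoly i a b = 0 \<or> cv (spoly i a b) z \<noteq> 0)"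
  proof cases
    case 1
    have E: "stable (spoly 0 n 0)" by (rule stable_spoly) (use n in auto)
    have "args_le (spoly 0 n 0) (spoly i n 0)" by (rule args_shift) (use ab n in auto)
    hence le: "args_le (spoly 0 n 0) (spoly i a b)" using args_le_trans args_down_chain[OF ab 1] by blast
    \<comment> \<open>The shift is admissible because i + b <= a + b = n <= r.\<close>
    have "args_close (spoly 0 n 0) (spoly (i + b) n 0)" by (rule args_shift) (use ab n in auto)
    hence "args_close (spoly 0 n 0) (spoly i a b)"
      using args_up_chain[OF ab 1] unfolding args_close_def args_le_def by (meson order_trans)
    thus ?thesis using args_ucone[OF E 1 le _ z] 1 z by (auto simp: stable_def)
  next
    case 2
    thus ?thesis using spoly_0_0_1 by simp
  qed
  thus "cv (spoly i a b) z * cnj (cv (spoly 0 n 0) z) \<in> ucone z" "spoly i a b = 0 \<or> cv (spoly i a b) z \<noteq> 0" by auto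
qed

theorem interlaces_spoly_sum:
  assumes J: "finite J" "\<And>j. j \<in> J \<Longrightarrow> w j \<ge> 0 \<and> a j + b j = n \<and> i j \<le> a j"
  shows "interlaces (sect r 0 (unity_poly r ^ n)) (\<Sum>j\<in>J. smult (w j) (spoly (i j) (a j) (b j)))" (is "interlaces ?E ?g")
proof -
  have E: "stable (spoly 0 n 0)" by (rule stable_spoly) (use n in auto)
  have Eq: "?E = spoly 0 n 0" by (simp add: chain_poly_def)
  have g_mult: "cv ?g z * cnj (cv ?E z) = (\<Sum>j\<in>J. of_real (w j) * (cv (spoly (i j) (a j) (b j)) z * cnj (cv ?E z)))" for z
    by (simp add: sum_distrib_right mult.assoc)
  have terms: "of_real (w j) * (cv (spoly (i j) (a j) (b j)) z * cnj (cv ?E z)) \<in> ucone z"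
    if "Im z > 0" "j \<in> J" for z j
    unfolding Eq by (intro ucone_scale spoly_ucone) (use J(2)[OF that(2)] that in auto)
  show ?thesis
  proof (cases "?g = 0")
    case True
    thus ?thesis using stable_real_rooted[OF E] by (simp add: interlaces_def Eq real_rooted_def)
  next
    case False
    have nz: "cv ?g z \<noteq> 0" if z: "Im z > 0" for z
    proof
      assume g0: "cv ?g z = 0"
      \<comment> \<open>Relative to E all terms lie in a pointed cone, so a zero of the sum in the
        upper half plane is a zero of every term; a term with such a zero vanishes
        identically.\<close>
      have "smult (w j) (spoly (i j) (a j) (b j)) = 0" if j: "j \<in> J" for j
      proof -
        have j': "w j \<ge> 0" "a j + b j = n" "i j \<le> a j" using J(2)[OF j] by auto
        have Enz: "cv ?E z \<noteq> 0" using E z by (simp add: stable_def Eq)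
        let ?t = "\<lambda>j. of_real (w j) * (cv (spoly (i j) (a j) (b j)) z * cnj (cv ?E z))"
        have "(\<Sum>j\<in>J. ?t j) = 0" unfolding g_mult[symmetric] g0 by simp
        hence s: "?t j + (\<Sum>k\<in>J-{j}. ?t k) = 0" using sum.remove[OF J(1) j, of ?t] by simp
        have "?t j = 0"
        proof -
          have "?t j \<in> ucone z" "(\<Sum>k\<in>J-{j}. ?t k) \<in> ucone z"
            using terms[OF z] j by (auto intro!: ucone_sum)
          thus ?thesis using ucone_antisym[OF z] s by blast
        qed
        hence "w j = 0 \<or> cv (spoly (i j) (a j) (b j)) z = 0" using Enz by simp
        thus ?thesis using spoly_ucone(2)[OF j'(2,3) z] by auto
      qed
      hence "?g = 0" by (intro sum.neutral) blast
      thus False using False by simp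
    qed
    have "coeff ?g k \<ge> 0" for k
      using J(2) coeff_chain_poly_nonneg[OF r_pos] r_pos by (auto simp: coeff_sum coeff_sect intro!: sum_nonneg mult_nonneg_nonneg)
    hence g: "stable ?g" using nz False by (auto simp: stable_def)
    have "cv ?g z * cnj (cv ?E z) \<in> ucone z" if "Im z > 0" for z
      unfolding g_mult by (intro ucone_sum terms[OF that])
    thus ?thesis using args_interlaces ucone_args E g by (simp add: Eq)
  qed
qed

end

section \<open>Expansion of the local h-polynomial\<close>

lemma icar_subset_iff:
  fixes v :: "nat \<Rightarrow> 'b::real_vector"
  assumes N: "finite N" "inj_on v N" and f: "fan (v ` N) G" and M: "M \<subseteq> N" and t: "\<tau> \<in> G"
  shows "icar (coord v N) N \<tau> \<subseteq> M \<longleftrightarrow> \<tau> \<subseteq> fcone (v ` M)"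
proof -
  have s: "\<tau> \<subseteq> fcone (v ` N)" by (rule fan_face_subset[OF f t])
  have "\<tau> \<subseteq> fcone (v ` M) \<longleftrightarrow> (\<forall>y\<in>\<tau>. \<forall>k\<in>N-M. coord v N k y = 0)"
    using s fcone_face[OF N fanD(2)[OF f] M] by blast
  also have "\<dots> \<longleftrightarrow> icar (coord v N) N \<tau> \<subseteq> M" by (auto simp: icar_def)
  finally show ?thesis ..
qed

lemma fan_conic_faces:
  fixes v :: "nat \<Rightarrow> 'b::real_vector"
  assumes N: "finite N" "inj_on v N" and f: "fan (v ` N) G" and M: "M \<subseteq> N"
  shows "fan (v ` M) {\<tau>\<in>G. \<tau> \<subseteq> fcone (v ` M)}"
proof -
  have "{\<tau>\<in>G. icar (coord v N) N \<tau> \<subseteq> M} = {\<tau>\<in>G. \<tau> \<subseteq> fcone (v ` M)}"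
    using icar_subset_iff[OF N f M] by blast
  thus ?thesis using fan_face[OF N f M] by simp
qed

lemma fcone_mono:
  assumes "finite B" "A \<subseteq> B" shows "fcone A \<subseteq> fcone B"
proof (rule fcone_trans[OF assms(1) finite_subset[OF assms(2,1)]])
  show "A \<subseteq> fcone B" using assms(2) fcone_base[of _ B] by blast
qed

lemma conic_local_h_nonneg:
  fixes v :: "nat \<Rightarrow> 'b::real_vector"
  assumes N: "finite N" "inj_on v N" and f: "fan (v ` N) G"
  shows "coeff (\<Sum>M\<in>Pow N. (-1) ^ (card N - card M) * tri_h (card M) {\<tau>\<in>G. \<tau> \<subseteq> fcone (v ` M)}) m \<ge> 0"
proof -
  have "fan_face_faces v N G M = {\<tau>\<in>G. \<tau> \<subseteq> fcone (v ` M)}" if "M \<in> Pow N" for M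
    unfolding fan_face_faces_def[OF N f] using icar_subset_iff[OF N f] that by blast
  thus ?thesis using fan_local_h_nonneg[OF N f, of m] by simp
qed

lemma fan_index:
  assumes "fan W G"
  obtains v where "inj_on v {0..<card W}" "v ` {0..<card W} = W"
  using ex_bij_betw_nat_finite[OF fanD(1)[OF assms]] by (auto simp: bij_betw_def)

lemma fan_restrict:
  assumes f: "fan W G" and F: "F \<subseteq> W"
  shows "fan F {\<tau>\<in>G. \<tau> \<subseteq> fcone F}"
proof -
  obtain v where v: "inj_on v {0..<card W}" "v ` {0..<card W} = W" using fan_index[OF f] .
  define M where "M = {k\<in>{0..<card W}. v k \<in> F}"
  have "F \<subseteq> v ` {0..<card W}" using F v(2) by simp
  hence M: "M \<subseteq> {0..<card W}" "v ` M = F" by (auto simp: M_def)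
  show ?thesis using fan_conic_faces[OF _ v(1), of G M] v(2) f M by simp
qed

theorem fan_local_h_coeff_nonneg:
  assumes f: "fan W G"
  shows "coeff (\<Sum>F\<in>Pow W. (-1) ^ (card W - card F) * tri_h (card F) {\<tau>\<in>G. \<tau> \<subseteq> fcone F}) m \<ge> 0"
proof -
  obtain v where v: "inj_on v {0..<card W}" "v ` {0..<card W} = W" using fan_index[OF f] .
  let ?N = "{0..<card W}"
  have c: "card (v ` M) = card M" if "M \<in> Pow ?N" for M
    by (rule card_image, rule inj_on_subset[OF v(1)]) (use that in simp)
  have "(\<Sum>F\<in>Pow W. (-1) ^ (card W - card F) * tri_h (card F) {\<tau>\<in>G. \<tau> \<subseteq> fcone F}) =
    (\<Sum>M\<in>Pow ?N. (-1) ^ (card W - card (v ` M)) * tri_h (card (v ` M)) {\<tau>\<in>G. \<tau> \<subseteq> fcone (v ` M)})"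
    by (rule sum.reindex_bij_betw[symmetric], rule bij_betw_Pow) (use v in \<open>auto simp: bij_betw_def\<close>)
  also have "\<dots> = (\<Sum>M\<in>Pow ?N. (-1) ^ (card ?N - card M) * tri_h (card M) {\<tau>\<in>G. \<tau> \<subseteq> fcone (v ` M)})"
    by (rule sum.cong) (auto simp: c)
  finally show ?thesis using conic_local_h_nonneg[OF _ v(1), of G m] v(2) f by simp
qed

lemma fan_has_full_face:
  assumes f: "fan W G" shows "\<exists>\<tau>\<in>G. card \<tau> = card W"
proof -
  obtain v where v: "inj_on v {0..<card W}" "v ` {0..<card W} = W" using fan_index[OF f] .
  show ?thesis using fan_full_face[OF _ v(1), of G] v(2) f by simp
qed

section \<open>Moebius inversion over the faces of the simplex\<close>

lemma sum_interval_powers: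
  fixes y z :: "'a::comm_ring_1"
  assumes V: "finite V" and G: "G \<subseteq> V"
  shows "(\<Sum>F\<in>{F\<in>Pow V. G \<subseteq> F}. y ^ (card F - card G) * z ^ (card V - card F)) = (y + z) ^ (card V - card G)"
proof -
  have fG: "finite G" by (rule finite_subset[OF G V])
  have "(\<Sum>F\<in>{F\<in>Pow V. G \<subseteq> F}. y ^ (card F - card G) * z ^ (card V - card F)) =
    (\<Sum>T\<in>Pow (V - G). y ^ card T * z ^ (card (V - G) - card T))"
  proof (rule sum.reindex_bij_witness[of _ "\<lambda>T. T \<union> G" "\<lambda>F. F - G"])
    fix F assume F: "F \<in> {F\<in>Pow V. G \<subseteq> F}"
    hence "finite F" using finite_subset V by auto
    moreover have "card (F - G) = card F - card G" "card (V - G) = card V - card G" "card G \<le> card F"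
      using F fG G \<open>finite F\<close> by (auto simp: card_Diff_subset card_mono)
    ultimately show "y ^ card (F - G) * z ^ (card (V - G) - card (F - G)) = y ^ (card F - card G) * z ^ (card V - card F)"
      by simp
  qed (use G in auto)
  also have "\<dots> = (y + z) ^ card (V - G)" by (rule sum_Pow_powers) (use V in simp)
  finally show ?thesis using card_Diff_subset[OF fG G] by simp
qed

text \<open>For the h-polynomials of the restrictions of a triangulation, this is the local
  h-polynomial of the restriction to \<open>F\<close>.\<close>

definition local_part :: "('a set \<Rightarrow> real poly) \<Rightarrow> 'a set \<Rightarrow> real poly" where
  "local_part h F = (\<Sum>F'\<in>Pow F. (-1) ^ (card F - card F') * h F')"

lemma sum_local_part:
  assumes V: "finite V"
  shows "(\<Sum>F\<in>Pow V. c F * h F) = (\<Sum>G\<in>Pow V. local_part h G * (\<Sum>F\<in>{F\<in>Pow V. G \<subseteq> F}. c F))"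
proof -
  have hF: "h F = (\<Sum>G\<in>Pow F. local_part h G)" if F: "F \<in> Pow V" for F
  proof -
    have fF: "finite F" using F V finite_subset by auto
    have "(\<Sum>G\<in>Pow F. local_part h G) = (\<Sum>G\<in>Pow F. \<Sum>F'\<in>{F'\<in>Pow F. F' \<subseteq> G}. (-1) ^ (card G - card F') * h F')"
      unfolding local_part_def by (rule sum.cong) (auto intro!: sum.cong)
    also have "\<dots> = (\<Sum>F'\<in>Pow F. \<Sum>G\<in>{G\<in>Pow F. F' \<subseteq> G}. (-1) ^ (card G - card F') * h F')"
      by (rule sum.swap_restrict) (use fF in auto)
    also have "\<dots> = (\<Sum>F'\<in>Pow F. (if F' = F then h F' else 0))"
    proof (rule sum.cong[OF refl])
      fix F' assume F': "F' \<in> Pow F"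
      have "(\<Sum>G\<in>{G\<in>Pow F. F' \<subseteq> G}. (-1) ^ (card G - card F') * h F') = ((-1) + 1) ^ (card F - card F') * h F'"
        using sum_interval_powers[OF fF, of F' "-1 :: real poly" 1] F' by (simp add: sum_distrib_right[symmetric])
      also have "\<dots> = (if F' = F then h F' else 0)"
      proof (cases "F' = F")
        case False
        hence "card F' < card F" using F' fF psubset_card_mono[of F F'] by auto
        thus ?thesis using False by (simp add: power_0_left)
      qed simp
      finally show "(\<Sum>G\<in>{G\<in>Pow F. F' \<subseteq> G}. (-1) ^ (card G - card F') * h F') = (if F' = F then h F' else 0)" .
    qed
    also have "\<dots> = h F" using fF by (subst sum.delta) auto
    finally show ?thesis ..
  qed
  have "(\<Sum>F\<in>Pow V. c F * h F) = (\<Sum>F\<in>Pow V. \<Sum>G\<in>{G\<in>Pow V. G \<subseteq> F}. c F * local_part h G)"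
    by (rule sum.cong) (auto simp: hF sum_distrib_left intro!: sum.cong)
  also have "\<dots> = (\<Sum>G\<in>Pow V. \<Sum>F\<in>{F\<in>Pow V. G \<subseteq> F}. c F * local_part h G)"
    by (rule sum.swap_restrict) (use V in auto)
  also have "\<dots> = (\<Sum>G\<in>Pow V. local_part h G * (\<Sum>F\<in>{F\<in>Pow V. G \<subseteq> F}. c F))"
    by (simp add: sum_distrib_left mult.commute)
  finally show ?thesis .
qed

text \<open>Writing \<open>h\<close> through its local parts leaves, for each \<open>G\<close>, the
  binomial sum over the faces containing \<open>G\<close>, where U - 1 = D appears.\<close>

lemma edgewise_local_expansion:
  assumes V: "finite V"
  shows "(\<Sum>F\<in>Pow V. (-1) ^ (card V - card F) * unity_poly r ^ card F * h F) =
    (\<Sum>G\<in>Pow V. local_part h G * (diff_poly r ^ (card V - card G) * unity_poly r ^ card G))"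
  unfolding sum_local_part[OF V, of _ h]
proof (rule sum.cong[OF refl])
  fix G assume G: "G \<in> Pow V"
  have "(\<Sum>F\<in>{F\<in>Pow V. G \<subseteq> F}. (-1) ^ (card V - card F) * unity_poly r ^ card F) =
    unity_poly r ^ card G * (\<Sum>F\<in>{F\<in>Pow V. G \<subseteq> F}. unity_poly r ^ (card F - card G) * (-1) ^ (card V - card F))"
    unfolding sum_distrib_left
  proof (rule sum.cong[OF refl])
    fix F assume F: "F \<in> {F\<in>Pow V. G \<subseteq> F}"
    hence "card G \<le> card F" using V finite_subset by (auto intro!: card_mono)
    hence "unity_poly r ^ card F = unity_poly r ^ card G * unity_poly r ^ (card F - card G)" by (simp flip: power_add)
    thus "(-1) ^ (card V - card F) * unity_poly r ^ card F =
      unity_poly r ^ card G * (unity_poly r ^ (card F - card G) * (-1) ^ (card V - card F))" by (simp add: mult_ac)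
  qed
  also have "\<dots> = diff_poly r ^ (card V - card G) * unity_poly r ^ card G"
    using sum_interval_powers[OF V, of G "unity_poly r" "-1"] G by (simp add: diff_poly_def mult.commute)
  finally show "local_part h G * (\<Sum>F\<in>{F\<in>Pow V. G \<subseteq> F}. (-1) ^ (card V - card F) * unity_poly r ^ card F) =
    local_part h G * (diff_poly r ^ (card V - card G) * unity_poly r ^ card G)" by simp
qed

lemma degree_tri_h:
  assumes "finite K" "\<And>S. S \<in> K \<Longrightarrow> card S \<le> d"
  shows "degree (tri_h d K) \<le> d"
  unfolding tri_h_def
proof (rule degree_sum_le[OF assms(1)])
  fix S assume S: "S \<in> K"
  have "degree (monom 1 (card S) * [:1, -1::real:] ^ (d - card S)) \<le> card S + (d - card S)"
    by (intro order_trans[OF degree_mult_le] add_mono degree_monom_le order_trans[OF degree_power_le]) simp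
  thus "degree (monom 1 (card S) * [:1, -1::real:] ^ (d - card S)) \<le> d" using assms(2)[OF S] by simp
qed

text \<open>Expanding each local part into monomials yields nonnegative multiples of sections of
  \<open>x^i U^a D^b\<close>. The degree bound supplies i <= a.\<close>

theorem interlaces_edgewise:
  assumes V: "finite V" "card V = n" and n: "0 < n" "n \<le> r"
    and nonneg: "\<And>G m. G \<subseteq> V \<Longrightarrow> coeff (local_part h G) m \<ge> 0"
    and deg: "\<And>G. G \<subseteq> V \<Longrightarrow> degree (h G) \<le> card G"
  shows "interlaces (sect r 0 (unity_poly r ^ n))
    (\<Sum>F\<in>Pow V. smult ((-1) ^ (n - card F)) (sect r 0 (unity_poly r ^ card F * h F)))"
proof -
  have r: "r > 0" using n by simp
  have dl: "degree (local_part h G) \<le> card G" if G: "G \<subseteq> V" for G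
    unfolding local_part_def
  proof (rule degree_sum_le)
    show "finite (Pow G)" using G V finite_subset by auto
    fix F assume F: "F \<in> Pow G"
    have "card F \<le> card G" using F G V(1) by (intro card_mono) (auto intro: finite_subset)
    hence hF: "degree (h F) \<le> card G" using deg[of F] F G by force
    have "(-1) ^ (card G - card F) * h F = h F \<or> (-1) ^ (card G - card F) * h F = - h F"
      by (cases "even (card G - card F)") auto
    thus "degree ((-1) ^ (card G - card F) * h F) \<le> card G" using hF by auto
  qed
  let ?J = "Sigma (Pow V) (\<lambda>G. {..card G})"
  have "(\<Sum>F\<in>Pow V. smult ((-1) ^ (n - card F)) (sect r 0 (unity_poly r ^ card F * h F))) =
    sect r 0 (\<Sum>F\<in>Pow V. (-1) ^ (card V - card F) * unity_poly r ^ card F * h F)"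
    unfolding sect_sum[OF r] V(2)
  proof (rule sum.cong[OF refl])
    fix F
    have "((-1) ^ k :: real poly) = [:(-1) ^ k:]" for k by (induction k) (simp_all add: one_pCons)
    thus "smult ((-1) ^ (n - card F)) (sect r 0 (unity_poly r ^ card F * h F)) =
      sect r 0 ((-1) ^ (n - card F) * unity_poly r ^ card F * h F)"
      by (simp add: mult.assoc sect_smult[OF r] del: minus_one_power_iff)
  qed
  also have "\<dots> = (\<Sum>G\<in>Pow V. \<Sum>i\<le>card G. smult (coeff (local_part h G) i) (sect r 0 (chain_poly r i (card G) (n - card G))))"
    unfolding edgewise_local_expansion[OF V(1)] unfolding sect_sum[OF r] V(2)
  proof (rule sum.cong[OF refl])
    fix G assume G: "G \<in> Pow V"
    let ?q = "diff_poly r ^ (n - card G) * unity_poly r ^ card G"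
    have "local_part h G = (\<Sum>i\<le>card G. monom (coeff (local_part h G) i) i)"
      using dl[of G] G poly_as_sum_of_monoms'[of "local_part h G" "card G"] by simp
    hence "local_part h G * ?q = (\<Sum>i\<le>card G. monom (coeff (local_part h G) i) i) * ?q" by simp
    also have "\<dots> = (\<Sum>i\<le>card G. smult (coeff (local_part h G) i) (chain_poly r i (card G) (n - card G)))"
      unfolding sum_distrib_right
    proof (rule sum.cong[OF refl])
      fix i
      have "monom (coeff (local_part h G) i) i = smult (coeff (local_part h G) i) (monom 1 i)" by (simp add: smult_monom)
      thus "monom (coeff (local_part h G) i) i * ?q = smult (coeff (local_part h G) i) (chain_poly r i (card G) (n - card G))"
        by (simp add: chain_poly_def)
    qed
    finally show "sect r 0 (local_part h G * ?q) =
      (\<Sum>i\<le>card G. smult (coeff (local_part h G) i) (sect r 0 (chain_poly r i (card G) (n - card G))))"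
      by (simp add: sect_sum[OF r] sect_smult[OF r])
  qed
  also have "\<dots> = (\<Sum>(G, i)\<in>?J. smult (coeff (local_part h G) i) (sect r 0 (chain_poly r i (card G) (n - card G))))"
    by (rule sum.Sigma) (use V in auto)
  finally have e: "(\<Sum>F\<in>Pow V. smult ((-1) ^ (n - card F)) (sect r 0 (unity_poly r ^ card F * h F))) =
    (\<Sum>j\<in>?J. smult (coeff (local_part h (fst j)) (snd j)) (sect r 0 (chain_poly r (snd j) (card (fst j)) (n - card (fst j)))))"
    by (simp add: case_prod_unfold)
  show ?thesis unfolding e
  proof (rule interlaces_spoly_sum[OF n])
    show "finite ?J" using V by simp
    fix j assume "j \<in> ?J"
    hence j: "fst j \<subseteq> V" "snd j \<le> card (fst j)" by auto
    have "card (fst j) \<le> n" using card_mono[OF V(1) j(1)] V(2) by simp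
    thus "0 \<le> coeff (local_part h (fst j)) (snd j) \<and> card (fst j) + (n - card (fst j)) = n \<and> snd j \<le> card (fst j)"
      using nonneg[OF j(1)] j(2) by simp
  qed
qed

section \<open>The fan over a geometric triangulation\<close>

text \<open>Homogenization at height 1: affine independence becomes linear independence, and convex
  hulls become sections of cones.\<close>

definition lift :: "'a::real_vector \<Rightarrow> 'a \<times> real" where "lift x = (x, 1)"

lemma inj_lift: "inj_on lift A" by (auto simp: inj_on_def lift_def)

lemma sum_lift: "(\<Sum>x\<in>S. u x *\<^sub>R lift x) = (\<Sum>x\<in>S. u x *\<^sub>R x, \<Sum>x\<in>S. u x)"
  by (simp add: prod_eq_iff fst_sum snd_sum lift_def)

lemma sum_lift_image: "(\<Sum>w\<in>lift ` S. t w *\<^sub>R w) = (\<Sum>x\<in>S. t (lift x) *\<^sub>R x, \<Sum>x\<in>S. t (lift x))"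
  by (simp add: sum.reindex[OF inj_lift] sum_lift)

lemma independent_lift:
  fixes V :: "'a::euclidean_space set"
  assumes "\<not> affine_dependent V"
  shows "independent (lift ` V)"
proof
  have fV: "finite V" using assms by (rule aff_independent_finite)
  assume "dependent (lift ` V)"
  then obtain u where u: "\<exists>v\<in>lift ` V. u v \<noteq> 0" "(\<Sum>v\<in>lift ` V. u v *\<^sub>R v) = 0"
    using fV by (auto simp: dependent_finite)
  have "(\<Sum>v\<in>V. u (lift v)) = 0" "(\<Sum>v\<in>V. u (lift v) *\<^sub>R v) = 0" "\<exists>v\<in>V. u (lift v) \<noteq> 0"
    using u by (auto simp: sum_lift_image zero_prod_def)
  hence "affine_dependent V" unfolding affine_dependent_explicit_finite[OF fV] by (intro exI[of _ "\<lambda>v. u (lift v)"]) auto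
  thus False using assms by blast
qed

lemma fcone_lift:
  assumes "finite S"
  shows "(p, c) \<in> fcone (lift ` S) \<longleftrightarrow> c = 0 \<and> p = 0 \<or> c > 0 \<and> p /\<^sub>R c \<in> convex hull S"
proof
  assume "(p, c) \<in> fcone (lift ` S)"
  then obtain t where t: "\<forall>w\<in>lift ` S. t w \<ge> (0::real)" "(p, c) = (\<Sum>w\<in>lift ` S. t w *\<^sub>R w)"
    using fcone_eq[of "lift ` S"] assms by auto
  have pc: "p = (\<Sum>x\<in>S. t (lift x) *\<^sub>R x)" "c = (\<Sum>x\<in>S. t (lift x))" using t(2) by (auto simp: sum_lift_image)
  have "c \<ge> 0" unfolding pc by (rule sum_nonneg) (use t in auto)
  show "c = 0 \<and> p = 0 \<or> c > 0 \<and> p /\<^sub>R c \<in> convex hull S"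
  proof (cases "c = 0")
    case True
    hence "\<forall>x\<in>S. t (lift x) = 0" unfolding pc by (subst (asm) sum_nonneg_eq_0_iff) (use t assms in auto)
    thus ?thesis using True pc by simp
  next
    case False
    hence "c > 0" using \<open>c \<ge> 0\<close> by simp
    moreover have "p /\<^sub>R c \<in> convex hull S" unfolding convex_hull_finite[OF assms]
    proof (intro CollectI exI conjI ballI)
      show "0 \<le> t (lift x) / c" if "x \<in> S" for x using t(1) that \<open>c > 0\<close> by simp
      show "(\<Sum>x\<in>S. t (lift x) / c) = 1" unfolding sum_divide_distrib[symmetric] pc(2)[symmetric] using \<open>c > 0\<close> by simp
      show "(\<Sum>x\<in>S. (t (lift x) / c) *\<^sub>R x) = p /\<^sub>R c" unfolding pc(1) scaleR_sum_right
        by (rule sum.cong) (auto simp: divide_inverse mult.commute)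
    qed
    ultimately show ?thesis by simp
  qed
next
  assume h: "c = 0 \<and> p = 0 \<or> c > 0 \<and> p /\<^sub>R c \<in> convex hull S"
  show "(p, c) \<in> fcone (lift ` S)"
  proof (cases "c > 0")
    case False
    thus ?thesis using h fcone_zero[of "lift ` S"] assms by (auto simp: zero_prod_def)
  next
    case True
    then obtain u where u: "\<forall>x\<in>S. 0 \<le> u x" "sum u S = 1" "(\<Sum>x\<in>S. u x *\<^sub>R x) = p /\<^sub>R c"
      using h convex_hull_finite[OF assms] by auto
    have "c *\<^sub>R (\<Sum>x\<in>S. u x *\<^sub>R lift x) = (p, c)" using True by (simp add: sum_lift u)
    moreover have "(\<Sum>x\<in>S. u x *\<^sub>R lift x) \<in> fcone (lift ` S)"
      using u assms by (intro fcone_sum fcone_scale fcone_base) auto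
    ultimately show ?thesis using fcone_scale[of "lift ` S" _ c] True assms by (metis finite_imageI less_imp_le)
  qed
qed

lemma lift_in_fcone: "finite S \<Longrightarrow> lift x \<in> fcone (lift ` S) \<longleftrightarrow> x \<in> convex hull S"
  unfolding lift_def[of x] by (simp add: fcone_lift)

lemma tri_h_image:
  assumes "inj_on \<phi> (\<Union>K)"
  shows "tri_h d ((`) \<phi> ` K) = tri_h d K"
proof -
  have "inj_on ((`) \<phi>) K" using inj_on_image[OF assms] .
  moreover have "card (\<phi> ` S) = card S" if "S \<in> K" for S
    by (rule card_image, rule inj_on_subset[OF assms]) (use that in blast)
  ultimately show ?thesis unfolding tri_h_def by (subst sum.reindex) (auto intro!: sum.cong)
qed

lemma h_poly_image:
  assumes K: "finite K" "K \<noteq> {}" and inj: "inj_on \<phi> (\<Union>K)"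
  shows "h_poly ((`) \<phi> ` K) = h_poly K"
proof -
  have "card (\<phi> ` S) = card S" if "S \<in> K" for S
    by (rule card_image, rule inj_on_subset[OF inj]) (use that in blast)
  hence "cdim1 ((`) \<phi> ` K) = cdim1 K" unfolding cdim1_def image_image by (simp cong: image_cong)
  thus ?thesis using K tri_h_image[OF inj] by (simp add: h_poly_eq_tri_h)
qed

text \<open>The extreme points of the hull of an affinely independent set are the points of that
  set.\<close>

lemma hull_eq_imp_eq:
  fixes S T :: "'a::euclidean_space set"
  assumes "\<not> affine_dependent S" "\<not> affine_dependent T" "convex hull S = convex hull T"
  shows "S = T"
proof (rule set_eqI)
  fix x show "x \<in> S \<longleftrightarrow> x \<in> T"
    using extreme_point_of_convex_hull_affine_independent[OF assms(1), of x]
      extreme_point_of_convex_hull_affine_independent[OF assms(2), of x] assms(3) by simp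
qed

text \<open>Faces of a simplex are closed under intersection, so the hull of the carrier still
  contains \<open>P\<close>.\<close>

lemma carrier_face_subset_iff:
  fixes V :: "'a::euclidean_space set"
  assumes V: "\<not> affine_dependent V" and P: "P \<subseteq> convex hull V" and F: "F \<subseteq> V"
  shows "carrier_face V P \<subseteq> F \<longleftrightarrow> P \<subseteq> convex hull F"
proof -
  let ?A = "{F. F \<subseteq> V \<and> convex hull P \<subseteq> convex hull F}"
  have c: "carrier_face V P = \<Inter>?A" by (rule carrier_face_eq_Inter[OF V P])
  have "\<not> affine_dependent (\<Union>?A)" using V by (rule affine_independent_subset) auto
  hence h: "convex hull (\<Inter>?A) = (\<Inter>F\<in>?A. convex hull F)" by (rule convex_hull_Inter)
  have "P \<subseteq> convex hull (\<Inter>?A)" unfolding h using hull_subset[of P convex] by blast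
  hence "P \<subseteq> convex hull F" if "carrier_face V P \<subseteq> F"
    using that hull_mono[of "carrier_face V P" F convex] unfolding c by blast
  moreover have "carrier_face V P \<subseteq> F" if "P \<subseteq> convex hull F"
  proof -
    have "convex hull P \<subseteq> convex hull F" using that by (rule hull_minimal) (rule convex_convex_hull)
    thus ?thesis unfolding c using F by blast
  qed
  ultimately show ?thesis by blast
qed

locale simplex_triangulation =
  fixes V :: "'a::euclidean_space set" and \<Gamma> :: "'a set set"
  assumes V: "\<not> affine_dependent V" "V \<noteq> {}" and tri: "geom_triangulation V \<Gamma>"
begin

lemma fV: "finite V" using V(1) by (rule aff_independent_finite)

lemma face_indep: "S \<in> \<Gamma> \<Longrightarrow> \<not> affine_dependent S"
  using tri by (simp add: geom_triangulation_def)

lemma face_finite: "S \<in> \<Gamma> \<Longrightarrow> finite S"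
  using face_indep aff_independent_finite by blast

lemma cover: "(\<Union>S\<in>\<Gamma>. convex hull S) = convex hull V"
  using tri by (simp add: geom_triangulation_def)

lemma face_hull: "S \<in> \<Gamma> \<Longrightarrow> convex hull S \<subseteq> convex hull V"
  using cover by blast

lemma complex: "simplicial_complex ((\<lambda>S. convex hull S) ` \<Gamma>)"
  using tri by (simp add: geom_triangulation_def)

lemma finite_faces: "finite \<Gamma>"
proof (rule finite_imageD)
  show "finite ((\<lambda>S. convex hull S) ` \<Gamma>)" using complex by (simp add: simplicial_complex_def)
  show "inj_on (\<lambda>S. convex hull S) \<Gamma>"
    by (rule inj_onI, rule hull_eq_imp_eq[OF face_indep face_indep])
qed

lemma face_down:
  assumes S: "S \<in> \<Gamma>" and T: "T \<subseteq> S" shows "T \<in> \<Gamma>"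
proof -
  have "convex hull T face_of convex hull S"
    using face_of_convex_hull_affine_independent[OF face_indep[OF S]] T by blast
  hence "convex hull T \<in> (\<lambda>S. convex hull S) ` \<Gamma>" using complex S unfolding simplicial_complex_def by blast
  then obtain T' where T': "T' \<in> \<Gamma>" "convex hull T = convex hull T'" by blast
  have "\<not> affine_dependent T" using face_indep[OF S] T by (rule affine_independent_subset)
  thus ?thesis using hull_eq_imp_eq[OF _ face_indep[OF T'(1)] T'(2)] T'(1) by simp
qed

lemma empty_face: "{} \<in> \<Gamma>"
proof -
  have "convex hull V \<noteq> {}" using V(2) by simp
  then obtain S where "S \<in> \<Gamma>" unfolding cover[symmetric] by blast
  thus ?thesis using face_down by blast
qed

text \<open>Two hulls meet in a common face, and a face that meets the relative interior of a hull
  is that whole hull.\<close>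

lemma rel_interior_unique:
  assumes S: "S \<in> \<Gamma>" and T: "T \<in> \<Gamma>" and y: "y \<in> rel_interior (convex hull S)" "y \<in> rel_interior (convex hull T)"
  shows "S = T"
proof -
  have main: "convex hull S \<subseteq> convex hull T"
    if h: "S \<in> \<Gamma>" "T \<in> \<Gamma>" "y \<in> rel_interior (convex hull S)" "y \<in> convex hull T" for S T
  proof -
    have f: "(convex hull S \<inter> convex hull T) face_of convex hull S"
      using complex h(1,2) unfolding simplicial_complex_def by blast
    have "y \<in> (convex hull S \<inter> convex hull T) \<inter> rel_interior (convex hull S)"
      using h(3,4) rel_interior_subset[of "convex hull S"] by blast
    hence "(convex hull S \<inter> convex hull T) \<inter> rel_interior (convex hull S) \<noteq> {}" by blast
    from subset_of_face_of[OF f order_refl this] have "convex hull S \<subseteq> convex hull S \<inter> convex hull T" .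
    thus ?thesis by blast
  qed
  have "y \<in> convex hull S" "y \<in> convex hull T" using y rel_interior_subset by blast+
  hence "convex hull S = convex hull T" using main[OF S T y(1)] main[OF T S y(2)] by blast
  thus ?thesis by (rule hull_eq_imp_eq[OF face_indep[OF S] face_indep[OF T]])
qed

abbreviation "fan_faces \<equiv> (`) lift ` \<Gamma>"

lemma cpos_faceE:
  assumes "s \<in> cpos fan_faces"
  obtains S where "S \<in> \<Gamma>" "rsupp s = lift ` S" "\<forall>x\<in>S. s (lift x) > 0"
    "vval s = (\<Sum>x\<in>S. s (lift x) *\<^sub>R x, \<Sum>x\<in>S. s (lift x))"
proof -
  obtain S where S: "S \<in> \<Gamma>" "rsupp s = lift ` S" using assms by (auto simp: cpos_def)
  have "\<forall>x\<in>S. s (lift x) > 0"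
  proof
    fix x assume "x \<in> S"
    hence "lift x \<in> rsupp s" using S by blast
    hence "s (lift x) \<noteq> 0" by (simp add: rsupp_def)
    moreover have "\<forall>w. s w \<ge> 0" using assms unfolding cpos_def by blast
    ultimately show "s (lift x) > 0" by (metis order_le_less)
  qed
  moreover have "vval s = (\<Sum>x\<in>S. s (lift x) *\<^sub>R x, \<Sum>x\<in>S. s (lift x))"
    unfolding vval_def S(2) by (rule sum_lift_image)
  ultimately show ?thesis using that S by blast
qed

text \<open>Rescaled to height 1, a point with positive coordinates on a face lies in the relative
  interior of its hull. This determines the face, and affine independence then determines the
  coordinates.\<close>

theorem fan_lift: "fan (lift ` V) fan_faces"
  unfolding fan_def
proof (intro conjI ballI allI impI)
  show "finite (lift ` V)" "independent (lift ` V)" "finite fan_faces"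
    using fV independent_lift V finite_faces by auto
  show "finite \<tau>" if "\<tau> \<in> fan_faces" for \<tau> using that face_finite by auto
  show "\<sigma> \<in> fan_faces" if "\<tau> \<in> fan_faces" "\<sigma> \<subseteq> \<tau>" for \<tau> \<sigma>
    using that face_down by (auto elim!: subset_imageE)
  show "bij_betw vval (cpos fan_faces) (fcone (lift ` V))"
    unfolding bij_betw_def
  proof (intro conjI inj_onI equalityI subsetI)
    fix s t assume st: "s \<in> cpos fan_faces" "t \<in> cpos fan_faces" "vval s = vval t"
    obtain S where S: "S \<in> \<Gamma>" "rsupp s = lift ` S" "\<forall>x\<in>S. s (lift x) > 0"
      "vval s = (\<Sum>x\<in>S. s (lift x) *\<^sub>R x, \<Sum>x\<in>S. s (lift x))" using cpos_faceE[OF st(1)] .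
    obtain T where T: "T \<in> \<Gamma>" "rsupp t = lift ` T" "\<forall>x\<in>T. t (lift x) > 0"
      "vval t = (\<Sum>x\<in>T. t (lift x) *\<^sub>R x, \<Sum>x\<in>T. t (lift x))" using cpos_faceE[OF st(2)] .
    let ?c = "\<Sum>x\<in>S. s (lift x)" and ?p = "\<Sum>x\<in>S. s (lift x) *\<^sub>R x"
    have e: "?c = (\<Sum>x\<in>T. t (lift x))" "?p = (\<Sum>x\<in>T. t (lift x) *\<^sub>R x)" using S(4) T(4) st(3) by auto
    have ri: "p /\<^sub>R c \<in> rel_interior (convex hull R)"
      if R: "R \<in> \<Gamma>" and q: "\<And>x. x \<in> R \<Longrightarrow> q x > 0" "p = (\<Sum>x\<in>R. q x *\<^sub>R x)" "c = (\<Sum>x\<in>R. q x)" "c > 0" for R p c q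
      unfolding rel_interior_convex_hull_explicit[OF face_indep[OF R]]
    proof (intro CollectI exI conjI ballI)
      show "0 < q x / c" if "x \<in> R" for x using q that by simp
      show "(\<Sum>x\<in>R. q x / c) = 1" unfolding sum_divide_distrib[symmetric] q(3)[symmetric] using q(4) by simp
      show "(\<Sum>x\<in>R. (q x / c) *\<^sub>R x) = p /\<^sub>R c" unfolding q(2) scaleR_sum_right
        by (rule sum.cong) (auto simp: divide_inverse mult.commute)
    qed
    have ne: "(\<Sum>x\<in>R. q x) > 0 \<longleftrightarrow> R \<noteq> {}" if "R \<in> \<Gamma>" "\<And>x. x \<in> R \<Longrightarrow> q x > 0" for R and q :: "'a \<Rightarrow> real"
      using sum_pos[OF face_finite[OF that(1)], of q] that(2) by (cases "R = {}") auto
    have ST: "S = T"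
    proof (cases "S = {}")
      case True
      hence "?c = 0" by simp
      hence "T = {}" using ne[OF T(1), of "\<lambda>x. t (lift x)"] T(3) e(1) by force
      thus ?thesis using True by simp
    next
      case False
      hence c: "?c > 0" using ne[OF S(1), of "\<lambda>x. s (lift x)"] S(3) by blast
      show ?thesis
        using rel_interior_unique[OF S(1) T(1) ri[OF S(1) S(3)[rule_format] refl refl c] ri[OF T(1) T(3)[rule_format] e(2) e(1) c]] .
    qed
    have "(\<Sum>w\<in>lift ` S. (s w - t w) *\<^sub>R w) = 0"
      using e ST by (simp add: sum_lift_image algebra_simps sum_subtractf zero_prod_def)
    hence "s w - t w = 0" if "w \<in> lift ` S" for w
      using independentD[OF independent_lift[OF face_indep[OF S(1)]], of "lift ` S" "\<lambda>w. s w - t w" w]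
        face_finite[OF S(1)] that by simp
    moreover have "s w = 0 \<and> t w = 0" if "w \<notin> lift ` S" for w using S(2) T(2) ST that by (auto simp: rsupp_def)
    ultimately show "s = t" by (intro ext) (metis eq_iff_diff_eq_0)
  next
    fix y assume "y \<in> vval ` cpos fan_faces"
    then obtain s where s: "s \<in> cpos fan_faces" "y = vval s" by blast
    obtain S where S: "S \<in> \<Gamma>" "rsupp s = lift ` S" using s(1) by (auto simp: cpos_def)
    have "s \<in> cpos (Pow (lift ` S))" using s(1) S(2) by (simp add: cpos_def)
    hence y: "y \<in> fcone (lift ` S)" unfolding fcone_def s(2) by (rule imageI)
    obtain p c where pc: "y = (p, c)" by (cases y)
    show "y \<in> fcone (lift ` V)"
      using y face_hull[OF S(1)] unfolding pc fcone_lift[OF face_finite[OF S(1)]] fcone_lift[OF fV] by blast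
  next
    fix y assume y: "y \<in> fcone (lift ` V)"
    obtain p c where pc: "y = (p, c)" by (cases y)
    have "\<exists>S\<in>\<Gamma>. y \<in> fcone (lift ` S)"
    proof (cases "c > 0")
      case True
      hence "p /\<^sub>R c \<in> convex hull V" using y unfolding pc fcone_lift[OF fV] by simp
      then obtain S where S: "S \<in> \<Gamma>" "p /\<^sub>R c \<in> convex hull S" unfolding cover[symmetric] by blast
      have "y \<in> fcone (lift ` S)" unfolding pc fcone_lift[OF face_finite[OF S(1)]] using True S(2) by simp
      thus ?thesis using S(1) by blast
    next
      case False
      hence "c = 0 \<and> p = 0" using y unfolding pc fcone_lift[OF fV] by simp
      hence "y \<in> fcone (lift ` {})" unfolding pc fcone_lift[OF finite.emptyI] by simp
      thus ?thesis using empty_face by blast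
    qed
    then obtain S where S: "S \<in> \<Gamma>" "y \<in> fcone (lift ` S)" by blast
    then obtain t where t: "t \<in> cpos (Pow (lift ` S))" "y = vval t" by (auto simp: fcone_def)
    have "rsupp t \<in> fan_faces" using t(1) S(1) face_down by (auto simp: cpos_def elim!: subset_imageE)
    thus "y \<in> vval ` cpos fan_faces" using t by (auto simp: cpos_def)
  qed
qed

definition faces_in :: "'a set \<Rightarrow> 'a set set" where
  "faces_in F = {S\<in>\<Gamma>. S \<subseteq> convex hull F}"

lemma fan_faces_in:
  assumes "F \<subseteq> V"
  shows "{\<tau>\<in>fan_faces. \<tau> \<subseteq> fcone (lift ` F)} = (`) lift ` faces_in F"
proof -
  have "finite F" using assms fV by (rule finite_subset)
  hence "lift ` S \<subseteq> fcone (lift ` F) \<longleftrightarrow> S \<subseteq> convex hull F" for S using lift_in_fcone by blast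
  thus ?thesis unfolding faces_in_def by blast
qed

lemma fan_restricted: "F \<subseteq> V \<Longrightarrow> fan (lift ` F) ((`) lift ` faces_in F)"
  using fan_restrict[OF fan_lift, of "lift ` F"] fan_faces_in[of F] by auto

lemma card_lift: "card (lift ` S) = card S" by (rule card_image[OF inj_lift])

lemma faces_in_card:
  assumes "F \<subseteq> V"
  shows "S \<in> faces_in F \<Longrightarrow> card S \<le> card F" "\<exists>S\<in>faces_in F. card S = card F"
proof -
  show "card S \<le> card F" if "S \<in> faces_in F"
  proof -
    have "lift ` S \<in> (`) lift ` faces_in F" using that by (rule imageI)
    from fan_card_le[OF fan_restricted[OF assms] this] show ?thesis by (simp add: card_lift)
  qed
  show "\<exists>S\<in>faces_in F. card S = card F"
    using fan_has_full_face[OF fan_restricted[OF assms]] by (auto simp: card_lift)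
qed

text \<open>The faces inside the hull of \<open>F\<close> again form a fan, whose restrictions to
  smaller faces are those of the whole triangulation.\<close>

lemma local_part_nonneg:
  assumes F: "F \<subseteq> V"
  shows "coeff (local_part (\<lambda>F. tri_h (card F) (faces_in F)) F) m \<ge> 0"
proof -
  have "(\<Sum>F'\<in>Pow (lift ` F). (-1) ^ (card (lift ` F) - card F') *
      tri_h (card F') {\<tau>\<in>(`) lift ` faces_in F. \<tau> \<subseteq> fcone F'}) =
    (\<Sum>F'\<in>Pow F. (-1) ^ (card (lift ` F) - card (lift ` F')) *
      tri_h (card (lift ` F')) {\<tau>\<in>(`) lift ` faces_in F. \<tau> \<subseteq> fcone (lift ` F')})"
    by (rule sum.reindex_bij_betw[symmetric], rule bij_betw_Pow) (simp add: bij_betw_def inj_lift)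
  also have "\<dots> = local_part (\<lambda>F. tri_h (card F) (faces_in F)) F"
    unfolding local_part_def
  proof (rule sum.cong[OF refl])
    fix F' assume F': "F' \<in> Pow F"
    have FF: "F' \<subseteq> V" "finite F" "finite F'"
      using F' F finite_subset[OF _ fV, of F] finite_subset[OF _ fV, of F'] by auto
    have "fcone (lift ` F') \<subseteq> fcone (lift ` F)" by (rule fcone_mono) (use F' FF in auto)
    hence "{\<tau>\<in>(`) lift ` faces_in F. \<tau> \<subseteq> fcone (lift ` F')} = {\<tau>\<in>fan_faces. \<tau> \<subseteq> fcone (lift ` F')}"
      unfolding fan_faces_in[OF F, symmetric] by blast
    also have "\<dots> = (`) lift ` faces_in F'" by (rule fan_faces_in[OF FF(1)])
    finally show "(-1) ^ (card (lift ` F) - card (lift ` F')) *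
      tri_h (card (lift ` F')) {\<tau>\<in>(`) lift ` faces_in F. \<tau> \<subseteq> fcone (lift ` F')} =
      (-1) ^ (card F - card F') * tri_h (card F') (faces_in F')"
      by (simp add: card_lift tri_h_image[OF inj_lift])
  qed
  finally show ?thesis using fan_local_h_coeff_nonneg[OF fan_restricted[OF F], of m] by simp
qed

section \<open>Restrictions of the edgewise subdivision\<close>

context
  fixes vs :: "'a list" and r :: nat
  assumes vs: "distinct vs" "set vs = \<Union>\<Gamma>" and r: "r > 0"
begin

lemma ordered_faces_in: "ordered_complex vs (faces_in F)"
proof
  show "distinct vs" by (rule vs(1))
  show "S \<subseteq> set vs" if "S \<in> faces_in F" for S using that vs(2) by (auto simp: faces_in_def)
  show "T \<in> faces_in F" if "S \<in> faces_in F" "T \<subseteq> S" for S T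
    using that face_down[of S T] by (auto simp: faces_in_def)
qed

lemma vert_sum:
  assumes "f \<in> esd_verts r vs \<Gamma>"
  shows "(\<Sum>x\<in>supp f. f x) = r"
proof -
  have "supp f \<subseteq> set vs" using assms vs(2) by (auto simp: esd_verts_def)
  hence "(\<Sum>x\<in>supp f. f x) = (\<Sum>x\<in>set vs. f x)" by (intro sum.mono_neutral_left) (auto simp: supp_def)
  thus ?thesis using assms by (simp add: esd_verts_def)
qed

lemma esd_point_rel_interior:
  assumes f: "f \<in> esd_verts r vs \<Gamma>"
  shows "esd_point r f \<in> rel_interior (convex hull (supp f))"
proof -
  have i: "\<not> affine_dependent (supp f)" using f face_indep by (simp add: esd_verts_def)
  show ?thesis unfolding rel_interior_convex_hull_explicit[OF i]
  proof (intro CollectI exI conjI ballI)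
    show "0 < real (f x) / real r" if "x \<in> supp f" for x using that r by (simp add: supp_def)
    show "(\<Sum>x\<in>supp f. real (f x) / real r) = 1"
      unfolding sum_divide_distrib[symmetric] of_nat_sum[symmetric] vert_sum[OF f] using r by simp
    show "(\<Sum>x\<in>supp f. (real (f x) / real r) *\<^sub>R x) = esd_point r f" by (simp add: esd_point_def)
  qed
qed

text \<open>The values f v / r are the coordinates of the lifted point in the fan over the
  triangulation, and these are unique.\<close>

lemma inj_esd_point: "inj_on (esd_point r) (esd_verts r vs \<Gamma>)"
proof (rule inj_onI)
  fix f g assume fg: "f \<in> esd_verts r vs \<Gamma>" "g \<in> esd_verts r vs \<Gamma>" "esd_point r f = esd_point r g"
  define c where "c f w = (if snd w = 1 then real (f (fst w)) / real r else 0)" for f :: "'a \<Rightarrow> nat" and w :: "'a \<times> real"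
  have m: "c f \<in> cpos fan_faces \<and> vval (c f) = (esd_point r f, 1)" if f: "f \<in> esd_verts r vs \<Gamma>" for f
  proof
    have rs: "rsupp (c f) = lift ` supp f" using r by (force simp: rsupp_def supp_def lift_def c_def)
    have cl: "c f (lift x) = real (f x) / real r" for x by (simp add: c_def lift_def)
    have "(\<Sum>x\<in>supp f. real (f x) / real r) = 1"
      unfolding sum_divide_distrib[symmetric] of_nat_sum[symmetric] vert_sum[OF f] using r by simp
    thus "vval (c f) = (esd_point r f, 1)"
      unfolding vval_def rs sum_lift_image cl by (simp add: esd_point_def)
    have "supp f \<in> \<Gamma>" using f by (simp add: esd_verts_def)
    moreover have "\<forall>w. c f w \<ge> 0" by (simp add: c_def)
    ultimately show "c f \<in> cpos fan_faces" unfolding cpos_def by (simp only: mem_Collect_eq rs imageI simp_thms)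
  qed
  have e: "c f = c g"
    by (rule fan_inj[OF fan_lift]) (use m[OF fg(1)] m[OF fg(2)] fg(3) in auto)
  show "f = g"
  proof
    fix x show "f x = g x" using fun_cong[OF e, of "(x, 1)"] r by (simp add: c_def)
  qed
qed

text \<open>A subdivision vertex lies in the relative interior of its supporting face. As the hull
  of \<open>F\<close> is a face of the simplex, it contains the vertex exactly when it contains that
  whole face, so restricting and subdividing commute.\<close>

lemma restrict_esd:
  assumes F: "F \<subseteq> V"
  shows "restrict_tri V (esd_geom r vs \<Gamma>) F = (`) (esd_point r) ` esd r vs (faces_in F)"
proof -
  have face: "convex hull F face_of convex hull V"
    using face_of_convex_hull_affine_independent[OF V(1)] F by blast
  have pt: "esd_point r f \<in> convex hull V" "esd_point r f \<in> convex hull F \<longleftrightarrow> supp f \<subseteq> convex hull F"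
    if f: "f \<in> esd_verts r vs \<Gamma>" for f
  proof -
    have s: "supp f \<in> \<Gamma>" using f by (simp add: esd_verts_def)
    have ri: "esd_point r f \<in> rel_interior (convex hull (supp f))" by (rule esd_point_rel_interior[OF f])
    hence h: "esd_point r f \<in> convex hull (supp f)" using rel_interior_subset by blast
    thus "esd_point r f \<in> convex hull V" using face_hull[OF s] by blast
    show "esd_point r f \<in> convex hull F \<longleftrightarrow> supp f \<subseteq> convex hull F"
    proof
      assume "esd_point r f \<in> convex hull F"
      hence "convex hull (supp f) \<subseteq> convex hull F"
        using subset_of_face_of[OF face face_hull[OF s]] ri by blast
      thus "supp f \<subseteq> convex hull F" using hull_subset[of "supp f" convex] by blast
    next
      assume "supp f \<subseteq> convex hull F"
      hence "convex hull (supp f) \<subseteq> convex hull F" by (rule hull_minimal) (rule convex_convex_hull)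
      thus "esd_point r f \<in> convex hull F" using h by blast
    qed
  qed
  have "carrier_face V (esd_point r ` E) \<subseteq> F \<longleftrightarrow> E \<in> esd r vs (faces_in F)" if E: "E \<in> esd r vs \<Gamma>" for E
  proof -
    have EV: "E \<subseteq> esd_verts r vs \<Gamma>" using E by (simp add: esd_iff)
    have "carrier_face V (esd_point r ` E) \<subseteq> F \<longleftrightarrow> esd_point r ` E \<subseteq> convex hull F"
      by (rule carrier_face_subset_iff[OF V(1) _ F]) (use pt(1) EV in blast)
    also have "\<dots> \<longleftrightarrow> (\<forall>f\<in>E. supp f \<subseteq> convex hull F)" using pt(2) EV by blast
    also have "\<dots> \<longleftrightarrow> E \<in> esd r vs (faces_in F)"
      using E unfolding esd_iff faces_in_def esd_verts_def by blast
    finally show ?thesis .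
  qed
  moreover have "esd r vs (faces_in F) \<subseteq> esd r vs \<Gamma>" unfolding esd_iff faces_in_def esd_verts_def subset_iff by blast
  ultimately show ?thesis unfolding restrict_tri_def esd_geom_def by blast
qed

lemma h_poly_restrict_esd:
  assumes F: "F \<subseteq> V"
  shows "h_poly (restrict_tri V (esd_geom r vs \<Gamma>) F) = sect r 0 (unity_poly r ^ card F * tri_h (card F) (faces_in F))"
proof -
  interpret o: ordered_complex vs "faces_in F" by (rule ordered_faces_in)
  obtain S where S: "S \<in> faces_in F" "card S = card F" using faces_in_card(2)[OF F] by blast
  have ne: "esd r vs (faces_in F) \<noteq> {}" using o.esd_full_face[OF S(1) r] by blast
  have "\<Union>(esd r vs (faces_in F)) \<subseteq> esd_verts r vs \<Gamma>" by (auto simp: esd_iff faces_in_def esd_verts_def)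
  hence inj: "inj_on (esd_point r) (\<Union>(esd r vs (faces_in F)))" by (rule inj_on_subset[OF inj_esd_point])
  have "h_poly (restrict_tri V (esd_geom r vs \<Gamma>) F) = h_poly (esd r vs (faces_in F))"
    unfolding restrict_esd[OF F] by (rule h_poly_image[OF o.finite_esd ne inj])
  also have "\<dots> = tri_h (card F) (esd r vs (faces_in F))"
    using h_poly_eq_tri_h[OF o.finite_esd ne] o.cdim1_esd[OF r faces_in_card(1)[OF F] S] by simp
  also have "\<dots> = sect r 0 (unity_poly r ^ card F * tri_h (card F) (faces_in F))"
    by (rule o.esd_tri_h[OF r faces_in_card(1)[OF F]])
  finally show ?thesis .
qed

theorem interlaces_local_h:
  assumes n: "n = card V" "n \<le> r"
  shows "interlaces (esd_simplex_h n r) (local_h V (esd_geom r vs \<Gamma>))"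
proof -
  let ?h = "\<lambda>F. tri_h (card F) (faces_in F)"
  have "local_h V (esd_geom r vs \<Gamma>) =
    (\<Sum>F\<in>Pow V. smult ((-1) ^ (n - card F)) (sect r 0 (unity_poly r ^ card F * ?h F)))"
    unfolding local_h_def n(1) by (rule sum.cong) (auto simp: h_poly_restrict_esd)
  moreover have "interlaces (sect r 0 (unity_poly r ^ n))
    (\<Sum>F\<in>Pow V. smult ((-1) ^ (n - card F)) (sect r 0 (unity_poly r ^ card F * ?h F)))"
  proof (rule interlaces_edgewise[OF fV n(1)[symmetric] _ n(2)])
    show "0 < n" using n V(2) fV by (simp add: card_gt_0_iff)
    show "0 \<le> coeff (local_part ?h G) m" if "G \<subseteq> V" for G m by (rule local_part_nonneg[OF that])
    show "degree (?h G) \<le> card G" if "G \<subseteq> V" for G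
      by (rule degree_tri_h) (use finite_faces faces_in_card(1)[OF that] in \<open>auto simp: faces_in_def\<close>)
  qed
  ultimately show ?thesis by (simp add: esd_simplex_h_eq[OF r])
qed

end

end

theorem theorem1p3:
  fixes V :: "'a::euclidean_space set" and \<Gamma> :: "'a set set" and vs :: "'a list"
    and n r :: nat
  assumes "n > 0" and "r > 0" and "r \<ge> n"
    and "card V = n" and "\<not> affine_dependent V"
    and "geom_triangulation V \<Gamma>"
    and "distinct vs" and "set vs = \<Union>\<Gamma>"
  shows "real_rooted (local_h V (esd_geom r vs \<Gamma>)) \<and>
    interlaces (esd_simplex_h n r) (local_h V (esd_geom r vs \<Gamma>))"
proof -
  interpret simplex_triangulation V \<Gamma> by unfold_locales (use assms in auto)
  have "interlaces (esd_simplex_h n r) (local_h V (esd_geom r vs \<Gamma>))"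
    by (rule interlaces_local_h) (use assms in auto)
  \<comment> \<open>\<open>interlaces\<close> includes the real-rootedness of both
    polynomials.\<close>
  thus ?thesis by (simp add: interlaces_def)
qed

end
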